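(* Let $\mathcal V=(V,\eta,\xi)$ be a polarized arrangement with Gale dual $\mathcal V^\vee=(V^\perp,-\xi,-\eta)$. Then there are ring isomorphisms $$A(\mathcal V)^{!}\;\cong\;A(\mathcal V^\vee)\qquad\text{and}\qquad A(\mathcal V^\vee)\;\cong\;B(\mathcal V),$$ where $A(\mathcal V)^!$ denotes the quadratic dual of the quadratic algebra $A(\mathcal V)$.
   Context: **Polarized arrangements.** Let $I$ be a finite set. A polarized arrangement indexed by $I$ is a triple $\mathcal V=(V,\eta,\xi)$ with $V\subset\mathbb R^I$ a linear subspace, $\eta\in\mathbb R^I/V$, $\xi\in V^*=(\mathbb R^I)^*/V^\perp$, such that every lift of $\eta$ to $\mathbb R^I$ has at least $|I|-\dim V$ nonzero entries and every lift of $\xi$ to $(\mathbb R^I)^*$ has at least $\dim V$ nonzero entries. Put $V_\eta=\{x\in\mathbb R^I: x+V=\eta\}$, $H_i=\{x\in V_\eta: x_i=0\}$, $H_S=\bigcap_{i\in S}H_i$ for $S\subset I$ (so $H_\emptyset=V_\eta$). For $\alpha\in\{\pm1\}^I$ put $\Delta_\alpha=\{x\in V_\eta:\alpha(i)x_i\ge0\ \forall i\}$ and $\Sigma_\alpha=\{x\in V:\alpha(i)x_i\ge 0\ \forall i\}$. Let $\mathcal F=\{\alpha:\Delta_\alpha\ne\emptyset\}$ (feasible), $\mathcal B=\{\alpha:\xi(\Sigma_\alpha)\text{ is bounded above}\}$ (bounded), $\mathcal P=\mathcal F\cap\mathcal B$. The Gale dual is $\mathcal V^\vee=(V^\perp,-\xi,-\eta)$,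 where $V^\perp\subset(\mathbb R^I)^*\cong\mathbb R^I$ (dual basis); it is again a polarized arrangement. **The algebra $A(\mathcal V)$.** Write $\alpha\leftrightarrow\beta$ if $\alpha,\beta\in\{\pm1\}^I$ differ in exactly one entry, and $\alpha\overset{i}\leftrightarrow\beta$ if that entry is the $i$-th. Let $Q$ be the quiver with vertex set $\mathcal F$ and one arrow $(\alpha,\beta)$ from $\alpha$ to $\beta$ whenever $\alpha\leftrightarrow\beta$. Let $P(Q)$ be its real path algebra with idempotents $e_\alpha$ and arrows $p(\alpha,\beta)=e_\alpha p(\alpha,\beta)e_\beta$; write $p(\alpha_1,\dots,\alpha_k)=p(\alpha_1,\alpha_2)\cdots p(\alpha_{k-1},\alpha_k)$. Let $t_i\in V^*$ be the restriction to $V$ of the $i$-th coordinate function. $A(\mathcal V)$ is the quotient of $P(Q)\otimes_{\mathbb R}\operatorname{Sym}V^*$ by the two-sided ideal generated by: (A1) $e_\alpha=0$ for $\alpha\in\mathcal F\setminus\mathcal P$; (A2) $p(\alpha,\beta,\gamma)=p(\alpha,\delta,\gamma)$ for distinct $\alpha,\beta,\gamma,\delta\in\mathcal F$ with $\alpha\leftrightarrow\beta\leftrightarrow\gamma\leftrightarrow\delta\leftrightarrow\alpha$; (A3) $p(\alpha,\beta,\alpha)=t_ie_\alpha$ for $\alpha,\beta\in\mathcal F$, $\alpha\overset i\leftrightarrow\beta$. Grading: $\deg e_\alpha=0$, $\deg p(\alpha,\beta)=1$, $\deg t_i=2$. $A(\mathcal V)$ is generated over its degree $0$ part $R=\mathbb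 R\{e_\alpha:\alpha\in\mathcal P\}$ by its degree $1$ part, with relations generated in degree $2$ (i.e. it is quadratic). **Quadratic dual.** For $R$ spanned by finitely many pairwise orthogonal idempotents, $M$ an $R$-bimodule, $W\subset M\otimes_RM$ a sub-bimodule and $E=T_R(M)/\langle W\rangle$, the quadratic dual is $E^!=T_R(M^* )/\langle W^\perp\rangle$, where $M^*$ is the vector space dual (with left and right $R$-actions interchanged) and $W^\perp\subset M^*\otimes_RM^*\cong(M\otimes_RM)^*$ is the annihilator of $W$. **The algebra $B(\mathcal V)$.** Consider $\operatorname{Sym}\mathbb R^I=\mathbb R[u_i]_{i\in I}$, $\deg u_i=2$, $u_S=\prod_{i\in S}u_i$. For $\Delta\subset V_\eta$ let $\tilde R_\Delta=\operatorname{Sym}\mathbb R^I/\langle u_S: S\subset I,\ H_S\cap\Delta=\emptyset\rangle$ and $R_\Delta=\tilde R_\Delta\otimes_{\operatorname{Sym}V}\mathbb R$ (via $V\hookrightarrow\mathbb R^I$ and the graded map $\operatorname{Sym}V\to\mathbb R$ killing $V$). Write $R_{\alpha\beta}=R_{\Delta_\alpha\cap\Delta_\beta}$, $R_{\alpha\beta\gamma}=R_{\Delta_\alpha\cap\Delta_\beta\cap\Delta_\gamma}$. Let $d_{\alpha\beta}=|\{i:\alpha(i)\ne\beta(i)\}|$ and $S(\alpha\beta\gamma)=\{i:\alpha(i)=\gamma(i)\ne\beta(i)\}$. Then $B(\mathcal V)=\bigoplus_{(\alpha,\beta)\in\mathcal P\times\mathcal P}R_{\alpha\beta}[-d_{\alpha\beta}]$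 (degrees shifted up by $d_{\alpha\beta}$), with product $R_{\alpha\beta}\otimes R_{\beta\gamma}\to R_{\alpha\gamma}$ given by mapping both factors to $R_{\alpha\beta\gamma}$ by the quotient maps, multiplying there, and applying the map $R_{\alpha\beta\gamma}\to R_{\alpha\gamma}$ induced by multiplication by $u_{S(\alpha\beta\gamma)}$; the product of $R_{\alpha\beta}$ and $R_{\delta\gamma}$ is zero if $\delta\ne\beta$. *)

theory Defs
  imports "HOL-Algebra.QuotRing" "HOL-Library.Poly_Mapping" "HOL-Analysis.Analysis"
begin

section \<open>Polarized arrangements\<close>

text \<open>
  The index set is the finite type \<open>'i\<close>, and both \<open>\<real>\<^sup>I\<close> and its dual are \<open>real ^ 'i\<close>, paired by the
  inner product; \<open>V\<^sup>\<bottom>\<close> is the orthogonal complement. The classes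
  \<open>\<eta> \<in> \<real>\<^sup>I / V\<close> and \<open>\<xi> \<in> V\<^sup>* = (\<real>\<^sup>I)\<^sup>* / V\<^sup>\<bottom>\<close> are stored as cosets, so that a lift of \<open>\<eta>\<close> (of \<open>\<xi>\<close>) is an
  element of \<open>eta\<close> (of \<open>xi\<close>), and \<open>V\<^sub>\<eta>\<close> is the set \<open>eta\<close> itself.
\<close>

record 'i arrangement =
  dir :: "(real ^ 'i) set"
  eta :: "(real ^ 'i) set"
  xi  :: "(real ^ 'i) set"

definition polarized :: "'i::finite arrangement \<Rightarrow> bool" where
  "polarized \<V> \<longleftrightarrow>
     subspace (dir \<V>) \<and>
     (\<exists>x. eta \<V> = (\<lambda>v. x + v) ` dir \<V>) \<and>
     (\<exists>y. xi \<V> = (\<lambda>v. y + v) ` ((dir \<V>)\<^sup>\<bottom>)) \<and>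
     (\<forall>x\<in>eta \<V>. CARD('i) - dim (dir \<V>) \<le> card {i. x $ i \<noteq> 0}) \<and>
     (\<forall>y\<in>xi \<V>. dim (dir \<V>) \<le> card {i. y $ i \<noteq> 0})"

definition gale_dual :: "'i::finite arrangement \<Rightarrow> 'i arrangement" where
  "gale_dual \<V> = \<lparr>dir = (dir \<V>)\<^sup>\<bottom>, eta = uminus ` xi \<V>, xi = uminus ` eta \<V>\<rparr>"

definition hyp :: "'i::finite arrangement \<Rightarrow> 'i set \<Rightarrow> (real ^ 'i) set" where
  "hyp \<V> S = {x \<in> eta \<V>. \<forall>i\<in>S. x $ i = 0}"

type_synonym 'i sign_vector = "'i \<Rightarrow> real"

definition sign_vectors :: "'i sign_vector set" where
  "sign_vectors = {\<alpha>. \<forall>i. \<alpha> i \<in> {1, -1}}"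

definition chamber :: "'i::finite arrangement \<Rightarrow> 'i sign_vector \<Rightarrow> (real ^ 'i) set" where
  "chamber \<V> \<alpha> = {x \<in> eta \<V>. \<forall>i. \<alpha> i * x $ i \<ge> 0}"

definition chamber_cone :: "'i::finite arrangement \<Rightarrow> 'i sign_vector \<Rightarrow> (real ^ 'i) set" where
  "chamber_cone \<V> \<alpha> = {x \<in> dir \<V>. \<forall>i. \<alpha> i * x $ i \<ge> 0}"

definition feasible :: "'i::finite arrangement \<Rightarrow> 'i sign_vector set" where
  "feasible \<V> = {\<alpha> \<in> sign_vectors. chamber \<V> \<alpha> \<noteq> {}}"

text \<open>All lifts \<open>y\<close> of \<open>\<xi>\<close> agree on \<open>V\<close>, so the set below is \<open>\<xi>(\<Sigma>\<^sub>\<alpha>)\<close>.\<close>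

definition bounded_signs :: "'i::finite arrangement \<Rightarrow> 'i sign_vector set" where
  "bounded_signs \<V> =
     {\<alpha> \<in> sign_vectors. bdd_above {y \<bullet> x | x y. y \<in> xi \<V> \<and> x \<in> chamber_cone \<V> \<alpha>}}"

definition bounded_feasible :: "'i::finite arrangement \<Rightarrow> 'i sign_vector set" where
  "bounded_feasible \<V> = feasible \<V> \<inter> bounded_signs \<V>"

definition adj_at :: "'i \<Rightarrow> 'i sign_vector \<Rightarrow> 'i sign_vector \<Rightarrow> bool" where
  "adj_at i \<alpha> \<beta> \<longleftrightarrow> {j. \<alpha> j \<noteq> \<beta> j} = {i}"

definition adj :: "'i sign_vector \<Rightarrow> 'i sign_vector \<Rightarrow> bool" where
  "adj \<alpha> \<beta> \<longleftrightarrow> (\<exists>i. adj_at i \<alpha> \<beta>)"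


section \<open>Polynomial rings\<close>

type_synonym 'i mpoly = "('i \<Rightarrow>\<^sub>0 nat) \<Rightarrow>\<^sub>0 real"

definition poly_ring :: "'i mpoly ring" where
  "poly_ring = \<lparr>carrier = UNIV, monoid.mult = (*), one = 1, ring.zero = 0, add = (+)\<rparr>"

definition poly_const :: "real \<Rightarrow> 'i mpoly" where
  "poly_const c = Poly_Mapping.single 0 c"

definition poly_var :: "'i \<Rightarrow> 'i mpoly" where
  "poly_var i = Poly_Mapping.single (Poly_Mapping.single i 1) 1"

definition linear_form :: "real ^ 'i \<Rightarrow> 'i::finite mpoly" where
  "linear_form a = (\<Sum>i\<in>UNIV. poly_const (a $ i) * poly_var i)"

definition homogeneous :: "nat \<Rightarrow> 'i::finite mpoly \<Rightarrow> bool" where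
  "homogeneous k p \<longleftrightarrow> (\<forall>m\<in>Poly_Mapping.keys p. (\<Sum>i\<in>UNIV. Poly_Mapping.lookup m i) = k)"

text \<open>
  As \<open>V\<^sup>* = (\<real>\<^sup>I)\<^sup>* / V\<^sup>\<bottom>\<close>, the algebra \<open>Sym V\<^sup>*\<close> is the polynomial ring on the coordinate functions
  modulo the linear forms in \<open>V\<^sup>\<bottom>\<close>; \<open>t\<^sub>i\<close> is the class of the \<open>i\<close>-th variable.
\<close>

definition sym_dual_ideal :: "'i::finite arrangement \<Rightarrow> 'i mpoly set" where
  "sym_dual_ideal \<V> = Idl\<^bsub>poly_ring\<^esub> (linear_form ` ((dir \<V>)\<^sup>\<bottom>))"

definition sym_dual :: "'i::finite arrangement \<Rightarrow> 'i mpoly set ring" where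
  "sym_dual \<V> = poly_ring Quot sym_dual_ideal \<V>"

definition sym_dual_class :: "'i::finite arrangement \<Rightarrow> 'i mpoly \<Rightarrow> 'i mpoly set" where
  "sym_dual_class \<V> p = sym_dual_ideal \<V> +>\<^bsub>poly_ring\<^esub> p"


section \<open>Path algebras\<close>

text \<open>
  The quivers in question have at most one arrow between two vertices, so a path is the nonempty list
  of vertices it visits. For a commutative ring \<open>S\<close> the elements of \<open>path_algebra F E S\<close> are the
  finite \<open>S\<close>-linear combinations of paths; for an \<open>\<real>\<close>-algebra \<open>S\<close> this is \<open>P(Q) \<otimes>\<^sub>\<real> S\<close>.
  A product of paths is their concatenation when the end of the first is the start of the second,
  and zero otherwise.
\<close>

definition paths :: "'v set \<Rightarrow> ('v \<Rightarrow> 'v \<Rightarrow> bool) \<Rightarrow> 'v list set" where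
  "paths F E = {w. w \<noteq> [] \<and> set w \<subseteq> F \<and> successively E w}"

definition path_algebra ::
  "'v set \<Rightarrow> ('v \<Rightarrow> 'v \<Rightarrow> bool) \<Rightarrow> ('s, 'z) ring_scheme \<Rightarrow> ('v list \<Rightarrow> 's) ring" where
  "path_algebra F E S =
    \<lparr>carrier = {f. (\<forall>w. f w \<in> carrier S) \<and> finite {w. f w \<noteq> \<zero>\<^bsub>S\<^esub>} \<and>
                  {w. f w \<noteq> \<zero>\<^bsub>S\<^esub>} \<subseteq> paths F E},
     monoid.mult = (\<lambda>f g w. \<Oplus>\<^bsub>S\<^esub>k\<in>{..<length w}. f (take (Suc k) w) \<otimes>\<^bsub>S\<^esub> g (drop k w)),
     one = (\<lambda>w. if w \<in> (\<lambda>v. [v]) ` F then \<one>\<^bsub>S\<^esub> else \<zero>\<^bsub>S\<^esub>),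
     ring.zero = (\<lambda>w. \<zero>\<^bsub>S\<^esub>),
     add = (\<lambda>f g w. f w \<oplus>\<^bsub>S\<^esub> g w)\<rparr>"


section \<open>The algebra \<open>A(\<V>)\<close>\<close>

text \<open>\<open>scaled_path \<V> s w\<close> is the element \<open>p(w) \<otimes> s\<close> of \<open>P(Q) \<otimes> Sym V\<^sup>*\<close>.\<close>

definition quiver_sym :: "'i::finite arrangement \<Rightarrow> ('i sign_vector list \<Rightarrow> 'i mpoly set) ring" where
  "quiver_sym \<V> = path_algebra (feasible \<V>) adj (sym_dual \<V>)"

definition scaled_path ::
  "'i::finite arrangement \<Rightarrow> 'i mpoly set \<Rightarrow> 'i sign_vector list \<Rightarrow> 'i sign_vector list \<Rightarrow> 'i mpoly set" where
  "scaled_path \<V> s w = (\<lambda>v. if v = w then s else \<zero>\<^bsub>sym_dual \<V>\<^esub>)"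

abbreviation path_elem ::
  "'i::finite arrangement \<Rightarrow> 'i sign_vector list \<Rightarrow> 'i sign_vector list \<Rightarrow> 'i mpoly set" where
  "path_elem \<V> \<equiv> scaled_path \<V> \<one>\<^bsub>sym_dual \<V>\<^esub>"

definition A_relations :: "'i::finite arrangement \<Rightarrow> ('i sign_vector list \<Rightarrow> 'i mpoly set) set" where
  "A_relations \<V> =
     {path_elem \<V> [\<alpha>] | \<alpha>. \<alpha> \<in> feasible \<V> - bounded_feasible \<V>} \<union>
     {path_elem \<V> [\<alpha>, \<beta>, \<gamma>] \<ominus>\<^bsub>quiver_sym \<V>\<^esub> path_elem \<V> [\<alpha>, \<delta>, \<gamma>] | \<alpha> \<beta> \<gamma> \<delta>.
        {\<alpha>, \<beta>, \<gamma>, \<delta>} \<subseteq> feasible \<V> \<and> distinct [\<alpha>, \<beta>, \<gamma>, \<delta>] \<and>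
        adj \<alpha> \<beta> \<and> adj \<beta> \<gamma> \<and> adj \<gamma> \<delta> \<and> adj \<delta> \<alpha>} \<union>
     {path_elem \<V> [\<alpha>, \<beta>, \<alpha>] \<ominus>\<^bsub>quiver_sym \<V>\<^esub> scaled_path \<V> (sym_dual_class \<V> (poly_var i)) [\<alpha>] | \<alpha> \<beta> i.
        {\<alpha>, \<beta>} \<subseteq> feasible \<V> \<and> adj_at i \<alpha> \<beta>}"

definition A_ideal :: "'i::finite arrangement \<Rightarrow> ('i sign_vector list \<Rightarrow> 'i mpoly set) set" where
  "A_ideal \<V> = Idl\<^bsub>quiver_sym \<V>\<^esub> (A_relations \<V>)"

definition A_algebra :: "'i::finite arrangement \<Rightarrow> ('i sign_vector list \<Rightarrow> 'i mpoly set) set ring" where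
  "A_algebra \<V> = quiver_sym \<V> Quot A_ideal \<V>"

definition A_class ::
  "'i::finite arrangement \<Rightarrow> ('i sign_vector list \<Rightarrow> 'i mpoly set) \<Rightarrow> ('i sign_vector list \<Rightarrow> 'i mpoly set) set" where
  "A_class \<V> f = A_ideal \<V> +>\<^bsub>quiver_sym \<V>\<^esub> f"

definition A_idem ::
  "'i::finite arrangement \<Rightarrow> 'i sign_vector \<Rightarrow> ('i sign_vector list \<Rightarrow> 'i mpoly set) set" where
  "A_idem \<V> \<alpha> = A_class \<V> (path_elem \<V> [\<alpha>])"

text \<open>The structure map \<open>\<real> \<rightarrow> A(\<V>)\<close>, sending \<open>c\<close> to \<open>c \<cdot> 1\<close>.\<close>

definition A_scalar ::
  "'i::finite arrangement \<Rightarrow> real \<Rightarrow> ('i sign_vector list \<Rightarrow> 'i mpoly set) set" where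
  "A_scalar \<V> c = A_class \<V> (\<lambda>w. if w \<in> (\<lambda>\<alpha>. [\<alpha>]) ` feasible \<V>
                                 then sym_dual_class \<V> (poly_const c) else \<zero>\<^bsub>sym_dual \<V>\<^esub>)"

text \<open>
  The graded pieces of \<open>A(\<V>)\<close>: a path with \<open>length w\<close> vertices has degree \<open>length w - 1\<close>, and the
  \<open>t\<^sub>i\<close> have degree \<open>2\<close>.
\<close>

definition A_degree ::
  "'i::finite arrangement \<Rightarrow> nat \<Rightarrow> ('i sign_vector list \<Rightarrow> 'i mpoly set) set set" where
  "A_degree \<V> d = A_class \<V> ` {f \<in> carrier (quiver_sym \<V>).
     \<forall>w. f w \<noteq> \<zero>\<^bsub>sym_dual \<V>\<^esub> \<longrightarrow>
       (\<exists>k p. length w - 1 + 2 * k = d \<and> homogeneous k p \<and> f w = sym_dual_class \<V> p)}"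


section \<open>Quadratic duality\<close>

text \<open>
  Throughout, \<open>R\<close> is the real algebra spanned by pairwise orthogonal idempotents \<open>e\<^sub>a\<close> with sum \<open>1\<close>,
  indexed by the finite set \<open>P\<close>. An \<open>R\<close>-bimodule is a real vector space with operations \<open>lact a\<close>
  and \<open>ract a\<close>, the left and right actions of \<open>e\<^sub>a\<close>.
\<close>

record ('p, 'm) bimodule = "'m partial_object" +
  vadd :: "'m \<Rightarrow> 'm \<Rightarrow> 'm"
  vscale :: "real \<Rightarrow> 'm \<Rightarrow> 'm"
  lact :: "'p \<Rightarrow> 'm \<Rightarrow> 'm"
  ract :: "'m \<Rightarrow> 'p \<Rightarrow> 'm"

definition free_algebra :: "'x set \<Rightarrow> ('x list \<Rightarrow> real) ring" where
  "free_algebra X =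
    \<lparr>carrier = {f. finite {w. f w \<noteq> 0} \<and> {w. f w \<noteq> 0} \<subseteq> lists X},
     monoid.mult = (\<lambda>f g w. \<Sum>k\<le>length w. f (take k w) * g (drop k w)),
     one = (\<lambda>w. if w = [] then 1 else 0),
     ring.zero = (\<lambda>w. 0),
     add = (\<lambda>f g w. f w + g w)\<rparr>"

definition word :: "real \<Rightarrow> 'x list \<Rightarrow> 'x list \<Rightarrow> real" where
  "word c w = (\<lambda>v. if v = w then c else 0)"

text \<open>
  \<open>T\<^sub>R(M)\<close> is the real algebra generated by symbols \<open>Idemp a\<close> (\<open>a \<in> P\<close>) and \<open>Vec m\<close> (\<open>m \<in> M\<close>),
  subject to the relations of \<open>R\<close>, linearity of \<open>Vec\<close>, and compatibility of \<open>Vec\<close> with both actions.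
\<close>

datatype ('p, 'm) tensor_gen = Idemp 'p | Vec 'm

definition tensor_free ::
  "'p set \<Rightarrow> ('p, 'm) bimodule \<Rightarrow> (('p, 'm) tensor_gen list \<Rightarrow> real) ring" where
  "tensor_free P M = free_algebra (Idemp ` P \<union> Vec ` carrier M)"

definition tensor_relations ::
  "'p set \<Rightarrow> ('p, 'm) bimodule \<Rightarrow> (('p, 'm) tensor_gen list \<Rightarrow> real) set" where
  "tensor_relations P M = (let T = tensor_free P M in
     {word 1 [Idemp a, Idemp b] \<ominus>\<^bsub>T\<^esub> (if a = b then word 1 [Idemp a] else \<zero>\<^bsub>T\<^esub>) | a b. a \<in> P \<and> b \<in> P} \<union>
     {(\<Oplus>\<^bsub>T\<^esub>a\<in>P. word 1 [Idemp a]) \<ominus>\<^bsub>T\<^esub> \<one>\<^bsub>T\<^esub>} \<union>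
     {word 1 [Vec (vadd M m n)] \<ominus>\<^bsub>T\<^esub> (word 1 [Vec m] \<oplus>\<^bsub>T\<^esub> word 1 [Vec n]) | m n.
        m \<in> carrier M \<and> n \<in> carrier M} \<union>
     {word 1 [Vec (vscale M c m)] \<ominus>\<^bsub>T\<^esub> word c [Vec m] | c m. m \<in> carrier M} \<union>
     {word 1 [Idemp a, Vec m] \<ominus>\<^bsub>T\<^esub> word 1 [Vec (lact M a m)] | a m. a \<in> P \<and> m \<in> carrier M} \<union>
     {word 1 [Vec m, Idemp a] \<ominus>\<^bsub>T\<^esub> word 1 [Vec (ract M m a)] | a m. a \<in> P \<and> m \<in> carrier M})"

definition tensor_ideal ::
  "'p set \<Rightarrow> ('p, 'm) bimodule \<Rightarrow> (('p, 'm) tensor_gen list \<Rightarrow> real) set" where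
  "tensor_ideal P M = Idl\<^bsub>tensor_free P M\<^esub> (tensor_relations P M)"

definition tensor_algebra ::
  "'p set \<Rightarrow> ('p, 'm) bimodule \<Rightarrow> (('p, 'm) tensor_gen list \<Rightarrow> real) set ring" where
  "tensor_algebra P M = tensor_free P M Quot tensor_ideal P M"

definition tensor_class ::
  "'p set \<Rightarrow> ('p, 'm) bimodule \<Rightarrow> (('p, 'm) tensor_gen list \<Rightarrow> real) \<Rightarrow>
   (('p, 'm) tensor_gen list \<Rightarrow> real) set" where
  "tensor_class P M f = tensor_ideal P M +>\<^bsub>tensor_free P M\<^esub> f"

text \<open>
  Formal combinations \<open>\<Sum> c\<^sub>k m\<^sub>k \<otimes> n\<^sub>k\<close>. Their classes in \<open>T\<^sub>R(M)\<close> form \<open>M \<otimes>\<^sub>R M\<close>.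
\<close>

definition formal_tensors :: "('p, 'm) bimodule \<Rightarrow> (('p, 'm) tensor_gen list \<Rightarrow> real) set" where
  "formal_tensors M =
     {f. finite {w. f w \<noteq> 0} \<and>
         {w. f w \<noteq> 0} \<subseteq> {[Vec m, Vec n] | m n. m \<in> carrier M \<and> n \<in> carrier M}}"

definition dual_bimodule :: "('p, 'm) bimodule \<Rightarrow> ('p, 'm \<Rightarrow> real) bimodule" where
  "dual_bimodule M =
    \<lparr>carrier = {f. (\<forall>x\<in>carrier M. \<forall>y\<in>carrier M. f (vadd M x y) = f x + f y) \<and>
                  (\<forall>c. \<forall>x\<in>carrier M. f (vscale M c x) = c * f x) \<and>
                  (\<forall>x. x \<notin> carrier M \<longrightarrow> f x = 0)},
     vadd = (\<lambda>f g x. f x + g x),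
     vscale = (\<lambda>c f x. c * f x),
     lact = (\<lambda>a f x. if x \<in> carrier M then f (ract M x a) else 0),
     ract = (\<lambda>f a x. if x \<in> carrier M then f (lact M a x) else 0)\<rparr>"

text \<open>
  The identification of \<open>M\<^sup>* \<otimes>\<^sub>R M\<^sup>*\<close> with \<open>(M \<otimes>\<^sub>R M)\<^sup>*\<close>. Since the actions on \<open>M\<^sup>*\<close> are interchanged,
  \<open>f \<otimes> g\<close> evaluates \<open>f\<close> on the second factor and \<open>g\<close> on the first factor of
  \<open>m \<otimes> n = \<Sum>\<^sub>a m e\<^sub>a \<otimes> e\<^sub>a n\<close>; the sum over \<open>a\<close> makes the form \<open>R\<close>-balanced in both arguments.
\<close>

definition tensor_pairing ::
  "'p set \<Rightarrow> ('p, 'm) bimodule \<Rightarrow> (('p, 'm \<Rightarrow> real) tensor_gen list \<Rightarrow> real) \<Rightarrow>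
   (('p, 'm) tensor_gen list \<Rightarrow> real) \<Rightarrow> real" where
  "tensor_pairing P M \<phi> q =
     (\<Sum>(f, g)\<in>{(f, g). \<phi> [Vec f, Vec g] \<noteq> 0}. \<Sum>(m, n)\<in>{(m, n). q [Vec m, Vec n] \<noteq> 0}.
        \<phi> [Vec f, Vec g] * q [Vec m, Vec n] * (\<Sum>a\<in>P. f (lact M a n) * g (ract M m a)))"

definition annihilator ::
  "'p set \<Rightarrow> ('p, 'm) bimodule \<Rightarrow> (('p, 'm) tensor_gen list \<Rightarrow> real) set set \<Rightarrow>
   (('p, 'm \<Rightarrow> real) tensor_gen list \<Rightarrow> real) set set" where
  "annihilator P M W = tensor_class P (dual_bimodule M) `
     {\<phi> \<in> formal_tensors (dual_bimodule M).
        \<forall>q\<in>formal_tensors M. tensor_class P M q \<in> W \<longrightarrow> tensor_pairing P M \<phi> q = 0}"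

text \<open>
  The quadratic dual \<open>T\<^sub>R(M\<^sup>*) / \<langle>W\<^sup>\<bottom>\<rangle>\<close> of \<open>T\<^sub>R(M) / \<langle>W\<rangle>\<close>; the sub-bimodule \<open>W\<close> of \<open>M \<otimes>\<^sub>R M\<close> is a set of
  classes of formal tensors.
\<close>

definition quadratic_dual ::
  "'p set \<Rightarrow> ('p, 'm) bimodule \<Rightarrow> (('p, 'm) tensor_gen list \<Rightarrow> real) set set \<Rightarrow>
   (('p, 'm \<Rightarrow> real) tensor_gen list \<Rightarrow> real) set set ring" where
  "quadratic_dual P M W =
     (let T = tensor_algebra P (dual_bimodule M) in T Quot (Idl\<^bsub>T\<^esub> (annihilator P M W)))"

text \<open>
  A quadratic algebra \<open>A\<close> with degree \<open>0\<close> part \<open>R\<close> is \<open>T\<^sub>R(A\<^sub>1) / \<langle>W\<rangle>\<close>, where \<open>W\<close> is the kernel of the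
  multiplication \<open>A\<^sub>1 \<otimes>\<^sub>R A\<^sub>1 \<rightarrow> A\<close>. Here \<open>\<kappa>\<close> is the structure map \<open>\<real> \<rightarrow> A\<close> and \<open>e\<close> the family of
  idempotents spanning \<open>R\<close>.
\<close>

definition degree_one_bimodule ::
  "('a, 'z) ring_scheme \<Rightarrow> (real \<Rightarrow> 'a) \<Rightarrow> ('p \<Rightarrow> 'a) \<Rightarrow> 'a set \<Rightarrow> ('p, 'a) bimodule" where
  "degree_one_bimodule A \<kappa> e A1 =
    \<lparr>carrier = A1,
     vadd = (\<lambda>x y. x \<oplus>\<^bsub>A\<^esub> y),
     vscale = (\<lambda>c x. \<kappa> c \<otimes>\<^bsub>A\<^esub> x),
     lact = (\<lambda>a x. e a \<otimes>\<^bsub>A\<^esub> x),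
     ract = (\<lambda>x a. x \<otimes>\<^bsub>A\<^esub> e a)\<rparr>"

definition formal_product ::
  "('a, 'z) ring_scheme \<Rightarrow> (real \<Rightarrow> 'a) \<Rightarrow> (('p, 'a) tensor_gen list \<Rightarrow> real) \<Rightarrow> 'a" where
  "formal_product A \<kappa> q =
     (\<Oplus>\<^bsub>A\<^esub>x\<in>{(m, n). q [Vec m, Vec n] \<noteq> 0}. \<kappa> (q [Vec (fst x), Vec (snd x)]) \<otimes>\<^bsub>A\<^esub> (fst x \<otimes>\<^bsub>A\<^esub> snd x))"

definition quadratic_relations ::
  "('a, 'z) ring_scheme \<Rightarrow> (real \<Rightarrow> 'a) \<Rightarrow> 'p set \<Rightarrow> ('p \<Rightarrow> 'a) \<Rightarrow> 'a set \<Rightarrow>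
   (('p, 'a) tensor_gen list \<Rightarrow> real) set set" where
  "quadratic_relations A \<kappa> P e A1 = (let M = degree_one_bimodule A \<kappa> e A1 in
     tensor_class P M ` {q \<in> formal_tensors M. formal_product A \<kappa> q = \<zero>\<^bsub>A\<^esub>})"

definition quadratic_dual_of ::
  "('a, 'z) ring_scheme \<Rightarrow> (real \<Rightarrow> 'a) \<Rightarrow> 'p set \<Rightarrow> ('p \<Rightarrow> 'a) \<Rightarrow> 'a set \<Rightarrow>
   (('p, 'a \<Rightarrow> real) tensor_gen list \<Rightarrow> real) set set ring" where
  "quadratic_dual_of A \<kappa> P e A1 =
     quadratic_dual P (degree_one_bimodule A \<kappa> e A1) (quadratic_relations A \<kappa> P e A1)"

definition A_quadratic_dual ::
  "'i::finite arrangement \<Rightarrow>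
   (('i sign_vector, ('i sign_vector list \<Rightarrow> 'i mpoly set) set \<Rightarrow> real) tensor_gen list \<Rightarrow> real) set set ring" where
  "A_quadratic_dual \<V> =
     quadratic_dual_of (A_algebra \<V>) (A_scalar \<V>) (bounded_feasible \<V>) (A_idem \<V>) (A_degree \<V> 1)"


section \<open>The algebra \<open>B(\<V>)\<close>\<close>

text \<open>
  \<open>R\<^sub>\<Delta>\<close> is the quotient of \<open>Sym \<real>\<^sup>I\<close> by the monomials \<open>u\<^sub>S\<close> with \<open>H\<^sub>S \<inter> \<Delta> = {}\<close> and by the linear forms
  \<open>\<Sum>\<^sub>i v\<^sub>i u\<^sub>i\<close> for \<open>v \<in> V\<close>; dividing by the latter is the base change along \<open>Sym V \<rightarrow> \<real>\<close>.
\<close>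

definition face_ideal :: "'i::finite arrangement \<Rightarrow> (real ^ 'i) set \<Rightarrow> 'i mpoly set" where
  "face_ideal \<V> \<Delta> =
     Idl\<^bsub>poly_ring\<^esub> ({(\<Prod>i\<in>S. poly_var i) | S. hyp \<V> S \<inter> \<Delta> = {}} \<union> linear_form ` dir \<V>)"

definition face_ring :: "'i::finite arrangement \<Rightarrow> (real ^ 'i) set \<Rightarrow> 'i mpoly set ring" where
  "face_ring \<V> \<Delta> = poly_ring Quot face_ideal \<V> \<Delta>"

definition ideal2 :: "'i::finite arrangement \<Rightarrow> 'i sign_vector \<Rightarrow> 'i sign_vector \<Rightarrow> 'i mpoly set" where
  "ideal2 \<V> \<alpha> \<beta> = face_ideal \<V> (chamber \<V> \<alpha> \<inter> chamber \<V> \<beta>)"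

definition ring2 :: "'i::finite arrangement \<Rightarrow> 'i sign_vector \<Rightarrow> 'i sign_vector \<Rightarrow> 'i mpoly set ring" where
  "ring2 \<V> \<alpha> \<beta> = face_ring \<V> (chamber \<V> \<alpha> \<inter> chamber \<V> \<beta>)"

definition ideal3 ::
  "'i::finite arrangement \<Rightarrow> 'i sign_vector \<Rightarrow> 'i sign_vector \<Rightarrow> 'i sign_vector \<Rightarrow> 'i mpoly set" where
  "ideal3 \<V> \<alpha> \<beta> \<gamma> = face_ideal \<V> (chamber \<V> \<alpha> \<inter> chamber \<V> \<beta> \<inter> chamber \<V> \<gamma>)"

definition ring3 ::
  "'i::finite arrangement \<Rightarrow> 'i sign_vector \<Rightarrow> 'i sign_vector \<Rightarrow> 'i sign_vector \<Rightarrow> 'i mpoly set ring" where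
  "ring3 \<V> \<alpha> \<beta> \<gamma> = face_ring \<V> (chamber \<V> \<alpha> \<inter> chamber \<V> \<beta> \<inter> chamber \<V> \<gamma>)"

text \<open>
  The map of quotients \<open>Sym/I \<rightarrow> Sym/J\<close> induced by multiplication with \<open>u\<close> (where \<open>u I \<subseteq> J\<close>)
  sends a coset \<open>X\<close> to the coset \<open>J + u X\<close>; for \<open>u = 1\<close> it is the quotient map.
\<close>

definition induced_mult :: "'i mpoly set \<Rightarrow> 'i mpoly \<Rightarrow> 'i mpoly set \<Rightarrow> 'i mpoly set" where
  "induced_mult J u X = J <+>\<^bsub>poly_ring\<^esub> ((\<lambda>p. u * p) ` X)"

definition B_local_mult ::
  "'i::finite arrangement \<Rightarrow> 'i sign_vector \<Rightarrow> 'i sign_vector \<Rightarrow> 'i sign_vector \<Rightarrow>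
   'i mpoly set \<Rightarrow> 'i mpoly set \<Rightarrow> 'i mpoly set" where
  "B_local_mult \<V> \<alpha> \<beta> \<gamma> x y =
     induced_mult (ideal2 \<V> \<alpha> \<gamma>) (\<Prod>i\<in>{i. \<alpha> i = \<gamma> i \<and> \<gamma> i \<noteq> \<beta> i}. poly_var i)
       (induced_mult (ideal3 \<V> \<alpha> \<beta> \<gamma>) 1 x \<otimes>\<^bsub>ring3 \<V> \<alpha> \<beta> \<gamma>\<^esub> induced_mult (ideal3 \<V> \<alpha> \<beta> \<gamma>) 1 y)"

text \<open>
  An element of \<open>B(\<V>)\<close> is the family of its components in the \<open>R\<^sub>\<alpha>\<^sub>\<beta>\<close>, \<open>\<alpha>, \<beta> \<in> \<P>\<close>. The degree shifts
  do not affect the ring structure.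
\<close>

definition B_algebra ::
  "'i::finite arrangement \<Rightarrow> ('i sign_vector \<times> 'i sign_vector \<Rightarrow> 'i mpoly set) ring" where
  "B_algebra \<V> = (let P = bounded_feasible \<V> in
    \<lparr>carrier = (\<Pi>\<^sub>E (\<alpha>, \<beta>)\<in>P \<times> P. carrier (ring2 \<V> \<alpha> \<beta>)),
     monoid.mult = (\<lambda>f g. \<lambda>(\<alpha>, \<gamma>)\<in>P \<times> P.
               \<Oplus>\<^bsub>ring2 \<V> \<alpha> \<gamma>\<^esub>\<beta>\<in>P. B_local_mult \<V> \<alpha> \<beta> \<gamma> (f (\<alpha>, \<beta>)) (g (\<beta>, \<gamma>))),
     one = (\<lambda>(\<alpha>, \<beta>)\<in>P \<times> P. if \<alpha> = \<beta> then \<one>\<^bsub>ring2 \<V> \<alpha> \<beta>\<^esub> else \<zero>\<^bsub>ring2 \<V> \<alpha> \<beta>\<^esub>),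
     ring.zero = (\<lambda>(\<alpha>, \<beta>)\<in>P \<times> P. \<zero>\<^bsub>ring2 \<V> \<alpha> \<beta>\<^esub>),
     add = (\<lambda>f g. \<lambda>(\<alpha>, \<beta>)\<in>P \<times> P. f (\<alpha>, \<beta>) \<oplus>\<^bsub>ring2 \<V> \<alpha> \<beta>\<^esub> g (\<alpha>, \<beta>))\<rparr>)"

end

theory Submission
  imports Defs
begin

text \<open>
  A shortest path from \<open>a\<close> to \<open>c\<close> in the quiver of \<open>A(V)\<close> defines an element \<open>T(a, c)\<close> that does not depend
  on the path, because any two first steps towards \<open>c\<close> are linked through faces of codimension two of
  \<open>\<Delta>\<^sub>a\<close>. These elements generate \<open>A(V)\<close> over \<open>Sym V\<^sup>*\<close>, and \<open>T(a, b) T(b, c) = u\<^sub>S T(a, c)\<close> with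
  \<open>S = S(a b c)\<close>. By Farkas' lemma the products that vanish because \<open>b\<close> is not bounded give exactly the relations
  \<open>u\<^sub>S = 0\<close> of the ring \<open>R\<^sub>a\<^sub>c\<close> of the Gale dual, so that \<open>A(V)\<close> is \<open>B\<close> of the Gale dual.

  Through this isomorphism the constant and linear coefficients of polynomials become functionals on the
  parts of degree at most two of \<open>A(V)\<close>. They show that, up to a sign on the edges of the cube, the annihilator of the
  quadratic relations of \<open>A(V)\<close> is the space of quadratic relations of \<open>A\<close> of the Gale dual.
\<close>

section \<open>Rings with carriers inside a type-class ring\<close>

text \<open>Elements of \<open>A_algebra\<close> are nested cosets without a visible basis, so that
  linear independence is read off only after mapping to the rings \<open>R_ac\<close>, whose ideals
  are explicit; injectivity becomes a comparison of ideals. For the quadratic dual no dimensions are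
  counted. Each functional on \<open>R_ac\<close> yields one relation there, and the two kinds of
  coefficients yield enough relations to define a map from \<open>A\<close> of the Gale dual by its
  presentation. The obstacle is \<open>t_i\<close>, which is not among the generators of the
  quadratic dual. It has to be rebuilt from loops \<open>a, flip a k, a\<close>, and the loop for
  \<open>k = i\<close> need not exist. A vertex of the dual chamber of \<open>a\<close> gives a
  vector congruent to the \<open>i\<close>-th unit vector modulo \<open>V\<close> that uses only
  existing loops; a vertex of the common facet of two neighbours gives one vector for both, and this
  makes \<open>t_i\<close> commute with the arrows. The sign is forced: (A2) identifies the two
  paths around a square, the annihilator of their difference contains the sum of the dual paths, and
  an anticommuting square has to be turned into a commuting one.\<close>

text \<open>
  The product of all rings on the type \<open>'a\<close> is a ring without carrier. Every ring on \<open>'a\<close> is a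
  factor of it, so that identities between elements of a ring \<open>X\<close> can be proved in the
  type-class ring. The factor \<open>int\<close> makes \<open>0 \<noteq> 1\<close> hold.
\<close>

typedef 'a rprod =
  "{z :: ('a ring \<Rightarrow> 'a) \<times> int. \<forall>X. fst z X \<in> (if ring X then carrier X else {undefined})}"
proof -
  have "(\<lambda>X. if ring X then \<zero>\<^bsub>X\<^esub> else undefined, 0::int)
      \<in> {z :: ('a ring \<Rightarrow> 'a) \<times> int. \<forall>X. fst z X \<in> (if ring X then carrier X else {undefined})}"
    by (auto intro: ring.ring_simprules)
  then show ?thesis by blast
qed

definition rcomp :: "'a rprod \<Rightarrow> 'a ring \<Rightarrow> 'a" where "rcomp x X = fst (Rep_rprod x) X"

definition rint :: "'a rprod \<Rightarrow> int" where "rint x = snd (Rep_rprod x)"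

text \<open>Components outside the carrier are replaced by zero, so that every function defines an
  element and the ring operations can be given by plain formulas.\<close>

definition rfamily :: "('a ring \<Rightarrow> 'a) \<Rightarrow> int \<Rightarrow> 'a rprod" where
  "rfamily f n =
    Abs_rprod (\<lambda>X. if ring X then if f X \<in> carrier X then f X else \<zero>\<^bsub>X\<^esub> else undefined, n)"

lemma Rep_rfamily:
  "Rep_rprod (rfamily f n) =
    (\<lambda>X. if ring X then if f X \<in> carrier X then f X else \<zero>\<^bsub>X\<^esub> else undefined, n)"
  unfolding rfamily_def by (rule Abs_rprod_inverse) (auto intro: ring.ring_simprules)

lemma rcomp_rfamily [simp]: "ring X \<Longrightarrow> f X \<in> carrier X \<Longrightarrow> rcomp (rfamily f n) X = f X"
  by (simp add: rcomp_def Rep_rfamily)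

lemma rint_rfamily [simp]: "rint (rfamily f n) = n"
  by (simp add: rint_def Rep_rfamily)

lemma rcomp_closed [simp]: "ring X \<Longrightarrow> rcomp x X \<in> carrier X"
  using Rep_rprod[of x] by (auto simp: rcomp_def split: if_splits)

lemma rprod_eqI:
  assumes "\<And>X. ring X \<Longrightarrow> rcomp x X = rcomp y X" "rint x = rint y"
  shows "x = y"
proof -
  have "fst (Rep_rprod x) X = fst (Rep_rprod y) X" for X
    using assms(1)[of X] Rep_rprod[of x] Rep_rprod[of y]
    by (cases "ring X") (auto simp: rcomp_def dest!: spec[of _ X])
  then have "Rep_rprod x = Rep_rprod y"
    using assms(2) by (auto simp: rint_def prod_eq_iff)
  then show ?thesis by (simp add: Rep_rprod_inject)
qed

instantiation rprod :: (type) ring_1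
begin

definition zero_rprod where "zero_rprod = rfamily (\<lambda>X. \<zero>\<^bsub>X\<^esub>) 0"
definition one_rprod where "one_rprod = rfamily (\<lambda>X. \<one>\<^bsub>X\<^esub>) 1"
definition plus_rprod where
  "plus_rprod x y = rfamily (\<lambda>X. rcomp x X \<oplus>\<^bsub>X\<^esub> rcomp y X) (rint x + rint y)"
definition times_rprod where
  "times_rprod x y = rfamily (\<lambda>X. rcomp x X \<otimes>\<^bsub>X\<^esub> rcomp y X) (rint x * rint y)"
definition uminus_rprod where
  "uminus_rprod x = rfamily (\<lambda>X. \<ominus>\<^bsub>X\<^esub> rcomp x X) (- rint x)"
definition minus_rprod where "minus_rprod x y = x + - (y :: 'a rprod)"

lemmas rprod_ops = zero_rprod_def one_rprod_def plus_rprod_def times_rprod_def uminus_rprod_def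

lemma rcomp_ops [simp]:
  assumes "ring X"
  shows "rcomp 0 X = \<zero>\<^bsub>X\<^esub>" "rcomp 1 X = \<one>\<^bsub>X\<^esub>" "rcomp (x + y) X = rcomp x X \<oplus>\<^bsub>X\<^esub> rcomp y X"
    "rcomp (x * y) X = rcomp x X \<otimes>\<^bsub>X\<^esub> rcomp y X" "rcomp (- x) X = \<ominus>\<^bsub>X\<^esub> rcomp x X"
  using assms by (simp_all add: rprod_ops ring.ring_simprules)

lemma rint_ops [simp]:
  "rint 0 = 0" "rint 1 = 1" "rint (x + y) = rint x + rint y" "rint (x * y) = rint x * rint y"
  "rint (- x) = - rint x"
  by (simp_all add: rprod_ops)

instance
proof
  fix a b c :: "'a rprod"
  show "a + b + c = a + (b + c)" by (rule rprod_eqI) (auto simp: ring.ring_simprules)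
  show "a + b = b + a" by (rule rprod_eqI) (auto simp: ring.ring_simprules)
  show "0 + a = a" by (rule rprod_eqI) (auto simp: ring.ring_simprules)
  show "- a + a = 0" by (rule rprod_eqI) (auto simp: ring.ring_simprules)
  show "a - b = a + - b" by (rule minus_rprod_def)
  show "a * b * c = a * (b * c)"
    by (rule rprod_eqI) (auto simp: ring.ring_simprules(11))
  show "1 * a = a" by (rule rprod_eqI) (auto simp: ring.ring_simprules)
  show "a * 1 = a" by (rule rprod_eqI) (auto simp: ring.is_monoid monoid.r_one)
  show "(a + b) * c = a * c + b * c" by (rule rprod_eqI) (auto simp: ring.ring_simprules algebra_simps)
  show "a * (b + c) = a * b + a * c" by (rule rprod_eqI) (auto simp: ring.ring_simprules algebra_simps)
  show "(0::'a rprod) \<noteq> 1" by (metis rint_ops(1,2) zero_neq_one)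
qed

end

section \<open>The copy of a single ring inside the product\<close>

definition emb :: "'a ring \<Rightarrow> 'a \<Rightarrow> 'a rprod" where
  "emb X x = rfamily (\<lambda>Y. if Y = X then x else \<zero>\<^bsub>Y\<^esub>) 0"

text \<open>Units are left out on purpose: \<open>emb X\<close> sends the unit of \<open>X\<close>
  to an idempotent that differs from 1, as its integer component is 0. This is why conditions such
  as \<open>s 1 * t i = t i\<close> recur below, and why unitality is recovered separately in
  \<open>ring_iso_of_emb\<close>.\<close>

definition ring_map :: "('a, 'z) ring_scheme \<Rightarrow> ('a \<Rightarrow> 'r::ring) \<Rightarrow> bool" where
  "ring_map X h \<longleftrightarrow> (\<forall>x\<in>carrier X. \<forall>y\<in>carrier X.
     h (x \<oplus>\<^bsub>X\<^esub> y) = h x + h y \<and> h (x \<otimes>\<^bsub>X\<^esub> y) = h x * h y)"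

lemma rcomp_emb: "ring X \<Longrightarrow> ring Y \<Longrightarrow> x \<in> carrier X \<Longrightarrow> rcomp (emb X x) Y = (if Y = X then x else \<zero>\<^bsub>Y\<^esub>)"
  unfolding emb_def by (subst rcomp_rfamily) (auto simp: ring.ring_simprules)

lemma rint_emb [simp]: "rint (emb X x) = 0"
  by (simp add: emb_def)

lemma emb_ring_map: "ring X \<Longrightarrow> ring_map X (emb X)"
  unfolding ring_map_def
  by (intro ballI conjI; rule rprod_eqI) (auto simp: rcomp_emb ring.ring_simprules)

lemma emb_inj: "ring X \<Longrightarrow> x \<in> carrier X \<Longrightarrow> y \<in> carrier X \<Longrightarrow> emb X x = emb X y \<longleftrightarrow> x = y"
  by (metis rcomp_emb)

lemma ring_mapD:
  assumes "ring_map X h" "x \<in> carrier X" "y \<in> carrier X"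
  shows "h (x \<oplus>\<^bsub>X\<^esub> y) = h x + h y" "h (x \<otimes>\<^bsub>X\<^esub> y) = h x * h y"
  using assms by (auto simp: ring_map_def)

lemma ring_map_zero:
  assumes "ring X" "ring_map X h" shows "h \<zero>\<^bsub>X\<^esub> = 0"
proof -
  have "h (\<zero>\<^bsub>X\<^esub> \<oplus>\<^bsub>X\<^esub> \<zero>\<^bsub>X\<^esub>) = h \<zero>\<^bsub>X\<^esub> + h \<zero>\<^bsub>X\<^esub>"
    using assms by (intro ring_mapD) (auto intro: ring.ring_simprules)
  then show ?thesis using assms(1) by (simp add: ring.ring_simprules)
qed

lemma ring_map_minus:
  assumes "ring X" "ring_map X h" "x \<in> carrier X"
  shows "h (\<ominus>\<^bsub>X\<^esub> x) = - h x"
proof -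
  have "h (\<ominus>\<^bsub>X\<^esub> x) + h x = h (\<ominus>\<^bsub>X\<^esub> x \<oplus>\<^bsub>X\<^esub> x)"
    using assms by (intro ring_mapD[symmetric]) (auto intro: ring.ring_simprules)
  then show ?thesis using assms ring_map_zero[OF assms(1,2)]
    by (simp add: ring.ring_simprules eq_neg_iff_add_eq_0)
qed

lemma ring_map_diff:
  assumes "ring X" "ring_map X h" "x \<in> carrier X" "y \<in> carrier X"
  shows "h (x \<ominus>\<^bsub>X\<^esub> y) = h x - h y"
  using assms by (simp add: a_minus_def ring_mapD ring_map_minus ring.ring_simprules)

lemma ring_map_finsum:
  assumes "ring X" "ring_map X h" "finite I" "\<And>i. i \<in> I \<Longrightarrow> g i \<in> carrier X"
  shows "h (\<Oplus>\<^bsub>X\<^esub>i\<in>I. g i) = (\<Sum>i\<in>I. h (g i))"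
proof -
  interpret ring X by fact
  show ?thesis using assms(3,4)
    by (induction I) (auto simp: ring_map_zero[OF assms(1,2)] ring_mapD[OF assms(2)] Pi_def)
qed

text \<open>The kernel is an ideal, so that it contains the ideal generated by any of its
  subsets.\<close>

lemma ring_map_Idl_zero:
  assumes "ring X" "ring_map X h" "G \<subseteq> carrier X" "\<And>g. g \<in> G \<Longrightarrow> h g = 0" "x \<in> Idl\<^bsub>X\<^esub> G"
  shows "h x = 0"
proof -
  interpret ring X by fact
  have "ideal {x \<in> carrier X. h x = 0} X"
  proof (rule idealI)
    show "ring X" by fact
    show "subgroup {x \<in> carrier X. h x = 0} (add_monoid X)"
      by (unfold_locales)
        (auto simp: ring_mapD[OF assms(2)] ring_map_zero[OF assms(1,2)] a_inv_def[symmetric]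
          ring_map_minus[OF assms(1,2)])
  qed (auto simp: ring_mapD[OF assms(2)])
  then have "Idl\<^bsub>X\<^esub> G \<subseteq> {x \<in> carrier X. h x = 0}"
    using assms(3,4) by (intro genideal_minimal) auto
  then show ?thesis using assms(5) by auto
qed

section \<open>Quotients by generated ideals\<close>

lemma quotient_ring_map:
  assumes "ideal I X" "ring_map (X Quot I) h"
  shows "ring_map X (\<lambda>x. h (I +>\<^bsub>X\<^esub> x))"
proof -
  interpret ideal I X by fact
  have "I +>\<^bsub>X\<^esub> x \<in> carrier (X Quot I)" if "x \<in> carrier X" for x
    using that by (auto simp: FactRing_def A_RCOSETS_def')
  moreover have "I +>\<^bsub>X\<^esub> (x \<oplus>\<^bsub>X\<^esub> y) = (I +>\<^bsub>X\<^esub> x) \<oplus>\<^bsub>X Quot I\<^esub> (I +>\<^bsub>X\<^esub> y)"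
    "I +>\<^bsub>X\<^esub> (x \<otimes>\<^bsub>X\<^esub> y) = (I +>\<^bsub>X\<^esub> x) \<otimes>\<^bsub>X Quot I\<^esub> (I +>\<^bsub>X\<^esub> y)"
    if "x \<in> carrier X" "y \<in> carrier X" for x y
    using that by (simp_all add: FactRing_def a_rcos_sum rcoset_mult_add)
  ultimately show ?thesis using assms(2) by (simp add: ring_map_def)
qed

lemma carrier_Quot: "carrier (X Quot I) = (\<lambda>x. I +>\<^bsub>X\<^esub> x) ` carrier X"
  by (auto simp: FactRing_def A_RCOSETS_def')

lemma coset_eq_iff:
  assumes "ideal I X" "x \<in> carrier X" "y \<in> carrier X"
  shows "I +>\<^bsub>X\<^esub> x = I +>\<^bsub>X\<^esub> y \<longleftrightarrow> x \<ominus>\<^bsub>X\<^esub> y \<in> I"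
proof -
  interpret ideal I X by fact
  show ?thesis
    using assms by (simp add: ring.quotient_eq_iff_same_a_r_cos[OF ring_axioms])
qed

lemma coset_eq_zero_iff:
  assumes "ideal I X" "x \<in> carrier X"
  shows "I +>\<^bsub>X\<^esub> x = \<zero>\<^bsub>X Quot I\<^esub> \<longleftrightarrow> x \<in> I"
proof -
  interpret ideal I X by fact
  show ?thesis using assms(2)
    by (simp add: FactRing_def) (metis a_coset_add_zero a_rcos_const a_subset assms(1) ideal.rcos_const_imp_mem)
qed

text \<open>The value on a coset is read off at a chosen representative; two representatives differ
  by an element of the ideal, on which \<open>h\<close> vanishes.\<close>

lemma quotient_lift:
  assumes "ring X" "ring_map X h" "G \<subseteq> carrier X" "\<And>g. g \<in> G \<Longrightarrow> h g = 0"
  obtains h' where "ring_map (X Quot (Idl\<^bsub>X\<^esub> G)) h'"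
    "\<And>x. x \<in> carrier X \<Longrightarrow> h' (Idl\<^bsub>X\<^esub> G +>\<^bsub>X\<^esub> x) = h x"
proof -
  interpret ring X by fact
  let ?I = "Idl\<^bsub>X\<^esub> G"
  interpret I: ideal ?I X by (rule genideal_ideal) fact
  define h' where "h' C = h (SOME x. x \<in> carrier X \<and> ?I +>\<^bsub>X\<^esub> x = C)" for C
  have 1: "h' (?I +>\<^bsub>X\<^esub> x) = h x" if "x \<in> carrier X" for x
  proof -
    define y where "y = (SOME y. y \<in> carrier X \<and> ?I +>\<^bsub>X\<^esub> y = ?I +>\<^bsub>X\<^esub> x)"
    have "y \<in> carrier X \<and> ?I +>\<^bsub>X\<^esub> y = ?I +>\<^bsub>X\<^esub> x"
      unfolding y_def by (rule someI[of _ x]) (use that in auto)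
    moreover from this have "h (y \<ominus>\<^bsub>X\<^esub> x) = 0"
      using that by (intro ring_map_Idl_zero[OF assms]) (auto simp: coset_eq_iff[OF I.is_ideal])
    ultimately show ?thesis
      using that by (simp add: h'_def y_def[symmetric] ring_map_diff[OF assms(1,2)])
  qed
  have "ring_map (X Quot ?I) h'"
    unfolding ring_map_def carrier_Quot
    by (auto simp: FactRing_def I.a_rcos_sum I.rcoset_mult_add 1 ring_mapD[OF assms(2)])
  then show ?thesis using 1 that by blast
qed

text \<open>Both isomorphisms of the theorem come from this criterion: a map with values in
  \<open>'b rprod\<close> is built by a universal property, and only its image and its kernel have
  to be determined.\<close>

lemma ring_iso_of_emb:
  fixes X :: "'a ring" and Y :: "'b ring" and h :: "'a \<Rightarrow> 'b rprod"
  assumes "ring X" "ring Y" "ring_map X h" "h ` carrier X = emb Y ` carrier Y"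
    "\<And>x. x \<in> carrier X \<Longrightarrow> h x = 0 \<Longrightarrow> x = \<zero>\<^bsub>X\<^esub>"
  shows "X \<simeq> Y"
proof -
  interpret X: ring X by fact
  interpret Y: ring Y by fact
  define g where "g x = rcomp (h x) Y" for x
  have g: "g x \<in> carrier Y \<and> emb Y (g x) = h x" if x: "x \<in> carrier X" for x
  proof -
    obtain y where "y \<in> carrier Y" "h x = emb Y y" using assms(4) x by blast
    then show ?thesis by (simp add: g_def rcomp_emb \<open>ring Y\<close>)
  qed
  have ginj: "inj_on g (carrier X)"
  proof (rule inj_onI)
    fix x y assume xy: "x \<in> carrier X" "y \<in> carrier X" "g x = g y"
    then have "h (x \<ominus>\<^bsub>X\<^esub> y) = 0"
      by (metis assms(1,3) g right_minus_eq ring_map_diff)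
    then have "emb X (x \<ominus>\<^bsub>X\<^esub> y) = 0"
      using assms(5) xy(1,2) by (metis X.minus_closed assms(1) emb_ring_map ring_map_zero)
    then show "x = y"
      using xy(1,2) by (simp add: ring_map_diff[OF \<open>ring X\<close> emb_ring_map] emb_inj \<open>ring X\<close>)
  qed
  have gim: "g ` carrier X = carrier Y"
  proof
    show "carrier Y \<subseteq> g ` carrier X"
    proof
      fix y assume y: "y \<in> carrier Y"
      then obtain x where "x \<in> carrier X" "h x = emb Y y" using assms(4) by (metis imageE imageI)
      then show "y \<in> g ` carrier X" using y g emb_inj[OF \<open>ring Y\<close>] by (metis imageI)
    qed
  qed (use g in auto)
  have gm: "g (x \<otimes>\<^bsub>X\<^esub> y) = g x \<otimes>\<^bsub>Y\<^esub> g y" "g (x \<oplus>\<^bsub>X\<^esub> y) = g x \<oplus>\<^bsub>Y\<^esub> g y"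
    if "x \<in> carrier X" "y \<in> carrier X" for x y
    using that by (simp_all add: g_def ring_mapD[OF assms(3)] \<open>ring Y\<close>)
  have "g \<one>\<^bsub>X\<^esub> = \<one>\<^bsub>Y\<^esub>"
  proof -
    \<comment> \<open>Unitality is not assumed of \<open>h\<close>. The unit of \<open>Y\<close> has
      a preimage \<open>x\<close>, and multiplication by \<open>g x\<close> identifies the image of
      the unit of \<open>X\<close>.\<close>
    obtain x where x: "x \<in> carrier X" "g x = \<one>\<^bsub>Y\<^esub>" using gim by (metis Y.one_closed imageE)
    have "g \<one>\<^bsub>X\<^esub> = g \<one>\<^bsub>X\<^esub> \<otimes>\<^bsub>Y\<^esub> g x" using x g by simp
    also have "\<dots> = g (\<one>\<^bsub>X\<^esub> \<otimes>\<^bsub>X\<^esub> x)" using x by (subst gm(1)) auto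
    finally show ?thesis using x by simp
  qed
  then have "g \<in> ring_iso X Y"
    using g gm ginj gim by (auto simp: ring_iso_def ring_hom_def bij_betw_def)
  then show ?thesis by (auto simp: is_ring_iso_def)
qed

section \<open>Path algebras and free algebras\<close>

text \<open>Both sides run over the pairs of cut points \<open>j \<le> k < n\<close>. This is the
  associativity of the product, for path algebras as well as for free algebras.\<close>

lemma sum_triangle_shift:
  fixes F :: "nat \<Rightarrow> nat \<Rightarrow> 'a::comm_monoid_add"
  shows "(\<Sum>k<n. \<Sum>j<Suc k. F j k) = (\<Sum>j<n. \<Sum>k<n - j. F j (j + k))"
proof -
  have "(\<Sum>k<n. \<Sum>j<Suc k. F j k) = (\<Sum>(k, j)\<in>Sigma {..<n} (\<lambda>k. {..<Suc k}). F j k)"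
    by (rule sum.Sigma) auto
  also have "\<dots> = (\<Sum>(j, k)\<in>Sigma {..<n} (\<lambda>j. {..<n - j}). F j (j + k))"
    by (rule sum.reindex_bij_witness[where i = "\<lambda>(j, k). (j + k, j)" and j = "\<lambda>(k, j). (j, k - j)"])
      auto
  also have "\<dots> = (\<Sum>j<n. \<Sum>k<n - j. F j (j + k))"
    by (rule sum.Sigma[symmetric]) auto
  finally show ?thesis .
qed

definition psingle :: "('s, 'z) ring_scheme \<Rightarrow> 'v list \<Rightarrow> 's \<Rightarrow> 'v list \<Rightarrow> 's" where
  "psingle S w s = (\<lambda>v. if v = w then s else \<zero>\<^bsub>S\<^esub>)"

lemma paths_append:
  assumes "u \<in> paths F E" "v \<in> paths F E" "last u = hd v"
  shows "u @ tl v \<in> paths F E"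
  using assms by (cases v) (auto simp: paths_def successively_append_iff successively_Cons)

text \<open>The pieces \<open>take (Suc k) w\<close> and \<open>drop k w\<close> share the vertex at
  position \<open>k\<close>, which is why paths are glued with \<open>tl\<close>.\<close>

lemma paths_split:
  assumes "k < length w" "take (Suc k) w \<in> paths F E" "drop k w \<in> paths F E"
  shows "w \<in> paths F E" "w = take (Suc k) w @ tl (drop k w)"
proof -
  show w: "w = take (Suc k) w @ tl (drop k w)"
    by (metis append_take_drop_id drop_Suc tl_drop)
  have "last (take (Suc k) w) = hd (drop k w)"
    using assms(1) by (simp add: take_Suc_conv_app_nth hd_drop_conv_nth)
  then show "w \<in> paths F E" using paths_append[OF assms(2,3)] w by simp
qed

text \<open>Identities between coefficients are proved after applying \<open>j\<close>, where the
  sums over cut points are sums of a type-class ring. Finiteness of \<open>F\<close> puts the sum of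
  the trivial paths, the unit, into the carrier.\<close>

locale path_algebra_over = cring S for S :: "'s ring" (structure) +
  fixes F :: "'v set" and E :: "'v \<Rightarrow> 'v \<Rightarrow> bool"
  assumes finite_vertices: "finite F"
begin

abbreviation "PA \<equiv> path_algebra F E S"
abbreviation "j \<equiv> emb S"

lemma j_map: "ring_map S j" by (rule emb_ring_map) (rule ring_axioms)

lemma j_eq: "x \<in> carrier S \<Longrightarrow> y \<in> carrier S \<Longrightarrow> x = y \<longleftrightarrow> j x = j y"
  by (simp add: emb_inj ring_axioms)

lemma j_simps:
  "x \<in> carrier S \<Longrightarrow> y \<in> carrier S \<Longrightarrow> j (x \<oplus> y) = j x + j y"
  "x \<in> carrier S \<Longrightarrow> y \<in> carrier S \<Longrightarrow> j (x \<otimes> y) = j x * j y"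
  "j \<zero> = 0"
  "finite I \<Longrightarrow> (\<And>i. i \<in> I \<Longrightarrow> g i \<in> carrier S) \<Longrightarrow> j (finsum S g I) = (\<Sum>i\<in>I. j (g i))"
  using ring_mapD[OF j_map] ring_map_zero[OF ring_axioms j_map] apply auto[3]
  by (rule ring_map_finsum[OF ring_axioms j_map])

lemma PA_simps:
  "monoid.mult PA f g w = (\<Oplus>k\<in>{..<length w}. f (take (Suc k) w) \<otimes> g (drop k w))"
  "\<one>\<^bsub>PA\<^esub> w = (if w \<in> (\<lambda>v. [v]) ` F then \<one> else \<zero>)"
  "\<zero>\<^bsub>PA\<^esub> w = \<zero>" "(f \<oplus>\<^bsub>PA\<^esub> g) w = f w \<oplus> g w"
  by (simp_all add: path_algebra_def)

lemma PA_carrierI: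
  "(\<And>w. f w \<in> carrier S) \<Longrightarrow> finite {w. f w \<noteq> \<zero>} \<Longrightarrow> {w. f w \<noteq> \<zero>} \<subseteq> paths F E \<Longrightarrow> f \<in> carrier PA"
  by (simp add: path_algebra_def)

lemma PA_carrierD:
  assumes "f \<in> carrier PA"
  shows "f w \<in> carrier S" "finite {w. f w \<noteq> \<zero>}" "f w \<noteq> \<zero> \<Longrightarrow> w \<in> paths F E"
  using assms by (auto simp: path_algebra_def)

lemma PA_mult_nonzero:
  assumes "f \<in> carrier PA" "g \<in> carrier PA" "(f \<otimes>\<^bsub>PA\<^esub> g) w \<noteq> \<zero>"
  shows "\<exists>k<length w. f (take (Suc k) w) \<noteq> \<zero> \<and> g (drop k w) \<noteq> \<zero>"
proof (rule ccontr)
  assume "\<not> ?thesis"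
  then have *: "f (take (Suc k) w) = \<zero> \<or> g (drop k w) = \<zero>" if "k < length w" for k using that by blast
  have "f (take (Suc k) w) \<otimes> g (drop k w) = \<zero>" if "k < length w" for k
    using *[OF that] PA_carrierD(1)[OF assms(1)] PA_carrierD(1)[OF assms(2)] by auto
  then have "(f \<otimes>\<^bsub>PA\<^esub> g) w = (\<Oplus>k\<in>{..<length w}. \<zero>)"
    unfolding PA_simps by (intro finsum_cong') auto
  then show False using assms(3) by simp
qed

lemma PA_mult_closed:
  assumes "f \<in> carrier PA" "g \<in> carrier PA" shows "f \<otimes>\<^bsub>PA\<^esub> g \<in> carrier PA"
proof (rule PA_carrierI)
  note D = PA_carrierD[OF assms(1)] PA_carrierD[OF assms(2)]
  show "(f \<otimes>\<^bsub>PA\<^esub> g) w \<in> carrier S" for w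
    unfolding PA_simps by (rule finsum_closed) (use D in auto)
  have *: "w \<in> (\<lambda>(u, v). u @ tl v) ` ({u. f u \<noteq> \<zero>} \<times> {v. g v \<noteq> \<zero>}) \<and> w \<in> paths F E"
    if nz: "(f \<otimes>\<^bsub>PA\<^esub> g) w \<noteq> \<zero>" for w
  proof -
    obtain k where k: "k < length w" "f (take (Suc k) w) \<noteq> \<zero>" "g (drop k w) \<noteq> \<zero>"
      using PA_mult_nonzero[OF assms nz] by blast
    show ?thesis using paths_split[OF k(1), of F E] k D(3,6) by (auto intro!: image_eqI[of _ _ "(take (Suc k) w, drop k w)"])
  qed
  show "finite {w. (f \<otimes>\<^bsub>PA\<^esub> g) w \<noteq> \<zero>}"
    by (rule finite_subset[of _ "(\<lambda>(u, v). u @ tl v) ` ({u. f u \<noteq> \<zero>} \<times> {v. g v \<noteq> \<zero>})"])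
      (use * D in auto)
  show "{w. (f \<otimes>\<^bsub>PA\<^esub> g) w \<noteq> \<zero>} \<subseteq> paths F E" using * by blast
qed

lemma PA_add_closed:
  assumes "f \<in> carrier PA" "g \<in> carrier PA" shows "f \<oplus>\<^bsub>PA\<^esub> g \<in> carrier PA"
proof (rule PA_carrierI)
  note D = PA_carrierD[OF assms(1)] PA_carrierD[OF assms(2)]
  show "(f \<oplus>\<^bsub>PA\<^esub> g) w \<in> carrier S" for w using D by (auto simp: PA_simps)
  have *: "f w \<noteq> \<zero> \<or> g w \<noteq> \<zero>" if "(f \<oplus>\<^bsub>PA\<^esub> g) w \<noteq> \<zero>" for w
    using that by (auto simp: PA_simps)
  show "finite {w. (f \<oplus>\<^bsub>PA\<^esub> g) w \<noteq> \<zero>}"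
    by (rule finite_subset[of _ "{w. f w \<noteq> \<zero>} \<union> {w. g w \<noteq> \<zero>}"]) (use * D in auto)
  show "{w. (f \<oplus>\<^bsub>PA\<^esub> g) w \<noteq> \<zero>} \<subseteq> paths F E" using * D by blast
qed

lemma psingle_closed:
  assumes "w \<in> paths F E" "s \<in> carrier S" shows "psingle S w s \<in> carrier PA"
proof (rule PA_carrierI)
  have "{v. psingle S w s v \<noteq> \<zero>} \<subseteq> {w}" by (auto simp: psingle_def)
  then show "finite {v. psingle S w s v \<noteq> \<zero>}" "{v. psingle S w s v \<noteq> \<zero>} \<subseteq> paths F E"
    using assms finite_subset by auto
qed (use assms in \<open>auto simp: psingle_def\<close>)

lemma J:
  assumes "a \<in> carrier PA" "b \<in> carrier PA"
  shows "j ((a \<otimes>\<^bsub>PA\<^esub> b) w) = (\<Sum>k<length w. j (a (take (Suc k) w)) * j (b (drop k w)))"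
  unfolding PA_simps using PA_carrierD[OF assms(1)] PA_carrierD[OF assms(2)]
  by (simp add: j_simps)

lemma j_one_mult: "x \<in> carrier S \<Longrightarrow> j \<one> * j x = j x" "x \<in> carrier S \<Longrightarrow> j x * j \<one> = j x"
  using j_simps(2)[of \<one> x] j_simps(2)[of x \<one>] by simp_all

lemma singleton_path: "v \<in> F \<Longrightarrow> [v] \<in> paths F E" by (auto simp: paths_def)

lemma PA_one_closed: "\<one>\<^bsub>PA\<^esub> \<in> carrier PA"
proof -
  have "{w. \<one>\<^bsub>PA\<^esub> w \<noteq> \<zero>} \<subseteq> (\<lambda>v. [v]) ` F" by (auto simp: PA_simps)
  then show ?thesis
    using finite_vertices singleton_path
    by (intro PA_carrierI) (auto simp: PA_simps intro: finite_subset)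
qed

lemma PA_ring: "ring PA"
proof (rule ringI)
  show "abelian_group PA"
  proof (rule abelian_groupI)
    fix f assume f: "f \<in> carrier PA"
    note D = PA_carrierD[OF f]
    have "(\<lambda>w. \<ominus> f w) \<in> carrier PA"
    proof (rule PA_carrierI)
      have "{w. \<ominus> f w \<noteq> \<zero>} \<subseteq> {w. f w \<noteq> \<zero>}" using D by auto
      then show "finite {w. \<ominus> f w \<noteq> \<zero>}" "{w. \<ominus> f w \<noteq> \<zero>} \<subseteq> paths F E"
        using D finite_subset by auto
    qed (use D in auto)
    moreover have "(\<lambda>w. \<ominus> f w) \<oplus>\<^bsub>PA\<^esub> f = \<zero>\<^bsub>PA\<^esub>" using D by (auto simp: PA_simps l_neg)
    ultimately show "\<exists>g\<in>carrier PA. g \<oplus>\<^bsub>PA\<^esub> f = \<zero>\<^bsub>PA\<^esub>" by blast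
  next
    show "\<zero>\<^bsub>PA\<^esub> \<in> carrier PA" by (rule PA_carrierI) (auto simp: PA_simps)
  qed (auto intro!: PA_add_closed simp: PA_simps PA_carrierD a_assoc fun_eq_iff intro: a_comm)
  show "monoid PA"
  proof (rule monoidI)
    show "\<one>\<^bsub>PA\<^esub> \<in> carrier PA" by (rule PA_one_closed)
    fix f g h assume fgh: "f \<in> carrier PA" "g \<in> carrier PA" "h \<in> carrier PA"
    note C = PA_mult_closed[OF fgh(1,2)] PA_mult_closed[OF fgh(2,3)]
    show "f \<otimes>\<^bsub>PA\<^esub> g \<otimes>\<^bsub>PA\<^esub> h = f \<otimes>\<^bsub>PA\<^esub> (g \<otimes>\<^bsub>PA\<^esub> h)"
    proof
      fix w :: "'v list"
      let ?n = "length w"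
      have "j ((f \<otimes>\<^bsub>PA\<^esub> g \<otimes>\<^bsub>PA\<^esub> h) w) = (\<Sum>k<?n. \<Sum>i<Suc k.
          j (f (take (Suc i) w)) * j (g (drop i (take (Suc k) w))) * j (h (drop k w)))"
        unfolding J[OF C(1) fgh(3)] J[OF fgh(1,2)] sum_distrib_right
        by (intro sum.cong refl) (auto simp: min_def)
      also have "\<dots> = (\<Sum>i<?n. \<Sum>k<?n - i.
          j (f (take (Suc i) w)) * j (g (drop i (take (Suc (i + k)) w))) * j (h (drop (i + k) w)))"
        by (rule sum_triangle_shift)
      also have "\<dots> = j ((f \<otimes>\<^bsub>PA\<^esub> (g \<otimes>\<^bsub>PA\<^esub> h)) w)"
        unfolding J[OF fgh(1) C(2)] J[OF fgh(2,3)] sum_distrib_left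
        by (intro sum.cong refl) (auto simp: mult.assoc drop_take add.commute)
      finally show "(f \<otimes>\<^bsub>PA\<^esub> g \<otimes>\<^bsub>PA\<^esub> h) w = (f \<otimes>\<^bsub>PA\<^esub> (g \<otimes>\<^bsub>PA\<^esub> h)) w"
        by (subst j_eq) (use PA_carrierD[OF PA_mult_closed] C fgh in auto)
    qed
  next
    fix f assume f: "f \<in> carrier PA"
    note D = PA_carrierD[OF f]
    have nil: "f [] = \<zero>" using D(3)[of "[]"] by (auto simp: paths_def)
    have hd: "f w = \<zero> \<or> hd w \<in> F" "f w = \<zero> \<or> last w \<in> F" for w
    proof -
      have "hd w \<in> F \<and> last w \<in> F" if "f w \<noteq> \<zero>"
        using D(3)[OF that] hd_in_set[of w] last_in_set[of w] by (auto simp: paths_def)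
      then show "f w = \<zero> \<or> hd w \<in> F" "f w = \<zero> \<or> last w \<in> F" by auto
    qed
    note one = PA_one_closed
    show "\<one>\<^bsub>PA\<^esub> \<otimes>\<^bsub>PA\<^esub> f = f"
    proof
      fix w
      have "j ((\<one>\<^bsub>PA\<^esub> \<otimes>\<^bsub>PA\<^esub> f) w) = (\<Sum>k<length w. if k = 0 then j (f w) else 0)"
        unfolding J[OF one f]
      proof (intro sum.cong refl)
        fix k assume k: "k \<in> {..<length w}"
        show "j (\<one>\<^bsub>PA\<^esub> (take (Suc k) w)) * j (f (drop k w)) = (if k = 0 then j (f w) else 0)"
        proof (cases "k = 0")
          case True
          then have "take (Suc k) w = [hd w]" "drop k w = w" using k by (auto simp: take_Suc)
          then show ?thesis using True hd(1)[of w] D(1) by (auto simp: PA_simps j_simps j_one_mult)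
        next
          case False
          then have "length (take (Suc k) w) \<noteq> 1" using k by auto
          then have "take (Suc k) w \<notin> (\<lambda>v. [v]) ` F"
            by (metis One_nat_def imageE length_Cons list.size(3))
          then show ?thesis using False by (simp add: PA_simps j_simps)
        qed
      qed
      also have "\<dots> = j (f w)" using nil by (cases w) (auto simp: j_simps)
      finally show "(\<one>\<^bsub>PA\<^esub> \<otimes>\<^bsub>PA\<^esub> f) w = f w"
        using PA_carrierD(1)[OF PA_mult_closed[OF one f]] D(1) by (simp add: j_eq)
    qed
    show "f \<otimes>\<^bsub>PA\<^esub> \<one>\<^bsub>PA\<^esub> = f"
    proof
      fix w
      have "j ((f \<otimes>\<^bsub>PA\<^esub> \<one>\<^bsub>PA\<^esub>) w) = (\<Sum>k<length w. if k = length w - 1 then j (f w) else 0)"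
        unfolding J[OF f one]
      proof (intro sum.cong refl)
        fix k assume k: "k \<in> {..<length w}"
        show "j (f (take (Suc k) w)) * j (\<one>\<^bsub>PA\<^esub> (drop k w)) = (if k = length w - 1 then j (f w) else 0)"
        proof (cases "k = length w - 1")
          case True
          with k have "drop k w = [last w]" "take (Suc k) w = w"
            by (cases w rule: rev_cases; simp)+
          then show ?thesis using True hd(2)[of w] D(1) by (auto simp: PA_simps j_simps j_one_mult)
        next
          case False
          then have "length (drop k w) \<noteq> 1" using k by auto
          then have "drop k w \<notin> (\<lambda>v. [v]) ` F"
            by (metis One_nat_def imageE length_Cons list.size(3))
          then show ?thesis using False by (simp add: PA_simps j_simps)
        qed
      qed
      also have "\<dots> = j (f w)" using nil by (cases w) (auto simp: j_simps)
      finally show "(f \<otimes>\<^bsub>PA\<^esub> \<one>\<^bsub>PA\<^esub>) w = f w"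
        using PA_carrierD(1)[OF PA_mult_closed[OF f one]] D(1) by (simp add: j_eq)
    qed
  qed (rule PA_mult_closed)
next
  fix f g h assume fgh: "f \<in> carrier PA" "g \<in> carrier PA" "h \<in> carrier PA"
  note D = PA_carrierD[OF fgh(1)] PA_carrierD[OF fgh(2)] PA_carrierD[OF fgh(3)]
  show "(f \<oplus>\<^bsub>PA\<^esub> g) \<otimes>\<^bsub>PA\<^esub> h = f \<otimes>\<^bsub>PA\<^esub> h \<oplus>\<^bsub>PA\<^esub> g \<otimes>\<^bsub>PA\<^esub> h"
    using D by (auto simp: PA_simps fun_eq_iff l_distr finsum_addf Pi_def)
  show "h \<otimes>\<^bsub>PA\<^esub> (f \<oplus>\<^bsub>PA\<^esub> g) = h \<otimes>\<^bsub>PA\<^esub> f \<oplus>\<^bsub>PA\<^esub> h \<otimes>\<^bsub>PA\<^esub> g"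
    using D by (auto simp: PA_simps fun_eq_iff r_distr finsum_addf Pi_def)
qed

lemma PA_induct [consumes 1, case_names zero single add]:
  assumes f: "f \<in> carrier PA" and "P \<zero>\<^bsub>PA\<^esub>"
    and "\<And>w s. w \<in> paths F E \<Longrightarrow> s \<in> carrier S \<Longrightarrow> P (psingle S w s)"
    and "\<And>f g. f \<in> carrier PA \<Longrightarrow> g \<in> carrier PA \<Longrightarrow> P f \<Longrightarrow> P g \<Longrightarrow> P (f \<oplus>\<^bsub>PA\<^esub> g)"
  shows "P f"
  using f
proof (induction "card {w. f w \<noteq> \<zero>}" arbitrary: f)
  case 0
  then have "f = \<zero>\<^bsub>PA\<^esub>" using PA_carrierD(2)[of f] by (auto simp: PA_simps fun_eq_iff)
  then show ?case using assms(2) by simp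
next
  case (Suc n)
  note D = PA_carrierD[OF Suc.prems]
  obtain w where w: "f w \<noteq> \<zero>" using Suc.hyps(2) by (metis (mono_tags) card.empty empty_Collect_eq nat.distinct(1))
  let ?g = "f(w := \<zero>)"
  have supp: "{v. ?g v \<noteq> \<zero>} = {v. f v \<noteq> \<zero>} - {w}" by auto
  have g: "?g \<in> carrier PA"
    by (rule PA_carrierI) (use D supp in auto)
  have "P ?g" by (rule Suc.hyps(1)[OF _ g]) (use supp w D(2) Suc.hyps(2) in simp)
  moreover have "psingle S w (f w) \<oplus>\<^bsub>PA\<^esub> ?g = f"
    using D by (auto simp: PA_simps psingle_def fun_eq_iff)
  ultimately show ?case
    using assms(3)[of w "f w"] assms(4)[OF psingle_closed g, of w "f w"] D w by auto
qed

lemma psingle_mult: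
  assumes "u \<in> paths F E" "v \<in> paths F E" "a \<in> carrier S" "b \<in> carrier S"
  shows "psingle S u a \<otimes>\<^bsub>PA\<^esub> psingle S v b =
    (if last u = hd v then psingle S (u @ tl v) (a \<otimes> b) else \<zero>\<^bsub>PA\<^esub>)"
proof
  fix w
  let ?f = "psingle S u a \<otimes>\<^bsub>PA\<^esub> psingle S v b"
  have ne: "u \<noteq> []" "v \<noteq> []" using assms by (auto simp: paths_def)
  have c: "psingle S u a \<in> carrier PA" "psingle S v b \<in> carrier PA"
    using assms psingle_closed by auto
  have *: "take (Suc k) w = u \<and> drop k w = v \<longleftrightarrow> k = length u - 1 \<and> w = u @ tl v \<and> last u = hd v"
    if "k < length w" for k
  proof
    assume H: "take (Suc k) w = u \<and> drop k w = v"
    then have "length u = Suc k" using that by auto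
    moreover have "last u = hd v" using H that by (auto simp: take_Suc_conv_app_nth hd_drop_conv_nth)
    moreover have "w = u @ tl v" using H by (metis append_take_drop_id drop_Suc tl_drop)
    ultimately show "k = length u - 1 \<and> w = u @ tl v \<and> last u = hd v" by auto
  next
    assume H: "k = length u - 1 \<and> w = u @ tl v \<and> last u = hd v"
    then have "take (Suc k) w = u" using ne by (simp add: Suc_leI)
    moreover have "drop k w = last u # tl v"
      using H ne by (metis append_butlast_last_id append_eq_conv_conj append_assoc append_Cons append_Nil length_butlast)
    ultimately show "take (Suc k) w = u \<and> drop k w = v" using H ne by simp
  qed
  have "j (?f w) = (\<Sum>k<length w. if k = length u - 1 \<and> w = u @ tl v \<and> last u = hd v then j a * j b else 0)"
    unfolding J[OF c]
  proof (intro sum.cong refl)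
    fix k assume "k \<in> {..<length w}"
    then have k: "k < length w" by simp
    show "j (psingle S u a (take (Suc k) w)) * j (psingle S v b (drop k w)) =
      (if k = length u - 1 \<and> w = u @ tl v \<and> last u = hd v then j a * j b else 0)"
      unfolding *[OF k, symmetric] by (auto simp: psingle_def j_simps)
  qed
  also have "\<dots> = (if w = u @ tl v \<and> last u = hd v then j a * j b else 0)"
  proof (cases "w = u @ tl v \<and> last u = hd v")
    case True
    then have "length u - 1 < length w" using ne by (cases u) auto
    then show ?thesis using True by (simp add: if_distrib cong: if_cong)
  qed auto
  also have "\<dots> = j ((if last u = hd v then psingle S (u @ tl v) (a \<otimes> b) else \<zero>\<^bsub>PA\<^esub>) w)"
    using assms by (auto simp: psingle_def j_simps PA_simps)
  finally show "?f w = (if last u = hd v then psingle S (u @ tl v) (a \<otimes> b) else \<zero>\<^bsub>PA\<^esub>) w"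
    using PA_carrierD(1)[OF PA_mult_closed[OF c]] assms
    by (subst j_eq) (auto simp: psingle_def PA_simps)
qed

lemma psingle_add:
  "a \<in> carrier S \<Longrightarrow> b \<in> carrier S \<Longrightarrow> psingle S w (a \<oplus> b) = psingle S w a \<oplus>\<^bsub>PA\<^esub> psingle S w b"
  by (auto simp: psingle_def PA_simps fun_eq_iff)

text \<open>Universal property of \<open>P(Q) \<otimes> S\<close>: a map on coefficients and a
  multiplicative map on paths combine as soon as their values commute.\<close>

lemma PA_lift:
  fixes h :: "'s \<Rightarrow> 'r::ring" and m :: "'v list \<Rightarrow> 'r"
  assumes h: "ring_map S h"
    and comm: "\<And>s w. s \<in> carrier S \<Longrightarrow> w \<in> paths F E \<Longrightarrow> h s * m w = m w * h s"
    and m: "\<And>u v. u \<in> paths F E \<Longrightarrow> v \<in> paths F E \<Longrightarrow>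
      m u * m v = (if last u = hd v then m (u @ tl v) else 0)"
  obtains \<Phi> where "ring_map PA \<Phi>"
    "\<And>w s. w \<in> paths F E \<Longrightarrow> s \<in> carrier S \<Longrightarrow> \<Phi> (psingle S w s) = h s * m w"
proof -
  define \<Phi> where "\<Phi> f = (\<Sum>w\<in>{w. f w \<noteq> \<zero>}. h (f w) * m w)" for f
  note hz = ring_map_zero[OF ring_axioms h]
  have sup: "\<Phi> f = (\<Sum>w\<in>W. h (f w) * m w)" if "finite W" "{w. f w \<noteq> \<zero>} \<subseteq> W" for f W
    unfolding \<Phi>_def by (rule sum.mono_neutral_left) (use that hz in auto)
  have add: "\<Phi> (f \<oplus>\<^bsub>PA\<^esub> g) = \<Phi> f + \<Phi> g" if fg: "f \<in> carrier PA" "g \<in> carrier PA" for f g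
  proof -
    note D = PA_carrierD[OF fg(1)] PA_carrierD[OF fg(2)]
    let ?W = "{w. f w \<noteq> \<zero>} \<union> {w. g w \<noteq> \<zero>}"
    have "\<Phi> (f \<oplus>\<^bsub>PA\<^esub> g) = (\<Sum>w\<in>?W. h ((f \<oplus>\<^bsub>PA\<^esub> g) w) * m w)"
      using D by (intro sup) (auto simp: PA_simps)
    also have "\<dots> = (\<Sum>w\<in>?W. h (f w) * m w) + (\<Sum>w\<in>?W. h (g w) * m w)"
      unfolding sum.distrib[symmetric]
      by (rule sum.cong) (use D in \<open>auto simp: PA_simps ring_mapD[OF h] algebra_simps\<close>)
    also have "\<dots> = \<Phi> f + \<Phi> g" using D sup[of ?W f] sup[of ?W g] by auto
    finally show ?thesis .
  qed
  have single: "\<Phi> (psingle S w s) = h s * m w" for w s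
    by (subst sup[of "{w}"]) (auto simp: psingle_def)
  have zero: "\<Phi> \<zero>\<^bsub>PA\<^esub> = 0" by (subst sup[of "{}"]) (auto simp: PA_simps)
  interpret PA: ring PA by (rule PA_ring)
  have "\<Phi> (f \<otimes>\<^bsub>PA\<^esub> g) = \<Phi> f * \<Phi> g" if f: "f \<in> carrier PA" and g: "g \<in> carrier PA" for f g
    using f
  proof (induction f rule: PA_induct)
    case (single u a)
    note u = this
    show ?case using g
    proof (induction g rule: PA_induct)
      case (single v b)
      \<comment> \<open>The coefficient \<open>b\<close> has to move past the path \<open>u\<close>;
        this is what the commutation hypothesis provides.\<close>
      have "h a * h b * m u * m v = h a * m u * h b * m v"
        using comm[of b u] u single by (simp add: mult.assoc)
      then show ?case
        using u single m[OF u(1) single(1)]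
        by (auto simp: psingle_mult \<open>\<And>w s. \<Phi> (psingle S w s) = h s * m w\<close> zero ring_mapD[OF h] mult.assoc)
    qed (use u psingle_closed in \<open>auto simp: zero add PA.r_distr algebra_simps\<close>)
  qed (use g in \<open>auto simp: zero add PA.l_distr algebra_simps\<close>)
  then have "ring_map PA \<Phi>" by (simp add: ring_map_def add)
  then show ?thesis using single that by blast
qed

end

section \<open>Free algebras\<close>

lemma free_algebra_simps:
  "monoid.mult (free_algebra X) f g w = (\<Sum>k\<le>length w. f (take k w) * g (drop k w))"
  "\<one>\<^bsub>free_algebra X\<^esub> = word 1 []" "\<zero>\<^bsub>free_algebra X\<^esub> w = 0"
  "(f \<oplus>\<^bsub>free_algebra X\<^esub> g) w = f w + g w"
  by (simp_all add: free_algebra_def word_def)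

lemma free_algebra_carrier:
  "f \<in> carrier (free_algebra X) \<longleftrightarrow> finite {w. f w \<noteq> 0} \<and> (\<forall>w. f w \<noteq> 0 \<longrightarrow> w \<in> lists X)"
  by (auto simp: free_algebra_def)

lemma word_closed: "w \<in> lists X \<Longrightarrow> word c w \<in> carrier (free_algebra X)"
  by (auto simp: free_algebra_carrier word_def intro: finite_subset[of _ "{w}"])

lemma free_algebra_mult_closed:
  assumes "f \<in> carrier (free_algebra X)" "g \<in> carrier (free_algebra X)"
  shows "f \<otimes>\<^bsub>free_algebra X\<^esub> g \<in> carrier (free_algebra X)"
proof -
  have *: "w \<in> (\<lambda>(u, v). u @ v) ` ({u. f u \<noteq> 0} \<times> {v. g v \<noteq> 0}) \<and> w \<in> lists X"
    if nz: "(f \<otimes>\<^bsub>free_algebra X\<^esub> g) w \<noteq> 0" for w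
  proof -
    obtain k where k: "f (take k w) \<noteq> 0" "g (drop k w) \<noteq> 0"
      using nz unfolding free_algebra_simps by (metis (no_types, lifting) mult_eq_0_iff sum.neutral)
    then have "take k w \<in> lists X" "drop k w \<in> lists X" using assms by (auto simp: free_algebra_carrier)
    then have "take k w @ drop k w \<in> lists X" by (simp only: append_in_lists_conv)
    then show ?thesis using k by (auto intro!: image_eqI[of _ _ "(take k w, drop k w)"])
  qed
  have "finite {w. (f \<otimes>\<^bsub>free_algebra X\<^esub> g) w \<noteq> 0}"
    by (rule finite_subset[of _ "(\<lambda>(u, v). u @ v) ` ({u. f u \<noteq> 0} \<times> {v. g v \<noteq> 0})"])
      (use * assms in \<open>auto simp: free_algebra_carrier\<close>)
  then show ?thesis using * by (auto simp: free_algebra_carrier)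
qed

lemma free_algebra_ring: "ring (free_algebra X)"
proof (rule ringI)
  let ?A = "free_algebra X"
  show "abelian_group ?A"
  proof (rule abelian_groupI)
    fix f g assume fg: "f \<in> carrier ?A" "g \<in> carrier ?A"
    have "{w. (f \<oplus>\<^bsub>?A\<^esub> g) w \<noteq> 0} \<subseteq> {w. f w \<noteq> 0} \<union> {w. g w \<noteq> 0}"
      by (auto simp: free_algebra_simps)
    moreover have "finite ({w. f w \<noteq> 0} \<union> {w. g w \<noteq> 0})" "{w. f w \<noteq> 0} \<union> {w. g w \<noteq> 0} \<subseteq> lists X"
      using fg unfolding free_algebra_carrier by blast+
    ultimately show "f \<oplus>\<^bsub>?A\<^esub> g \<in> carrier ?A"
      unfolding free_algebra_carrier by (meson finite_subset mem_Collect_eq subset_iff)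
  next
    fix f assume f: "f \<in> carrier ?A"
    have "(\<lambda>w. - f w) \<in> carrier ?A" using f by (auto simp: free_algebra_carrier)
    moreover have "(\<lambda>w. - f w) \<oplus>\<^bsub>?A\<^esub> f = \<zero>\<^bsub>?A\<^esub>"
      by (auto simp: free_algebra_simps)
    ultimately show "\<exists>g\<in>carrier ?A. g \<oplus>\<^bsub>?A\<^esub> f = \<zero>\<^bsub>?A\<^esub>" by blast
  qed (auto simp: free_algebra_carrier free_algebra_simps fun_eq_iff)
  show "monoid ?A"
  proof (rule monoidI)
    show "\<one>\<^bsub>?A\<^esub> \<in> carrier ?A" unfolding free_algebra_simps by (rule word_closed) simp
    fix f g h assume "f \<in> carrier ?A"
    show "f \<otimes>\<^bsub>?A\<^esub> g \<otimes>\<^bsub>?A\<^esub> h = f \<otimes>\<^bsub>?A\<^esub> (g \<otimes>\<^bsub>?A\<^esub> h)"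
    proof
      fix w :: "'a list"
      let ?n = "length w"
      have "(f \<otimes>\<^bsub>?A\<^esub> g \<otimes>\<^bsub>?A\<^esub> h) w = (\<Sum>k<Suc ?n. \<Sum>i<Suc k.
          f (take i w) * g (drop i (take k w)) * h (drop k w))"
        unfolding free_algebra_simps sum_distrib_right lessThan_Suc_atMost
        by (intro sum.cong refl) (auto simp: min_def)
      also have "\<dots> = (\<Sum>i<Suc ?n. \<Sum>k<Suc ?n - i.
          f (take i w) * g (drop i (take (i + k) w)) * h (drop (i + k) w))"
        by (rule sum_triangle_shift)
      also have "\<dots> = (f \<otimes>\<^bsub>?A\<^esub> (g \<otimes>\<^bsub>?A\<^esub> h)) w"
        unfolding free_algebra_simps sum_distrib_left lessThan_Suc_atMost[symmetric]
        by (intro sum.cong refl) (auto simp: mult.assoc drop_take add.commute Suc_diff_le)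
      finally show "(f \<otimes>\<^bsub>?A\<^esub> g \<otimes>\<^bsub>?A\<^esub> h) w = (f \<otimes>\<^bsub>?A\<^esub> (g \<otimes>\<^bsub>?A\<^esub> h)) w" .
    qed
    show "\<one>\<^bsub>?A\<^esub> \<otimes>\<^bsub>?A\<^esub> f = f"
    proof
      fix w
      have "(\<one>\<^bsub>?A\<^esub> \<otimes>\<^bsub>?A\<^esub> f) w = (\<Sum>k\<le>length w. if k = 0 then f w else 0)"
        unfolding free_algebra_simps by (intro sum.cong refl) (auto simp: word_def)
      then show "(\<one>\<^bsub>?A\<^esub> \<otimes>\<^bsub>?A\<^esub> f) w = f w" by simp
    qed
    show "f \<otimes>\<^bsub>?A\<^esub> \<one>\<^bsub>?A\<^esub> = f"
    proof
      fix w
      have "(f \<otimes>\<^bsub>?A\<^esub> \<one>\<^bsub>?A\<^esub>) w = (\<Sum>k\<le>length w. if k = length w then f w else 0)"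
        unfolding free_algebra_simps by (intro sum.cong refl) (auto simp: word_def)
      then show "(f \<otimes>\<^bsub>?A\<^esub> \<one>\<^bsub>?A\<^esub>) w = f w" by simp
    qed
  qed (rule free_algebra_mult_closed)
qed (auto simp: free_algebra_simps fun_eq_iff algebra_simps sum.distrib)

lemma free_algebra_induct [consumes 1, case_names zero word add]:
  assumes f: "f \<in> carrier (free_algebra X)" and "P \<zero>\<^bsub>free_algebra X\<^esub>"
    and "\<And>w c. w \<in> lists X \<Longrightarrow> P (word c w)"
    and "\<And>f g. f \<in> carrier (free_algebra X) \<Longrightarrow> g \<in> carrier (free_algebra X) \<Longrightarrow> P f \<Longrightarrow> P g \<Longrightarrow>
      P (f \<oplus>\<^bsub>free_algebra X\<^esub> g)"
  shows "P f"
  using f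
proof (induction "card {w. f w \<noteq> 0}" arbitrary: f)
  case 0
  then have "f = \<zero>\<^bsub>free_algebra X\<^esub>" by (auto simp: free_algebra_simps free_algebra_carrier fun_eq_iff)
  then show ?case using assms(2) by simp
next
  case (Suc n)
  obtain w where w: "f w \<noteq> 0" using Suc.hyps(2) by (metis (mono_tags) card.empty empty_Collect_eq nat.distinct(1))
  let ?g = "f(w := 0)"
  have supp: "{v. ?g v \<noteq> 0} = {v. f v \<noteq> 0} - {w}" by auto
  have g: "?g \<in> carrier (free_algebra X)"
    using Suc.prems supp by (auto simp: free_algebra_carrier)
  have "P ?g" using Suc.prems by (intro Suc.hyps(1)[OF _ g]) (use supp w Suc.hyps(2) in \<open>simp add: free_algebra_carrier\<close>)
  moreover have "word (f w) w \<oplus>\<^bsub>free_algebra X\<^esub> ?g = f"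
    by (auto simp: free_algebra_simps word_def fun_eq_iff)
  moreover have "w \<in> lists X" using w Suc.prems by (auto simp: free_algebra_carrier)
  ultimately show ?case
    using assms(3)[of w "f w"] assms(4)[OF word_closed g] by metis
qed

lemma word_mult: "word c u \<otimes>\<^bsub>free_algebra X\<^esub> word d v = word (c * d) (u @ v)"
proof
  fix w
  have *: "take k w = u \<and> drop k w = v \<longleftrightarrow> k = length u \<and> w = u @ v" if "k \<le> length w" for k
    using that by auto
  have "(word c u \<otimes>\<^bsub>free_algebra X\<^esub> word d v) w =
    (\<Sum>k\<le>length w. if k = length u \<and> w = u @ v then c * d else 0)"
    unfolding free_algebra_simps
  proof (intro sum.cong refl)
    fix k assume "k \<in> {..length w}"
    then have k: "k \<le> length w" by simp
    show "word c u (take k w) * word d v (drop k w) = (if k = length u \<and> w = u @ v then c * d else 0)"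
      unfolding *[OF k, symmetric] by (simp add: word_def)
  qed
  also have "\<dots> = word (c * d) (u @ v) w" by (auto simp: word_def)
  finally show "(word c u \<otimes>\<^bsub>free_algebra X\<^esub> word d v) w = word (c * d) (u @ v) w" .
qed

lemma word_add: "word c w \<oplus>\<^bsub>free_algebra X\<^esub> word d w = word (c + d) w"
  by (auto simp: free_algebra_simps word_def)

text \<open>Scalars act through \<open>s\<close>, which may send 1 to an idempotent. The explicit
  sum is kept as a third conclusion, since it evaluates formal tensors.\<close>

lemma free_algebra_lift:
  fixes s :: "real \<Rightarrow> 'r::ring_1" and m :: "'x \<Rightarrow> 'r"
  assumes s: "\<And>c d. s (c + d) = s c + s d" "\<And>c d. s (c * d) = s c * s d"
    and comm: "\<And>c x. x \<in> X \<Longrightarrow> s c * m x = m x * s c"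
  obtains \<Phi> where "ring_map (free_algebra X) \<Phi>"
    "\<And>w c. w \<in> lists X \<Longrightarrow> \<Phi> (word c w) = s c * prod_list (map m w)"
    "\<And>f. f \<in> carrier (free_algebra X) \<Longrightarrow> \<Phi> f = (\<Sum>w\<in>{w. f w \<noteq> 0}. s (f w) * prod_list (map m w))"
proof -
  let ?A = "free_algebra X"
  define \<Phi> where "\<Phi> f = (\<Sum>w\<in>{w. f w \<noteq> 0}. s (f w) * prod_list (map m w))" for f
  have sz: "s 0 = 0" using s(1)[of 0 0] by simp
  have sup: "\<Phi> f = (\<Sum>w\<in>W. s (f w) * prod_list (map m w))" if "finite W" "{w. f w \<noteq> 0} \<subseteq> W" for f W
    unfolding \<Phi>_def by (rule sum.mono_neutral_left) (use that sz in auto)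
  have add: "\<Phi> (f \<oplus>\<^bsub>?A\<^esub> g) = \<Phi> f + \<Phi> g" if fg: "f \<in> carrier ?A" "g \<in> carrier ?A" for f g
  proof -
    let ?W = "{w. f w \<noteq> 0} \<union> {w. g w \<noteq> 0}"
    have fin: "finite ?W" using fg by (auto simp: free_algebra_carrier)
    have "\<Phi> (f \<oplus>\<^bsub>?A\<^esub> g) = (\<Sum>w\<in>?W. s ((f \<oplus>\<^bsub>?A\<^esub> g) w) * prod_list (map m w))"
      using fin by (intro sup) (auto simp: free_algebra_simps)
    then show ?thesis using fin sup[of ?W f] sup[of ?W g]
      by (simp add: free_algebra_simps s algebra_simps sum.distrib)
  qed
  have word: "\<Phi> (word c w) = s c * prod_list (map m w)" for w c
    by (subst sup[of "{w}"]) (auto simp: word_def)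
  have zero: "\<Phi> \<zero>\<^bsub>?A\<^esub> = 0" by (subst sup[of "{}"]) (auto simp: free_algebra_simps)
  have comm': "s c * prod_list (map m w) = prod_list (map m w) * s c" if "w \<in> lists X" for c w
    using that
  proof (induction w)
    case (Cons x w)
    then show ?case using comm[of x c] by (metis list.simps(9) lists.simps list.inject list.distinct(1) mult.assoc prod_list.Cons)
  qed simp
  interpret A: ring ?A by (rule free_algebra_ring)
  have "\<Phi> (f \<otimes>\<^bsub>?A\<^esub> g) = \<Phi> f * \<Phi> g" if f: "f \<in> carrier ?A" and g: "g \<in> carrier ?A" for f g
    using f
  proof (induction f rule: free_algebra_induct)
    case (word u a)
    note u = this
    show ?case using g
    proof (induction g rule: free_algebra_induct)
      case (word v b)
      have "s a * s b * (prod_list (map m u) * prod_list (map m v))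
        = s a * (s b * prod_list (map m u)) * prod_list (map m v)" by (simp add: mult.assoc)
      also have "\<dots> = s a * prod_list (map m u) * (s b * prod_list (map m v))"
        by (metis comm'[OF u, of b] mult.assoc)
      finally show ?case
        by (simp add: word_mult \<open>\<And>w c. \<Phi> (word c w) = s c * prod_list (map m w)\<close> s)
    qed (use word_closed[OF u] in \<open>simp_all add: zero add A.r_distr distrib_left del: lists_eq_set\<close>)
  qed (use g in \<open>auto simp: zero add A.l_distr algebra_simps\<close>)
  then have "ring_map ?A \<Phi>" by (simp add: ring_map_def add)
  then show ?thesis using word that[of \<Phi>] \<Phi>_def by blast
qed

section \<open>Evaluation of polynomials\<close>

lemma poly_ring_cring: "cring (poly_ring :: 'i mpoly ring)"
proof (rule cringI)
  show "abelian_group (poly_ring :: 'i mpoly ring)"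
    by (rule abelian_groupI)
      (auto simp: poly_ring_def algebra_simps intro: exI[of _ "- x" for x])
  show "comm_monoid (poly_ring :: 'i mpoly ring)"
    by (rule comm_monoidI) (auto simp: poly_ring_def algebra_simps)
qed (auto simp: poly_ring_def algebra_simps)

lemma poly_ring_simps [simp]:
  "carrier poly_ring = UNIV" "p \<otimes>\<^bsub>poly_ring\<^esub> q = p * q" "p \<oplus>\<^bsub>poly_ring\<^esub> q = p + q"
  "\<one>\<^bsub>poly_ring\<^esub> = 1" "\<zero>\<^bsub>poly_ring\<^esub> = 0"
  by (simp_all add: poly_ring_def)

lemma poly_ring_ring: "ring poly_ring"
  using poly_ring_cring by (rule cring.axioms(1))

lemma poly_const_simps:
  "poly_const (a + b) = poly_const a + poly_const b" "poly_const (a * b) = poly_const a * poly_const b"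
  "poly_const 0 = 0" "poly_const 1 = 1"
  by (simp_all add: poly_const_def single_add mult_single)

lemma poly_mapping_single_induct [case_names single sum]:
  fixes q :: "'a \<Rightarrow>\<^sub>0 'b::comm_monoid_add"
  assumes single: "\<And>k x. P (Poly_Mapping.single k x)"
    and sum: "\<And>f g. P f \<Longrightarrow> P g \<Longrightarrow> P (f + g)"
  shows "P q"
proof (induction q rule: update_induct)
  case const
  show ?case using single[of undefined 0] by simp
next
  case (update f a b)
  have "Poly_Mapping.update a b f = Poly_Mapping.single a b + f"
    using update(1)
    by (intro poly_mapping_eqI) (auto simp: lookup_add lookup_single when_def in_keys_iff update.rep_eq)
  then show ?case using sum[OF single update(3)] by simp
qed

lemma mpoly_induct [case_names const var add mult]:
  fixes q :: "'i mpoly"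
  assumes c: "\<And>c. P (poly_const c)" and v: "\<And>i. P (poly_var i)"
    and a: "\<And>p q. P p \<Longrightarrow> P q \<Longrightarrow> P (p + q)" and m: "\<And>p q. P p \<Longrightarrow> P q \<Longrightarrow> P (p * q)"
  shows "P q"
proof -
  have mono: "P (Poly_Mapping.single k 1)" for k :: "'i \<Rightarrow>\<^sub>0 nat"
  proof (induction k rule: poly_mapping_single_induct)
    case (single i n)
    show ?case
    proof (induction n)
      case 0
      then show ?case using c[of 1] by (simp add: poly_const_def)
    next
      case (Suc n)
      have "Poly_Mapping.single (Poly_Mapping.single i (Suc n)) (1::real)
        = poly_var i * Poly_Mapping.single (Poly_Mapping.single i n) 1"
        by (simp add: poly_var_def mult_single flip: single_add)
      then show ?case using m[OF v Suc] by simp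
    qed
  next
    case (sum f g)
    have "Poly_Mapping.single (f + g) (1::real) = Poly_Mapping.single f 1 * Poly_Mapping.single g 1"
      by (simp add: mult_single)
    then show ?case using m[OF sum] by simp
  qed
  show ?thesis
  proof (induction q rule: poly_mapping_single_induct)
    case (single k x)
    have "Poly_Mapping.single k x = poly_const x * Poly_Mapping.single k 1"
      by (simp add: poly_const_def mult_single)
    then show ?case using m[OF c mono] by simp
  qed (rule a)
qed

text \<open>The variables take values in a noncommutative type-class ring, so that a monomial has to
  be evaluated as a product along a list in a fixed order.\<close>

definition index_list :: "'i::finite list" where
  "index_list = (SOME l. distinct l \<and> set l = UNIV)"

lemma index_list: "distinct (index_list :: 'i::finite list)" "set (index_list :: 'i list) = UNIV"
proof -
  obtain l :: "'i list" where "distinct l \<and> set l = UNIV"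
    using finite_distinct_list[OF finite_class.finite_UNIV] by blast
  then have "distinct (index_list :: 'i list) \<and> set (index_list :: 'i list) = UNIV"
    unfolding index_list_def by (rule someI)
  then show "distinct (index_list :: 'i list)" "set (index_list :: 'i list) = UNIV" by auto
qed

definition ev_mono :: "('i::finite \<Rightarrow> 'r::ring_1) \<Rightarrow> ('i \<Rightarrow>\<^sub>0 nat) \<Rightarrow> 'r" where
  "ev_mono t m = prod_list (map (\<lambda>i. t i ^ Poly_Mapping.lookup m i) index_list)"

definition ev :: "(real \<Rightarrow> 'r::ring_1) \<Rightarrow> ('i::finite \<Rightarrow> 'r) \<Rightarrow> 'i mpoly \<Rightarrow> 'r" where
  "ev s t q = (\<Sum>m\<in>Poly_Mapping.keys q. s (Poly_Mapping.lookup q m) * ev_mono t m)"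

text \<open>The value \<open>s 1\<close> is only an idempotent; \<open>s_one\<close> takes over the
  role of a unital target.\<close>

locale evaluation =
  fixes s :: "real \<Rightarrow> 'r::ring_1" and t :: "'i::finite \<Rightarrow> 'r"
  assumes s_add: "s (c + d) = s c + s d" and s_mult: "s (c * d) = s c * s d"
    and comm_s: "s c * t i = t i * s c" and comm_t: "t i * t j = t j * t i"
    and s_one: "s 1 * t i = t i"
begin

lemma s_zero: "s 0 = 0" using s_add[of 0 0] by simp

lemma ev_mono_comm: "(\<And>i. t i * x = x * t i) \<Longrightarrow> ev_mono t m * x = x * ev_mono t m"
proof -
  assume *: "\<And>i. t i * x = x * t i"
  have "prod_list (map (\<lambda>i. t i ^ Poly_Mapping.lookup m i) l) * x
    = x * prod_list (map (\<lambda>i. t i ^ Poly_Mapping.lookup m i) l)" for l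
  proof (induction l)
    case (Cons i l)
    have "t i ^ n * x = x * t i ^ n" for n by (rule power_commuting_commutes) (rule *)
    then show ?case using Cons by (simp add: mult.assoc) (simp add: mult.assoc[symmetric])
  qed simp
  then show ?thesis by (simp add: ev_mono_def)
qed

lemma ev_mono_add: "ev_mono t (m + n) = ev_mono t m * ev_mono t n"
proof -
  let ?M = "\<lambda>m l. prod_list (map (\<lambda>i. t i ^ Poly_Mapping.lookup m i) l)"
  have comm: "?M m l * t i ^ k = t i ^ k * ?M m l" for m l i k
  proof (induction l)
    case (Cons i' l)
    have 1: "t i ^ a * t i' = t i' * t i ^ a" for a by (rule power_commuting_commutes) (rule comm_t)
    have "t i' ^ b * t i ^ a = t i ^ a * t i' ^ b" for a b
      by (rule power_commuting_commutes) (rule 1[symmetric])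
    then show ?case using Cons by (simp add: mult.assoc) (simp add: mult.assoc[symmetric])
  qed simp
  have "?M (m + n) l = ?M m l * ?M n l" for l
  proof (induction l)
    case (Cons i l)
    have "?M (m + n) (i # l) = t i ^ Poly_Mapping.lookup m i * (t i ^ Poly_Mapping.lookup n i * ?M m l) * ?M n l"
      using Cons by (simp add: lookup_add power_add mult.assoc)
    also have "\<dots> = t i ^ Poly_Mapping.lookup m i * (?M m l * t i ^ Poly_Mapping.lookup n i) * ?M n l"
      by (simp only: comm)
    finally show ?case by (simp add: mult.assoc)
  qed simp
  then show ?thesis by (simp add: ev_mono_def)
qed

lemma ev_superset: "finite K \<Longrightarrow> Poly_Mapping.keys q \<subseteq> K \<Longrightarrow>
    ev s t q = (\<Sum>m\<in>K. s (Poly_Mapping.lookup q m) * ev_mono t m)"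
  unfolding ev_def by (rule sum.mono_neutral_left) (auto simp: s_zero in_keys_iff)

lemma ev_add: "ev s t (p + q) = ev s t p + ev s t q"
proof -
  let ?K = "Poly_Mapping.keys p \<union> Poly_Mapping.keys q"
  have "ev s t (p + q) = (\<Sum>m\<in>?K. s (Poly_Mapping.lookup (p + q) m) * ev_mono t m)"
    by (rule ev_superset) (use Poly_Mapping.keys_add[of p q] in auto)
  then show ?thesis using ev_superset[of ?K p] ev_superset[of ?K q]
    by (simp add: lookup_add s_add algebra_simps sum.distrib)
qed

lemma ev_single: "ev s t (Poly_Mapping.single m c) = s c * ev_mono t m"
  by (subst ev_superset[of "{m}"]) auto

lemma ev_zero: "ev s t 0 = 0" by (simp add: ev_def)

lemma ev_mult: "ev s t (p * q) = ev s t p * ev s t q"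
proof (induction p rule: poly_mapping_single_induct)
  case (single k x)
  show ?case
  proof (induction q rule: poly_mapping_single_induct)
    case (single l y)
    have "s y * ev_mono t k = ev_mono t k * s y"
      by (rule ev_mono_comm[symmetric]) (simp add: comm_s)
    then have "s x * ev_mono t k * (s y * ev_mono t l) = s x * s y * (ev_mono t k * ev_mono t l)"
      by (metis mult.assoc)
    then show ?case by (simp add: mult_single ev_single s_mult ev_mono_add)
  qed (simp add: ev_add algebra_simps)
qed (simp add: ev_add algebra_simps)

lemma ev_const: "ev s t (poly_const c) = s c"
proof -
  have "prod_list (map (\<lambda>i. 1) l) = (1::'r)" for l :: "'i list" by (induction l) auto
  then show ?thesis unfolding poly_const_def ev_single by (simp add: ev_mono_def)
qed

lemma ev_var: "ev s t (poly_var i) = t i"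
proof -
  have "prod_list (map (\<lambda>j. t j ^ Poly_Mapping.lookup (Poly_Mapping.single i 1) j) l) =
    (if i \<in> set l then t i else 1)" if "distinct l" for l
    using that by (induction l) (auto simp: lookup_single when_def)
  from this[OF index_list(1)] show ?thesis
    unfolding poly_var_def ev_single by (simp add: ev_mono_def s_one index_list(2))
qed

lemma ev_comm: "(\<And>c. s c * x = x * s c) \<Longrightarrow> (\<And>i. t i * x = x * t i) \<Longrightarrow> ev s t q * x = x * ev s t q"
proof (induction q rule: mpoly_induct)
  case (mult p q)
  then show ?case by (metis ev_mult mult.assoc)
qed (simp_all add: ev_const ev_var ev_add algebra_simps)

lemma ev_sum: "ev s t (sum f A) = (\<Sum>i\<in>A. ev s t (f i))"
  by (induction A rule: infinite_finite_induct) (simp_all add: ev_zero ev_add)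

lemma ev_linear_form: "ev s t (linear_form a) = (\<Sum>i\<in>UNIV. s (a $ i) * t i)"
  by (simp add: linear_form_def ev_sum ev_mult ev_const ev_var)

end

section \<open>Geometry of arrangements\<close>

definition flip :: "'i sign_vector \<Rightarrow> 'i \<Rightarrow> 'i sign_vector" where
  "flip a i = a(i := - a i)"

definition separating :: "'i sign_vector \<Rightarrow> 'i sign_vector \<Rightarrow> 'i set" where
  "separating a c = {i. a i \<noteq> c i}"

text \<open>Stable under \<open>gale_dual\<close>, so that an arrangement and its Gale dual are both
  instances of the locale \<open>arrangement\<close>.\<close>

definition arrangement_data :: "'i::finite arrangement \<Rightarrow> bool" where
  "arrangement_data W \<longleftrightarrow> subspace (dir W) \<and> (\<exists>x. eta W = (\<lambda>v. x + v) ` dir W) \<and>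
     (\<exists>y. xi W = (\<lambda>v. y + v) ` ((dir W)\<^sup>\<bottom>))"

lemma polarized_arrangement_data: "polarized W \<Longrightarrow> arrangement_data W"
  by (simp add: polarized_def arrangement_data_def)

lemma gale_dual_arrangement_data:
  assumes "arrangement_data W" shows "arrangement_data (gale_dual W)"
proof -
  obtain x y where *: "subspace (dir W)" "eta W = (\<lambda>v. x + v) ` dir W" "xi W = (\<lambda>v. y + v) ` ((dir W)\<^sup>\<bottom>)"
    using assms by (auto simp: arrangement_data_def)
  have neg: "uminus ` ((\<lambda>v. z + v) ` S) = (\<lambda>v. - z + v) ` S" if "subspace S" for z and S :: "(real ^ 'a) set"
    using that by (force simp: image_iff subspace_neg minus_add_distrib intro: bexI[of _ "- v" for v])
  have "eta (gale_dual W) = (\<lambda>v. - y + v) ` dir (gale_dual W)"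
    "xi (gale_dual W) = (\<lambda>v. - x + v) ` ((dir (gale_dual W))\<^sup>\<bottom>)"
    unfolding gale_dual_def arrangement.simps orthogonal_comp_self[OF *(1)] *(2,3)
    by (rule neg[OF subspace_orthogonal_comp], rule neg[OF *(1)])
  moreover have "subspace (dir (gale_dual W))" by (simp add: gale_dual_def subspace_orthogonal_comp)
  ultimately show ?thesis
    unfolding arrangement_data_def by blast
qed

lemma gale_dual_gale_dual: "arrangement_data W \<Longrightarrow> gale_dual (gale_dual W) = W"
  by (cases W) (auto simp: gale_dual_def arrangement_data_def orthogonal_comp_self image_image)

lemma sign_cases: "a \<in> sign_vectors \<Longrightarrow> a i = 1 \<or> a i = - 1"
  by (auto simp: sign_vectors_def)

lemma sign_sq: "a \<in> sign_vectors \<Longrightarrow> a i * a i = 1"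
  by (metis sign_cases mult_1 minus_mult_minus)

lemma sign_neq: "a \<in> sign_vectors \<Longrightarrow> c \<in> sign_vectors \<Longrightarrow> a i \<noteq> c i \<longleftrightarrow> c i = - a i"
  by (metis sign_cases add.inverse_inverse one_neq_neg_one)

lemma sign_nonzero: "a \<in> sign_vectors \<Longrightarrow> a i \<noteq> 0"
  by (metis sign_cases zero_neq_one neg_equal_0_iff_equal)

lemma flip_sign: "a \<in> sign_vectors \<Longrightarrow> flip a i \<in> sign_vectors"
  by (auto simp: sign_vectors_def flip_def)

lemma flip_flip [simp]: "flip (flip a i) i = a"
  by (simp add: flip_def)

lemma flip_commute: "flip (flip a i) j = flip (flip a j) i"
  by (auto simp: flip_def)

lemma flip_apply: "flip a i j = (if j = i then - a j else a j)"
  by (simp add: flip_def)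

lemma flip_neq: "a \<in> sign_vectors \<Longrightarrow> flip a i \<noteq> a"
  using sign_nonzero[of a i] by (auto simp: flip_def fun_eq_iff)

lemma flip_inj: "a \<in> sign_vectors \<Longrightarrow> flip a i = flip a j \<longleftrightarrow> i = j"
  using sign_nonzero[of a i] by (auto simp: flip_def fun_eq_iff split: if_splits)

lemma adj_at_flip:
  assumes "a \<in> sign_vectors" "b \<in> sign_vectors"
  shows "adj_at i a b \<longleftrightarrow> b = flip a i"
proof
  assume *: "adj_at i a b"
  show "b = flip a i"
  proof
    fix j
    have "a j \<noteq> b j \<longleftrightarrow> j = i" using * by (simp add: adj_at_def set_eq_iff)
    then show "b j = flip a i j"
      using sign_neq[OF assms, of j] unfolding flip_apply by metis
  qed
next
  assume "b = flip a i"
  then show "adj_at i a b" using sign_nonzero[OF assms(1), of i]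
    by (simp add: adj_at_def flip_apply set_eq_iff)
qed

lemma adj_flip: "a \<in> sign_vectors \<Longrightarrow> b \<in> sign_vectors \<Longrightarrow> adj a b \<longleftrightarrow> (\<exists>i. b = flip a i)"
  by (simp add: adj_def adj_at_flip)

lemma finite_sign_vectors: "finite (sign_vectors :: 'i::finite sign_vector set)"
proof -
  have "sign_vectors \<subseteq> (Pi\<^sub>E UNIV (\<lambda>_. {1, -1}) :: 'i sign_vector set)" by (auto simp: sign_vectors_def)
  then show ?thesis by (rule finite_subset) (auto intro: finite_PiE)
qed

lemma feasible_sign: "a \<in> feasible W \<Longrightarrow> a \<in> sign_vectors"
  by (simp add: feasible_def)

lemma finite_feasible: "finite (feasible W)"
  using finite_sign_vectors by (rule finite_subset[rotated]) (auto simp: feasible_def)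

lemma chamber_flip:
  assumes "x \<in> chamber W a" "x $ i = 0" shows "x \<in> chamber W (flip a i)"
  using assms by (auto simp: chamber_def flip_apply)

lemma chamber_agree:
  assumes "z \<in> chamber W c" "\<And>k. a k \<noteq> c k \<Longrightarrow> z $ k = 0"
  shows "z \<in> chamber W a"
proof -
  have "a k * z $ k \<ge> 0" for k
    using assms unfolding chamber_def by (cases "a k = c k") auto
  then show ?thesis using assms(1) by (simp add: chamber_def)
qed

lemma feasible_flipI:
  assumes "a \<in> feasible W" "x \<in> chamber W a" "x $ i = 0" shows "flip a i \<in> feasible W"
  using assms chamber_flip[OF assms(2,3)] flip_sign by (auto simp: feasible_def)

text \<open>In finite dimension the subspace \<open>S + T\<close> is its own double orthogonal
  complement; the hypothesis on \<open>z\<close> says that \<open>x\<close> is orthogonal to the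
  complement of \<open>S + T\<close>.\<close>

lemma orthogonal_comp_sum:
  fixes S T :: "'a::euclidean_space set"
  assumes "subspace S" "subspace T"
    and "\<And>z. (\<And>s. s \<in> S \<Longrightarrow> z \<bullet> s = 0) \<Longrightarrow> (\<And>t. t \<in> T \<Longrightarrow> z \<bullet> t = 0) \<Longrightarrow> z \<bullet> x = 0"
  shows "\<exists>s\<in>S. \<exists>t\<in>T. x = s + t"
proof -
  let ?U = "{s + t | s t. s \<in> S \<and> t \<in> T}"
  have U: "subspace ?U" using assms(1,2) by (rule subspace_sums)
  have "x \<in> ?U\<^sup>\<bottom>\<^sup>\<bottom>"
  proof -
    have "z \<bullet> x = 0" if "z \<in> ?U\<^sup>\<bottom>" for z
    proof (rule assms(3))
      show "z \<bullet> s = 0" if "s \<in> S" for s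
        using that \<open>z \<in> ?U\<^sup>\<bottom>\<close> subspace_0[OF assms(2)]
        by (fastforce simp: orthogonal_comp_def orthogonal_def inner_commute)
      show "z \<bullet> t = 0" if "t \<in> T" for t
        using that \<open>z \<in> ?U\<^sup>\<bottom>\<close> subspace_0[OF assms(1)]
        by (fastforce simp: orthogonal_comp_def orthogonal_def inner_commute)
    qed
    then show ?thesis by (auto simp: orthogonal_comp_def orthogonal_def)
  qed
  then show ?thesis using orthogonal_comp_self[OF U] by auto
qed

lemma inner_orthogonal_comp: "y \<in> S\<^sup>\<bottom> \<Longrightarrow> x \<in> S \<Longrightarrow> y \<bullet> x = 0"
  by (auto simp: orthogonal_comp_def orthogonal_def inner_commute)

lemma orthogonal_compI: "(\<And>x. x \<in> S \<Longrightarrow> y \<bullet> x = 0) \<Longrightarrow> y \<in> S\<^sup>\<bottom>"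
  by (auto simp: orthogonal_comp_def orthogonal_def inner_commute)

text \<open>Farkas' lemma: a cone generated by finitely many vectors is closed, so that \<open>e\<close> can be separated from it.\<close>

lemma farkas:
  fixes V :: "(real ^ 'i::finite) set" and a :: "'i \<Rightarrow> real"
  assumes V: "subspace V" and a: "a \<in> sign_vectors"
    and none: "\<not> (\<exists>v\<in>V. (\<forall>i\<in>G. a i * (e + v) $ i \<ge> 0) \<and> (\<forall>i. i \<notin> G \<longrightarrow> (e + v) $ i = 0))"
  shows "\<exists>y\<in>V\<^sup>\<bottom>. (\<forall>i\<in>G. a i * y $ i \<ge> 0) \<and> y \<bullet> e < 0"
proof -
  obtain B where B: "B \<subseteq> V" "independent B" "V \<subseteq> span B" using basis_exists[of V] by metis
  \<comment> \<open>Both the basis vectors of \<open>V\<close> and their negatives are generators,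
    so that the cone contains \<open>V\<close> and the separating functional has to vanish on
    it.\<close>
  let ?X = "B \<union> uminus ` B \<union> (\<lambda>i. a i *\<^sub>R axis i 1) ` G"
  let ?K = "convex_cone hull ?X"
  have fin: "finite ?X" using B(2) by (auto intro: independent_imp_finite)
  let ?O = "{v + w | v w. v \<in> V \<and> w \<in> {w. (\<forall>i\<in>G. a i * w $ i \<ge> 0) \<and> (\<forall>i. i \<notin> G \<longrightarrow> w $ i = 0)}}"
  have "?K \<subseteq> ?O"
  proof (rule hull_minimal)
    show "?X \<subseteq> ?O"
    proof
      fix z assume "z \<in> ?X"
      then consider "z \<in> V" | i where "i \<in> G" "z = a i *\<^sub>R axis i 1"
        using B(1) V by (auto simp: subspace_neg)
      then show "z \<in> ?O"
      proof cases
        case 1 then show ?thesis by (intro CollectI exI[of _ z] exI[of _ 0]) auto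
      next
        case 2
        then show ?thesis using subspace_0[OF V] sign_sq[OF a]
          by (intro CollectI exI[of _ 0] exI[of _ z]) (auto simp: axis_def)
      qed
    qed
    show "convex_cone ?O"
      unfolding convex_cone_iff
    proof (intro conjI ballI allI impI)
      show "0 \<in> ?O" using subspace_0[OF V] by (intro CollectI exI[of _ 0]) auto
    next
      fix p q assume "p \<in> ?O" "q \<in> ?O"
      then obtain v w v' w' where *: "p = v + w" "q = v' + w'" "v \<in> V" "v' \<in> V"
        "\<forall>i\<in>G. a i * w $ i \<ge> 0" "\<forall>i. i \<notin> G \<longrightarrow> w $ i = 0"
        "\<forall>i\<in>G. a i * w' $ i \<ge> 0" "\<forall>i. i \<notin> G \<longrightarrow> w' $ i = 0" by auto
      then show "p + q \<in> ?O"
        by (intro CollectI exI[of _ "v + v'"] exI[of _ "w + w'"])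
          (auto simp: subspace_add[OF V] algebra_simps)
    next
      fix p and c :: real assume "p \<in> ?O" "c \<ge> 0"
      then obtain v w where *: "p = v + w" "v \<in> V"
        "\<forall>i\<in>G. a i * w $ i \<ge> 0" "\<forall>i. i \<notin> G \<longrightarrow> w $ i = 0" by auto
      then show "c *\<^sub>R p \<in> ?O" using \<open>c \<ge> 0\<close>
        by (intro CollectI exI[of _ "c *\<^sub>R v"] exI[of _ "c *\<^sub>R w"])
          (auto simp: subspace_scale[OF V] algebra_simps mult.left_commute[of _ c])
    qed
  qed
  have "e \<notin> ?K"
  proof
    assume "e \<in> ?K"
    then obtain v w where "v \<in> V" "e = v + w"
      "\<forall>i\<in>G. a i * w $ i \<ge> 0" "\<forall>i. i \<notin> G \<longrightarrow> w $ i = 0" using \<open>?K \<subseteq> ?O\<close> by blast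
    then show False using none subspace_neg[OF V, of v] by (auto dest!: bspec[of _ _ "- v"])
  qed
  then obtain y b where y: "y \<bullet> e < b" "\<And>k. k \<in> ?K \<Longrightarrow> y \<bullet> k > b"
    using separating_hyperplane_closed_point[OF convex_convex_cone_hull closed_convex_cone_hull[OF fin]]
    by blast
  have b: "b < 0" using y(2)[OF convex_cone_hull_contains_0] by simp
  have pos: "y \<bullet> k \<ge> 0" if k: "k \<in> ?X" for k
  proof (rule ccontr)
    assume neg: "\<not> y \<bullet> k \<ge> 0"
    \<comment> \<open>The positive multiple of \<open>k\<close> on which \<open>y\<close> takes
      exactly the value \<open>b\<close>, although \<open>y\<close> exceeds \<open>b\<close> on the
      whole cone.\<close>
    have "(b / (y \<bullet> k)) *\<^sub>R k \<in> ?K"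
      using neg b hull_inc[OF k] by (intro convex_cone_hull_mul) (auto simp: divide_nonpos_neg)
    then show False using y(2) neg by fastforce
  qed
  have "y \<bullet> v = 0" if "v \<in> span B" for v
    using that
  proof (induction rule: span_induct_alt)
    case (step c x z)
    have "y \<bullet> x = 0" using pos[of x] pos[of "- x"] step(1) by auto
    then show ?case using step by (simp add: inner_simps)
  qed simp
  then have "y \<in> V\<^sup>\<bottom>" using B by (intro orthogonal_compI) auto
  moreover have "a i * y $ i \<ge> 0" if "i \<in> G" for i
    using pos[of "a i *\<^sub>R axis i 1"] that by (auto simp: inner_axis)
  ultimately show ?thesis using y(1) b by force
qed

section \<open>Chambers and the segments between them\<close>

locale arrangement =
  fixes W :: "'i::finite arrangement"
  assumes data: "arrangement_data W"
begin

abbreviation "F \<equiv> feasible W"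
abbreviation "\<Delta> \<equiv> chamber W"

lemma subspace_dir: "subspace (dir W)" using data by (simp add: arrangement_data_def)

lemma eta_add: "x \<in> eta W \<Longrightarrow> v \<in> dir W \<Longrightarrow> x + v \<in> eta W"
  using data subspace_add[OF subspace_dir] by (force simp: arrangement_data_def add.assoc)

lemma eta_diff: "x \<in> eta W \<Longrightarrow> z \<in> eta W \<Longrightarrow> x - z \<in> dir W"
  using data subspace_diff[OF subspace_dir] by (force simp: arrangement_data_def)

lemma eta_nonempty: "\<exists>x. x \<in> eta W"
  using data subspace_0[OF subspace_dir] by (force simp: arrangement_data_def)

lemma xi_add: "y \<in> xi W \<Longrightarrow> v \<in> (dir W)\<^sup>\<bottom> \<Longrightarrow> y + v \<in> xi W"
  using data subspace_add[OF subspace_orthogonal_comp[of "dir W"]] by (force simp: arrangement_data_def add.assoc)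

lemma xi_diff: "x \<in> xi W \<Longrightarrow> z \<in> xi W \<Longrightarrow> x - z \<in> (dir W)\<^sup>\<bottom>"
  using data subspace_diff[OF subspace_orthogonal_comp[of "dir W"]] by (force simp: arrangement_data_def)

lemma xi_nonempty: "\<exists>y. y \<in> xi W"
  using data subspace_0[OF subspace_orthogonal_comp[of "dir W"]] by (force simp: arrangement_data_def)

lemma feasibleE:
  assumes "a \<in> F" obtains x where "x \<in> \<Delta> a"
  using assms by (auto simp: feasible_def)

lemma chamberD: "x \<in> \<Delta> a \<Longrightarrow> x \<in> eta W" "x \<in> \<Delta> a \<Longrightarrow> a i * x $ i \<ge> 0"
  by (auto simp: chamber_def)

text \<open>The segment from \<open>s\<close> to \<open>z\<close> leaves \<open>\<Delta> a\<close> at the parameter \<open>r / (1 + r)\<close>, with \<open>r\<close> the least ratio.\<close>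

lemma first_hit:
  assumes a: "a \<in> sign_vectors" and c: "c \<in> sign_vectors"
    and s: "s \<in> \<Delta> a" and z: "z \<in> \<Delta> c" and r: "r \<ge> 0"
    and le: "\<And>k. a k \<noteq> c k \<Longrightarrow> r * (c k * z $ k) \<le> a k * s $ k"
  obtains w where "w \<in> \<Delta> a" "\<And>k. s $ k = 0 \<Longrightarrow> z $ k = 0 \<Longrightarrow> w $ k = 0"
    "\<And>k. a k \<noteq> c k \<Longrightarrow> a k * s $ k = r * (c k * z $ k) \<Longrightarrow> w $ k = 0"
proof -
  define w where "w = s + (r / (1 + r)) *\<^sub>R (z - s)"
  have w: "(1 + r) * w $ k = s $ k + r * z $ k" for k
  proof -
    have "(1 + r) * w $ k = (1 + r) * s $ k + ((1 + r) * (r / (1 + r))) * (z $ k - s $ k)"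
      by (simp add: w_def distrib_left mult.assoc)
    also have "(1 + r) * (r / (1 + r)) = r" using r by simp
    finally show ?thesis by (simp add: algebra_simps)
  qed
  have "w \<in> eta W"
    unfolding w_def using chamberD(1)[OF s] chamberD(1)[OF z]
    by (intro eta_add subspace_scale subspace_dir eta_diff)
  moreover have "a k * w $ k \<ge> 0" for k
  proof -
    have "(1 + r) * (a k * w $ k) = a k * s $ k + r * (a k * z $ k)"
      by (metis (no_types) w distrib_left mult.left_commute)
    also have "\<dots> \<ge> 0"
    proof (cases "a k = c k")
      case True
      then show ?thesis using chamberD(2)[OF s, of k] chamberD(2)[OF z, of k] r by simp
    next
      case False
      then have "c k = - a k" using sign_neq[OF a c] by blast
      then show ?thesis using le[OF False] by simp
    qed
    finally show ?thesis using r by (simp add: zero_le_mult_iff)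
  qed
  ultimately have "w \<in> \<Delta> a" by (simp add: chamber_def)
  moreover have "w $ k = 0" if "s $ k = 0" "z $ k = 0" for k
    using w[of k] that r by (auto simp: w_def)
  moreover have "w $ k = 0" if k: "a k \<noteq> c k" "a k * s $ k = r * (c k * z $ k)" for k
  proof -
    have "c k = - a k" using sign_neq[OF a c] k by blast
    then have "a k * (s $ k + r * z $ k) = 0" using k(2) by (simp add: algebra_simps)
    then show ?thesis using w[of k] r sign_nonzero[OF a, of k] by auto
  qed
  ultimately show ?thesis using that by blast
qed

text \<open>The segment from \<open>s\<close> to \<open>z\<close> leaves \<open>\<Delta> a\<close>
  through a hyperplane that separates \<open>a\<close> from \<open>c\<close>, and it stays on every
  coordinate hyperplane that contains both ends.\<close>

lemma towards:
  assumes a: "a \<in> F" and c: "c \<in> F" and ne: "a \<noteq> c" and s: "s \<in> \<Delta> a" and z: "z \<in> \<Delta> c"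
  obtains w i where "w \<in> \<Delta> a" "i \<in> separating a c" "w $ i = 0"
    "\<And>k. s $ k = 0 \<Longrightarrow> z $ k = 0 \<Longrightarrow> w $ k = 0"
proof (cases "\<forall>k\<in>separating a c. z $ k = 0")
  case True
  obtain i where "i \<in> separating a c" using ne by (auto simp: separating_def)
  \<comment> \<open>If \<open>z\<close> vanishes at every separating coordinate there is no ratio to
    minimise, but then \<open>z\<close> itself is the point wanted.\<close>
  moreover have "z \<in> \<Delta> a" using True by (intro chamber_agree[OF z]) (auto simp: separating_def)
  ultimately show ?thesis using that True by blast
next
  case False
  let ?D = "{k \<in> separating a c. z $ k \<noteq> 0}"
  \<comment> \<open>The ratio at \<open>k\<close> tells when the coordinate \<open>k\<close> reaches
    zero along the segment: the smaller the ratio, the earlier.\<close>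
  let ?r = "\<lambda>k. (a k * s $ k) / (c k * z $ k)"
  have sg: "a \<in> sign_vectors" "c \<in> sign_vectors" using a c feasible_sign by auto
  have "Min (?r ` ?D) \<in> ?r ` ?D" using False by (intro Min_in) auto
  then obtain i where i: "i \<in> ?D" "?r i = Min (?r ` ?D)" by auto
  have min: "?r i \<le> ?r k" if "k \<in> ?D" for k using i(2) that by simp
  have cz: "c k * z $ k > 0" if "z $ k \<noteq> 0" for k
    using that chamberD(2)[OF z, of k] sign_nonzero[OF sg(2), of k] by (simp add: less_le)
  have cz_eq: "?r k * (c k * z $ k) = a k * s $ k" if "z $ k \<noteq> 0" for k
    using cz[OF that] by (metis nonzero_eq_divide_eq less_irrefl)
  have r0: "?r i \<ge> 0" using chamberD(2)[OF s] chamberD(2)[OF z] by simp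
  have le: "?r i * (c k * z $ k) \<le> a k * s $ k" if k: "a k \<noteq> c k" for k
  proof (cases "z $ k = 0")
    case True
    then show ?thesis using chamberD(2)[OF s] by simp
  next
    case False
    have "?r i * (c k * z $ k) \<le> ?r k * (c k * z $ k)"
      using min[of k] cz[OF False] k False by (intro mult_right_mono) (auto simp: separating_def)
    then show ?thesis using cz_eq[OF False] by simp
  qed
  obtain w where w: "w \<in> \<Delta> a" "\<And>k. s $ k = 0 \<Longrightarrow> z $ k = 0 \<Longrightarrow> w $ k = 0"
    "\<And>k. a k \<noteq> c k \<Longrightarrow> a k * s $ k = ?r i * (c k * z $ k) \<Longrightarrow> w $ k = 0"
    using first_hit[OF sg s z r0 le] by blast
  have "w $ i = 0" using w(3)[OF _ cz_eq[symmetric]] i(1) by (simp add: separating_def)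
  then show ?thesis using that w i(1) by blast
qed

lemma exists_flip_towards:
  assumes "a \<in> F" "c \<in> F" "a \<noteq> c"
  obtains i where "i \<in> separating a c" "flip a i \<in> F"
  using assms by (metis feasibleE towards feasible_flipI)

lemma separating_flip: "a \<in> sign_vectors \<Longrightarrow> separating a (flip a i) = {i}"
  using sign_nonzero[of a i] by (simp add: separating_def flip_apply set_eq_iff)

text \<open>Only the coordinate \<open>i\<close> separates \<open>a\<close> from
  \<open>flip a i\<close>, so that \<open>towards\<close> has to stop on the hyperplane of
  \<open>i\<close>.\<close>

lemma facet_point:
  assumes "a \<in> F" "flip a i \<in> F"
  obtains x where "x \<in> \<Delta> a" "x $ i = 0"
proof -
  have sg: "a \<in> sign_vectors" using assms(1) by (rule feasible_sign)
  obtain s where s: "s \<in> \<Delta> a" by (rule feasibleE[OF assms(1)])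
  obtain z where z: "z \<in> \<Delta> (flip a i)" by (rule feasibleE[OF assms(2)])
  obtain w k where "w \<in> \<Delta> a" "k \<in> separating a (flip a i)" "w $ k = 0"
    by (rule towards[OF assms flip_neq[OF sg, symmetric] s z])
  then show ?thesis using that separating_flip[OF sg] by auto
qed

text \<open>Start on the facet \<open>x_i = 0\<close> of \<open>\<Delta> a\<close> and aim at the
  same facet of the chamber of \<open>flip a j\<close>: the segment stays on \<open>x_i = 0\<close>
  and leaves \<open>\<Delta> a\<close> through \<open>x_j = 0\<close>.\<close>

lemma codim2_point:
  assumes "a \<in> F" "flip a i \<in> F" "flip a j \<in> F" "flip (flip a j) i \<in> F"
  obtains x where "x \<in> \<Delta> a" "x $ i = 0" "x $ j = 0"
proof -
  have sg: "a \<in> sign_vectors" using assms(1) by (rule feasible_sign)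
  obtain s where s: "s \<in> \<Delta> a" "s $ i = 0" by (rule facet_point[OF assms(1,2)])
  obtain z where z: "z \<in> \<Delta> (flip a j)" "z $ i = 0" by (rule facet_point[OF assms(3,4)])
  obtain w k where "w \<in> \<Delta> a" "k \<in> separating a (flip a j)" "w $ k = 0"
    "\<And>k. s $ k = 0 \<Longrightarrow> z $ k = 0 \<Longrightarrow> w $ k = 0"
    using towards[OF assms(1,3) flip_neq[OF sg, symmetric] s(1) z(1)] by metis
  then show ?thesis using that s z separating_flip[OF sg] by auto
qed

lemma continuous_on_Min:
  fixes f :: "'a \<Rightarrow> real \<Rightarrow> real"
  assumes "finite I" "I \<noteq> {}" "\<And>i. i \<in> I \<Longrightarrow> continuous_on S (f i)"
  shows "continuous_on S (\<lambda>t. Min ((\<lambda>i. f i t) ` I))"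
  using assms
proof (induction I rule: finite_ne_induct)
  case (insert i I)
  have "continuous_on S (\<lambda>t. min (f i t) (Min ((\<lambda>i. f i t) ` I)))"
    using insert by (intro continuous_on_min) auto
  then show ?case using insert by simp
qed simp

text \<open>
  Move a point \<open>s\<close> along a segment between two facets of \<open>\<Delta> a\<close>, and aim from \<open>s\<close> at a point of \<open>\<Delta> c\<close>.
  The set of hyperplanes hit first changes only through sets with more than one element.
\<close>

lemma flips_towards_connected:
  assumes a: "a \<in> F" and c: "c \<in> F"
    and i: "i \<in> separating a c" "flip a i \<in> F" and j: "j \<in> separating a c" "flip a j \<in> F"
  defines "link \<equiv> \<lambda>k l. k \<in> separating a c \<and> l \<in> separating a c \<and> (\<exists>w\<in>\<Delta> a. w $ k = 0 \<and> w $ l = 0)"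
  shows "link\<^sup>*\<^sup>* i j"
proof -
  obtain x where x: "x \<in> \<Delta> a" "x $ i = 0" using facet_point[OF a i(2)] .
  obtain y where y: "y \<in> \<Delta> a" "y $ j = 0" using facet_point[OF a j(2)] .
  obtain z where z: "z \<in> \<Delta> c" using feasibleE[OF c] .
  have sg: "a \<in> sign_vectors" "c \<in> sign_vectors" using a c feasible_sign by auto
  let ?D = "{k \<in> separating a c. z $ k \<noteq> 0}"
  show ?thesis
  proof (cases "?D = {}")
    case True
    \<comment> \<open>All separating hyperplanes pass through \<open>z\<close>, which then lies in
      \<open>\<Delta> a\<close> and links any two of them at once.\<close>
    then have "z \<in> \<Delta> a" using z by (auto simp: chamber_def separating_def) (metis mult_zero_right order_refl)
    then have "link i j" using True i j by (auto simp: link_def)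
    then show ?thesis by blast
  next
    case False
    have cz: "c k * z $ k > 0" if "k \<in> ?D" for k
      using that chamberD(2)[OF z, of k] sign_nonzero[OF sg(2), of k] by (simp add: less_le)
    define s where "s t = (1 - t) *\<^sub>R x + t *\<^sub>R y" for t
    define f where "f k t = (a k * s t $ k) / (c k * z $ k)" for k t
    have f_eq: "f k t * (c k * z $ k) = a k * s t $ k" if "k \<in> ?D" for k t
      using cz[OF that] unfolding f_def by (metis nonzero_eq_divide_eq less_irrefl)
    have s: "s t \<in> \<Delta> a" if "0 \<le> t" "t \<le> 1" for t
    proof -
      have "s t = x + t *\<^sub>R (y - x)" by (simp add: s_def algebra_simps)
      then have "s t \<in> eta W"
        using chamberD(1)[OF x(1)] chamberD(1)[OF y(1)]
        by (simp add: eta_add subspace_scale subspace_dir eta_diff)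
      moreover have "a k * s t $ k = (1 - t) * (a k * x $ k) + t * (a k * y $ k)" for k
        by (simp add: s_def algebra_simps)
      ultimately show ?thesis using that chamberD(2)[OF x(1)] chamberD(2)[OF y(1)]
        by (auto simp: chamber_def)
    qed
    have f0: "f k t \<ge> 0" if "k \<in> ?D" "0 \<le> t" "t \<le> 1" for k t
      using chamberD(2)[OF s[OF that(2,3)], of k] chamberD(2)[OF z, of k] by (simp add: f_def)
    have cont: "continuous_on {0..1} (f k)" if "k \<in> ?D" for k
      unfolding f_def s_def using cz[OF that] by (auto intro!: continuous_intros)
    define m where "m R t = Min ((\<lambda>k. f k t) ` R)" for R t
    have mcont: "continuous_on {0..1} (m R)" if "R \<noteq> {}" "R \<subseteq> ?D" for R
      unfolding m_def using that cont by (intro continuous_on_Min) auto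
    have hit: "\<exists>w\<in>\<Delta> a. (\<forall>k\<in>?D. f k t = m ?D t \<longrightarrow> w $ k = 0) \<and> (\<forall>k. s t $ k = 0 \<and> z $ k = 0 \<longrightarrow> w $ k = 0)"
      if t: "0 \<le> t" "t \<le> 1" for t
    proof -
      have min: "m ?D t \<le> f k t" if "k \<in> ?D" for k using that by (simp add: m_def)
      have "m ?D t \<in> (\<lambda>k. f k t) ` ?D" unfolding m_def using False by (intro Min_in) auto
      then have r: "m ?D t \<ge> 0" using f0 t by auto
      have le: "m ?D t * (c k * z $ k) \<le> a k * s t $ k" if "a k \<noteq> c k" for k
      proof (cases "z $ k = 0")
        case True
        then show ?thesis using chamberD(2)[OF s[OF t]] by simp
      next
        case False
        then have k: "k \<in> ?D" using that by (simp add: separating_def)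
        have "m ?D t * (c k * z $ k) \<le> f k t * (c k * z $ k)"
          using min[OF k] cz[OF k] by (intro mult_right_mono) auto
        then show ?thesis using f_eq[OF k] by simp
      qed
      obtain w where w: "w \<in> \<Delta> a" "\<And>k. s t $ k = 0 \<Longrightarrow> z $ k = 0 \<Longrightarrow> w $ k = 0"
        "\<And>k. a k \<noteq> c k \<Longrightarrow> a k * s t $ k = m ?D t * (c k * z $ k) \<Longrightarrow> w $ k = 0"
        using first_hit[OF sg s[OF t] z r le] by blast
      have "w $ k = 0" if k: "k \<in> ?D" "f k t = m ?D t" for k
        using w(3)[of k] k f_eq[OF k(1), of t] by (simp add: separating_def)
      then show ?thesis using w by blast
    qed
    have argmin: "\<exists>k\<in>R. f k t = m R t" if "R \<noteq> {}" "R \<subseteq> ?D" for R t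
    proof -
      have "m R t \<in> (\<lambda>k. f k t) ` R" unfolding m_def using that by (intro Min_in) (auto intro: finite_subset)
      then show ?thesis by auto
    qed
    \<comment> \<open>At an end of the segment the point \<open>s t\<close> already lies on the
      hyperplane of \<open>i'\<close>. That hyperplane passes through the first hit, either because
      its ratio is zero and hence minimal, or because it contains \<open>z\<close> as well.\<close>
    have endp: "\<exists>k\<in>?D. f k t = m ?D t \<and> link i' k \<and> link k i'"
      if t: "0 \<le> t" "t \<le> 1" and i': "i' \<in> separating a c" "s t $ i' = 0" for t i'
    proof -
      obtain w where w: "w \<in> \<Delta> a" "\<And>k. k \<in> ?D \<Longrightarrow> f k t = m ?D t \<Longrightarrow> w $ k = 0"
        "\<And>k. s t $ k = 0 \<Longrightarrow> z $ k = 0 \<Longrightarrow> w $ k = 0" using hit[OF t] by blast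
      obtain k where k: "k \<in> ?D" "f k t = m ?D t" using argmin[OF False] by blast
      have "w $ i' = 0"
      proof (cases "z $ i' = 0")
        case True
        then show ?thesis using w(3) i' by blast
      next
        case False
        then have "i' \<in> ?D" using i' by simp
        moreover have "f i' t = 0" using i' by (simp add: f_def)
        moreover have "m ?D t \<le> f i' t" using \<open>i' \<in> ?D\<close> by (simp add: m_def)
        ultimately have "f i' t = m ?D t" using k f0[OF k(1) t] by simp
        then show ?thesis using w(2)[OF \<open>i' \<in> ?D\<close>] by blast
      qed
      then show ?thesis using k w i' by (auto simp: link_def)
    qed
    obtain k where k: "k \<in> ?D" "f k 0 = m ?D 0" "link i k"
      using endp[of 0 i] i x by (auto simp: s_def)
    obtain l where l: "l \<in> ?D" "f l 1 = m ?D 1" "link l j"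
      using endp[of 1 j] j y by (auto simp: s_def)
    have "link\<^sup>*\<^sup>* k l"
    proof (rule ccontr)
      assume no: "\<not> link\<^sup>*\<^sup>* k l"
      \<comment> \<open>\<open>?R\<close> consists of the coordinates reachable from
        \<open>k\<close>, \<open>?Q\<close> of the others. The overall minimum is attained in
        \<open>?R\<close> at time 0 and in \<open>?Q\<close> at time 1, so that by continuity the
        two minima agree at some time; the first hit at that time links the two sets.\<close>
      let ?R = "{h \<in> ?D. link\<^sup>*\<^sup>* k h}" and ?Q = "{h \<in> ?D. \<not> link\<^sup>*\<^sup>* k h}"
      have R: "?R \<noteq> {}" "?R \<subseteq> ?D" "k \<in> ?R" and Q: "?Q \<noteq> {}" "?Q \<subseteq> ?D" "l \<in> ?Q" using k l no by auto
      have mono: "m ?D t \<le> m R t" if "R \<noteq> {}" "R \<subseteq> ?D" for R t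
        unfolding m_def using that by (intro Min_antimono) (auto intro: finite_subset)
      have le: "m R t \<le> f h t" if "h \<in> R" "R \<subseteq> ?D" for R h t
        unfolding m_def using that by (intro Min_le) (auto intro: finite_subset)
      have "m ?R 0 \<le> m ?Q 0" using le[OF R(3,2), of 0] k(2) mono[OF Q(1,2), of 0] by linarith
      moreover have "m ?Q 1 \<le> m ?R 1" using le[OF Q(3,2), of 1] l(2) mono[OF R(1,2), of 1] by linarith
      moreover have "continuous_on {0..1} (\<lambda>t. m ?R t - m ?Q t)"
        using mcont[OF R(1,2)] mcont[OF Q(1,2)] by (intro continuous_intros)
      ultimately obtain t where t: "0 \<le> t" "t \<le> 1" "m ?R t - m ?Q t = 0"
        using IVT'[of "\<lambda>t. m ?R t - m ?Q t" 0 0 1] by auto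
      obtain h where h: "h \<in> ?R" "f h t = m ?R t" using argmin[OF R(1,2)] by blast
      obtain h' where h': "h' \<in> ?Q" "f h' t = m ?Q t" using argmin[OF Q(1,2)] by blast
      obtain g where g: "g \<in> ?D" "f g t = m ?D t" using argmin[OF False] by blast
      have "m ?D t = m ?R t \<or> m ?D t = m ?Q t"
        using g le[of g ?R t] le[of g ?Q t] mono[OF R(1,2), of t] mono[OF Q(1,2), of t] by fastforce
      then have "f h t = m ?D t" "f h' t = m ?D t" using h h' t(3) by auto
      then have "link h h'" using hit[OF t(1,2)] h(1) h'(1) by (auto simp: link_def)
      then show False using h(1) h'(1) by (auto dest: rtranclp.rtrancl_into_rtrancl)
    qed
    then show ?thesis using k(3) l(3) by (meson converse_rtranclp_into_rtranclp rtranclp.rtrancl_into_rtrancl)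
  qed
qed

section \<open>The Gale dual and certificates from Farkas' lemma\<close>

abbreviation "U \<equiv> gale_dual W"

lemma dual_arrangement: "arrangement U"
  using data by unfold_locales (rule gale_dual_arrangement_data)

lemma dir_dual: "dir U = (dir W)\<^sup>\<bottom>" "(dir U)\<^sup>\<bottom> = dir W"
  by (simp_all add: gale_dual_def orthogonal_comp_self subspace_dir)

lemma sign_inner_nonneg:
  assumes "b \<in> sign_vectors" "\<And>i. b i * x $ i \<ge> 0" "\<And>i. b i * y $ i \<ge> 0"
  shows "x \<bullet> y \<ge> 0"
proof -
  have "x $ i * y $ i \<ge> 0" for i
  proof -
    have *: "x $ i * y $ i = (b i * x $ i) * (b i * y $ i)"
      using sign_sq[OF assms(1), of i] by (metis mult.assoc mult.left_commute mult_1)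
    show ?thesis unfolding * by (rule mult_nonneg_nonneg[OF assms(2,3)])
  qed
  then show ?thesis by (simp add: inner_vec_def sum_nonneg)
qed

text \<open>Linear programming duality. A point \<open>- y\<close> of the dual chamber shows that
  \<open>\<xi>\<close> is at most zero on the cone; if there is no such point, \<open>farkas\<close>
  gives a direction in the cone on which \<open>\<xi>\<close> is positive, and therefore
  unbounded.\<close>

lemma bounded_signs_eq: "bounded_signs W = feasible U"
proof (rule antisym; rule subsetI)
  fix a assume "a \<in> feasible U"
  then obtain y where y: "a \<in> sign_vectors" "y \<in> xi W" "\<And>i. a i * (- y) $ i \<ge> 0"
    by (auto simp: feasible_def chamber_def gale_dual_def)
  have "y' \<bullet> x \<le> 0" if "y' \<in> xi W" "x \<in> chamber_cone W a" for y' x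
  proof -
    have "y' \<bullet> x = y \<bullet> x"
      using inner_orthogonal_comp[OF xi_diff[OF that(1) y(2)], of x] that(2)
      by (simp add: chamber_cone_def inner_diff_left)
    moreover have "(- y) \<bullet> x \<ge> 0"
      using that(2) by (intro sign_inner_nonneg[OF y(1) y(3)]) (auto simp: chamber_cone_def)
    ultimately show ?thesis by simp
  qed
  then show "a \<in> bounded_signs W"
    using y(1) by (auto simp: bounded_signs_def intro!: bdd_aboveI[of _ 0])
next
  fix a assume a: "a \<in> bounded_signs W"
  then have sg: "a \<in> sign_vectors" by (simp add: bounded_signs_def)
  obtain y where y: "y \<in> xi W" using xi_nonempty by blast
  show "a \<in> feasible U"
  proof (rule ccontr)
    assume no: "a \<notin> feasible U"
    have "\<not> (\<exists>v\<in>(dir W)\<^sup>\<bottom>. (\<forall>i\<in>UNIV. a i * (- y + v) $ i \<ge> 0) \<and> (\<forall>i. i \<notin> UNIV \<longrightarrow> (- y + v) $ i = 0))"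
    proof
      assume "\<exists>v\<in>(dir W)\<^sup>\<bottom>. (\<forall>i\<in>UNIV. a i * (- y + v) $ i \<ge> 0) \<and> (\<forall>i. i \<notin> UNIV \<longrightarrow> (- y + v) $ i = 0)"
      then obtain v where v: "v \<in> (dir W)\<^sup>\<bottom>" "\<And>i. a i * (- y + v) $ i \<ge> 0" by blast
      have "- v \<in> (dir W)\<^sup>\<bottom>" using v(1) subspace_neg subspace_orthogonal_comp by blast
      then have "- y + v \<in> eta U" using xi_add[OF y]
        by (auto simp: gale_dual_def image_iff intro!: bexI[of _ "y + - v"])
      then show False using no v(2) sg by (auto simp: feasible_def chamber_def)
    qed
    then obtain x where x: "x \<in> (dir W)\<^sup>\<bottom>\<^sup>\<bottom>" "\<And>i. a i * x $ i \<ge> 0" "x \<bullet> (- y) < 0"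
      using farkas[OF subspace_orthogonal_comp sg, of "dir W" UNIV "- y"] by blast
    obtain M where M: "\<And>y x. y \<in> xi W \<Longrightarrow> x \<in> chamber_cone W a \<Longrightarrow> y \<bullet> x \<le> M"
      using a by (auto simp: bounded_signs_def bdd_above_def)
    \<comment> \<open>The scaling makes the value of \<open>y\<close> equal to
      \<open>|M| + 1\<close>, beyond the bound.\<close>
    define t where "t = (\<bar>M\<bar> + 1) / (y \<bullet> x)"
    have pos: "y \<bullet> x > 0" using x(3) by (simp add: inner_commute)
    then have "t \<ge> 0" by (simp add: t_def)
    then have "t *\<^sub>R x \<in> chamber_cone W a"
      using x subspace_scale[OF subspace_dir]
      by (auto simp: chamber_cone_def orthogonal_comp_self[OF subspace_dir] mult.left_commute[of _ t])
    from M[OF y this] pos show False by (simp add: t_def)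
  qed
qed

lemma bounded_feasible_eq: "bounded_feasible W = F \<inter> feasible U"
  by (simp add: bounded_feasible_def bounded_signs_eq)

text \<open>The flippable coordinates come from a vertex of \<open>\<Delta> a \<inter> \<Delta> c\<close>; there is one, as coordinates separate points.\<close>

lemma common_flips:
  assumes a: "a \<in> F" and c: "c \<in> F" and ne: "x0 \<in> \<Delta> a" "x0 \<in> \<Delta> c"
  obtains Z where "\<And>k. k \<in> Z \<Longrightarrow> flip a k \<in> F" "\<And>k. k \<in> Z \<Longrightarrow> flip c k \<in> F"
    "\<And>u. \<exists>w. (\<forall>k. k \<notin> Z \<longrightarrow> w $ k = 0) \<and> u - w \<in> (dir W)\<^sup>\<bottom>"
proof -
  have sg: "a \<in> sign_vectors" "c \<in> sign_vectors" using a c feasible_sign by auto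
  let ?z = "\<lambda>x :: real ^ 'i. card {k. x $ k = 0}"
  \<comment> \<open>A vertex is obtained as a point with the largest number of vanishing
    coordinates.\<close>
  have "\<exists>x. (x \<in> \<Delta> a \<and> x \<in> \<Delta> c) \<and> (\<forall>y. y \<in> \<Delta> a \<and> y \<in> \<Delta> c \<longrightarrow> ?z y \<le> ?z x)"
    by (rule ex_has_greatest_nat[of _ x0 _ "Suc (CARD('i))"])
      (use ne in \<open>auto simp: less_Suc_eq_le intro!: card_mono\<close>)
  then obtain x where x: "x \<in> \<Delta> a" "x \<in> \<Delta> c"
    and max: "\<And>y. y \<in> \<Delta> a \<Longrightarrow> y \<in> \<Delta> c \<Longrightarrow> ?z y \<le> ?z x" by blast
  let ?Z = "{k. x $ k = 0}"
  have inj: "v = 0" if v: "v \<in> dir W" "\<And>k. k \<in> ?Z \<Longrightarrow> v $ k = 0" for v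
  proof (rule ccontr)
    assume "v \<noteq> 0"
    then have D: "{k. v $ k \<noteq> 0} \<noteq> {}" by (auto simp: vec_eq_iff)
    let ?r = "\<lambda>k. \<bar>x $ k\<bar> / \<bar>v $ k\<bar>"
    have "Min (?r ` {k. v $ k \<noteq> 0}) \<in> ?r ` {k. v $ k \<noteq> 0}" using D by (intro Min_in) auto
    then obtain m where m: "v $ m \<noteq> 0" "?r m = Min (?r ` {k. v $ k \<noteq> 0})" by auto
    have rm: "?r m \<le> ?r k" if "v $ k \<noteq> 0" for k using m(2) that by simp
    \<comment> \<open>Among the parameters at which some coordinate with
      \<open>v_k \<noteq> 0\<close> vanishes, the one for \<open>m\<close> is nearest to zero. So no
      sign changes on the way, and one more coordinate vanishes.\<close>
    define t where "t = - (x $ m / v $ m)"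
    have tv: "\<bar>t * v $ k\<bar> \<le> \<bar>x $ k\<bar>" for k
    proof (cases "v $ k = 0")
      case False
      have "\<bar>t * v $ k\<bar> = ?r m * \<bar>v $ k\<bar>" by (simp add: t_def abs_mult abs_divide)
      also have "\<dots> \<le> ?r k * \<bar>v $ k\<bar>" using rm[OF False] by (intro mult_right_mono) auto
      finally show ?thesis using False by simp
    qed simp
    let ?y = "x + t *\<^sub>R v"
    have inD: "?y \<in> \<Delta> b" if b: "b \<in> sign_vectors" "x \<in> \<Delta> b" for b
    proof -
      have "b k * ?y $ k \<ge> 0" for k
      proof -
        have "\<bar>b k\<bar> = 1" using sign_cases[OF b(1), of k] by auto
        then have "b k * x $ k = \<bar>x $ k\<bar>" "\<bar>b k * (t * v $ k)\<bar> \<le> \<bar>x $ k\<bar>"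
          using chamberD(2)[OF b(2), of k] tv[of k] by (metis abs_mult abs_of_nonneg mult_1, simp add: abs_mult)
        then show ?thesis by (simp add: distrib_left)
      qed
      moreover have "?y \<in> eta W" using chamberD(1)[OF b(2)] v(1)
        by (intro eta_add subspace_scale subspace_dir)
      ultimately show ?thesis by (simp add: chamber_def)
    qed
    have "?z x < ?z ?y"
    proof (rule psubset_card_mono)
      have "?y $ m = 0" using m(1) by (simp add: t_def)
      moreover have "x $ m \<noteq> 0" using m(1) v(2)[of m] by auto
      moreover have "?y $ k = 0" if "x $ k = 0" for k using that v(2)[of k] by simp
      ultimately show "?Z \<subset> {k. ?y $ k = 0}" by blast
    qed simp
    then show False using max[OF inD[OF sg(1) x(1)] inD[OF sg(2) x(2)]] by simp
  qed
  \<comment> \<open>The dual form of \<open>inj\<close>: no nonzero vector of \<open>V\<close>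
    vanishes on \<open>?Z\<close>, so that \<open>V\<^sup>\<bottom>\<close> and the vectors
    supported on \<open>?Z\<close> together span the whole space.\<close>
  have sp: "\<exists>w. (\<forall>k. k \<notin> ?Z \<longrightarrow> w $ k = 0) \<and> u - w \<in> (dir W)\<^sup>\<bottom>" for u
  proof -
    let ?S = "{w :: real ^ 'i. \<forall>k. k \<notin> ?Z \<longrightarrow> w $ k = 0}"
    have S: "subspace ?S" by (auto simp: subspace_def)
    have *: "z \<bullet> u = 0" if z: "\<And>s. s \<in> ?S \<Longrightarrow> z \<bullet> s = 0" "\<And>t. t \<in> (dir W)\<^sup>\<bottom> \<Longrightarrow> z \<bullet> t = 0" for z
    proof -
      have "z \<in> (dir W)\<^sup>\<bottom>\<^sup>\<bottom>" using z(2) by (rule orthogonal_compI)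
      then have "z \<in> dir W" using orthogonal_comp_self[OF subspace_dir] by simp
      moreover have "z $ k = 0" if "k \<in> ?Z" for k
      proof -
        have "axis k 1 \<in> ?S" using that by (auto simp: axis_def)
        from z(1)[OF this] show ?thesis by (simp add: inner_axis)
      qed
      ultimately have "z = 0" by (rule inj)
      then show ?thesis by simp
    qed
    have "\<exists>s\<in>?S. \<exists>t\<in>(dir W)\<^sup>\<bottom>. u = s + t"
      by (rule orthogonal_comp_sum[OF S subspace_orthogonal_comp]) (rule *)
    then obtain s t where "s \<in> ?S" "t \<in> (dir W)\<^sup>\<bottom>" "u = s + t" by blast
    then show ?thesis by (intro exI[of _ s]) auto
  qed
  show ?thesis
  proof (rule that[of ?Z])
    show "\<exists>w. (\<forall>k. k \<notin> ?Z \<longrightarrow> w $ k = 0) \<and> u - w \<in> (dir W)\<^sup>\<bottom>" for u by (rule sp)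
  qed (use feasible_flipI[OF a x(1)] feasible_flipI[OF c x(2)] in simp_all)
qed

text \<open>If \<open>flip a k\<close> is infeasible, no point of \<open>\<Delta> a\<close> has
  \<open>x_k = 0\<close>, and \<open>farkas\<close> certifies this by a vector that is negative on a
  point of \<open>\<Delta> a\<close>. As it agrees with \<open>a\<close> in all other coordinates,
  it must disagree at \<open>k\<close>.\<close>

lemma unflippable_certificate:
  assumes a: "a \<in> F" and k: "flip a k \<notin> F"
  obtains y where "y \<in> (dir W)\<^sup>\<bottom>" "\<And>i. i \<noteq> k \<Longrightarrow> a i * y $ i \<ge> 0" "a k * y $ k < 0"
proof -
  have sg: "a \<in> sign_vectors" using a by (rule feasible_sign)
  obtain x where x: "x \<in> \<Delta> a" by (rule feasibleE[OF a])
  have "\<not> (\<exists>v\<in>dir W. (\<forall>i\<in>- {k}. a i * (x + v) $ i \<ge> 0) \<and> (\<forall>i. i \<notin> - {k} \<longrightarrow> (x + v) $ i = 0))"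
  proof
    assume "\<exists>v\<in>dir W. (\<forall>i\<in>- {k}. a i * (x + v) $ i \<ge> 0) \<and> (\<forall>i. i \<notin> - {k} \<longrightarrow> (x + v) $ i = 0)"
    then obtain v where v: "v \<in> dir W" "\<And>i. i \<noteq> k \<Longrightarrow> a i * (x + v) $ i \<ge> 0" "(x + v) $ k = 0" by auto
    have "a i * (x + v) $ i \<ge> 0" for i using v(2,3) by (cases "i = k") auto
    then have "x + v \<in> \<Delta> a" using eta_add[OF chamberD(1)[OF x] v(1)] by (simp add: chamber_def)
    then show False using feasible_flipI[OF a _ v(3)] k by blast
  qed
  then obtain y where y: "y \<in> (dir W)\<^sup>\<bottom>" "\<And>i. i \<in> - {k} \<Longrightarrow> a i * y $ i \<ge> 0" "y \<bullet> x < 0"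
    using farkas[OF subspace_dir sg] by blast
  have "a k * y $ k < 0"
  proof (rule ccontr)
    assume "\<not> a k * y $ k < 0"
    then have "a i * y $ i \<ge> 0" for i using y(2)[of i] by (cases "i = k") auto
    then have "y \<bullet> x \<ge> 0" using chamberD(2)[OF x] by (intro sign_inner_nonneg[OF sg])
    then show False using y(3) by simp
  qed
  then show ?thesis using that y(1,2) by auto
qed

text \<open>Otherwise there are certificates in \<open>V\<^sup>\<bottom>\<close> and in
  \<open>V\<close> for the same \<open>a\<close> and \<open>k\<close>. Their products are
  nonnegative in each coordinate and positive at \<open>k\<close>, against orthogonality. So a
  neighbour of a vertex in \<open>P\<close> fails at most one of the two conditions.\<close>

lemma flip_feasible_or_bounded:
  assumes "a \<in> F" "a \<in> feasible U"
  shows "flip a k \<in> F \<or> flip a k \<in> feasible U"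
proof (rule ccontr)
  interpret U: arrangement U by (rule dual_arrangement)
  assume "\<not> ?thesis"
  then have no: "flip a k \<notin> F" "flip a k \<notin> feasible U" by auto
  have sg: "a \<in> sign_vectors" using assms(1) by (rule feasible_sign)
  obtain y where y: "y \<in> (dir W)\<^sup>\<bottom>" "\<And>i. i \<noteq> k \<Longrightarrow> a i * y $ i \<ge> 0" "a k * y $ k < 0"
    using unflippable_certificate[OF assms(1) no(1)] by metis
  obtain x where x: "x \<in> dir W" "\<And>i. i \<noteq> k \<Longrightarrow> a i * x $ i \<ge> 0" "a k * x $ k < 0"
    using U.unflippable_certificate[OF assms(2) no(2)] dir_dual(2) by metis
  have 1: "y $ i * x $ i = (a i * y $ i) * (a i * x $ i)" for i
    using sign_sq[OF sg, of i] by (metis mult.assoc mult.left_commute mult_1)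
  have "y $ i * x $ i \<ge> 0" if "i \<noteq> k" for i
    unfolding 1 by (rule mult_nonneg_nonneg[OF y(2)[OF that] x(2)[OF that]])
  moreover have "y $ k * x $ k > 0" unfolding 1 by (rule mult_neg_neg[OF y(3) x(3)])
  ultimately have "(\<Sum>i\<in>UNIV. y $ i * x $ i) > 0"
    by (intro sum_pos2[of _ k]) (auto, metis less_imp_le)
  then show False using inner_orthogonal_comp[OF y(1) x(1)] by (simp add: inner_vec_def)
qed

text \<open>Emptiness is certified by some \<open>y\<close> in \<open>V\<^sup>\<bottom>\<close> that
  is negative on \<open>V_\<eta>\<close>. Let \<open>b\<close> have the signs of \<open>y\<close>.
  Its chamber is empty because \<open>y\<close> would be nonnegative there, and it is feasible for
  the Gale dual because a point of the dual chamber of \<open>a\<close> can be moved far in the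
  direction of \<open>y\<close>.\<close>

lemma empty_face_certificate:
  assumes a: "a \<in> feasible U" and c: "c \<in> sign_vectors"
    and empty: "hyp W S \<inter> (\<Delta> a \<inter> \<Delta> c) = {}"
  obtains b where "b \<in> feasible U" "\<Delta> b = {}" "{i. a i = c i \<and> c i \<noteq> b i} \<subseteq> S"
proof -
  interpret U: arrangement U by (rule dual_arrangement)
  have sg: "a \<in> sign_vectors" using a by (rule feasible_sign)
  obtain x where x: "x \<in> eta W" using eta_nonempty by blast
  \<comment> \<open>The points of \<open>H_S\<close> in both chambers vanish outside
    \<open>?G\<close>: on \<open>S\<close> by definition, and where \<open>a\<close> and
    \<open>c\<close> differ because they satisfy opposite inequalities.\<close>
  let ?G = "{i. a i = c i \<and> i \<notin> S}"
  have none: "\<not> (\<exists>v\<in>dir W. (\<forall>i\<in>?G. a i * (x + v) $ i \<ge> 0) \<and> (\<forall>i. i \<notin> ?G \<longrightarrow> (x + v) $ i = 0))"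
  proof
    assume "\<exists>v\<in>dir W. (\<forall>i\<in>?G. a i * (x + v) $ i \<ge> 0) \<and> (\<forall>i. i \<notin> ?G \<longrightarrow> (x + v) $ i = 0)"
    then obtain v where v: "v \<in> dir W" "\<And>i. i \<in> ?G \<Longrightarrow> a i * (x + v) $ i \<ge> 0"
      "\<And>i. i \<notin> ?G \<Longrightarrow> (x + v) $ i = 0" by auto
    have "a i * (x + v) $ i \<ge> 0 \<and> c i * (x + v) $ i \<ge> 0" for i
      using v(2,3)[of i] by (cases "i \<in> ?G") auto
    then have "x + v \<in> hyp W S \<inter> (\<Delta> a \<inter> \<Delta> c)"
      using eta_add[OF x v(1)] v(3) by (simp add: chamber_def hyp_def)
    then show False using empty by blast
  qed
  obtain y where y: "y \<in> (dir W)\<^sup>\<bottom>" "\<And>i. i \<in> ?G \<Longrightarrow> a i * y $ i \<ge> 0" "y \<bullet> x < 0"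
    using farkas[OF subspace_dir sg none] by blast
  define b where "b i = (if y $ i = 0 then a i else sgn (y $ i))" for i
  have b0: "b i = a i" if "y $ i = 0" for i using that by (simp add: b_def)
  have b1: "b i = sgn (y $ i)" if "y $ i \<noteq> 0" for i using that by (simp add: b_def)
  have "b i = 1 \<or> b i = - 1" for i
    by (metis b0 b1 sgn_real_def sign_cases[OF sg])
  then have bs: "b \<in> sign_vectors" by (simp add: sign_vectors_def)
  have b_abs: "b i * y $ i = \<bar>y $ i\<bar>" for i
    by (cases "y $ i = 0") (simp_all add: b1 abs_sgn mult.commute)
  have "\<Delta> b = {}"
  proof (rule ccontr)
    assume "\<Delta> b \<noteq> {}"
    then obtain z where z: "z \<in> \<Delta> b" by blast
    have "y \<bullet> z \<ge> 0" using b_abs chamberD(2)[OF z] by (intro sign_inner_nonneg[OF bs]) auto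
    moreover have "y \<bullet> (z - x) = 0" using inner_orthogonal_comp[OF y(1)] eta_diff[OF chamberD(1)[OF z] x] by blast
    ultimately show False using y(3) by (simp add: inner_diff_right)
  qed
  moreover have "b \<in> feasible U"
  proof -
    obtain z where z: "z \<in> chamber U a" by (rule U.feasibleE[OF a])
    \<comment> \<open>Terms with \<open>y_i = 0\<close> count zero by the convention for division;
      each of the others ensures that \<open>t |y_i|\<close> is at least
      \<open>|z_i|\<close>.\<close>
    define t where "t = (\<Sum>i\<in>UNIV. \<bar>z $ i\<bar> / \<bar>y $ i\<bar>)"
    have "b i * (z + t *\<^sub>R y) $ i \<ge> 0" for i
    proof (cases "y $ i = 0")
      case True
      then show ?thesis using U.chamberD(2)[OF z, of i] b0[OF True] by simp
    next
      case False
      have "\<bar>z $ i\<bar> / \<bar>y $ i\<bar> \<le> t" unfolding t_def by (rule member_le_sum) auto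
      then have "\<bar>z $ i\<bar> \<le> t * \<bar>y $ i\<bar>" using False by (simp add: pos_divide_le_eq)
      moreover have "b i * (z + t *\<^sub>R y) $ i = b i * z $ i + t * \<bar>y $ i\<bar>"
        using b_abs[of i] by (simp add: distrib_left mult.left_commute[of _ t])
      moreover have "\<bar>b i * z $ i\<bar> = \<bar>z $ i\<bar>"
        using False by (simp add: b1 abs_mult)
      ultimately show ?thesis by linarith
    qed
    moreover have "z + t *\<^sub>R y \<in> eta U"
      using U.chamberD(1)[OF z] y(1) dir_dual(1) by (intro U.eta_add subspace_scale U.subspace_dir) auto
    ultimately show ?thesis using bs by (auto simp: feasible_def chamber_def)
  qed
  moreover have "i \<in> S" if i: "a i = c i" "c i \<noteq> b i" for i
  proof (rule ccontr)
    assume "i \<notin> S"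
    then have "a i * y $ i \<ge> 0" using y(2) i by simp
    moreover have "y $ i \<noteq> 0" using i b0[of i] by metis
    ultimately have "sgn (y $ i) = a i"
      by (rule_tac disjE[OF sign_cases[OF sg, of i]]) (simp_all add: sgn_if)
    then show False using i b1[OF \<open>y $ i \<noteq> 0\<close>] by metis
  qed
  ultimately show ?thesis using that by blast
qed

end

section \<open>Generators and relations of \<open>A(W)\<close>\<close>

lemma vertex_path: "a \<in> F \<Longrightarrow> [a] \<in> paths F E"
  by (simp add: paths_def)

lemma edge_path: "a \<in> F \<Longrightarrow> b \<in> F \<Longrightarrow> E a b \<Longrightarrow> [a, b] \<in> paths F E"
  by (simp add: paths_def)

lemma adj_sym: "adj a b \<Longrightarrow> adj b a"
proof -
  have "{j. b j \<noteq> a j} = {j. a j \<noteq> b j}" by auto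
  then show "adj a b \<Longrightarrow> adj b a" by (simp add: adj_def adj_at_def)
qed

lemma adj_flipI: "a \<in> sign_vectors \<Longrightarrow> adj a (flip a i)"
  by (auto simp: adj_flip flip_sign)

context path_algebra_over
begin

lemma vertex_sum_closed:
  assumes "G \<subseteq> F" "s \<in> carrier S"
  shows "(\<lambda>w. if w \<in> (\<lambda>v. [v]) ` G then s else \<zero>) \<in> carrier PA"
proof (rule PA_carrierI)
  have sub: "{w. (if w \<in> (\<lambda>v. [v]) ` G then s else \<zero>) \<noteq> \<zero>} \<subseteq> (\<lambda>v. [v]) ` G" by auto
  show "finite {w. (if w \<in> (\<lambda>v. [v]) ` G then s else \<zero>) \<noteq> \<zero>}"
    by (rule finite_subset[OF sub]) (use assms finite_vertices finite_subset in auto)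
  show "{w. (if w \<in> (\<lambda>v. [v]) ` G then s else \<zero>) \<noteq> \<zero>} \<subseteq> paths F E"
    using sub assms(1) by (auto simp: vertex_path)
qed (use assms in auto)

lemma ring_map_vertex_sum:
  fixes h :: "_ \<Rightarrow> 'r::ring"
  assumes h: "ring_map PA h" and G: "finite G" "G \<subseteq> F" and s: "s \<in> carrier S"
  shows "h (\<lambda>w. if w \<in> (\<lambda>v. [v]) ` G then s else \<zero>) = (\<Sum>a\<in>G. h (psingle S [a] s))"
  using G
proof (induction G)
  case empty
  have "(\<lambda>w. if w \<in> (\<lambda>v. [v]) ` {} then s else \<zero>) = \<zero>\<^bsub>PA\<^esub>" by (auto simp: PA_simps)
  then show ?case using ring_map_zero[OF PA_ring h] by simp
next
  case (insert a G)
  let ?f = "\<lambda>G w. if w \<in> (\<lambda>v. [v]) ` G then s else \<zero>"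
  have "?f (insert a G) = psingle S [a] s \<oplus>\<^bsub>PA\<^esub> ?f G"
    using insert.hyps s by (auto simp: fun_eq_iff PA_simps psingle_def)
  moreover have "psingle S [a] s \<in> carrier PA" "?f G \<in> carrier PA"
    using insert.prems s by (auto intro!: psingle_closed vertex_path vertex_sum_closed)
  ultimately show ?case using insert by (simp add: ring_mapD(1)[OF h])
qed

end

lemma sym_dual_cring: "cring (sym_dual W)"
proof -
  interpret cring "poly_ring :: 'a mpoly ring" by (rule poly_ring_cring)
  have "ideal (sym_dual_ideal W) poly_ring" unfolding sym_dual_ideal_def by (rule genideal_ideal) auto
  then show ?thesis
    unfolding sym_dual_def by (rule ideal.quotient_is_cring) (rule poly_ring_cring)
qed

sublocale arrangement \<subseteq> PA: path_algebra_over "sym_dual W" "feasible W" adj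
  by (intro path_algebra_over.intro path_algebra_over_axioms.intro sym_dual_cring finite_feasible)

section \<open>The algebra inside a type-class ring\<close>

context arrangement
begin

abbreviation "cls \<equiv> sym_dual_class W"
abbreviation "S \<equiv> sym_dual W"
abbreviation "Q \<equiv> quiver_sym W"
abbreviation "P \<equiv> bounded_feasible W"

lemma Q_eq: "Q = PA.PA" by (simp add: quiver_sym_def)

lemma sym_ideal: "ideal (sym_dual_ideal W) poly_ring"
  unfolding sym_dual_ideal_def using ring.genideal_ideal[OF poly_ring_ring] by auto

lemma cls_closed [simp]: "cls q \<in> carrier S"
  by (simp add: sym_dual_def sym_dual_class_def carrier_Quot)

lemma cls_cases: "s \<in> carrier S \<Longrightarrow> \<exists>q. s = cls q"
  by (auto simp: sym_dual_def sym_dual_class_def carrier_Quot)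

lemma cls_simps:
  "cls (p + q) = cls p \<oplus>\<^bsub>S\<^esub> cls q" "cls (p * q) = cls p \<otimes>\<^bsub>S\<^esub> cls q" "cls 1 = \<one>\<^bsub>S\<^esub>" "cls 0 = \<zero>\<^bsub>S\<^esub>"
proof -
  interpret ideal "sym_dual_ideal W" poly_ring by (rule sym_ideal)
  show "cls (p + q) = cls p \<oplus>\<^bsub>S\<^esub> cls q"
    using a_rcos_sum[of p q] by (simp add: sym_dual_class_def sym_dual_def FactRing_def)
  show "cls (p * q) = cls p \<otimes>\<^bsub>S\<^esub> cls q"
    using rcoset_mult_add[of p q] by (simp add: sym_dual_class_def sym_dual_def FactRing_def)
  show "cls 1 = \<one>\<^bsub>S\<^esub>" by (simp add: sym_dual_class_def sym_dual_def FactRing_def)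
  show "cls 0 = \<zero>\<^bsub>S\<^esub>"
    using coset_eq_zero_iff[OF sym_ideal, of 0] additive_subgroup.zero_closed[OF additive_subgroup_axioms]
    by (simp add: sym_dual_class_def sym_dual_def)
qed

lemma cls_linear_form: "v \<in> (dir W)\<^sup>\<bottom> \<Longrightarrow> cls (linear_form v) = \<zero>\<^bsub>S\<^esub>"
  unfolding sym_dual_def sym_dual_class_def
  by (subst coset_eq_zero_iff[OF sym_ideal]) (auto simp: sym_dual_ideal_def intro!: ring.genideal_self'[OF poly_ring_ring]
      subsetD[OF ring.genideal_self[OF poly_ring_ring]])

lemma scaled_path_eq: "scaled_path W s w = psingle S w s"
  by (simp add: scaled_path_def psingle_def)

lemma Q_ring: "ring Q" unfolding Q_eq by (rule PA.PA_ring)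

lemma psingle_Q: "w \<in> paths F adj \<Longrightarrow> s \<in> carrier S \<Longrightarrow> psingle S w s \<in> carrier Q"
  unfolding Q_eq by (rule PA.psingle_closed)

lemma A_relations_closed: "A_relations W \<subseteq> carrier Q"
proof -
  interpret Q: ring Q by (rule Q_ring)
  have 1: "\<one>\<^bsub>S\<^esub> \<in> carrier S" by (rule PA.one_closed)
  have p: "path_elem W [a] \<in> carrier Q" if "a \<in> F" for a
    using that 1 by (auto simp: scaled_path_eq intro!: psingle_Q vertex_path)
  have p3: "path_elem W [a, b, c] \<in> carrier Q" if "a \<in> F" "b \<in> F" "c \<in> F" "adj a b" "adj b c" for a b c
    using that 1 by (auto simp: scaled_path_eq paths_def intro!: psingle_Q)
  show ?thesis
    unfolding A_relations_def
  proof (intro Un_least subsetI; clarify)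
    fix \<alpha> \<beta> i assume *: "{\<alpha>, \<beta>} \<subseteq> F" "adj_at i \<alpha> \<beta>"
    then have "adj \<alpha> \<beta>" by (auto simp: adj_def)
    then show "path_elem W [\<alpha>, \<beta>, \<alpha>] \<ominus>\<^bsub>Q\<^esub> scaled_path W (cls (poly_var i)) [\<alpha>] \<in> carrier Q"
      using * by (intro Q.minus_closed p3) (auto simp: scaled_path_eq adj_sym intro!: psingle_Q vertex_path)
  next
    fix \<alpha> \<beta> \<gamma> \<delta> assume "{\<alpha>, \<beta>, \<gamma>, \<delta>} \<subseteq> F" "adj \<alpha> \<beta>" "adj \<beta> \<gamma>" "adj \<gamma> \<delta>" "adj \<delta> \<alpha>"
    then show "path_elem W [\<alpha>, \<beta>, \<gamma>] \<ominus>\<^bsub>Q\<^esub> path_elem W [\<alpha>, \<delta>, \<gamma>] \<in> carrier Q"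
      by (intro Q.minus_closed p3) (auto simp: adj_sym)
  qed (use p in auto)
qed

lemma A_ideal_ideal: "ideal (A_ideal W) Q"
  unfolding A_ideal_def by (rule ring.genideal_ideal[OF Q_ring A_relations_closed])

lemma A_ring: "ring (A_algebra W)"
  unfolding A_algebra_def by (rule ideal.quotient_is_ring[OF A_ideal_ideal])

definition "AQ f = emb (A_algebra W) (A_class W f)"

lemma AQ_ring_map: "ring_map Q AQ"
  using quotient_ring_map[OF A_ideal_ideal emb_ring_map[OF A_ring[unfolded A_algebra_def]]]
  unfolding AQ_def[abs_def] A_algebra_def A_class_def .

lemma A_class_closed: "f \<in> carrier Q \<Longrightarrow> A_class W f \<in> carrier (A_algebra W)"
  by (simp add: A_algebra_def A_class_def carrier_Quot)

lemma AQ_relation: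
  assumes "r \<in> A_relations W" shows "AQ r = 0"
proof -
  have "r \<in> carrier Q" using assms A_relations_closed by blast
  moreover have "r \<in> A_ideal W"
    unfolding A_ideal_def using ring.genideal_self[OF Q_ring A_relations_closed] assms by blast
  ultimately have "A_class W r = \<zero>\<^bsub>A_algebra W\<^esub>"
    unfolding A_class_def A_algebra_def by (simp add: coset_eq_zero_iff[OF A_ideal_ideal])
  then show ?thesis by (simp add: AQ_def ring_map_zero[OF A_ring emb_ring_map[OF A_ring]])
qed

definition "apath w = AQ (psingle S w \<one>\<^bsub>S\<^esub>)"
text \<open>The image of the polynomial \<open>q\<close> in the copy of \<open>A(W)\<close>; in
  particular \<open>AH 1\<close> is the unit of that copy, not of \<open>rprod\<close>.\<close>

definition "AH q = (\<Sum>a\<in>F. AQ (psingle S [a] (cls q)))"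
definition "Aid a = (if a \<in> F then apath [a] else 0)"
text \<open>Extended by zero to all pairs, like \<open>Aid\<close> to all sign vectors, so that most
  identities below hold without side conditions.\<close>

definition "AP a b = (if a \<in> F \<and> b \<in> F \<and> adj a b then apath [a, b] else 0)"

lemma AQ_mult:
  assumes "u \<in> paths F adj" "v \<in> paths F adj"
  shows "AQ (psingle S u (cls p)) * AQ (psingle S v (cls q)) =
    (if last u = hd v then AQ (psingle S (u @ tl v) (cls (p * q))) else 0)"
proof -
  have "AQ (psingle S u (cls p)) * AQ (psingle S v (cls q)) =
    AQ (psingle S u (cls p) \<otimes>\<^bsub>Q\<^esub> psingle S v (cls q))"
    by (rule ring_mapD(2)[OF AQ_ring_map, symmetric]) (use assms in \<open>auto intro: psingle_Q\<close>)
  then show ?thesis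
    using PA.psingle_mult[OF assms, of "cls p" "cls q"] ring_map_zero[OF Q_ring AQ_ring_map]
    by (simp add: Q_eq cls_simps)
qed

text \<open>Of the sum over vertices that defines \<open>AH p\<close> only the start of
  \<open>w\<close> contributes on the left, and only its end on the right; hence polynomials are
  central.\<close>

lemma AH_AQ:
  assumes w: "w \<in> paths F adj"
  shows "AH p * AQ (psingle S w (cls q)) = AQ (psingle S w (cls (p * q)))"
    "AQ (psingle S w (cls q)) * AH p = AQ (psingle S w (cls (p * q)))"
proof -
  have ne: "w \<noteq> []" "hd w \<in> F" "last w \<in> F"
    using w hd_in_set[of w] last_in_set[of w] by (auto simp: paths_def)
  have "AH p * AQ (psingle S w (cls q)) = (\<Sum>a\<in>F. if a = hd w then AQ (psingle S w (cls (p * q))) else 0)"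
    unfolding AH_def sum_distrib_right using ne
    by (intro sum.cong refl) (auto simp: AQ_mult[OF vertex_path w])
  then show "AH p * AQ (psingle S w (cls q)) = AQ (psingle S w (cls (p * q)))"
    using ne by (simp add: finite_feasible)
  have "AQ (psingle S w (cls q)) * AH p = (\<Sum>a\<in>F. if a = last w then AQ (psingle S w (cls (p * q))) else 0)"
    unfolding AH_def sum_distrib_left
    by (intro sum.cong refl) (auto simp: AQ_mult[OF w vertex_path] mult.commute)
  then show "AQ (psingle S w (cls q)) * AH p = AQ (psingle S w (cls (p * q)))"
    using ne by (simp add: finite_feasible)
qed

lemma AQ_single: "w \<in> paths F adj \<Longrightarrow> AQ (psingle S w (cls q)) = AH q * apath w"
  by (simp add: apath_def AH_AQ(1)[of w q 1] flip: cls_simps(3))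

lemma AH_add: "AH (p + q) = AH p + AH q"
proof -
  have "AQ (psingle S [a] (cls (p + q))) = AQ (psingle S [a] (cls p)) + AQ (psingle S [a] (cls q))" if "a \<in> F" for a
    using that ring_mapD(1)[OF AQ_ring_map, of "psingle S [a] (cls p)" "psingle S [a] (cls q)"]
    by (simp add: psingle_Q vertex_path cls_simps PA.psingle_add[folded Q_eq])
  then show ?thesis by (simp add: AH_def sum.distrib)
qed

lemma AH_mult: "AH (p * q) = AH p * AH q"
proof -
  have "AH p * AH q = (\<Sum>a\<in>F. AH p * AQ (psingle S [a] (cls q)))"
    unfolding AH_def[of q] sum_distrib_left ..
  also have "\<dots> = AH (p * q)" unfolding AH_def[of "p * q"] by (simp add: AH_AQ(1) vertex_path)
  finally show ?thesis ..
qed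

lemma AH_zero: "AH 0 = 0" using AH_add[of 0 0] by simp

lemma AH_linear_form: "v \<in> (dir W)\<^sup>\<bottom> \<Longrightarrow> AH (linear_form v) = 0"
  using AH_zero by (simp add: AH_def cls_linear_form cls_simps(4))

lemma AH_one: "AH 1 = (\<Sum>a\<in>F. Aid a)"
  by (simp add: AH_def Aid_def apath_def cls_simps(3))

lemma apath_mult:
  assumes "u \<in> paths F adj" "v \<in> paths F adj"
  shows "apath u * apath v = (if last u = hd v then apath (u @ tl v) else 0)"
  using AQ_mult[OF assms, of 1 1] by (simp add: apath_def cls_simps(3))

lemma AH_apath_comm: "w \<in> paths F adj \<Longrightarrow> AH q * apath w = apath w * AH q"
  using AH_AQ(1)[where p = q and q = 1] AH_AQ(2)[where p = q and q = 1]
  by (simp add: apath_def cls_simps(3))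

lemma AH_comm: "AH q * Aid a = Aid a * AH q" "AH q * AP a b = AP a b * AH q" "AH p * AH q = AH q * AH p"
  by (auto simp: Aid_def AP_def AH_apath_comm vertex_path edge_path mult.commute simp flip: AH_mult)

lemma AH_one_mult: "w \<in> paths F adj \<Longrightarrow> AH 1 * apath w = apath w"
  using AH_AQ(1)[of w 1 1] by (simp add: apath_def cls_simps(3))

lemma AH_unit: "AH 1 * Aid a = Aid a" "AH 1 * AP a b = AP a b"
  by (auto simp: Aid_def AP_def AH_one_mult vertex_path edge_path)

lemma Aid_mult: "Aid a * Aid b = (if a = b then Aid a else 0)"
  by (auto simp: Aid_def apath_mult vertex_path)

lemma Aid_AP: "Aid c * AP a b = (if c = a then AP a b else 0)" "AP a b * Aid c = (if c = b then AP a b else 0)"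
  by (auto simp: Aid_def AP_def apath_mult vertex_path edge_path)

lemma Aid_unbounded:
  assumes "a \<notin> P" shows "Aid a = 0"
proof (cases "a \<in> F")
  case True
  then have "path_elem W [a] \<in> A_relations W" using assms by (auto simp: A_relations_def)
  then show ?thesis using True AQ_relation by (auto simp: Aid_def apath_def scaled_path_eq)
qed (simp add: Aid_def)

lemma AP_unbounded: "a \<notin> P \<or> b \<notin> P \<Longrightarrow> AP a b = 0"
  using Aid_AP(1)[of a a b] Aid_AP(2)[of a b b] Aid_unbounded by auto

lemma path3: "a \<in> F \<Longrightarrow> b \<in> F \<Longrightarrow> c \<in> F \<Longrightarrow> adj a b \<Longrightarrow> adj b c \<Longrightarrow> [a, b, c] \<in> paths F adj"
  by (simp add: paths_def)

lemma AP_AP: "a \<in> F \<Longrightarrow> b \<in> F \<Longrightarrow> c \<in> F \<Longrightarrow> adj a b \<Longrightarrow> adj b c \<Longrightarrow> AP a b * AP b c = apath [a, b, c]"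
  by (simp add: AP_def apath_mult edge_path)

text \<open>This is (A2); distinct coordinates \<open>i\<close> and \<open>j\<close> give four
  distinct vertices, as that relation demands.\<close>

lemma AP_square:
  assumes "a \<in> F" "flip a i \<in> F" "flip a j \<in> F" "flip (flip a i) j \<in> F" "i \<noteq> j"
  shows "AP a (flip a i) * AP (flip a i) (flip (flip a i) j)
    = AP a (flip a j) * AP (flip a j) (flip (flip a i) j)"
proof -
  let ?b = "flip a i" and ?d = "flip a j" and ?c = "flip (flip a i) j"
  have sg: "a \<in> sign_vectors" "?b \<in> sign_vectors" "?d \<in> sign_vectors" "?c \<in> sign_vectors"
    using assms feasible_sign by auto
  have adj: "adj a ?b" "adj ?b ?c" "adj ?c ?d" "adj ?d a" "adj a ?d" "adj ?d ?c"
    using adj_flipI[OF sg(1), of i] adj_flipI[OF sg(2), of j] adj_flipI[OF sg(1), of j]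
      adj_flipI[OF sg(3), of i] by (simp_all add: adj_sym flip_commute[of a j i])
  have "?c \<noteq> a" using sign_nonzero[OF sg(1), of i] assms(5) by (auto simp: flip_def fun_eq_iff)
  moreover have "?b \<noteq> ?d" using flip_inj[OF sg(1)] assms(5) by auto
  moreover have "?c \<noteq> ?d" using flip_neq[OF sg(3), of i] by (simp add: flip_commute)
  ultimately have dist: "distinct [a, ?b, ?c, ?d]"
    using flip_neq[OF sg(1)] flip_neq[OF sg(2)] by (auto simp: eq_commute)
  have "path_elem W [a, ?b, ?c] \<ominus>\<^bsub>Q\<^esub> path_elem W [a, ?d, ?c] \<in> A_relations W"
    unfolding A_relations_def using assms adj dist by blast
  then have "AQ (psingle S [a, ?b, ?c] \<one>\<^bsub>S\<^esub> \<ominus>\<^bsub>Q\<^esub> psingle S [a, ?d, ?c] \<one>\<^bsub>S\<^esub>) = 0"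
    by (simp add: AQ_relation scaled_path_eq)
  then have "apath [a, ?b, ?c] = apath [a, ?d, ?c]"
    using assms adj by (subst (asm) ring_map_diff[OF Q_ring AQ_ring_map]) (auto simp: apath_def intro!: psingle_Q path3)
  then show ?thesis using assms adj by (simp add: AP_AP)
qed

lemma AP_back:
  assumes "a \<in> F" "flip a i \<in> F"
  shows "AP a (flip a i) * AP (flip a i) a = AH (poly_var i) * Aid a"
proof -
  let ?b = "flip a i"
  have sg: "a \<in> sign_vectors" "?b \<in> sign_vectors" using assms feasible_sign by auto
  have at: "adj_at i a ?b" "adj_at i ?b a" using sg by (auto simp: adj_at_flip)
  then have adj: "adj a ?b" "adj ?b a" by (auto simp: adj_def)
  have "path_elem W [a, ?b, a] \<ominus>\<^bsub>Q\<^esub> scaled_path W (cls (poly_var i)) [a] \<in> A_relations W"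
    unfolding A_relations_def using assms at by blast
  then have "AQ (psingle S [a, ?b, a] \<one>\<^bsub>S\<^esub> \<ominus>\<^bsub>Q\<^esub> psingle S [a] (cls (poly_var i))) = 0"
    by (simp add: AQ_relation scaled_path_eq)
  then have "apath [a, ?b, a] = AQ (psingle S [a] (cls (poly_var i)))"
    using assms adj
    by (subst (asm) ring_map_diff[OF Q_ring AQ_ring_map]) (auto simp: apath_def intro!: psingle_Q path3 vertex_path)
  then show ?thesis using assms adj AQ_single[OF vertex_path[OF assms(1)]] by (simp add: AP_AP Aid_def)
qed

lemma emb_A_induct [consumes 1, case_names zero single add]:
  assumes "x \<in> carrier (A_algebra W)" and "R 0"
    and "\<And>w q. w \<in> paths F adj \<Longrightarrow> R (AH q * apath w)"
    and "\<And>y z. R y \<Longrightarrow> R z \<Longrightarrow> R (y + z)"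
  shows "R (emb (A_algebra W) x)"
proof -
  obtain f where f: "f \<in> carrier Q" "x = A_class W f"
    using assms(1) by (auto simp: A_algebra_def A_class_def carrier_Quot)
  have "R (AQ f)"
    using f(1) unfolding Q_eq
  proof (induction f rule: PA.PA_induct)
    case zero
    then show ?case using assms(2) ring_map_zero[OF Q_ring AQ_ring_map] by (simp add: Q_eq)
  next
    case (single w s)
    then show ?case using assms(3) cls_cases[of s] AQ_single by auto
  next
    case (add f g)
    then show ?case using assms(4) ring_mapD(1)[OF AQ_ring_map] by (simp add: Q_eq)
  qed
  then show ?thesis using f by (simp add: AQ_def)
qed

lemma apath_Cons:
  assumes "a # b # w \<in> paths F adj" shows "apath (a # b # w) = AP a b * apath (b # w)"
proof -
  have *: "[a, b] \<in> paths F adj" "b # w \<in> paths F adj" "a \<in> F" "b \<in> F" "adj a b"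
    using assms by (auto simp: paths_def)
  show ?thesis using apath_mult[OF *(1,2)] * by (simp add: AP_def)
qed

end

text \<open>Images of the generators of \<open>A(W)\<close> with the defining relations rewritten by
  flips; \<open>h_one\<close> stands in for unitality. It is instantiated by \<open>B\<close> of the
  Gale dual and, with the Gale dual in place of \<open>W\<close>, by the quadratic dual.\<close>

locale A_representation = arrangement W for W :: "'i::finite arrangement" +
  fixes h :: "'i mpoly \<Rightarrow> 'r::ring" and e :: "'i sign_vector \<Rightarrow> 'r"
    and p :: "'i sign_vector \<Rightarrow> 'i sign_vector \<Rightarrow> 'r"
  assumes h_add: "h (q + r) = h q + h r" and h_mult: "h (q * r) = h q * h r"
    and h_linear_form: "v \<in> (dir W)\<^sup>\<bottom> \<Longrightarrow> h (linear_form v) = 0"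
    and h_e: "a \<in> F \<Longrightarrow> h q * e a = e a * h q"
    and h_p: "a \<in> F \<Longrightarrow> flip a i \<in> F \<Longrightarrow> h q * p a (flip a i) = p a (flip a i) * h q"
    and h_one: "a \<in> F \<Longrightarrow> h 1 * e a = e a"
    and e_mult: "a \<in> F \<Longrightarrow> b \<in> F \<Longrightarrow> e a * e b = (if a = b then e a else 0)"
    and e_p: "a \<in> F \<Longrightarrow> flip a i \<in> F \<Longrightarrow> e a * p a (flip a i) = p a (flip a i)"
    and p_e: "a \<in> F \<Longrightarrow> flip a i \<in> F \<Longrightarrow> p a (flip a i) * e (flip a i) = p a (flip a i)"
    and e_unbounded: "a \<in> F - bounded_feasible W \<Longrightarrow> e a = 0"
    and p_square: "a \<in> F \<Longrightarrow> flip a i \<in> F \<Longrightarrow> flip a j \<in> F \<Longrightarrow> flip (flip a i) j \<in> F \<Longrightarrow> i \<noteq> j \<Longrightarrow>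
      p a (flip a i) * p (flip a i) (flip (flip a i) j) = p a (flip a j) * p (flip a j) (flip (flip a i) j)"
    and p_back: "a \<in> F \<Longrightarrow> flip a i \<in> F \<Longrightarrow> p a (flip a i) * p (flip a i) a = h (poly_var i) * e a"
begin

fun path_value :: "'i sign_vector list \<Rightarrow> 'r" where
  "path_value [] = 0"
| "path_value [a] = e a"
| "path_value (a # b # w) = p a b * path_value (b # w)"

lemma adjE:
  assumes "a \<in> F" "b \<in> F" "adj a b" obtains i where "b = flip a i"
  using assms adj_flip feasible_sign by metis

lemma e_path_value: "w \<in> paths F adj \<Longrightarrow> e (hd w) * path_value w = path_value w"
proof (induction w rule: path_value.induct)
  case (3 a b w)
  then have *: "a \<in> F" "b \<in> F" "adj a b" by (auto simp: paths_def)
  then obtain i where "b = flip a i" by (auto elim: adjE)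
  then show ?case using e_p[of a i] * by (simp flip: mult.assoc)
qed (auto simp: paths_def e_mult)

lemma h_path_value: "w \<in> paths F adj \<Longrightarrow> h q * path_value w = path_value w * h q"
proof (induction w rule: path_value.induct)
  case (3 a b w)
  then have *: "a \<in> F" "b \<in> F" "adj a b" "b # w \<in> paths F adj" by (auto simp: paths_def)
  then obtain i where "b = flip a i" by (auto elim: adjE)
  then have "h q * p a b = p a b * h q" using h_p[of a i] * by simp
  then show ?case using 3(1)[OF *(4)] by (metis mult.assoc path_value.simps(3))
qed (auto simp: paths_def h_e)

lemma h_one_path_value: "w \<in> paths F adj \<Longrightarrow> h 1 * path_value w = path_value w"
proof -
  assume w: "w \<in> paths F adj"
  then have "hd w \<in> F" using hd_in_set[of w] by (auto simp: paths_def)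
  then have "h 1 * (e (hd w) * path_value w) = e (hd w) * path_value w"
    by (simp add: h_one flip: mult.assoc)
  then show ?thesis by (simp add: e_path_value[OF w])
qed

lemma path_value_mult:
  assumes "u \<in> paths F adj" "v \<in> paths F adj"
  shows "path_value u * path_value v = (if last u = hd v then path_value (u @ tl v) else 0)"
  using assms
proof (induction u rule: path_value.induct)
  case (2 a)
  then have *: "a \<in> F" "hd v \<in> F" "v \<noteq> []" using hd_in_set[of v] by (auto simp: paths_def)
  have "e a * path_value v = e a * e (hd v) * path_value v"
    using e_path_value[OF 2(2)] by (simp add: mult.assoc)
  also have "\<dots> = (if a = hd v then path_value v else 0)"
    using e_mult[OF *(1,2)] e_path_value[OF 2(2)] by simp
  finally show ?case using *(3) by (cases v) auto
next
  case (3 a b w)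
  then have "b # w \<in> paths F adj" by (auto simp: paths_def)
  then show ?case using 3 by (auto simp: mult.assoc)
qed (simp add: paths_def)

lemma extension:
  obtains \<Phi> where "ring_map (A_algebra W) \<Phi>"
    "\<And>w q. w \<in> paths F adj \<Longrightarrow> \<Phi> (A_class W (psingle S w (cls q))) = h q * path_value w"
proof -
  have hr: "ring_map poly_ring h" by (simp add: ring_map_def h_add h_mult)
  have sub: "linear_form ` ((dir W)\<^sup>\<bottom>) \<subseteq> carrier poly_ring" by simp
  obtain h' where h': "ring_map S h'" "\<And>q. h' (cls q) = h q"
  proof (rule quotient_lift[OF poly_ring_ring hr sub])
    show "h g = 0" if "g \<in> linear_form ` ((dir W)\<^sup>\<bottom>)" for g using that h_linear_form by auto
  qed (use that in \<open>simp_all add: sym_dual_def sym_dual_class_def sym_dual_ideal_def\<close>)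
  obtain \<Psi> where \<Psi>: "ring_map Q \<Psi>"
    "\<And>w s. w \<in> paths F adj \<Longrightarrow> s \<in> carrier S \<Longrightarrow> \<Psi> (psingle S w s) = h' s * path_value w"
  proof (rule PA.PA_lift[of h' path_value, folded Q_eq])
    show "h' s * path_value w = path_value w * h' s" if "s \<in> carrier S" "w \<in> paths F adj" for s w
      using cls_cases[OF that(1)] h_path_value[OF that(2)] h'(2) by auto
  qed (use h'(1) path_value_mult in blast)+
  have val: "\<Psi> (psingle S w (cls q)) = h q * path_value w" if "w \<in> paths F adj" for w q
    using \<Psi>(2)[OF that] h'(2) by simp
  have val1: "\<Psi> (psingle S w \<one>\<^bsub>S\<^esub>) = path_value w" if "w \<in> paths F adj" for w
    using val[OF that, of 1] h_one_path_value[OF that] by (simp add: cls_simps(3))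
  have one: "psingle S w \<one>\<^bsub>S\<^esub> \<in> carrier Q" if "w \<in> paths F adj" for w
    using psingle_Q[OF that, of "cls 1"] cls_closed[of 1] unfolding cls_simps(3) by blast
  have rel: "\<Psi> r = 0" if "r \<in> A_relations W" for r
    using that unfolding A_relations_def
  proof (elim UnE)
    assume "r \<in> {path_elem W [\<alpha>] | \<alpha>. \<alpha> \<in> F - bounded_feasible W}"
    then show ?thesis using e_unbounded by (auto simp: scaled_path_eq val1 vertex_path)
  next
    assume "r \<in> {path_elem W [\<alpha>, \<beta>, \<alpha>] \<ominus>\<^bsub>Q\<^esub> scaled_path W (cls (poly_var i)) [\<alpha>] | \<alpha> \<beta> i.
        {\<alpha>, \<beta>} \<subseteq> F \<and> adj_at i \<alpha> \<beta>}"
    then obtain a b i where r: "r = psingle S [a, b, a] \<one>\<^bsub>S\<^esub> \<ominus>\<^bsub>Q\<^esub> psingle S [a] (cls (poly_var i))"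
      "a \<in> F" "b \<in> F" "adj_at i a b" by (auto simp: scaled_path_eq)
    have b: "b = flip a i"
      using adj_at_flip[OF feasible_sign[OF r(2)] feasible_sign[OF r(3)]] r(4) by simp
    have "adj a b" using r(4) by (auto simp: adj_def)
    then have w: "[a, b, a] \<in> paths F adj" using r by (intro path3) (auto intro: adj_sym)
    have "\<Psi> r = p a b * (p b a * e a) - h (poly_var i) * e a"
      unfolding r(1) using r w by (subst ring_map_diff[OF Q_ring \<Psi>(1)])
        (auto simp: val val1 vertex_path intro!: one psingle_Q)
    also have "p b a * e a = p b a" using p_e[of b i] r b by auto
    finally show ?thesis using p_back[of a i] r b by simp
  next
    assume "r \<in> {path_elem W [\<alpha>, \<beta>, \<gamma>] \<ominus>\<^bsub>Q\<^esub> path_elem W [\<alpha>, \<delta>, \<gamma>] | \<alpha> \<beta> \<gamma> \<delta>.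
        {\<alpha>, \<beta>, \<gamma>, \<delta>} \<subseteq> F \<and> distinct [\<alpha>, \<beta>, \<gamma>, \<delta>] \<and> adj \<alpha> \<beta> \<and> adj \<beta> \<gamma> \<and> adj \<gamma> \<delta> \<and> adj \<delta> \<alpha>}"
    then obtain a b c d where r: "r = psingle S [a, b, c] \<one>\<^bsub>S\<^esub> \<ominus>\<^bsub>Q\<^esub> psingle S [a, d, c] \<one>\<^bsub>S\<^esub>"
      "a \<in> F" "b \<in> F" "c \<in> F" "d \<in> F" "distinct [a, b, c, d]"
      "adj a b" "adj b c" "adj c d" "adj d a" by (auto simp: scaled_path_eq)
    note r = this(1-8) this(9,10)[THEN adj_sym]
    obtain i where i: "b = flip a i" by (rule adjE[OF r(2,3,7)])
    obtain j where j: "c = flip b j" by (rule adjE[OF r(3,4,8)])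
    obtain k where k: "d = flip a k" by (rule adjE[OF r(2,5,10)])
    obtain l where l: "c = flip d l" by (rule adjE[OF r(5,4,9)])
    have sg: "a \<in> sign_vectors" by (rule feasible_sign[OF r(2)])
    have ij: "i \<noteq> j" using r i j by auto
    have ik: "i \<noteq> k" using r i k by auto
    have kl: "k \<noteq> l" using r k l by auto
    \<comment> \<open>Through \<open>d\<close> it is visible that the coordinate \<open>k\<close>
      differs between \<open>a\<close> and \<open>c\<close>. The path through \<open>b\<close> has
      to cross it too, and its first step does not.\<close>
    have "j = k"
    proof (rule ccontr)
      assume "j \<noteq> k"
      then have "c k = a k" using ij ik j i by (simp add: flip_apply)
      moreover have "c k = - a k" using kl l k by (simp add: flip_apply)
      ultimately show False using sign_nonzero[OF sg, of k] by simp
    qed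
    have w: "[a, b, c] \<in> paths F adj" "[a, d, c] \<in> paths F adj" using r by (auto intro!: path3)
    have "\<Psi> r = p a b * (p b c * e c) - p a d * (p d c * e c)"
      unfolding r(1) using w by (subst ring_map_diff[OF Q_ring \<Psi>(1)]) (auto simp: val1 intro!: one)
    also have "p b c * e c = p b c" using p_e[of b j] r j by auto
    also have "p d c * e c = p d c" using p_e[of d l] r l by auto
    also have "p a b * p b c = p a d * p d c"
      using p_square[of a i j] r i j k \<open>j = k\<close> ij by auto
    finally show ?thesis by simp
  qed
  obtain \<Phi> where "ring_map (A_algebra W) \<Phi>" "\<And>x. x \<in> carrier Q \<Longrightarrow> \<Phi> (A_class W x) = \<Psi> x"
    by (rule quotient_lift[OF Q_ring \<Psi>(1) A_relations_closed rel])
      (simp_all add: A_algebra_def A_class_def A_ideal_def)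
  then show ?thesis using that val by (simp add: psingle_Q)
qed

end

section \<open>Taut paths\<close>

text \<open>The monomial \<open>u_S\<close> for \<open>S = S(a b c)\<close>. The same polynomial is
  read in the \<open>t_i\<close> inside \<open>A(W)\<close> and in the \<open>u_i\<close> inside
  \<open>B\<close>.\<close>

definition crossing :: "'i sign_vector \<Rightarrow> 'i sign_vector \<Rightarrow> 'i sign_vector \<Rightarrow> 'i::finite mpoly" where
  "crossing a b c = (\<Prod>i\<in>{i. a i = c i \<and> c i \<noteq> b i}. poly_var i)"

text \<open>The polynomials with property \<open>R\<close> form an ideal; negation is multiplication
  by \<open>- 1\<close>.\<close>

lemma poly_ideal_induct [consumes 1, case_names zero gen add mult]:
  assumes q: "q \<in> Idl\<^bsub>poly_ring\<^esub> G" and "R 0" and "\<And>g. g \<in> G \<Longrightarrow> R g"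
    and add: "\<And>p q. R p \<Longrightarrow> R q \<Longrightarrow> R (p + q)" and mult: "\<And>p q. R q \<Longrightarrow> R (p * q)"
  shows "R q"
proof -
  interpret cring "poly_ring :: 'a mpoly ring" by (rule poly_ring_cring)
  have "ideal {q. R q} poly_ring"
  proof (rule idealI[OF poly_ring_ring])
    have neg: "\<ominus>\<^bsub>poly_ring\<^esub> p = - p" for p :: "'a mpoly"
      by (rule minus_equality) simp_all
    have "R (- p)" if "R p" for p using mult[OF that, of "- 1"] by simp
    then show "subgroup {q. R q} (add_monoid poly_ring)"
      using assms(2) add by (unfold_locales) (auto simp: neg[unfolded a_inv_def, simplified])
  qed (use mult in \<open>auto simp: mult.commute\<close>)
  then have "Idl\<^bsub>poly_ring\<^esub> G \<subseteq> {q. R q}" using assms(3) by (intro genideal_minimal) auto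
  then show ?thesis using q by auto
qed

lemma poly_ideal_zero: "ideal I poly_ring \<Longrightarrow> 0 \<in> I"
  using additive_subgroup.zero_closed[OF ideal.axioms(1), of I poly_ring] by simp

lemma separating_flip_in:
  assumes "a \<in> sign_vectors" "c \<in> sign_vectors" "i \<in> separating a c"
  shows "separating (flip a i) c = separating a c - {i}"
  using assms(3) sign_neq[OF assms(1,2), of i] by (auto simp: separating_def flip_apply)

text \<open>A check in each coordinate, where the four signs take two values only. This cocycle
  identity is behind both the associativity of \<open>B\<close> and the induction for
  \<open>taut_mult\<close>.\<close>

lemma crossing_cocycle:
  assumes "a \<in> sign_vectors" "b \<in> sign_vectors" "c \<in> sign_vectors" "d \<in> sign_vectors"
  shows "crossing a b c * crossing a c d = crossing a b d * crossing b c d"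
proof -
  have prod: "(\<Prod>i\<in>S. poly_var i) = (\<Prod>i\<in>UNIV. if i \<in> S then poly_var i else 1)" for S :: "'a set"
    by (simp add: prod.If_cases)
  show ?thesis
    unfolding crossing_def prod[of "{i. _ i}"] prod.distrib[symmetric]
  proof (rule prod.cong[OF refl])
    fix i
    show "(if i \<in> {i. a i = c i \<and> c i \<noteq> b i} then poly_var i else 1) *
         (if i \<in> {i. a i = d i \<and> d i \<noteq> c i} then poly_var i else 1) =
         (if i \<in> {i. a i = d i \<and> d i \<noteq> b i} then poly_var i else 1) *
         (if i \<in> {i. b i = d i \<and> d i \<noteq> c i} then poly_var i else 1)"
      using sign_cases[OF assms(1), of i] sign_cases[OF assms(2), of i]
        sign_cases[OF assms(3), of i] sign_cases[OF assms(4), of i]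
      by (elim disjE) simp_all
  qed
qed

lemma crossing_refl [simp]: "crossing a a c = 1" "crossing a c c = 1"
proof -
  have "{i. a i = c i \<and> c i \<noteq> a i} = {}" "{i. a i = c i \<and> c i \<noteq> c i} = {}" by auto
  then show "crossing a a c = 1" "crossing a c c = 1" by (simp_all add: crossing_def del: Collect_empty_eq)
qed

lemma crossing_flip:
  assumes "a \<in> sign_vectors"
  shows "crossing a (flip a i) c = (if i \<in> separating a c then 1 else poly_var i)"
proof -
  have "{k. a k = c k \<and> c k \<noteq> flip a i k} = (if i \<in> separating a c then {} else {i})"
    using sign_nonzero[OF assms, of i] by (auto simp: flip_apply separating_def)
  then show ?thesis by (simp add: crossing_def)
qed

context arrangement
begin

text \<open>The counter is the number of coordinates still to be flipped. The first step is an
  arbitrary choice, shown to be immaterial in \<open>taut_step\<close>.\<close>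

primrec taut_steps :: "nat \<Rightarrow> 'i sign_vector \<Rightarrow> 'i sign_vector \<Rightarrow> ('i sign_vector list \<Rightarrow> 'i mpoly set) set rprod" where
  "taut_steps 0 a c = Aid a"
| "taut_steps (Suc n) a c = (let b = flip a (SOME i. i \<in> separating a c \<and> flip a i \<in> F)
     in AP a b * taut_steps n b c)"

definition "taut a c = taut_steps (card (separating a c)) a c"

lemma taut_refl [simp]: "taut a a = Aid a"
  by (simp add: taut_def separating_def)

lemma card_separating_flip:
  assumes "a \<in> F" "c \<in> F" "i \<in> separating a c"
  shows "card (separating a c) = Suc (card (separating (flip a i) c))"
  using separating_flip_in[OF feasible_sign[OF assms(1)] feasible_sign[OF assms(2)] assms(3)]
  by (simp add: card.remove[OF _ assms(3)])

text \<open>For linked first steps \<open>k\<close> and \<open>l\<close> the induction hypothesis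
  lets either product continue with the other coordinate, and \<open>AP_square\<close> identifies
  the two beginnings. A chain of links then leads from the chosen first step to
  \<open>i\<close>.\<close>

lemma taut_step:
  assumes "a \<in> F" "c \<in> F" "i \<in> separating a c" "flip a i \<in> F"
  shows "taut a c = AP a (flip a i) * taut (flip a i) c"
  using assms
proof (induction "card (separating a c)" arbitrary: a i rule: less_induct)
  case less
  let ?G = "\<lambda>k. AP a (flip a k) * taut (flip a k) c"
  define i0 where "i0 = (SOME i. i \<in> separating a c \<and> flip a i \<in> F)"
  have i0: "i0 \<in> separating a c" "flip a i0 \<in> F"
    using someI[of "\<lambda>i. i \<in> separating a c \<and> flip a i \<in> F" i] less.prems by (auto simp: i0_def)
  have eq: "taut a c = ?G i0"
    using card_separating_flip[OF less.prems(1,2) i0(1)] by (simp add: taut_def i0_def Let_def)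
  let ?link = "\<lambda>k l. k \<in> separating a c \<and> l \<in> separating a c \<and> (\<exists>w\<in>\<Delta> a. w $ k = 0 \<and> w $ l = 0)"
  have G: "?G k = ?G l" if link: "?link k l" for k l
  proof (cases "k = l")
    case False
    obtain w where w: "w \<in> \<Delta> a" "w $ k = 0" "w $ l = 0" using link by blast
    have fl: "flip a k \<in> F" "flip a l \<in> F" using feasible_flipI[OF less.prems(1) w(1)] w by auto
    \<comment> \<open>The point \<open>w\<close> lies in all four chambers around the face, so that
      all corners of the square are feasible.\<close>
    have fkl: "flip (flip a k) l \<in> F" "flip (flip a l) k \<in> F"
      using feasible_flipI[OF fl(1) chamber_flip[OF w(1,2)] w(3)]
        feasible_flipI[OF fl(2) chamber_flip[OF w(1,3)] w(2)] by auto
    have sep: "l \<in> separating (flip a k) c" "k \<in> separating (flip a l) c"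
      using link False by (auto simp: separating_def flip_apply)
    have lt: "card (separating (flip a k) c) < card (separating a c)"
      "card (separating (flip a l) c) < card (separating a c)"
      using card_separating_flip[OF less.prems(1,2), of k] card_separating_flip[OF less.prems(1,2), of l] link
      by auto
    have "?G k = AP a (flip a k) * AP (flip a k) (flip (flip a k) l) * taut (flip (flip a k) l) c"
      using less.hyps[OF lt(1) fl(1) less.prems(2) sep(1) fkl(1)] by (simp add: mult.assoc)
    also have "\<dots> = AP a (flip a l) * AP (flip a l) (flip (flip a l) k) * taut (flip (flip a l) k) c"
      using AP_square[OF less.prems(1) fl fkl(1) False] by (simp add: flip_commute)
    also have "\<dots> = ?G l"
      using less.hyps[OF lt(2) fl(2) less.prems(2) sep(2) fkl(2)] by (simp add: mult.assoc)
    finally show ?thesis .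
  qed simp
  have "?link\<^sup>*\<^sup>* i0 i"
    by (rule flips_towards_connected[OF less.prems(1,2) i0 less.prems(3,4)])
  then have "?G i0 = ?G i"
  proof (induction rule: rtranclp_induct)
    case (step k l)
    then show ?case using G[OF step(2)] by simp
  qed simp
  then show ?case using eq by simp
qed

lemma taut_adj: "a \<in> F \<Longrightarrow> flip a i \<in> F \<Longrightarrow> taut a (flip a i) = AP a (flip a i)"
  using taut_step[of a "flip a i" i] separating_flip[OF feasible_sign, of a W i] by (simp add: Aid_AP)

text \<open>A step towards \<open>c\<close> begins a shortest path. A step away can be undone by the
  first step of the path from \<open>flip a i\<close>, and going back and forth is multiplication by
  \<open>t_i\<close>.\<close>

lemma AP_taut:
  assumes "a \<in> F" "flip a i \<in> F" "c \<in> F"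
  shows "AP a (flip a i) * taut (flip a i) c = AH (crossing a (flip a i) c) * taut a c"
proof (cases "i \<in> separating a c")
  case True
  then show ?thesis using taut_step[OF assms(1,3) True assms(2)] AH_unit(2)
    by (simp add: crossing_flip[OF feasible_sign[OF assms(1)]] flip: mult.assoc)
next
  case False
  have "a i \<noteq> 0" using sign_nonzero[OF feasible_sign[OF assms(1)]] by blast
  then have "i \<in> separating (flip a i) c" using False by (auto simp: separating_def flip_apply)
  then have "taut (flip a i) c = AP (flip a i) a * taut a c"
    using taut_step[OF assms(2,3), of i] assms(1) by simp
  then have "AP a (flip a i) * taut (flip a i) c = AH (poly_var i) * (Aid a * taut a c)"
    using AP_back[OF assms(1,2)] by (simp flip: mult.assoc)
  moreover have "Aid a * taut a c = taut a c"
  proof (cases "a = c")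
    case False
    then obtain k where "k \<in> separating a c" "flip a k \<in> F"
      by (rule exists_flip_towards[OF assms(1,3)])
    then show ?thesis using taut_step[OF assms(1,3)] Aid_AP(1)[of a a]
      by (simp flip: mult.assoc)
  qed (simp add: Aid_mult)
  ultimately show ?thesis using False by (simp add: crossing_flip[OF feasible_sign[OF assms(1)]])
qed

lemma AH_AP_left: "AP a b * (AH q * x) = AH q * (AP a b * x)"
  by (simp only: mult.assoc[symmetric] AH_comm(2))

lemma Aid_taut:
  assumes "a \<in> F" "c \<in> F"
  shows "Aid a * taut a c = taut a c"
proof (cases "a = c")
  case False
  then obtain k where "k \<in> separating a c" "flip a k \<in> F"
    by (rule exists_flip_towards[OF assms])
  then show ?thesis using taut_step[OF assms] Aid_AP(1)[of a a]
    by (simp flip: mult.assoc)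
qed (simp add: Aid_mult)

lemma AH_one_taut:
  assumes "a \<in> F" "c \<in> F" shows "AH 1 * taut a c = taut a c"
proof -
  have "AH 1 * (Aid a * taut a c) = Aid a * taut a c"
    by (simp only: mult.assoc[symmetric] AH_unit(1))
  then show ?thesis by (simp only: Aid_taut[OF assms])
qed

text \<open>Induction on the distance of \<open>a\<close> and \<open>b\<close>: strip the first
  step, and rearrange the monomials by the cocycle identity for \<open>a\<close>,
  \<open>flip a i\<close>, \<open>b\<close>, \<open>c\<close>.\<close>

lemma taut_mult:
  assumes "a \<in> F" "b \<in> F" "c \<in> F"
  shows "taut a b * taut b c = AH (crossing a b c) * taut a c"
  using assms
proof (induction "card (separating a b)" arbitrary: a)
  case 0
  then have "a = b" by (auto simp: separating_def)
  then show ?case using Aid_taut AH_one_taut 0 by simp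
next
  case (Suc n)
  then have "a \<noteq> b" by (auto simp: separating_def)
  then obtain i where i: "i \<in> separating a b" "flip a i \<in> F"
    by (rule exists_flip_towards[OF Suc.prems(1,2)])
  let ?a = "flip a i"
  note sg = feasible_sign[OF Suc.prems(1)] feasible_sign[OF i(2)] feasible_sign[OF Suc.prems(2)] feasible_sign[OF Suc.prems(3)]
  have IH: "taut ?a b * taut b c = AH (crossing ?a b c) * taut ?a c"
    using card_separating_flip[OF Suc.prems(1,2) i(1)] Suc.hyps(2) i(2) Suc.prems
    by (intro Suc.hyps(1)) auto
  have "taut a b * taut b c = AP a ?a * (taut ?a b * taut b c)"
    using taut_step[OF Suc.prems(1,2) i] by (simp add: mult.assoc)
  also have "\<dots> = AH (crossing ?a b c) * (AP a ?a * taut ?a c)"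
    unfolding IH by (rule AH_AP_left)
  also have "\<dots> = AH (crossing ?a b c * crossing a ?a c) * taut a c"
    unfolding AP_taut[OF Suc.prems(1) i(2) Suc.prems(3)] AH_mult by (simp add: mult.assoc)
  also have "crossing ?a b c * crossing a ?a c = crossing a ?a b * crossing a b c"
    using crossing_cocycle[of a ?a b c] sg by (simp add: mult.commute)
  also have "crossing a ?a b = 1" using i(1) by (simp add: crossing_flip[OF sg(1)])
  finally show ?case by simp
qed

lemma taut_unbounded:
  assumes ac: "a \<in> F" "c \<in> F" and "a \<notin> P \<or> c \<notin> P"
  shows "taut a c = 0"
  using assms(3)
proof
  assume "a \<notin> P"
  then have "Aid a * taut a c = 0" by (simp add: Aid_unbounded)
  then show ?thesis by (simp only: Aid_taut[OF ac])
next
  assume "c \<notin> P"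
  then have "taut a c * taut c c = 0" by (simp add: Aid_unbounded)
  then show ?thesis by (simp only: taut_mult[OF ac ac(2)] crossing_refl AH_one_taut[OF ac])
qed

lemma apath_taut:
  assumes "w \<in> paths F adj"
  shows "\<exists>q. apath w = AH q * taut (hd w) (last w)"
  using assms
proof (induction w rule: induct_list012)
  case (2 a)
  then have "a \<in> F" by (auto simp: paths_def)
  then have "apath [a] = AH 1 * taut a a" 
    by (simp only: taut_refl AH_unit) (simp add: Aid_def)
  then show ?case by auto
next
  case (3 a b w)
  have *: "a \<in> F" "b \<in> F" "adj a b" "b # w \<in> paths F adj" "last (b # w) \<in> F"
    using 3(3) last_in_set[of "b # w"] by (auto simp: paths_def split: if_splits)
  obtain i where i: "b = flip a i"
    using *(3) adj_flip[OF feasible_sign[OF *(1)] feasible_sign[OF *(2)]] by blast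
  obtain q where q: "apath (b # w) = AH q * taut b (last (b # w))"
    using 3(2)[OF *(4)] by auto
  have "apath (a # b # w) = AP a b * apath (b # w)" by (rule apath_Cons[OF 3(3)])
  also have "\<dots> = AH (q * crossing a b (last (b # w))) * taut a (last (b # w))"
    unfolding q AH_AP_left using AP_taut[OF *(1) *(2)[unfolded i] *(5)] by (simp only: i AH_mult mult.assoc)
  finally show ?case by (metis last_ConsR list.distinct(1) list.sel(1))
qed (simp add: paths_def)

lemma P_subset: "P \<subseteq> F" by (simp add: bounded_feasible_eq)

lemma finite_P: "finite P" using finite_subset[OF P_subset finite_feasible] .

text \<open>Not a normal form: each polynomial \<open>q a c\<close> matters only modulo
  \<open>ideal2\<close> of the Gale dual.\<close>

lemma emb_A_taut:
  assumes "x \<in> carrier (A_algebra W)"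
  shows "\<exists>q. emb (A_algebra W) x = (\<Sum>a\<in>P. \<Sum>c\<in>P. AH (q a c) * taut a c)"
  using assms
proof (induction rule: emb_A_induct)
  case zero
  then show ?case by (intro exI[of _ "\<lambda>a c. 0"]) (simp add: AH_zero)
next
  case (single w q)
  let ?a = "hd w" and ?c = "last w"
  have ac: "?a \<in> F" "?c \<in> F" using single(1) hd_in_set[of w] last_in_set[of w] by (auto simp: paths_def)
  obtain r where r: "apath w = AH r * taut ?a ?c" using apath_taut[OF single(1)] by blast
  let ?q = "\<lambda>a c. if a = ?a \<and> c = ?c then q * r else 0"
  have "(\<Sum>a\<in>P. \<Sum>c\<in>P. AH (?q a c) * taut a c) =
    (\<Sum>a\<in>P. if a = ?a then \<Sum>c\<in>P. if c = ?c then AH (q * r) * taut ?a ?c else 0 else 0)"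
    by (intro sum.cong refl) (auto simp: AH_zero intro!: sum.cong)
  also have "\<dots> = AH (q * r) * taut ?a ?c"
    using taut_unbounded[OF ac] finite_P by (auto simp: sum.delta')
  also have "\<dots> = AH q * apath w" by (simp add: r AH_mult mult.assoc)
  finally show ?case by (intro exI[of _ ?q]) simp
next
  case (add y z)
  then obtain p q where "y = (\<Sum>a\<in>P. \<Sum>c\<in>P. AH (p a c) * taut a c)" "z = (\<Sum>a\<in>P. \<Sum>c\<in>P. AH (q a c) * taut a c)"
    by auto
  then have "y + z = (\<Sum>a\<in>P. \<Sum>c\<in>P. AH (p a c + q a c) * taut a c)"
    by (simp add: AH_add sum.distrib distrib_right)
  then show ?case by (intro exI[of _ "\<lambda>a c. p a c + q a c"]) simp
qed

lemma dual_dual: "gale_dual U = W"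
  by (rule gale_dual_gale_dual[OF data])

lemma bounded_feasible_dual: "bounded_feasible U = P"
  using arrangement.bounded_feasible_eq[OF dual_arrangement] bounded_feasible_eq dual_dual by auto

text \<open>An empty face yields a vertex \<open>b\<close> in \<open>F - P\<close> whose monomial
  \<open>crossing a b c\<close> divides the generator, while the product of \<open>taut\<close>
  through \<open>b\<close> is zero. The linear generators vanish already in
  \<open>Sym V\<^sup>*\<close>.\<close>

lemma taut_ideal2:
  assumes a: "a \<in> F" and c: "c \<in> F" and q: "q \<in> ideal2 U a c"
  shows "AH q * taut a c = 0"
  using q unfolding ideal2_def face_ideal_def
proof (induction q rule: poly_ideal_induct)
  case (gen g)
  then consider (face) T where "g = (\<Prod>i\<in>T. poly_var i)" "hyp U T \<inter> (chamber U a \<inter> chamber U c) = {}"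
    | (linear) v where "v \<in> (dir W)\<^sup>\<bottom>" "g = linear_form v" using dir_dual(1) by auto
  then show ?case
  proof cases
    case face
    \<comment> \<open>The certificate is taken for the Gale dual, whose own Gale dual is
      \<open>W\<close>; so the vertex \<open>b\<close> that it produces is feasible for
      \<open>W\<close>.\<close>
    have "a \<in> feasible (gale_dual U)" using a dual_dual by simp
    then obtain b where b: "b \<in> feasible (gale_dual U)" "chamber U b = {}" "{i. a i = c i \<and> c i \<noteq> b i} \<subseteq> T"
      using arrangement.empty_face_certificate[OF dual_arrangement _ feasible_sign[OF c] face(2)] by metis
    have bF: "b \<in> F" using b(1) dual_dual by simp
    have "b \<notin> P" using b(2) by (simp add: bounded_feasible_eq feasible_def)
    then have "AH (crossing a b c) * taut a c = 0"
      using taut_mult[OF a bF c] taut_unbounded[OF bF c] by simp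
    moreover have "g = (\<Prod>i\<in>T - {i. a i = c i \<and> c i \<noteq> b i}. poly_var i) * crossing a b c"
      unfolding face(1) crossing_def by (rule prod.subset_diff[OF b(3)]) simp
    ultimately show ?thesis by (simp add: AH_mult mult.assoc)
  next
    case linear
    then show ?thesis by (simp add: AH_linear_form)
  qed
qed (simp_all add: AH_zero AH_add AH_mult distrib_right mult.assoc)

end

section \<open>The ring \<open>B(W)\<close>\<close>

context arrangement
begin

lemma face_ideal_ideal: "ideal (face_ideal W D) poly_ring"
  unfolding face_ideal_def by (rule ring.genideal_ideal[OF poly_ring_ring]) simp

lemma face_ideal_subset: "hyp W T \<inter> D = {} \<Longrightarrow> (\<Prod>i\<in>T. poly_var i) \<in> face_ideal W D"
  unfolding face_ideal_def
  using ring.genideal_self[OF poly_ring_ring, of "{\<Prod>i\<in>T. poly_var i | T. hyp W T \<inter> D = {}} \<union> linear_form ` dir W"]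
  by auto

lemma face_ideal_linear: "v \<in> dir W \<Longrightarrow> linear_form v \<in> face_ideal W D"
  unfolding face_ideal_def
  using ring.genideal_self[OF poly_ring_ring, of "{\<Prod>i\<in>T. poly_var i | T. hyp W T \<inter> D = {}} \<union> linear_form ` dir W"]
  by auto

lemma face_ideal_closed:
  "0 \<in> face_ideal W D" "p \<in> face_ideal W D \<Longrightarrow> q \<in> face_ideal W D \<Longrightarrow> p + q \<in> face_ideal W D"
  "p \<in> face_ideal W D \<Longrightarrow> q * p \<in> face_ideal W D" "p \<in> face_ideal W D \<Longrightarrow> - p \<in> face_ideal W D"
proof -
  interpret ideal "face_ideal W D" poly_ring by (rule face_ideal_ideal)
  show "0 \<in> face_ideal W D" by (rule poly_ideal_zero[OF face_ideal_ideal])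
  show "p \<in> face_ideal W D \<Longrightarrow> q \<in> face_ideal W D \<Longrightarrow> p + q \<in> face_ideal W D" 
    using additive_subgroup.a_closed[OF ideal.axioms(1)[OF face_ideal_ideal], of p D q] by simp
  show *: "p \<in> face_ideal W D \<Longrightarrow> q * p \<in> face_ideal W D" for p q using I_l_closed[of p q] by simp
  show "p \<in> face_ideal W D \<Longrightarrow> - p \<in> face_ideal W D" using *[of p "- 1"] by simp
qed

text \<open>For \<open>T = S(a b c)\<close> the set \<open>H\<^sub>T\<close> meets \<open>\<Delta> a \<inter> \<Delta> c\<close> inside \<open>\<Delta> b\<close>.\<close>

lemma crossing_ideal3:
  assumes sg: "a \<in> sign_vectors" "b \<in> sign_vectors" "c \<in> sign_vectors"
    and q: "q \<in> ideal3 W a b c"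
  shows "crossing a b c * q \<in> ideal2 W a c"
  using q unfolding ideal3_def ideal2_def face_ideal_def[of W "\<Delta> a \<inter> \<Delta> b \<inter> \<Delta> c"]
proof (induction q rule: poly_ideal_induct)
  case (gen g)
  let ?I = "{i. a i = c i \<and> c i \<noteq> b i}"
  consider (face) T where "g = (\<Prod>i\<in>T. poly_var i)" "hyp W T \<inter> (\<Delta> a \<inter> \<Delta> b \<inter> \<Delta> c) = {}"
    | (linear) v where "v \<in> dir W" "g = linear_form v" using gen by auto
  then show ?case
  proof cases
    case face
    have "x \<in> \<Delta> b" if "x \<in> hyp W (?I \<union> T)" "x \<in> \<Delta> a" "x \<in> \<Delta> c" for x
    proof (rule chamber_agree[OF that(2)])
      fix k assume "b k \<noteq> a k"
      show "x $ k = 0"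
      proof (cases "a k = c k")
        case True
        then show ?thesis using that(1) \<open>b k \<noteq> a k\<close> by (auto simp: hyp_def)
      next
        case False
        then have "c k = - a k" using sign_neq[OF sg(1,3)] by blast
        then have "a k * x $ k = 0" using chamberD(2)[OF that(2), of k] chamberD(2)[OF that(3), of k] by simp
        then show ?thesis using sign_nonzero[OF sg(1), of k] by simp
      qed
    qed
    then have "hyp W (?I \<union> T) \<inter> (\<Delta> a \<inter> \<Delta> c) = {}"
      using face(2) by (auto simp: hyp_def)
    then have "(\<Prod>i\<in>?I \<union> T. poly_var i) \<in> face_ideal W (\<Delta> a \<inter> \<Delta> c)" by (rule face_ideal_subset)
    moreover have "(\<Prod>i\<in>?I. poly_var i) * (\<Prod>i\<in>T. poly_var i) =
      (\<Prod>i\<in>?I \<inter> T. poly_var i) * ((\<Prod>i\<in>?I \<union> T. poly_var i) :: 'i mpoly)"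
      using prod.union_inter[of ?I T "poly_var :: 'i \<Rightarrow> 'i mpoly"] by (simp add: mult.commute)
    ultimately show ?thesis
      unfolding crossing_def face(1) by (simp only: face_ideal_closed(3))
  next
    case linear
    then show ?thesis using face_ideal_closed(3)[OF face_ideal_linear[OF linear(1)]] by simp
  qed
next
  case (mult p q)
  have "p * (crossing a b c * q) \<in> face_ideal W (\<Delta> a \<inter> \<Delta> c)" by (rule face_ideal_closed(3)[OF mult])
  then show ?case by (simp only: mult.left_commute)
qed (simp_all add: face_ideal_closed distrib_left)

text \<open>A smaller set meets fewer of the \<open>H_T\<close>, so that more monomials are
  generators.\<close>

lemma face_ideal_mono: "D \<subseteq> D' \<Longrightarrow> face_ideal W D' \<subseteq> face_ideal W D"
proof
  fix q assume "D \<subseteq> D'" and "q \<in> face_ideal W D'"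
  from this(2) show "q \<in> face_ideal W D"
    unfolding face_ideal_def[of W D']
  proof (induction q rule: poly_ideal_induct)
    case (gen g)
    then show ?case using face_ideal_subset face_ideal_linear \<open>D \<subseteq> D'\<close> by blast
  qed (auto intro: face_ideal_closed)
qed

text \<open>The sum of sets in \<open>induced_mult\<close> collapses to one coset, because
  \<open>u\<close> maps \<open>I\<close> into \<open>J\<close> and \<open>I\<close> contains
  0.\<close>

lemma induced_mult_coset:
  assumes I: "ideal I poly_ring" and J: "ideal J poly_ring" and sub: "\<And>p. p \<in> I \<Longrightarrow> u * p \<in> J"
  shows "induced_mult J u (I +>\<^bsub>poly_ring\<^esub> q) = J +>\<^bsub>poly_ring\<^esub> (u * q)"
proof -
  interpret I: ideal I poly_ring by (rule I)
  interpret J: ideal J poly_ring by (rule J)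
  have z: "0 \<in> I" by (rule poly_ideal_zero[OF I])
  have *: "(\<exists>h\<in>J. \<exists>p\<in>I. x = h + u * (p + q)) \<longleftrightarrow> (\<exists>h\<in>J. x = h + u * q)" for x
  proof
    assume "\<exists>h\<in>J. \<exists>p\<in>I. x = h + u * (p + q)"
    then obtain h p where "h \<in> J" "p \<in> I" "x = (h + u * p) + u * q" by (auto simp: algebra_simps)
    moreover have "h + u * p \<in> J" 
      using additive_subgroup.a_closed[OF ideal.axioms(1)[OF J], of h "u * p"] sub[OF \<open>p \<in> I\<close>] \<open>h \<in> J\<close> by simp
    ultimately show "\<exists>h\<in>J. x = h + u * q" by blast
  next
    assume "\<exists>h\<in>J. x = h + u * q"
    then show "\<exists>h\<in>J. \<exists>p\<in>I. x = h + u * (p + q)" using z by (metis add_0)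
  qed
  have "induced_mult J u (I +>\<^bsub>poly_ring\<^esub> q) = {x. \<exists>h\<in>J. \<exists>p\<in>I. x = h + u * (p + q)}"
    by (auto simp: induced_mult_def a_r_coset_def' set_add_def')
  moreover have "J +>\<^bsub>poly_ring\<^esub> (u * q) = {x. \<exists>h\<in>J. x = h + u * q}"
    by (auto simp: a_r_coset_def')
  ultimately show ?thesis by (simp only: *)
qed

text \<open>Elements of \<open>B(W)\<close> are represented by matrices of polynomials; this is
  matrix multiplication twisted by the cocycle \<open>crossing\<close>.\<close>

definition "tmul f g = (\<lambda>(a, c). \<Sum>b\<in>P. crossing a b c * (f (a, b) * g (b, c)))"

definition "Bcls f = (\<lambda>(a, c)\<in>P \<times> P. ideal2 W a c +>\<^bsub>poly_ring\<^esub> f (a, c))"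

lemma ideal2_ideal: "ideal (ideal2 W a c) poly_ring" "ideal (ideal3 W a b c) poly_ring"
  by (simp_all add: ideal2_def ideal3_def face_ideal_ideal)

lemma coset_simps:
  assumes "ideal I poly_ring"
  shows "(I +>\<^bsub>poly_ring\<^esub> p) \<oplus>\<^bsub>poly_ring Quot I\<^esub> (I +>\<^bsub>poly_ring\<^esub> q) = I +>\<^bsub>poly_ring\<^esub> (p + q)"
    "(I +>\<^bsub>poly_ring\<^esub> p) \<otimes>\<^bsub>poly_ring Quot I\<^esub> (I +>\<^bsub>poly_ring\<^esub> q) = I +>\<^bsub>poly_ring\<^esub> (p * q)"
    "\<one>\<^bsub>poly_ring Quot I\<^esub> = I +>\<^bsub>poly_ring\<^esub> 1" "\<zero>\<^bsub>poly_ring Quot I\<^esub> = I +>\<^bsub>poly_ring\<^esub> 0"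
proof -
  interpret ideal I poly_ring by fact
  show "(I +>\<^bsub>poly_ring\<^esub> p) \<oplus>\<^bsub>poly_ring Quot I\<^esub> (I +>\<^bsub>poly_ring\<^esub> q) = I +>\<^bsub>poly_ring\<^esub> (p + q)"
    using a_rcos_sum[of p q] by (simp add: FactRing_def)
  show "(I +>\<^bsub>poly_ring\<^esub> p) \<otimes>\<^bsub>poly_ring Quot I\<^esub> (I +>\<^bsub>poly_ring\<^esub> q) = I +>\<^bsub>poly_ring\<^esub> (p * q)"
    using rcoset_mult_add[of p q] by (simp add: FactRing_def)
  show "\<one>\<^bsub>poly_ring Quot I\<^esub> = I +>\<^bsub>poly_ring\<^esub> 1" by (simp add: FactRing_def)
  show "\<zero>\<^bsub>poly_ring Quot I\<^esub> = I +>\<^bsub>poly_ring\<^esub> 0"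
    using coset_eq_zero_iff[OF assms, of 0] poly_ideal_zero[OF assms] by simp
qed

lemma coset_finsum:
  assumes I: "ideal I poly_ring" and "finite A"
  shows "(\<Oplus>\<^bsub>poly_ring Quot I\<^esub>x\<in>A. I +>\<^bsub>poly_ring\<^esub> f x) = I +>\<^bsub>poly_ring\<^esub> (\<Sum>x\<in>A. f x)"
proof -
  interpret R: ring "poly_ring Quot I" by (rule ideal.quotient_is_ring[OF I])
  have c: "I +>\<^bsub>poly_ring\<^esub> p \<in> carrier (poly_ring Quot I)" for p by (simp add: carrier_Quot)
  show ?thesis using assms(2)
  proof (induction A)
    case (insert x A)
    have "(\<Oplus>\<^bsub>poly_ring Quot I\<^esub>x\<in>insert x A. I +>\<^bsub>poly_ring\<^esub> f x) =
      (I +>\<^bsub>poly_ring\<^esub> f x) \<oplus>\<^bsub>poly_ring Quot I\<^esub> (\<Oplus>\<^bsub>poly_ring Quot I\<^esub>x\<in>A. I +>\<^bsub>poly_ring\<^esub> f x)"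
      using insert.hyps c by (intro R.finsum_insert) auto
    then show ?case using insert by (simp add: coset_simps(1)[OF I])
  qed (simp add: coset_simps(4)[OF I])
qed

text \<open>On representatives the induced maps multiply by 1, by 1 and by
  \<open>crossing a b c\<close>; the last one is well defined by
  \<open>crossing_ideal3\<close>.\<close>

lemma B_local_mult_coset:
  assumes "a \<in> sign_vectors" "b \<in> sign_vectors" "c \<in> sign_vectors"
  shows "B_local_mult W a b c (ideal2 W a b +>\<^bsub>poly_ring\<^esub> p) (ideal2 W b c +>\<^bsub>poly_ring\<^esub> q)
    = ideal2 W a c +>\<^bsub>poly_ring\<^esub> (crossing a b c * (p * q))"
proof -
  have "ideal2 W a b \<subseteq> ideal3 W a b c" "ideal2 W b c \<subseteq> ideal3 W a b c"
    unfolding ideal2_def ideal3_def by (rule face_ideal_mono, blast)+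
  then have 1: "induced_mult (ideal3 W a b c) 1 (ideal2 W a b +>\<^bsub>poly_ring\<^esub> p) = ideal3 W a b c +>\<^bsub>poly_ring\<^esub> p"
    "induced_mult (ideal3 W a b c) 1 (ideal2 W b c +>\<^bsub>poly_ring\<^esub> q) = ideal3 W a b c +>\<^bsub>poly_ring\<^esub> q"
    using induced_mult_coset[OF ideal2_ideal(1)[of a b] ideal2_ideal(2)[of a b c], of 1 p]
      induced_mult_coset[OF ideal2_ideal(1)[of b c] ideal2_ideal(2)[of a b c], of 1 q] by auto
  have 2: "(ideal3 W a b c +>\<^bsub>poly_ring\<^esub> p) \<otimes>\<^bsub>ring3 W a b c\<^esub> (ideal3 W a b c +>\<^bsub>poly_ring\<^esub> q)
    = ideal3 W a b c +>\<^bsub>poly_ring\<^esub> (p * q)"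
    using coset_simps(2)[OF ideal2_ideal(2)[of a b c]] by (simp add: ring3_def face_ring_def ideal3_def)
  show ?thesis
    unfolding B_local_mult_def 1 2 crossing_def[symmetric]
    by (rule induced_mult_coset[OF ideal2_ideal(2,1)]) (rule crossing_ideal3[OF assms])
qed

lemma P_sign: "a \<in> P \<Longrightarrow> a \<in> sign_vectors"
  using P_subset feasible_sign by blast

lemma ring2_eq: "ring2 W a c = poly_ring Quot ideal2 W a c"
  by (simp add: ring2_def face_ring_def ideal2_def)

lemma B_simps:
  "Bcls f \<oplus>\<^bsub>B_algebra W\<^esub> Bcls g = Bcls (\<lambda>x. f x + g x)"
  "Bcls f \<otimes>\<^bsub>B_algebra W\<^esub> Bcls g = Bcls (tmul f g)"
  "\<one>\<^bsub>B_algebra W\<^esub> = Bcls (\<lambda>(a, c). if a = c then 1 else 0)"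
  "\<zero>\<^bsub>B_algebra W\<^esub> = Bcls (\<lambda>_. 0)"
proof -
  show "Bcls f \<oplus>\<^bsub>B_algebra W\<^esub> Bcls g = Bcls (\<lambda>x. f x + g x)"
    by (auto simp: B_algebra_def Let_def Bcls_def ring2_eq coset_simps[OF ideal2_ideal(1)] fun_eq_iff)
  show "\<one>\<^bsub>B_algebra W\<^esub> = Bcls (\<lambda>(a, c). if a = c then 1 else 0)"
    by (auto simp: B_algebra_def Let_def Bcls_def ring2_eq coset_simps[OF ideal2_ideal(1)] fun_eq_iff)
  show "\<zero>\<^bsub>B_algebra W\<^esub> = Bcls (\<lambda>_. 0)"
    by (auto simp: B_algebra_def Let_def Bcls_def ring2_eq coset_simps[OF ideal2_ideal(1)] fun_eq_iff)
  have *: "(\<Oplus>\<^bsub>ring2 W a c\<^esub>b\<in>P. B_local_mult W a b c (Bcls f (a, b)) (Bcls g (b, c))) =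
    ideal2 W a c +>\<^bsub>poly_ring\<^esub> tmul f g (a, c)" if "a \<in> P" "c \<in> P" for a c
  proof -
    interpret R: ring "poly_ring Quot ideal2 W a c" by (rule ideal.quotient_is_ring[OF ideal2_ideal(1)])
    have "(\<Oplus>\<^bsub>poly_ring Quot ideal2 W a c\<^esub>b\<in>P. B_local_mult W a b c (Bcls f (a, b)) (Bcls g (b, c))) =
      (\<Oplus>\<^bsub>poly_ring Quot ideal2 W a c\<^esub>b\<in>P. ideal2 W a c +>\<^bsub>poly_ring\<^esub> (crossing a b c * (f (a, b) * g (b, c))))"
      using that by (intro R.finsum_cong') (auto simp: Bcls_def B_local_mult_coset P_sign carrier_Quot)
    then show ?thesis by (simp add: ring2_eq coset_finsum[OF ideal2_ideal(1) finite_P] tmul_def)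
  qed
  have "Bcls f \<otimes>\<^bsub>B_algebra W\<^esub> Bcls g = (\<lambda>(a, c)\<in>P \<times> P.
      \<Oplus>\<^bsub>ring2 W a c\<^esub>b\<in>P. B_local_mult W a b c (Bcls f (a, b)) (Bcls g (b, c)))"
    by (simp add: B_algebra_def Let_def)
  also have "\<dots> = Bcls (tmul f g)"
    unfolding Bcls_def[of "tmul f g"] by (rule restrict_ext) (auto simp: *)
  finally show "Bcls f \<otimes>\<^bsub>B_algebra W\<^esub> Bcls g = Bcls (tmul f g)" .
qed

lemma B_carrier: "carrier (B_algebra W) = range Bcls"
proof (intro equalityI subsetI)
  fix x assume x: "x \<in> carrier (B_algebra W)"
  then have "\<forall>y\<in>P \<times> P. \<exists>q. x y = ideal2 W (fst y) (snd y) +>\<^bsub>poly_ring\<^esub> q"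
    by (auto simp: B_algebra_def Let_def ring2_eq carrier_Quot PiE_def Pi_def split: prod.splits)
      (meson rangeE)
  then obtain f where f: "\<And>y. y \<in> P \<times> P \<Longrightarrow> x y = ideal2 W (fst y) (snd y) +>\<^bsub>poly_ring\<^esub> f y" by metis
  have "x \<in> extensional (P \<times> P)" using x by (auto simp: B_algebra_def Let_def PiE_def)
  then have "x = Bcls f" using f by (auto simp: Bcls_def fun_eq_iff extensional_def)
  then show "x \<in> range Bcls" by blast
qed (auto simp: B_algebra_def Let_def Bcls_def ring2_eq carrier_Quot split: if_splits)

lemma Bcls_cong: "(\<And>a c. a \<in> P \<Longrightarrow> c \<in> P \<Longrightarrow> f (a, c) = g (a, c)) \<Longrightarrow> Bcls f = Bcls g"
  by (auto simp: Bcls_def fun_eq_iff)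

lemma tmul_assoc:
  assumes "a \<in> P" "d \<in> P"
  shows "tmul (tmul f g) h (a, d) = tmul f (tmul g h) (a, d)"
proof -
  have "tmul (tmul f g) h (a, d) =
    (\<Sum>c\<in>P. \<Sum>b\<in>P. (crossing a b c * crossing a c d) * (f (a, b) * (g (b, c) * h (c, d))))"
    by (simp add: tmul_def sum_distrib_left sum_distrib_right algebra_simps)
  also have "\<dots> = (\<Sum>c\<in>P. \<Sum>b\<in>P. (crossing a b d * crossing b c d) * (f (a, b) * (g (b, c) * h (c, d))))"
  proof (intro sum.cong refl)
    fix c b assume "c \<in> P" "b \<in> P"
    then show "(crossing a b c * crossing a c d) * (f (a, b) * (g (b, c) * h (c, d)))
      = (crossing a b d * crossing b c d) * (f (a, b) * (g (b, c) * h (c, d)))"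
      using crossing_cocycle[of a b c d] assms by (simp only: P_sign)
  qed
  also have "\<dots> = (\<Sum>b\<in>P. \<Sum>c\<in>P. (crossing a b d * crossing b c d) * (f (a, b) * (g (b, c) * h (c, d))))"
    by (rule sum.swap)
  also have "\<dots> = tmul f (tmul g h) (a, d)"
    by (simp add: tmul_def sum_distrib_left algebra_simps)
  finally show ?thesis .
qed

lemma tmul_one:
  assumes "a \<in> P" "c \<in> P"
  shows "tmul (\<lambda>(a, c). if a = c then 1 else 0) f (a, c) = f (a, c)"
    "tmul f (\<lambda>(a, c). if a = c then 1 else 0) (a, c) = f (a, c)"
proof -
  have "tmul (\<lambda>(a, c). if a = c then 1 else 0) f (a, c) = (\<Sum>b\<in>P. if b = a then f (a, c) else 0)"
    by (auto simp: tmul_def intro!: sum.cong)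
  then show "tmul (\<lambda>(a, c). if a = c then 1 else 0) f (a, c) = f (a, c)" using assms finite_P by simp
  have "tmul f (\<lambda>(a, c). if a = c then 1 else 0) (a, c) = (\<Sum>b\<in>P. if b = c then f (a, c) else 0)"
    by (auto simp: tmul_def intro!: sum.cong)
  then show "tmul f (\<lambda>(a, c). if a = c then 1 else 0) (a, c) = f (a, c)" using assms finite_P by simp
qed

lemma B_ring: "ring (B_algebra W)"
proof (rule ringI)
  show "abelian_group (B_algebra W)"
  proof (rule abelian_groupI)
    fix x assume "x \<in> carrier (B_algebra W)"
    then obtain f where "x = Bcls f" by (auto simp: B_carrier)
    then show "\<exists>y\<in>carrier (B_algebra W). y \<oplus>\<^bsub>B_algebra W\<^esub> x = \<zero>\<^bsub>B_algebra W\<^esub>"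
      by (auto simp: B_carrier B_simps intro!: exI[of _ "\<lambda>x. - f x"])
  qed (auto simp: B_carrier B_simps algebra_simps)
  have one: "Bcls (tmul (\<lambda>(a, c). if a = c then 1 else 0) f) = Bcls f"
    "Bcls (tmul f (\<lambda>(a, c). if a = c then 1 else 0)) = Bcls f" for f
    by (rule Bcls_cong, rule tmul_one, assumption+)+
  have assoc: "Bcls (tmul (tmul f g) h) = Bcls (tmul f (tmul g h))" for f g h
    by (rule Bcls_cong) (rule tmul_assoc)
  show "monoid (B_algebra W)"
    by (rule monoidI) (auto simp only: B_carrier B_simps one assoc)
  have distr: "tmul (\<lambda>x. f x + g x) h = (\<lambda>x. tmul f h x + tmul g h x)"
    "tmul h (\<lambda>x. f x + g x) = (\<lambda>x. tmul h f x + tmul h g x)" for f g h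
    by (auto simp: tmul_def algebra_simps sum.distrib)
  fix x y z
  assume "x \<in> carrier (B_algebra W)" "y \<in> carrier (B_algebra W)" "z \<in> carrier (B_algebra W)"
  then obtain f g h where "x = Bcls f" "y = Bcls g" "z = Bcls h" by (auto simp: B_carrier)
  then show "(x \<oplus>\<^bsub>B_algebra W\<^esub> y) \<otimes>\<^bsub>B_algebra W\<^esub> z = x \<otimes>\<^bsub>B_algebra W\<^esub> z \<oplus>\<^bsub>B_algebra W\<^esub> y \<otimes>\<^bsub>B_algebra W\<^esub> z"
    "z \<otimes>\<^bsub>B_algebra W\<^esub> (x \<oplus>\<^bsub>B_algebra W\<^esub> y) = z \<otimes>\<^bsub>B_algebra W\<^esub> x \<oplus>\<^bsub>B_algebra W\<^esub> z \<otimes>\<^bsub>B_algebra W\<^esub> y"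
    by (simp_all only: B_simps distr)
qed

definition "BE f = emb (B_algebra W) (Bcls f)"

lemma BE_simps: "BE (\<lambda>x. f x + g x) = BE f + BE g" "BE (tmul f g) = BE f * BE g" "BE (\<lambda>x. 0) = 0"
  using ring_mapD[OF emb_ring_map[OF B_ring], of "Bcls f" "Bcls g"] ring_map_zero[OF B_ring emb_ring_map[OF B_ring]]
  by (auto simp: BE_def B_carrier B_simps)

text \<open>The kernel of the presentation by matrices, entry by entry. Injectivity of the map into
  \<open>B\<close> and every linear independence statement about \<open>A(W)\<close> rest on
  it.\<close>

lemma BE_eq_0_iff: "BE f = 0 \<longleftrightarrow> (\<forall>a\<in>P. \<forall>c\<in>P. f (a, c) \<in> ideal2 W a c)"
proof -
  have "BE f = 0 \<longleftrightarrow> Bcls f = Bcls (\<lambda>_. 0)"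
    using emb_inj[OF B_ring, of "Bcls f" "Bcls (\<lambda>_. 0)"] BE_simps(3) by (auto simp: BE_def B_carrier)
  also have "\<dots> \<longleftrightarrow> (\<forall>a\<in>P. \<forall>c\<in>P. ideal2 W a c +>\<^bsub>poly_ring\<^esub> f (a, c) = ideal2 W a c +>\<^bsub>poly_ring\<^esub> 0)"
    by (auto simp: Bcls_def fun_eq_iff)
  also have "\<dots> \<longleftrightarrow> (\<forall>a\<in>P. \<forall>c\<in>P. f (a, c) \<in> ideal2 W a c)"
    using coset_eq_zero_iff[OF ideal2_ideal(1)] coset_simps(4)[OF ideal2_ideal(1)] by simp
  finally show ?thesis .
qed

definition "munit a c q = (\<lambda>x. if x = (a, c) then q else 0)"

lemma tmul_munit:
  assumes "b \<in> P"
  shows "tmul (munit a b p) (munit b' c q) = (if b = b' then munit a c (crossing a b c * (p * q)) else (\<lambda>_. 0))"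
proof
  fix x :: "'i sign_vector \<times> 'i sign_vector"
  obtain y z where x: "x = (y, z)" by (cases x)
  have "tmul (munit a b p) (munit b' c q) x =
    (\<Sum>k\<in>P. if k = b then (if b = b' then munit a c (crossing a b c * (p * q)) x else 0) else 0)"
    unfolding tmul_def x prod.case by (intro sum.cong refl) (simp add: munit_def)
  then show "tmul (munit a b p) (munit b' c q) x =
    (if b = b' then munit a c (crossing a b c * (p * q)) else (\<lambda>_. 0)) x"
    using assms finite_P by simp
qed

text \<open>The scalar matrix, hence the central element by which the polynomial \<open>q\<close>
  acts.\<close>

definition "Bdiag q = (\<lambda>(a, c). if a = c then q else 0)"

lemma tmul_Bdiag:
  assumes "a \<in> P" "c \<in> P"
  shows "tmul (Bdiag q) f (a, c) = q * f (a, c)" "tmul f (Bdiag q) (a, c) = q * f (a, c)"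
proof -
  have "tmul (Bdiag q) f (a, c) = (\<Sum>b\<in>P. if b = a then q * f (a, c) else 0)"
    by (auto simp: tmul_def Bdiag_def intro!: sum.cong)
  then show "tmul (Bdiag q) f (a, c) = q * f (a, c)" using assms finite_P by simp
  have "tmul f (Bdiag q) (a, c) = (\<Sum>b\<in>P. if b = c then q * f (a, c) else 0)"
    by (auto simp: tmul_def Bdiag_def mult.commute intro!: sum.cong)
  then show "tmul f (Bdiag q) (a, c) = q * f (a, c)" using assms finite_P by simp
qed

lemma BE_cong: "(\<And>a c. a \<in> P \<Longrightarrow> c \<in> P \<Longrightarrow> f (a, c) = g (a, c)) \<Longrightarrow> BE f = BE g"
  unfolding BE_def by (rule arg_cong[OF Bcls_cong])

lemma BE_Bdiag: "BE (Bdiag q) * BE f = BE (\<lambda>x. q * f x)" "BE f * BE (Bdiag q) = BE (\<lambda>x. q * f x)"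
  unfolding BE_simps(2)[symmetric] by (auto intro!: BE_cong simp: tmul_Bdiag)

lemma BE_sum: "BE (\<lambda>x. \<Sum>i\<in>I. f i x) = (\<Sum>i\<in>I. BE (f i))"
  by (induction I rule: infinite_finite_induct) (simp_all add: BE_simps)

lemma BE_munit_sum: "BE f = (\<Sum>a\<in>P. \<Sum>c\<in>P. BE (munit a c (f (a, c))))"
proof -
  have "f (y, z) = (\<Sum>a\<in>P. \<Sum>c\<in>P. munit a c (f (a, c)) (y, z))" if "y \<in> P" "z \<in> P" for y z
  proof -
    have "(\<Sum>a\<in>P. \<Sum>c\<in>P. munit a c (f (a, c)) (y, z)) = (\<Sum>a\<in>P. if a = y then f (y, z) else 0)"
      using that finite_P by (intro sum.cong refl) (auto simp: munit_def)
    then show ?thesis using that finite_P by simp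
  qed
  then have "BE f = BE (\<lambda>x. \<Sum>a\<in>P. \<Sum>c\<in>P. munit a c (f (a, c)) x)" by (intro BE_cong)
  then show ?thesis by (simp add: BE_sum)
qed

end

section \<open>The isomorphism with \<open>B\<close> of the Gale dual\<close>

context arrangement
begin

text \<open>The copy of \<open>A(W)\<close> in \<open>rprod\<close>. Maps out of \<open>A(W)\<close>
  are controlled only there, which explains the membership premises below.\<close>

abbreviation "Aset \<equiv> emb (A_algebra W) ` carrier (A_algebra W)"

lemma Aset_closed:
  assumes "x \<in> Aset" "y \<in> Aset" shows "x + y \<in> Aset" "x * y \<in> Aset"
proof -
  interpret X: ring "A_algebra W" by (rule A_ring)
  obtain x' y' where *: "x = emb (A_algebra W) x'" "y = emb (A_algebra W) y'"
    "x' \<in> carrier (A_algebra W)" "y' \<in> carrier (A_algebra W)" using assms by blast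
  show "x + y \<in> Aset" "x * y \<in> Aset"
    unfolding *(1,2) using ring_mapD[OF emb_ring_map[OF A_ring] *(3,4), symmetric] *(3,4)
    by (auto intro!: imageI)
qed

lemma Aset_zero: "0 \<in> Aset"
  using ring_map_zero[OF A_ring emb_ring_map[OF A_ring]] ring.ring_simprules(2)[OF A_ring] by (metis imageI)

lemma Aset_sum: "(\<And>i. i \<in> I \<Longrightarrow> f i \<in> Aset) \<Longrightarrow> sum f I \<in> Aset"
  by (induction I rule: infinite_finite_induct) (simp_all add: Aset_zero Aset_closed del: image_iff)

lemma AQ_Aset: "f \<in> carrier Q \<Longrightarrow> AQ f \<in> Aset"
  unfolding AQ_def by (intro imageI A_class_closed)

lemma apath_Aset: "w \<in> paths F adj \<Longrightarrow> apath w \<in> Aset"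
  unfolding apath_def by (intro AQ_Aset psingle_Q) auto

lemma AH_Aset: "AH q \<in> Aset"
  unfolding AH_def by (intro Aset_sum AQ_Aset psingle_Q vertex_path) auto

lemma Aid_Aset: "Aid a \<in> Aset"
  by (simp add: Aid_def apath_Aset vertex_path Aset_zero del: image_iff)

lemma AP_Aset: "AP a b \<in> Aset"
  by (simp add: AP_def apath_Aset edge_path Aset_zero del: image_iff)

lemma taut_Aset: "taut a c \<in> Aset"
proof -
  have "taut_steps n a c \<in> Aset" for n
    by (induction n arbitrary: a) (simp_all add: Aid_Aset AP_Aset Aset_closed Let_def del: image_iff)
  then show ?thesis unfolding taut_def .
qed

lemma AH_one_Aset:
  assumes "x \<in> Aset" shows "AH 1 * x = x"
proof -
  obtain x' where x': "x = emb (A_algebra W) x'" "x' \<in> carrier (A_algebra W)" using assms by blast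
  show ?thesis unfolding x'(1) using x'(2)
  proof (induction rule: emb_A_induct)
    case (single w q)
    have "AH 1 * (AH q * apath w) = AH q * (AH 1 * apath w)"
      by (simp only: mult.assoc[symmetric] AH_comm(3))
    then show ?case using single AH_one_mult by simp
  qed (simp_all add: distrib_left)
qed

end

context A_representation
begin

text \<open>The universal property transported to \<open>Aset\<close>, where the generators
  \<open>AH\<close>, \<open>Aid\<close> and \<open>AP\<close> live.\<close>

lemma extension_rprod:
  obtains \<Psi> where "ring_map (A_algebra W) (\<lambda>x. \<Psi> (emb (A_algebra W) x))"
    "\<And>x y. x \<in> Aset \<Longrightarrow> y \<in> Aset \<Longrightarrow> \<Psi> (x + y) = \<Psi> x + \<Psi> y"
    "\<And>x y. x \<in> Aset \<Longrightarrow> y \<in> Aset \<Longrightarrow> \<Psi> (x * y) = \<Psi> x * \<Psi> y"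
    "\<Psi> 0 = 0" "\<And>q y. y \<in> Aset \<Longrightarrow> \<Psi> (AH q * y) = h q * \<Psi> y"
    "\<And>a. a \<in> F \<Longrightarrow> \<Psi> (Aid a) = e a"
    "\<And>a i. a \<in> F \<Longrightarrow> flip a i \<in> F \<Longrightarrow> \<Psi> (AP a (flip a i)) = p a (flip a i)"
proof -
  let ?X = "A_algebra W"
  obtain \<Phi> where \<Phi>: "ring_map ?X \<Phi>"
    "\<And>w q. w \<in> paths F adj \<Longrightarrow> \<Phi> (A_class W (psingle S w (cls q))) = h q * path_value w"
    by (rule extension) blast
  define \<Psi> where "\<Psi> y = \<Phi> (rcomp y ?X)" for y
  have emb: "\<Psi> (emb ?X x) = \<Phi> x" if "x \<in> carrier ?X" for x
    using that by (simp add: \<Psi>_def rcomp_emb A_ring)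
  have map: "ring_map ?X (\<lambda>x. \<Psi> (emb ?X x))"
    using \<Phi>(1) emb ring.ring_simprules(1,5)[OF A_ring] by (simp add: ring_map_def)
  have add: "\<Psi> (x + y) = \<Psi> x + \<Psi> y" if "x \<in> Aset" "y \<in> Aset" for x y
    using that ring_mapD(1)[OF emb_ring_map[OF A_ring]] ring_mapD(1)[OF map]
    by (auto simp flip: ring_mapD(1)[OF emb_ring_map[OF A_ring]] ring_mapD(1)[OF map])
  have mult: "\<Psi> (x * y) = \<Psi> x * \<Psi> y" if "x \<in> Aset" "y \<in> Aset" for x y
    using that by (auto simp flip: ring_mapD(2)[OF emb_ring_map[OF A_ring]] ring_mapD(2)[OF map])
  have zero: "\<Psi> 0 = 0"
    using ring_map_zero[OF A_ring map] ring_map_zero[OF A_ring emb_ring_map[OF A_ring]] by simp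
  have sum: "\<Psi> (sum f I) = (\<Sum>i\<in>I. \<Psi> (f i))" if "\<And>i. i \<in> I \<Longrightarrow> f i \<in> Aset" for f and I :: "'i sign_vector set"
    using that by (induction I rule: infinite_finite_induct) (simp_all add: zero add Aset_sum del: image_iff)
  have AQ: "\<Psi> (AQ (psingle S w (cls q))) = h q * path_value w" if "w \<in> paths F adj" for w q
    using \<Phi>(2)[OF that] that by (simp add: AQ_def emb A_class_closed psingle_Q)
  have path: "\<Psi> (apath w) = path_value w" if "w \<in> paths F adj" for w
    using AQ[OF that, of 1] h_one_path_value[OF that] by (simp add: apath_def cls_simps(3))
  have AH: "\<Psi> (AH q) = (\<Sum>a\<in>F. h q * e a)" for q
    unfolding AH_def by (subst sum) (simp_all add: AQ_Aset psingle_Q vertex_path AQ del: image_iff)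
  \<comment> \<open>\<open>\<Psi> (AH q)\<close> is the sum of the \<open>h q * e a\<close>, which
    need not be \<open>h q\<close>; but the discrepancy disappears in products, as
    \<open>AH 1\<close> acts as the unit on \<open>Aset\<close>.\<close>
  have AHy: "\<Psi> (AH q * y) = h q * \<Psi> y" if y: "y \<in> Aset" for q y
  proof -
    have "\<Psi> (AH q) = h q * \<Psi> (AH 1)"
      by (simp add: AH sum_distrib_left h_one)
    then have "\<Psi> (AH q * y) = h q * \<Psi> (AH 1 * y)" by (simp only: mult AH_Aset y mult.assoc)
    then show ?thesis by (simp only: AH_one_Aset[OF y])
  qed
  have id: "\<Psi> (Aid a) = e a" if "a \<in> F" for a
    using that path[OF vertex_path] by (simp add: Aid_def)
  have AP: "\<Psi> (AP a (flip a i)) = p a (flip a i)" if "a \<in> F" "flip a i \<in> F" for a i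
  proof -
    have ad: "adj a (flip a i)" by (rule adj_flipI[OF feasible_sign[OF that(1)]])
    have "\<Psi> (AP a (flip a i)) = path_value [a, flip a i]"
      using path[OF edge_path[OF that(1,2), of adj]] that ad by (simp add: AP_def)
    then show ?thesis using p_e[OF that] by simp
  qed
  show ?thesis by (rule that[of \<Psi>, OF map add mult zero AHy id AP])
qed

end

context arrangement
begin

interpretation U: arrangement U by (rule dual_arrangement)

text \<open>The matrix unit at \<open>(a, c)\<close> in \<open>B\<close> of the Gale dual, extended
  by zero outside \<open>P\<close>; it will be the image of \<open>AH q * taut a c\<close>.\<close>

definition "B_unit a c q = (if a \<in> P \<and> c \<in> P then arrangement.BE (gale_dual W) (arrangement.munit a c q) else 0)"

lemma B_unit_mult:
  "b \<in> P \<Longrightarrow> B_unit a b p * B_unit b c q = B_unit a c (crossing a b c * (p * q))"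
  using U.BE_simps(2)[of "U.munit a b p" "U.munit b c q"] U.tmul_munit[of b a p b c q]
  by (simp add: B_unit_def bounded_feasible_dual)

lemma B_unit_Bdiag:
  "U.BE (U.Bdiag q) * B_unit a c p = B_unit a c (q * p)" "B_unit a c p * U.BE (U.Bdiag q) = B_unit a c (q * p)"
proof -
  have *: "(\<lambda>x. q * U.munit a c p x) = U.munit a c (q * p)" by (auto simp: U.munit_def)
  show "U.BE (U.Bdiag q) * B_unit a c p = B_unit a c (q * p)" "B_unit a c p * U.BE (U.Bdiag q) = B_unit a c (q * p)"
    using U.BE_Bdiag[where q = q and f = "U.munit a c p"] by (simp_all add: B_unit_def *)
qed

lemma B_unit_eq_0:
  assumes "q \<in> ideal2 U a c" shows "B_unit a c q = 0"
proof -
  have "U.BE (U.munit a c q) = 0"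
    unfolding U.BE_eq_0_iff using assms U.face_ideal_closed(1) by (auto simp: U.munit_def ideal2_def)
  then show ?thesis by (simp add: B_unit_def)
qed

text \<open>A common point of the chambers of \<open>a\<close> and \<open>c\<close> satisfies each
  inequality of \<open>b\<close>, since it is one of \<open>a\<close> or of
  \<open>c\<close>.\<close>

lemma empty_between:
  assumes "chamber U b = {}" "\<And>k. b k = a k \<or> b k = c k"
  shows "chamber U a \<inter> chamber U c = {}"
proof -
  have "x \<in> chamber U b" if "x \<in> chamber U a" "x \<in> chamber U c" for x
  proof -
    have "b k * x $ k \<ge> 0" for k using assms(2)[of k] that by (auto simp: chamber_def)
    then show ?thesis using that by (simp add: chamber_def)
  qed
  then show ?thesis using assms(1) by blast
qed

lemma unbounded_chamber_empty: "b \<in> F \<Longrightarrow> b \<notin> P \<Longrightarrow> chamber U b = {}"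
  by (auto simp: bounded_feasible_eq feasible_def)

lemma B_unit_between:
  assumes "b \<in> F" "b \<notin> P" "\<And>k. b k = a k \<or> b k = c k"
  shows "B_unit a c q = 0"
proof (rule B_unit_eq_0)
  have e: "hyp U {} \<inter> (chamber U a \<inter> chamber U c) = {}"
    using empty_between[OF unbounded_chamber_empty[OF assms(1,2)] assms(3)] by simp
  have "1 \<in> ideal2 U a c" unfolding ideal2_def using U.face_ideal_subset[OF e] by simp
  then show "q \<in> ideal2 U a c" unfolding ideal2_def using U.face_ideal_closed(3)[of 1 _ q] by simp
qed

text \<open>If \<open>b\<close> is not in \<open>P\<close>, the left side is zero by definition. The
  right side is zero too, because \<open>b\<close> lies between \<open>a\<close> and
  \<open>c\<close> and has an empty dual chamber, so that \<open>R_ac = 0\<close>.\<close>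

lemma B_unit_step:
  assumes "a \<in> F" "b \<in> F" "c \<in> F" "b = flip a i" "i \<in> separating a c"
  shows "B_unit a b 1 * B_unit b c 1 = B_unit a c 1"
proof (cases "b \<in> P")
  case True
  then show ?thesis using assms by (simp add: B_unit_mult crossing_flip feasible_sign)
next
  case False
  have "b k = a k \<or> b k = c k" for k
    using sign_neq[OF feasible_sign[OF assms(1)] feasible_sign[OF assms(3)], of i] assms(4,5)
    by (simp add: flip_apply separating_def)
  then show ?thesis using B_unit_between[OF assms(2) False] False by (simp add: B_unit_def)
qed

text \<open>If \<open>flip a i\<close> is not in \<open>P\<close>, a point of the dual chamber of
  \<open>a\<close> with \<open>x_i = 0\<close> would lie in the empty dual chamber of
  \<open>flip a i\<close>. So \<open>u_i\<close> is zero in \<open>R_aa\<close>.\<close>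

lemma B_unit_back:
  assumes "a \<in> F" "flip a i \<in> F"
  shows "B_unit a (flip a i) 1 * B_unit (flip a i) a 1 = B_unit a a (poly_var i)"
proof (cases "flip a i \<in> P")
  case True
  then show ?thesis using assms by (simp add: B_unit_mult crossing_flip feasible_sign separating_def)
next
  case False
  have e: "hyp U {i} \<inter> (chamber U a \<inter> chamber U a) = {}"
    using chamber_flip[of _ U a i] unbounded_chamber_empty[OF assms(2) False] by (auto simp: hyp_def)
  have "poly_var i \<in> ideal2 U a a" unfolding ideal2_def using U.face_ideal_subset[OF e] by simp
  then have "B_unit a a (poly_var i) = 0" by (rule B_unit_eq_0)
  moreover have "B_unit a (flip a i) 1 = 0" using False by (simp add: B_unit_def)
  ultimately show ?thesis by simp
qed

lemma B_representation:
  "A_representation W (\<lambda>q. U.BE (U.Bdiag q)) (\<lambda>a. B_unit a a 1) (\<lambda>a b. B_unit a b 1)"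
proof
  show "U.BE (U.Bdiag (q + r)) = U.BE (U.Bdiag q) + U.BE (U.Bdiag r)" for q r
    unfolding U.BE_simps(1)[symmetric] by (rule arg_cong[of _ _ U.BE]) (auto simp: U.Bdiag_def)
  show "U.BE (U.Bdiag (q * r)) = U.BE (U.Bdiag q) * U.BE (U.Bdiag r)" for q r
    unfolding U.BE_Bdiag by (rule arg_cong[of _ _ U.BE]) (auto simp: U.Bdiag_def)
  show "U.BE (U.Bdiag (linear_form v)) = 0" if "v \<in> (dir W)\<^sup>\<bottom>" for v
    unfolding U.BE_eq_0_iff using that dir_dual(1) U.face_ideal_linear U.face_ideal_closed(1)
    by (auto simp: U.Bdiag_def ideal2_def)
  show "U.BE (U.Bdiag q) * B_unit a a 1 = B_unit a a 1 * U.BE (U.Bdiag q)" for q a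
    by (simp add: B_unit_Bdiag)
  show "U.BE (U.Bdiag q) * B_unit a (flip a i) 1 = B_unit a (flip a i) 1 * U.BE (U.Bdiag q)" for q a i
    by (simp add: B_unit_Bdiag)
  show "U.BE (U.Bdiag 1) * B_unit a a 1 = B_unit a a 1" for a
    by (simp add: B_unit_Bdiag)
  show "B_unit a a 1 * B_unit b b 1 = (if a = b then B_unit a a 1 else 0)" for a b
  proof (cases "a = b \<or> a \<notin> P \<or> b \<notin> P")
    case False
    then show ?thesis
      using U.BE_simps(2)[of "U.munit a a 1" "U.munit b b 1"] U.tmul_munit[of a a 1 b b 1] U.BE_simps(3)
      by (simp add: B_unit_def bounded_feasible_dual)
  qed (auto simp: B_unit_def B_unit_mult[unfolded B_unit_def] dest: B_unit_mult[of b b 1 b 1])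
  show "B_unit a a 1 * B_unit a (flip a i) 1 = B_unit a (flip a i) 1" for a i
    by (cases "a \<in> P") (simp_all add: B_unit_mult, simp add: B_unit_def)
  show "B_unit a (flip a i) 1 * B_unit (flip a i) (flip a i) 1 = B_unit a (flip a i) 1" for a i
    by (cases "flip a i \<in> P") (simp_all add: B_unit_mult, simp add: B_unit_def)
  show "B_unit a a 1 = 0" if "a \<in> F - P" for a
    using that by (simp add: B_unit_def)
  show "B_unit a (flip a i) 1 * B_unit (flip a i) (flip (flip a i) j) 1 =
      B_unit a (flip a j) 1 * B_unit (flip a j) (flip (flip a i) j) 1"
    if *: "a \<in> F" "flip a i \<in> F" "flip a j \<in> F" "flip (flip a i) j \<in> F" "i \<noteq> j" for a i j
  proof -
    \<comment> \<open>Both middle vertices lie on shortest paths to the opposite corner, so that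
      both products equal the matrix unit between the two corners.\<close>
    have "i \<in> separating a (flip (flip a i) j)" "j \<in> separating a (flip (flip a i) j)"
      using sign_nonzero[OF feasible_sign[OF *(1)]] *(5) by (auto simp: separating_def flip_apply)
    then show ?thesis
      using B_unit_step[OF *(1,2,4) refl] B_unit_step[OF *(1,3,4) refl] by simp
  qed
  show "B_unit a (flip a i) 1 * B_unit (flip a i) a 1 = U.BE (U.Bdiag (poly_var i)) * B_unit a a 1"
    if "a \<in> F" "flip a i \<in> F" for a i
    using B_unit_back[OF that] by (simp add: B_unit_Bdiag)
qed

lemma A_to_B:
  obtains \<Psi> where "ring_map (A_algebra W) (\<lambda>x. \<Psi> (emb (A_algebra W) x))"
    "\<And>x y. x \<in> Aset \<Longrightarrow> y \<in> Aset \<Longrightarrow> \<Psi> (x + y) = \<Psi> x + \<Psi> y"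
    "\<And>x y. x \<in> Aset \<Longrightarrow> y \<in> Aset \<Longrightarrow> \<Psi> (x * y) = \<Psi> x * \<Psi> y"
    "\<Psi> 0 = 0" "\<And>q a c. a \<in> F \<Longrightarrow> c \<in> F \<Longrightarrow> \<Psi> (AH q * taut a c) = B_unit a c q"
proof -
  interpret A_representation W "\<lambda>q. U.BE (U.Bdiag q)" "\<lambda>a. B_unit a a 1" "\<lambda>a b. B_unit a b 1"
    by (rule B_representation)
  obtain \<Psi> where map: "ring_map (A_algebra W) (\<lambda>x. \<Psi> (emb (A_algebra W) x))"
    and add: "\<And>x y. x \<in> Aset \<Longrightarrow> y \<in> Aset \<Longrightarrow> \<Psi> (x + y) = \<Psi> x + \<Psi> y"
    and mult: "\<And>x y. x \<in> Aset \<Longrightarrow> y \<in> Aset \<Longrightarrow> \<Psi> (x * y) = \<Psi> x * \<Psi> y"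
    and zero: "\<Psi> 0 = 0" and AH: "\<And>q y. y \<in> Aset \<Longrightarrow> \<Psi> (AH q * y) = U.BE (U.Bdiag q) * \<Psi> y"
    and id: "\<And>a. a \<in> F \<Longrightarrow> \<Psi> (Aid a) = B_unit a a 1"
    and AP: "\<And>a i. a \<in> F \<Longrightarrow> flip a i \<in> F \<Longrightarrow> \<Psi> (AP a (flip a i)) = B_unit a (flip a i) 1"
    by (rule extension_rprod) blast
  have taut: "\<Psi> (taut a c) = B_unit a c 1" if "a \<in> F" "c \<in> F" for a c
    using that
  proof (induction "card (separating a c)" arbitrary: a)
    case 0
    then have "a = c" by (auto simp: separating_def)
    then show ?case using id 0 by simp
  next
    case (Suc n)
    then have "a \<noteq> c" by (auto simp: separating_def)
    then obtain i where i: "i \<in> separating a c" "flip a i \<in> F"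
      by (rule exists_flip_towards[OF Suc.prems])
    have "\<Psi> (taut a c) = \<Psi> (AP a (flip a i)) * \<Psi> (taut (flip a i) c)"
      unfolding taut_step[OF Suc.prems i] by (rule mult[OF AP_Aset taut_Aset])
    also have "\<dots> = B_unit a (flip a i) 1 * B_unit (flip a i) c 1"
      using Suc.hyps card_separating_flip[OF Suc.prems i(1)] i(2) Suc.prems by (simp add: AP)
    also have "\<dots> = B_unit a c 1" by (rule B_unit_step[OF Suc.prems(1) i(2) Suc.prems(2) refl i(1)])
    finally show ?case .
  qed
  have AHtaut: "\<Psi> (AH q * taut a c) = B_unit a c q" if "a \<in> F" "c \<in> F" for q a c
    unfolding AH[OF taut_Aset] taut[OF that] B_unit_Bdiag by simp
  show ?thesis by (rule that[of \<Psi>, OF map add mult zero AHtaut])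
qed

text \<open>Combinations of the \<open>taut a c\<close> go to matrices of their coefficients. If
  such a matrix has class zero, its entries lie in the ideals that kill the \<open>taut a c\<close>,
  so the combination is zero as well.\<close>

theorem A_iso_B: "A_algebra W \<simeq> B_algebra U"
proof -
  obtain \<Psi> where map: "ring_map (A_algebra W) (\<lambda>x. \<Psi> (emb (A_algebra W) x))"
    and add: "\<And>x y. x \<in> Aset \<Longrightarrow> y \<in> Aset \<Longrightarrow> \<Psi> (x + y) = \<Psi> x + \<Psi> y"
    and zero: "\<Psi> 0 = 0"
    and taut: "\<And>q a c. a \<in> F \<Longrightarrow> c \<in> F \<Longrightarrow> \<Psi> (AH q * taut a c) = B_unit a c q"
    by (rule A_to_B) blast
  have sum: "\<Psi> (sum f I) = (\<Sum>i\<in>I. \<Psi> (f i))" if "\<And>i. i \<in> I \<Longrightarrow> f i \<in> Aset" for f and I :: "'i sign_vector set"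
    using that by (induction I rule: infinite_finite_induct) (simp_all add: zero add Aset_sum del: image_iff)
  let ?y = "\<lambda>q. \<Sum>a\<in>P. \<Sum>c\<in>P. AH (q a c) * taut a c"
  have PF: "a \<in> F" if "a \<in> P" for a using that P_subset by blast
  have val: "\<Psi> (?y q) = U.BE (\<lambda>(a, c). q a c)" for q
  proof -
    have "\<Psi> (?y q) = (\<Sum>a\<in>P. \<Psi> (\<Sum>c\<in>P. AH (q a c) * taut a c))"
      by (rule sum) (intro Aset_sum Aset_closed AH_Aset taut_Aset)
    also have "\<dots> = (\<Sum>a\<in>P. \<Sum>c\<in>P. B_unit a c (q a c))"
    proof (rule sum.cong[OF refl])
      fix a assume "a \<in> P"
      have "\<Psi> (\<Sum>c\<in>P. AH (q a c) * taut a c) = (\<Sum>c\<in>P. \<Psi> (AH (q a c) * taut a c))"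
        by (rule sum) (intro Aset_closed AH_Aset taut_Aset)
      then show "\<Psi> (\<Sum>c\<in>P. AH (q a c) * taut a c) = (\<Sum>c\<in>P. B_unit a c (q a c))"
        using \<open>a \<in> P\<close> by (simp add: taut PF)
    qed
    also have "\<dots> = U.BE (\<lambda>(a, c). q a c)"
      using U.BE_munit_sum[of "\<lambda>(a, c). q a c"] by (simp add: B_unit_def bounded_feasible_dual)
    finally show ?thesis .
  qed
  show ?thesis
  proof (rule ring_iso_of_emb[OF A_ring U.B_ring map])
    have "emb (B_algebra U) ` carrier (B_algebra U) = range U.BE"
      by (simp add: U.B_carrier U.BE_def image_image)
    moreover have "\<Psi> (emb (A_algebra W) x) \<in> range U.BE" if x: "x \<in> carrier (A_algebra W)" for x
    proof -
      obtain q where q: "emb (A_algebra W) x = ?y q" using emb_A_taut[OF x] by blast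
      show ?thesis unfolding q val by (rule rangeI)
    qed
    moreover have "U.BE f \<in> (\<lambda>x. \<Psi> (emb (A_algebra W) x)) ` carrier (A_algebra W)" for f
    proof -
      have "?y (\<lambda>a c. f (a, c)) \<in> Aset" by (intro Aset_sum Aset_closed AH_Aset taut_Aset)
      then obtain x where x: "?y (\<lambda>a c. f (a, c)) = emb (A_algebra W) x" "x \<in> carrier (A_algebra W)"
        by (rule imageE)
      have "U.BE f = \<Psi> (emb (A_algebra W) x)" unfolding x(1)[symmetric] val by simp
      then show ?thesis using x(2) by (rule image_eqI)
    qed
    ultimately show "(\<lambda>x. \<Psi> (emb (A_algebra W) x)) ` carrier (A_algebra W) = emb (B_algebra U) ` carrier (B_algebra U)"
      by auto
  next
    fix x assume x: "x \<in> carrier (A_algebra W)" "\<Psi> (emb (A_algebra W) x) = 0"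
    obtain q where q: "emb (A_algebra W) x = ?y q" using emb_A_taut[OF x(1)] by blast
    have "U.BE (\<lambda>(a, c). q a c) = 0" using x(2) q val by simp
    then have "q a c \<in> ideal2 U a c" if "a \<in> P" "c \<in> P" for a c
      using that by (auto simp: U.BE_eq_0_iff bounded_feasible_dual)
    then have "emb (A_algebra W) x = 0" unfolding q by (simp add: taut_ideal2 PF)
    then have "emb (A_algebra W) x = emb (A_algebra W) \<zero>\<^bsub>A_algebra W\<^esub>"
      by (simp add: ring_map_zero[OF A_ring emb_ring_map[OF A_ring]])
    then show "x = \<zero>\<^bsub>A_algebra W\<^esub>"
      using emb_inj[OF A_ring x(1) ring.ring_simprules(2)[OF A_ring]] by simp
  qed
qed

end

section \<open>Quadratic duals\<close>

text \<open>The formal tensor \<open>\<Sum> c f \<otimes> g\<close>. Different indices may name the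
  same word, whose coefficients then add up.\<close>

definition tensor_sum :: "'b set \<Rightarrow> ('b \<Rightarrow> real) \<Rightarrow> ('b \<Rightarrow> 'm) \<Rightarrow> ('b \<Rightarrow> 'm) \<Rightarrow> ('p, 'm) tensor_gen list \<Rightarrow> real" where
  "tensor_sum B c f g = (\<lambda>w. \<Sum>b\<in>B. word (c b) [Vec (f b), Vec (g b)] w)"

lemma tensor_sum_apply:
  "tensor_sum B c f g [Vec m, Vec n] = (\<Sum>b\<in>B. if m = f b \<and> n = g b then c b else 0)"
  by (simp add: tensor_sum_def word_def)

lemma tensor_sum_nonzero:
  assumes "finite B"
  shows "{w. tensor_sum B c f g w \<noteq> 0} \<subseteq> (\<lambda>b. [Vec (f b), Vec (g b)]) ` B"
  by (rule subsetI, rule ccontr) (auto simp: tensor_sum_def word_def intro!: sum.neutral)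

lemma tensor_sum_formal:
  assumes "finite B" "\<And>b. b \<in> B \<Longrightarrow> f b \<in> carrier M" "\<And>b. b \<in> B \<Longrightarrow> g b \<in> carrier M"
  shows "tensor_sum B c f g \<in> formal_tensors M"
proof -
  have "finite {w. tensor_sum B c f g w \<noteq> 0}"
    using tensor_sum_nonzero[OF assms(1)] by (rule finite_subset) (use assms(1) in simp)
  moreover have "{w. tensor_sum B c f g w \<noteq> 0} \<subseteq> {[Vec m, Vec n] | m n. m \<in> carrier M \<and> n \<in> carrier M}"
    using tensor_sum_nonzero[OF assms(1), of c f g] assms(2,3) by blast
  ultimately show ?thesis by (simp add: formal_tensors_def)
qed

text \<open>Words of different indices may coincide or cancel; additivity of \<open>h\<close> is
  what still turns the sum over the support into a sum over the indices.\<close>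

lemma sum_tensor_sum:
  fixes h :: "real \<Rightarrow> 'r::ring" and H :: "'m \<times> 'm \<Rightarrow> 'r" and c :: "'b \<Rightarrow> real"
    and f g :: "'b \<Rightarrow> 'm" and B :: "'b set"
  defines "t \<equiv> \<lambda>x. tensor_sum B c f g [Vec (fst x), (Vec (snd x) :: ('p, 'm) tensor_gen)]"
  assumes B: "finite B" and h: "\<And>x y. h (x + y) = h x + h y"
  shows "(\<Sum>x\<in>{x. t x \<noteq> 0}. h (t x) * H x) = (\<Sum>b\<in>B. h (c b) * H (f b, g b))"
proof -
  have h0: "h 0 = 0" using h[of 0 0] by simp
  have hs: "h (sum k I) = (\<Sum>i\<in>I. h (k i))" if "finite I" for k and I :: "'b set"
    using that by (induction I) (simp_all add: h0 h)
  have t: "t x = (\<Sum>b\<in>B. if fst x = f b \<and> snd x = g b then c b else 0)" for x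
    by (simp add: t_def tensor_sum_apply)
  let ?K = "(\<lambda>b. (f b, g b)) ` B"
  have "x \<in> ?K" if "t x \<noteq> 0" for x
  proof -
    have "\<exists>b\<in>B. fst x = f b \<and> snd x = g b"
    proof (rule ccontr)
      assume "\<not> ?thesis"
      then have "t x = 0" unfolding t by (intro sum.neutral) auto
      then show False using that by simp
    qed
    then show ?thesis by (auto simp: image_iff prod_eq_iff)
  qed
  then have "(\<Sum>x\<in>{x. t x \<noteq> 0}. h (t x) * H x) = (\<Sum>x\<in>?K. h (t x) * H x)"
    using B by (intro sum.mono_neutral_left) (auto simp: h0)
  also have "\<dots> = (\<Sum>x\<in>?K. \<Sum>b\<in>B. if x = (f b, g b) then h (c b) * H (f b, g b) else 0)"
  proof (rule sum.cong[OF refl])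
    fix x assume "x \<in> ?K"
    have "h (t x) = (\<Sum>b\<in>B. h (if fst x = f b \<and> snd x = g b then c b else 0))"
      unfolding t by (rule hs[OF B])
    then show "h (t x) * H x = (\<Sum>b\<in>B. if x = (f b, g b) then h (c b) * H (f b, g b) else 0)"
      unfolding \<open>h (t x) = _\<close> sum_distrib_right by (intro sum.cong refl) (cases x; auto simp: h0)
  qed
  also have "\<dots> = (\<Sum>b\<in>B. \<Sum>x\<in>?K. if x = (f b, g b) then h (c b) * H (f b, g b) else 0)"
    by (rule sum.swap)
  also have "\<dots> = (\<Sum>b\<in>B. h (c b) * H (f b, g b))"
    using B by (intro sum.cong refl) (simp add: sum.delta)
  finally show ?thesis .
qed

lemma tensor_pairing_left:
  fixes P :: "'p set" and M :: "('p, 'm) bimodule"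
  assumes B: "finite B"
  shows "tensor_pairing P M (tensor_sum B c f g) q = (\<Sum>b\<in>B. c b *
    (\<Sum>x\<in>{(m, n). q [Vec m, Vec n] \<noteq> 0}. q [Vec (fst x), Vec (snd x)] *
      (\<Sum>a\<in>P. f b (lact M a (snd x)) * g b (ract M (fst x) a))))"
proof -
  have "tensor_pairing P M (tensor_sum B c f g) q =
    (\<Sum>x\<in>{x. (tensor_sum B c f g :: ('p, 'm \<Rightarrow> real) tensor_gen list \<Rightarrow> real) [Vec (fst x), Vec (snd x)] \<noteq> 0}.
      tensor_sum B c f g [Vec (fst x), (Vec (snd x) :: ('p, 'm \<Rightarrow> real) tensor_gen)] *
      (\<Sum>y\<in>{(m, n). q [Vec m, Vec n] \<noteq> 0}. q [Vec (fst y), Vec (snd y)] *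
        (\<Sum>a\<in>P. fst x (lact M a (snd y)) * snd x (ract M (fst y) a))))"
    unfolding tensor_pairing_def by (simp only: case_prod_unfold sum_distrib_left mult.assoc)
  also have "\<dots> = (\<Sum>b\<in>B. c b *
    (\<Sum>y\<in>{(m, n). q [Vec m, Vec n] \<noteq> 0}. q [Vec (fst y), Vec (snd y)] *
      (\<Sum>a\<in>P. fst (f b, g b) (lact M a (snd y)) * snd (f b, g b) (ract M (fst y) a))))"
    by (rule sum_tensor_sum[where h = "\<lambda>x. x", OF B refl])
  finally show ?thesis by simp
qed

lemma tensor_pairing_right:
  fixes P :: "'p set" and M :: "('p, 'm) bimodule"
  assumes B: "finite B"
  shows "tensor_pairing P M \<phi> (tensor_sum B c m n) = (\<Sum>b\<in>B. c b *
    (\<Sum>x\<in>{(f, g). \<phi> [Vec f, Vec g] \<noteq> 0}. \<phi> [Vec (fst x), Vec (snd x)] *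
      (\<Sum>a\<in>P. fst x (lact M a (n b)) * snd x (ract M (m b) a))))"
proof -
  let ?F = "{(f, g). \<phi> [Vec f, Vec g] \<noteq> 0}"
  let ?G = "\<lambda>x b. \<phi> [Vec (fst x), Vec (snd x)] * (\<Sum>a\<in>P. fst x (lact M a (n b)) * snd x (ract M (m b) a))"
  let ?S = "{x. (tensor_sum B c m n :: ('p, 'm) tensor_gen list \<Rightarrow> real) [Vec (fst x), Vec (snd x)] \<noteq> 0}"
  have *: "(\<Sum>y\<in>?S. tensor_sum B c m n [Vec (fst y), (Vec (snd y) :: ('p, 'm) tensor_gen)] *
      (\<phi> [Vec (fst x), Vec (snd x)] * (\<Sum>a\<in>P. fst x (lact M a (snd y)) * snd x (ract M (fst y) a))))
    = (\<Sum>b\<in>B. c b * ?G x b)" for x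
    using sum_tensor_sum[where h = "\<lambda>x. x" and f = m and g = n and c = c
        and H = "\<lambda>y. \<phi> [Vec (fst x), Vec (snd x)] * (\<Sum>a\<in>P. fst x (lact M a (snd y)) * snd x (ract M (fst y) a))",
        OF B refl] by simp
  have "tensor_pairing P M \<phi> (tensor_sum B c m n) = (\<Sum>x\<in>?F. \<Sum>y\<in>?S.
      tensor_sum B c m n [Vec (fst y), (Vec (snd y) :: ('p, 'm) tensor_gen)] *
      (\<phi> [Vec (fst x), Vec (snd x)] * (\<Sum>a\<in>P. fst x (lact M a (snd y)) * snd x (ract M (fst y) a))))"
    unfolding tensor_pairing_def case_prod_unfold by (intro sum.cong refl) (simp only: ac_simps)
  also have "\<dots> = (\<Sum>x\<in>?F. \<Sum>b\<in>B. c b * ?G x b)"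
    by (simp only: *)
  also have "\<dots> = (\<Sum>b\<in>B. \<Sum>x\<in>?F. c b * ?G x b)"
    by (rule sum.swap)
  finally show ?thesis by (simp only: sum_distrib_left)
qed

lemma free_algebra_tensor_sum:
  fixes h :: "(('p, 'm) tensor_gen list \<Rightarrow> real) \<Rightarrow> 'r::ring"
  assumes h: "ring_map (free_algebra X) h" and B: "finite B"
    and X: "\<And>b. b \<in> B \<Longrightarrow> Vec (f b) \<in> X" "\<And>b. b \<in> B \<Longrightarrow> Vec (g b) \<in> X"
  shows "h (tensor_sum B c f g) = (\<Sum>b\<in>B. h (word (c b) [Vec (f b), Vec (g b)]))"
  using B X
proof (induction B)
  case empty
  have "tensor_sum {} c f g = \<zero>\<^bsub>free_algebra X\<^esub>" by (simp add: tensor_sum_def free_algebra_simps fun_eq_iff)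
  then show ?case using ring_map_zero[OF free_algebra_ring h] by simp
next
  case (insert b B)
  have "tensor_sum B c f g \<in> carrier (free_algebra X)"
    unfolding free_algebra_carrier
  proof (intro conjI allI impI)
    show "finite {w :: ('p, 'm) tensor_gen list. tensor_sum B c f g w \<noteq> 0}"
      using tensor_sum_nonzero[OF insert.hyps(1)] by (rule finite_subset) (use insert.hyps(1) in simp)
    fix w :: "('p, 'm) tensor_gen list" assume "tensor_sum B c f g w \<noteq> 0"
    then obtain x where "w = [Vec (f x), Vec (g x)]" "x \<in> B"
      using tensor_sum_nonzero[OF insert.hyps(1), of c f g] by blast
    then show "w \<in> lists X" using insert.prems by (simp del: lists_eq_set)
  qed
  moreover have "word (c b) [Vec (f b), Vec (g b)] \<in> carrier (free_algebra X)"
    using insert.prems by (intro word_closed) simp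
  moreover have "tensor_sum (insert b B) c f g = word (c b) [Vec (f b), Vec (g b)] \<oplus>\<^bsub>free_algebra X\<^esub> tensor_sum B c f g"
    using insert.hyps by (simp add: tensor_sum_def free_algebra_simps fun_eq_iff)
  ultimately show ?case using insert by (simp add: ring_mapD(1)[OF h])
qed

section \<open>The tensor algebra of a bimodule\<close>

locale tensor_data =
  fixes P :: "'p set" and N :: "('p, 'm) bimodule"
  assumes finite_idem: "finite P"
    and N_vadd: "f \<in> carrier N \<Longrightarrow> g \<in> carrier N \<Longrightarrow> vadd N f g \<in> carrier N"
    and N_vscale: "f \<in> carrier N \<Longrightarrow> vscale N c f \<in> carrier N"
    and N_act: "a \<in> P \<Longrightarrow> f \<in> carrier N \<Longrightarrow> lact N a f \<in> carrier N"
      "a \<in> P \<Longrightarrow> f \<in> carrier N \<Longrightarrow> ract N f a \<in> carrier N"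
begin

abbreviation "X \<equiv> Idemp ` P \<union> Vec ` carrier N"
abbreviation "T0 \<equiv> free_algebra X"

lemma T0_eq: "tensor_free P N = T0" by (simp add: tensor_free_def)

lemma tensor_relations_closed: "tensor_relations P N \<subseteq> carrier T0"
proof -
  interpret T: ring T0 by (rule free_algebra_ring)
  have i: "word c [Idemp a] \<in> carrier T0" if "a \<in> P" for a c using that by (intro word_closed) auto
  have v: "word c [Vec m] \<in> carrier T0" if "m \<in> carrier N" for m c using that by (intro word_closed) auto
  have ii: "word c [Idemp a, Idemp b] \<in> carrier T0" if "a \<in> P" "b \<in> P" for a b c
    using that by (intro word_closed) auto
  have iv: "word c [Idemp a, Vec m] \<in> carrier T0" "word c [Vec m, Idemp a] \<in> carrier T0"
    if "a \<in> P" "m \<in> carrier N" for a m c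
    using that by (intro word_closed; auto)+
  have s: "(\<Oplus>\<^bsub>T0\<^esub>a\<in>P. word 1 [Idemp a]) \<in> carrier T0" using i by (intro T.finsum_closed) auto
  show ?thesis
    unfolding tensor_relations_def T0_eq Let_def
  proof (intro Un_least subsetI)
    fix r assume "r \<in> {word 1 [Idemp a, Idemp b] \<ominus>\<^bsub>T0\<^esub> (if a = b then word 1 [Idemp a] else \<zero>\<^bsub>T0\<^esub>) | a b. a \<in> P \<and> b \<in> P}"
    then obtain a b where "a \<in> P" "b \<in> P" "r = word 1 [Idemp a, Idemp b] \<ominus>\<^bsub>T0\<^esub> (if a = b then word 1 [Idemp a] else \<zero>\<^bsub>T0\<^esub>)"
      by blast
    then show "r \<in> carrier T0" using ii[of a b] i[of a] by (cases "a = b") (auto intro!: T.minus_closed)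
  next
    fix r assume "r \<in> {(\<Oplus>\<^bsub>T0\<^esub>a\<in>P. word 1 [Idemp a]) \<ominus>\<^bsub>T0\<^esub> \<one>\<^bsub>T0\<^esub>}"
    then show "r \<in> carrier T0" using T.minus_closed[OF s T.one_closed] by blast
  next
    fix r assume "r \<in> {word 1 [Vec (vadd N m n)] \<ominus>\<^bsub>T0\<^esub> (word 1 [Vec m] \<oplus>\<^bsub>T0\<^esub> word 1 [Vec n]) | m n.
        m \<in> carrier N \<and> n \<in> carrier N}"
    then show "r \<in> carrier T0" using T.minus_closed[OF v T.a_closed[OF v v]] N_vadd by blast
  next
    fix r assume "r \<in> {word 1 [Vec (vscale N c m)] \<ominus>\<^bsub>T0\<^esub> word c [Vec m] | c m. m \<in> carrier N}"
    then show "r \<in> carrier T0" using T.minus_closed[OF v v] N_vscale by blast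
  next
    fix r assume "r \<in> {word 1 [Idemp a, Vec m] \<ominus>\<^bsub>T0\<^esub> word 1 [Vec (lact N a m)] | a m. a \<in> P \<and> m \<in> carrier N}"
    then show "r \<in> carrier T0" using T.minus_closed[OF iv(1) v] N_act(1) by blast
  next
    fix r assume "r \<in> {word 1 [Vec m, Idemp a] \<ominus>\<^bsub>T0\<^esub> word 1 [Vec (ract N m a)] | a m. a \<in> P \<and> m \<in> carrier N}"
    then show "r \<in> carrier T0" using T.minus_closed[OF iv(2) v] N_act(2) by blast
  qed
qed

lemma tensor_ideal_ideal: "ideal (tensor_ideal P N) T0"
  unfolding tensor_ideal_def T0_eq
  by (rule ring.genideal_ideal[OF free_algebra_ring tensor_relations_closed])

abbreviation "TA \<equiv> tensor_algebra P N"

lemma TA_eq: "TA = T0 Quot tensor_ideal P N" by (simp add: tensor_algebra_def T0_eq)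

lemma TA_ring: "ring TA"
  unfolding TA_eq by (rule ideal.quotient_is_ring[OF tensor_ideal_ideal])

lemma tensor_class_eq: "tensor_class P N f = tensor_ideal P N +>\<^bsub>T0\<^esub> f"
  by (simp add: tensor_class_def T0_eq)

lemma formal_closed:
  assumes "\<phi> \<in> formal_tensors N" shows "\<phi> \<in> carrier T0"
  unfolding free_algebra_carrier
proof (intro conjI allI impI)
  show "finite {w. \<phi> w \<noteq> 0}" using assms by (simp add: formal_tensors_def)
  fix w assume "\<phi> w \<noteq> 0"
  then have "w \<in> {[Vec m, Vec n] | m n. m \<in> carrier N \<and> n \<in> carrier N}"
    using assms unfolding formal_tensors_def by blast
  then show "w \<in> lists X" by auto
qed

text \<open>The map stays on the free algebra, and its vanishing on the relations is a separate
  conclusion: \<open>RR_value\<close> needs its values on formal tensors, while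
  \<open>dual_map\<close> passes to a further quotient.\<close>

lemma tensor_lift:
  fixes s :: "real \<Rightarrow> 'r::ring_1" and m :: "('p, 'm) tensor_gen \<Rightarrow> 'r"
  assumes s: "\<And>c d. s (c + d) = s c + s d" "\<And>c d. s (c * d) = s c * s d"
    and comm: "\<And>c x. x \<in> X \<Longrightarrow> s c * m x = m x * s c" and one: "\<And>x. x \<in> X \<Longrightarrow> s 1 * m x = m x"
    and idem: "\<And>a b. a \<in> P \<Longrightarrow> b \<in> P \<Longrightarrow> m (Idemp a) * m (Idemp b) = (if a = b then m (Idemp a) else 0)"
      "(\<Sum>a\<in>P. m (Idemp a)) = s 1"
    and add: "\<And>f g. f \<in> carrier N \<Longrightarrow> g \<in> carrier N \<Longrightarrow> m (Vec (vadd N f g)) = m (Vec f) + m (Vec g)"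
    and scale: "\<And>c f. f \<in> carrier N \<Longrightarrow> m (Vec (vscale N c f)) = s c * m (Vec f)"
    and act: "\<And>a f. a \<in> P \<Longrightarrow> f \<in> carrier N \<Longrightarrow> m (Vec (lact N a f)) = m (Idemp a) * m (Vec f)"
      "\<And>a f. a \<in> P \<Longrightarrow> f \<in> carrier N \<Longrightarrow> m (Vec (ract N f a)) = m (Vec f) * m (Idemp a)"
  obtains \<Phi> where "ring_map T0 \<Phi>" "\<And>w c. w \<in> lists X \<Longrightarrow> \<Phi> (word c w) = s c * prod_list (map m w)"
    "\<And>r. r \<in> tensor_relations P N \<Longrightarrow> \<Phi> r = 0"
    "\<And>\<phi>. \<phi> \<in> formal_tensors N \<Longrightarrow> \<Phi> \<phi> = (\<Sum>x\<in>{(f, g). \<phi> [Vec f, Vec g] \<noteq> 0}.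
      s (\<phi> [Vec (fst x), Vec (snd x)]) * (m (Vec (fst x)) * m (Vec (snd x))))"
proof -
  interpret T: ring T0 by (rule free_algebra_ring)
  obtain \<Phi> where \<Phi>: "ring_map T0 \<Phi>" "\<And>w c. w \<in> lists X \<Longrightarrow> \<Phi> (word c w) = s c * prod_list (map m w)"
    "\<And>f. f \<in> carrier T0 \<Longrightarrow> \<Phi> f = (\<Sum>w\<in>{w. f w \<noteq> 0}. s (f w) * prod_list (map m w))"
    by (rule free_algebra_lift[of s X m, OF s comm]) (assumption, rule that)
  have c1: "word c [x] \<in> carrier T0" if "x \<in> X" for c x using that by (intro word_closed) simp
  have c2: "word c [x, y] \<in> carrier T0" if "x \<in> X" "y \<in> X" for c x y using that by (intro word_closed) simp
  have w1: "\<Phi> (word c [x]) = s c * m x" if "x \<in> X" for c x using \<Phi>(2)[of "[x]" c] that by simp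
  have w2: "\<Phi> (word 1 [x, y]) = m x * m y" if "x \<in> X" "y \<in> X" for x y
    using \<Phi>(2)[of "[x, y]" 1] that one[of x] by (simp flip: mult.assoc)
  have i: "Idemp a \<in> X" if "a \<in> P" for a using that by blast
  have v: "Vec f \<in> X" if "f \<in> carrier N" for f using that by blast
  note diff = ring_map_diff[OF free_algebra_ring \<Phi>(1)]
  have rel: "\<Phi> r = 0" if "r \<in> tensor_relations P N" for r
    using that unfolding tensor_relations_def T0_eq Let_def
  proof (elim UnE)
    assume "r \<in> {word 1 [Idemp a, Idemp b] \<ominus>\<^bsub>T0\<^esub> (if a = b then word 1 [Idemp a] else \<zero>\<^bsub>T0\<^esub>) | a b. a \<in> P \<and> b \<in> P}"
    then obtain a b where r: "r = word 1 [Idemp a, Idemp b] \<ominus>\<^bsub>T0\<^esub> (if a = b then word 1 [Idemp a] else \<zero>\<^bsub>T0\<^esub>)"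
      and ab: "a \<in> P" "b \<in> P" by blast
    have "\<Phi> r = \<Phi> (word 1 [Idemp a, Idemp b]) - \<Phi> (if a = b then word 1 [Idemp a] else \<zero>\<^bsub>T0\<^esub>)"
      unfolding r by (rule diff[OF c2[OF i i]]) (use ab c1[OF i] in auto)
    then show ?thesis using ab ring_map_zero[OF free_algebra_ring \<Phi>(1)]
      by (cases "a = b") (simp_all add: w1[OF i] w2[OF i i] idem(1) one[OF i])
  next
    assume "r \<in> {(\<Oplus>\<^bsub>T0\<^esub>a\<in>P. word 1 [Idemp a]) \<ominus>\<^bsub>T0\<^esub> \<one>\<^bsub>T0\<^esub>}"
    then have r: "r = (\<Oplus>\<^bsub>T0\<^esub>a\<in>P. word 1 [Idemp a]) \<ominus>\<^bsub>T0\<^esub> \<one>\<^bsub>T0\<^esub>" by blast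
    have "(\<Oplus>\<^bsub>T0\<^esub>a\<in>P. word 1 [Idemp a]) \<in> carrier T0" using c1[OF i] by (intro T.finsum_closed) auto
    then have "\<Phi> r = \<Phi> (\<Oplus>\<^bsub>T0\<^esub>a\<in>P. word 1 [Idemp a]) - \<Phi> \<one>\<^bsub>T0\<^esub>"
      unfolding r by (rule diff) (rule T.one_closed)
    also have "\<Phi> (\<Oplus>\<^bsub>T0\<^esub>a\<in>P. word 1 [Idemp a]) = (\<Sum>a\<in>P. \<Phi> (word 1 [Idemp a]))"
      by (rule ring_map_finsum[OF free_algebra_ring \<Phi>(1) finite_idem c1[OF i]])
    also have "\<dots> = s 1" unfolding idem(2)[symmetric] by (intro sum.cong refl) (simp add: w1[OF i] one[OF i])
    also have "\<Phi> \<one>\<^bsub>T0\<^esub> = s 1" using \<Phi>(2)[of "[]" 1] by (simp add: free_algebra_simps(2))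
    finally show ?thesis by simp
  next
    assume "r \<in> {word 1 [Vec (vadd N m n)] \<ominus>\<^bsub>T0\<^esub> (word 1 [Vec m] \<oplus>\<^bsub>T0\<^esub> word 1 [Vec n]) | m n.
        m \<in> carrier N \<and> n \<in> carrier N}"
    then obtain f g where r: "r = word 1 [Vec (vadd N f g)] \<ominus>\<^bsub>T0\<^esub> (word 1 [Vec f] \<oplus>\<^bsub>T0\<^esub> word 1 [Vec g])"
      and fg: "f \<in> carrier N" "g \<in> carrier N" by blast
    have "\<Phi> r = \<Phi> (word 1 [Vec (vadd N f g)]) - (\<Phi> (word 1 [Vec f]) + \<Phi> (word 1 [Vec g]))"
      unfolding r diff[OF c1[OF v[OF N_vadd[OF fg]]] T.a_closed[OF c1[OF v[OF fg(1)]] c1[OF v[OF fg(2)]]]]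
        ring_mapD(1)[OF \<Phi>(1) c1[OF v[OF fg(1)]] c1[OF v[OF fg(2)]]] ..
    then show ?thesis using fg N_vadd by (simp add: w1[OF v] one[OF v] add distrib_left)
  next
    assume "r \<in> {word 1 [Vec (vscale N c m)] \<ominus>\<^bsub>T0\<^esub> word c [Vec m] | c m. m \<in> carrier N}"
    then obtain c f where r: "r = word 1 [Vec (vscale N c f)] \<ominus>\<^bsub>T0\<^esub> word c [Vec f]" and f: "f \<in> carrier N" by blast
    have "\<Phi> r = \<Phi> (word 1 [Vec (vscale N c f)]) - \<Phi> (word c [Vec f])"
      unfolding r by (rule diff[OF c1[OF v[OF N_vscale[OF f]]] c1[OF v[OF f]]])
    also have "\<Phi> (word 1 [Vec (vscale N c f)]) = m (Vec (vscale N c f))"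
      using N_vscale[OF f] by (simp only: w1[OF v] one[OF v])
    finally show ?thesis using f by (simp add: w1[OF v] scale)
  next
    assume "r \<in> {word 1 [Idemp a, Vec m] \<ominus>\<^bsub>T0\<^esub> word 1 [Vec (lact N a m)] | a m. a \<in> P \<and> m \<in> carrier N}"
    then obtain a f where r: "r = word 1 [Idemp a, Vec f] \<ominus>\<^bsub>T0\<^esub> word 1 [Vec (lact N a f)]"
      and af: "a \<in> P" "f \<in> carrier N" by blast
    have "\<Phi> r = \<Phi> (word 1 [Idemp a, Vec f]) - \<Phi> (word 1 [Vec (lact N a f)])"
      unfolding r by (rule diff[OF c2[OF i[OF af(1)] v[OF af(2)]] c1[OF v[OF N_act(1)[OF af]]]])
    also have "\<Phi> (word 1 [Vec (lact N a f)]) = m (Vec (lact N a f))"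
      using N_act(1)[OF af] by (simp only: w1[OF v] one[OF v])
    finally show ?thesis using af by (simp add: w2[OF i v] act)
  next
    assume "r \<in> {word 1 [Vec m, Idemp a] \<ominus>\<^bsub>T0\<^esub> word 1 [Vec (ract N m a)] | a m. a \<in> P \<and> m \<in> carrier N}"
    then obtain a f where r: "r = word 1 [Vec f, Idemp a] \<ominus>\<^bsub>T0\<^esub> word 1 [Vec (ract N f a)]"
      and af: "a \<in> P" "f \<in> carrier N" by blast
    have "\<Phi> r = \<Phi> (word 1 [Vec f, Idemp a]) - \<Phi> (word 1 [Vec (ract N f a)])"
      unfolding r by (rule diff[OF c2[OF v[OF af(2)] i[OF af(1)]] c1[OF v[OF N_act(2)[OF af]]]])
    also have "\<Phi> (word 1 [Vec (ract N f a)]) = m (Vec (ract N f a))"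
      using N_act(2)[OF af] by (simp only: w1[OF v] one[OF v])
    finally show ?thesis using af by (simp add: w2[OF v i] act)
  qed
  have formal: "\<Phi> \<phi> = (\<Sum>x\<in>{(f, g). \<phi> [Vec f, Vec g] \<noteq> 0}.
      s (\<phi> [Vec (fst x), Vec (snd x)]) * (m (Vec (fst x)) * m (Vec (snd x))))" if \<phi>: "\<phi> \<in> formal_tensors N" for \<phi>
  proof -
    have "w \<in> (\<lambda>x. [Vec (fst x), Vec (snd x)]) ` {(f, g). \<phi> [Vec f, Vec g] \<noteq> 0}" if nz: "\<phi> w \<noteq> 0" for w
    proof -
      obtain f g where "w = [Vec f, Vec g]" using \<phi> nz unfolding formal_tensors_def by blast
      then show ?thesis using nz by (intro image_eqI[of _ _ "(f, g)"]) auto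
    qed
    then have img: "{w. \<phi> w \<noteq> 0} = (\<lambda>x. [Vec (fst x), Vec (snd x)]) ` {(f, g). \<phi> [Vec f, Vec g] \<noteq> 0}" by auto
    have inj: "inj_on (\<lambda>x. [Vec (fst x), Vec (snd x)]) {(f, g). \<phi> [Vec f, Vec g] \<noteq> 0}"
      by (auto simp: inj_on_def)
    show ?thesis
      unfolding \<Phi>(3)[OF formal_closed[OF \<phi>]] img sum.reindex[OF inj] by simp
  qed
  show ?thesis by (rule that[of \<Phi>, OF \<Phi>(1,2) rel formal])
qed

end

section \<open>The quadratic dual as a quotient of the tensor algebra\<close>

locale quadratic_data = tensor_data P N for P :: "'p set" and N :: "('p, 'm \<Rightarrow> real) bimodule" +
  fixes M :: "('p, 'm) bimodule" and R :: "(('p, 'm) tensor_gen list \<Rightarrow> real) set set"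
  assumes N_def: "N = dual_bimodule M"
begin

abbreviation "D \<equiv> quadratic_dual P M R"

lemma annihilator_closed: "annihilator P M R \<subseteq> carrier TA"
  unfolding annihilator_def N_def[symmetric] TA_eq carrier_Quot tensor_class_eq using formal_closed by blast

definition "ann_ideal = Idl\<^bsub>TA\<^esub> (annihilator P M R)"

lemma ann_ideal_ideal: "ideal ann_ideal TA"
  unfolding ann_ideal_def by (rule ring.genideal_ideal[OF TA_ring annihilator_closed])

lemma D_eq: "D = TA Quot ann_ideal"
  by (simp only: quadratic_dual_def Let_def ann_ideal_def N_def[symmetric])

lemma D_ring: "ring D"
  unfolding D_eq by (rule ideal.quotient_is_ring[OF ann_ideal_ideal])

definition "Dcls f = ann_ideal +>\<^bsub>TA\<^esub> tensor_class P N f"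

definition "dcl f = emb D (Dcls f)"

lemma D_carrier: "carrier D = Dcls ` carrier T0"
  unfolding D_eq carrier_Quot TA_eq Dcls_def tensor_class_eq by (simp add: image_image)

lemma dcl_ring_map: "ring_map T0 dcl"
proof -
  have "ring_map (TA Quot ann_ideal) (emb D)" using emb_ring_map[OF D_ring] by (simp add: D_eq)
  then have "ring_map (T0 Quot tensor_ideal P N) (\<lambda>x. emb D (ann_ideal +>\<^bsub>TA\<^esub> x))"
    using quotient_ring_map[OF ann_ideal_ideal] by (simp add: TA_eq)
  from quotient_ring_map[OF tensor_ideal_ideal this] show ?thesis
    by (simp add: dcl_def[abs_def] Dcls_def tensor_class_eq)
qed

lemma emb_D_zero: "emb D \<zero>\<^bsub>D\<^esub> = 0"
  by (rule ring_map_zero[OF D_ring emb_ring_map[OF D_ring]])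

lemma dcl_relation:
  assumes "r \<in> tensor_relations P N" shows "dcl r = 0"
proof -
  have r: "r \<in> carrier T0" using assms tensor_relations_closed by blast
  have "r \<in> tensor_ideal P N"
    unfolding tensor_ideal_def T0_eq using ring.genideal_self[OF free_algebra_ring tensor_relations_closed] assms by blast
  then have "tensor_class P N r = \<zero>\<^bsub>TA\<^esub>"
    unfolding tensor_class_eq TA_eq by (simp only: coset_eq_zero_iff[OF tensor_ideal_ideal r])
  moreover have "\<zero>\<^bsub>TA\<^esub> \<in> ann_ideal"
    by (rule additive_subgroup.zero_closed[OF ideal.axioms(1)[OF ann_ideal_ideal]])
  ultimately have "Dcls r = \<zero>\<^bsub>D\<^esub>"
    unfolding Dcls_def D_eq using coset_eq_zero_iff[OF ann_ideal_ideal ring.ring_simprules(2)[OF TA_ring]] by simp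
  then show ?thesis by (simp add: dcl_def emb_D_zero)
qed

text \<open>The source of all relations of the quadratic dual beyond those of the tensor
  algebra.\<close>

lemma dcl_annihilator:
  assumes "\<phi> \<in> formal_tensors N"
    and "\<And>q. q \<in> formal_tensors M \<Longrightarrow> tensor_class P M q \<in> R \<Longrightarrow> tensor_pairing P M \<phi> q = 0"
  shows "dcl \<phi> = 0"
proof -
  have *: "tensor_class P N \<phi> \<in> annihilator P M R"
    using assms by (auto simp: annihilator_def N_def)
  then have c: "tensor_class P N \<phi> \<in> carrier TA" using annihilator_closed by blast
  have "tensor_class P N \<phi> \<in> ann_ideal"
    unfolding ann_ideal_def using ring.genideal_self[OF TA_ring annihilator_closed] * by blast
  then have "Dcls \<phi> = \<zero>\<^bsub>D\<^esub>"
    unfolding Dcls_def D_eq by (simp only: coset_eq_zero_iff[OF ann_ideal_ideal c])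
  then show ?thesis by (simp add: dcl_def emb_D_zero)
qed

lemma D_lift:
  fixes h :: "_ \<Rightarrow> 'r::ring"
  assumes h: "ring_map T0 h" and rel: "\<And>r. r \<in> tensor_relations P N \<Longrightarrow> h r = 0"
    and ann: "\<And>\<phi>. \<phi> \<in> formal_tensors N \<Longrightarrow>
      (\<And>q. q \<in> formal_tensors M \<Longrightarrow> tensor_class P M q \<in> R \<Longrightarrow> tensor_pairing P M \<phi> q = 0) \<Longrightarrow> h \<phi> = 0"
  obtains h' where "ring_map D h'" "\<And>f. f \<in> carrier T0 \<Longrightarrow> h' (Dcls f) = h f"
proof -
  obtain h1 where h1: "ring_map TA h1" "\<And>f. f \<in> carrier T0 \<Longrightarrow> h1 (tensor_class P N f) = h f"
    by (rule quotient_lift[OF free_algebra_ring h tensor_relations_closed rel])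
      (simp_all add: TA_eq tensor_class_eq tensor_ideal_def T0_eq)
  have z: "h1 y = 0" if y: "y \<in> annihilator P M R" for y
  proof -
    obtain \<phi> where \<phi>: "y = tensor_class P N \<phi>" "\<phi> \<in> formal_tensors N"
      "\<And>q. q \<in> formal_tensors M \<Longrightarrow> tensor_class P M q \<in> R \<Longrightarrow> tensor_pairing P M \<phi> q = 0"
      using y by (auto simp: annihilator_def N_def)
    show ?thesis unfolding \<phi>(1) using h1(2)[OF formal_closed[OF \<phi>(2)]] ann[OF \<phi>(2,3)] by simp
  qed
  obtain h2 where h2: "ring_map D h2" "\<And>y. y \<in> carrier TA \<Longrightarrow> h2 (ann_ideal +>\<^bsub>TA\<^esub> y) = h1 y"
    by (rule quotient_lift[OF TA_ring h1(1) annihilator_closed z])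
      (simp_all add: D_eq ann_ideal_def)
  have "h2 (Dcls f) = h f" if "f \<in> carrier T0" for f
    using that h2(2)[of "tensor_class P N f"] h1(2)[OF that]
    by (simp add: Dcls_def tensor_class_eq TA_eq carrier_Quot)
  then show ?thesis using that h2(1) by blast
qed

definition "sc c = dcl (word c [])"
definition "Did a = dcl (word 1 [Idemp a])"
definition "DV f = dcl (word 1 [Vec f])"

lemma dcl_word_mult:
  assumes "u \<in> lists X" "v \<in> lists X"
  shows "dcl (word c u) * dcl (word d v) = dcl (word (c * d) (u @ v))"
  using ring_mapD(2)[OF dcl_ring_map word_closed[OF assms(1)] word_closed[OF assms(2)], of c d]
  by (simp add: word_mult)

lemma sc_add: "sc (c + d) = sc c + sc d"
  unfolding sc_def word_add[where X = X, symmetric]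
  by (rule ring_mapD(1)[OF dcl_ring_map]) (auto intro!: word_closed simp del: lists_eq_set)

lemma sc_mult: "sc (c * d) = sc c * sc d"
  unfolding sc_def by (subst dcl_word_mult) simp_all

lemma sc_word: "w \<in> lists X \<Longrightarrow> sc c * dcl (word d w) = dcl (word (c * d) w)"
  "w \<in> lists X \<Longrightarrow> dcl (word d w) * sc c = dcl (word (c * d) w)"
  unfolding sc_def by (subst dcl_word_mult; simp add: mult.commute)+

lemma Did_lists: "a \<in> P \<Longrightarrow> [Idemp a] \<in> lists X" "f \<in> carrier N \<Longrightarrow> [Vec f] \<in> lists X"
  by auto

lemma sc_comm: "a \<in> P \<Longrightarrow> sc c * Did a = Did a * sc c" "f \<in> carrier N \<Longrightarrow> sc c * DV f = DV f * sc c"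
  unfolding Did_def DV_def by (simp_all only: sc_word Did_lists)

lemma sc_one: "a \<in> P \<Longrightarrow> sc 1 * Did a = Did a" "f \<in> carrier N \<Longrightarrow> sc 1 * DV f = DV f"
  unfolding Did_def DV_def by (simp_all only: sc_word Did_lists mult_1)

lemma dcl_diff:
  assumes "x \<in> carrier T0" "y \<in> carrier T0" "x \<ominus>\<^bsub>T0\<^esub> y \<in> tensor_relations P N"
  shows "dcl x = dcl y"
  using dcl_relation[OF assms(3)] ring_map_diff[OF free_algebra_ring dcl_ring_map assms(1,2)] by simp

lemma X_word: "x \<in> X \<Longrightarrow> word c [x] \<in> carrier T0" "x \<in> X \<Longrightarrow> y \<in> X \<Longrightarrow> word c [x, y] \<in> carrier T0"
  by (auto intro!: word_closed simp del: lists_eq_set)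

lemma Did_mult:
  assumes "a \<in> P" "b \<in> P" shows "Did a * Did b = (if a = b then Did a else 0)"
proof -
  let ?r = "if a = b then word 1 [Idemp a] else \<zero>\<^bsub>T0\<^esub>"
  have "word 1 [Idemp a, Idemp b] \<ominus>\<^bsub>T0\<^esub> ?r \<in> tensor_relations P N"
    unfolding tensor_relations_def T0_eq Let_def using assms by blast
  moreover have "?r \<in> carrier T0" using assms X_word ring.ring_simprules(2)[OF free_algebra_ring] by auto
  ultimately have "dcl (word 1 [Idemp a, Idemp b]) = dcl ?r"
    using assms by (intro dcl_diff X_word) auto
  then show ?thesis
    using dcl_word_mult[OF Did_lists(1)[OF assms(1)] Did_lists(1)[OF assms(2)], of 1 1]
      ring_map_zero[OF free_algebra_ring dcl_ring_map] by (simp add: Did_def)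
qed

lemma Did_sum: "(\<Sum>a\<in>P. Did a) = sc 1"
proof -
  interpret T: ring T0 by (rule free_algebra_ring)
  have i: "word 1 [Idemp a] \<in> carrier T0" if "a \<in> P" for a using that X_word by auto
  have "(\<Oplus>\<^bsub>T0\<^esub>a\<in>P. word 1 [Idemp a]) \<ominus>\<^bsub>T0\<^esub> \<one>\<^bsub>T0\<^esub> \<in> tensor_relations P N"
    unfolding tensor_relations_def T0_eq Let_def by blast
  then have "dcl (\<Oplus>\<^bsub>T0\<^esub>a\<in>P. word 1 [Idemp a]) = dcl \<one>\<^bsub>T0\<^esub>"
    using i by (intro dcl_diff T.finsum_closed T.one_closed) auto
  then show ?thesis
    using ring_map_finsum[OF free_algebra_ring dcl_ring_map finite_idem i]
    by (simp add: Did_def sc_def free_algebra_simps(2))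
qed

lemma DV_add:
  assumes "f \<in> carrier N" "g \<in> carrier N" shows "DV (vadd N f g) = DV f + DV g"
proof -
  interpret T: ring T0 by (rule free_algebra_ring)
  have c: "word 1 [Vec f] \<in> carrier T0" "word 1 [Vec g] \<in> carrier T0" "word 1 [Vec (vadd N f g)] \<in> carrier T0"
    using assms N_vadd by (auto intro!: X_word)
  have "word 1 [Vec (vadd N f g)] \<ominus>\<^bsub>T0\<^esub> (word 1 [Vec f] \<oplus>\<^bsub>T0\<^esub> word 1 [Vec g]) \<in> tensor_relations P N"
    unfolding tensor_relations_def T0_eq Let_def using assms by blast
  then have "dcl (word 1 [Vec (vadd N f g)]) = dcl (word 1 [Vec f] \<oplus>\<^bsub>T0\<^esub> word 1 [Vec g])"
    using c by (intro dcl_diff T.a_closed)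
  then show ?thesis using ring_mapD(1)[OF dcl_ring_map c(1,2)] by (simp add: DV_def)
qed

lemma DV_scale:
  assumes "f \<in> carrier N" shows "DV (vscale N c f) = sc c * DV f"
proof -
  have "word 1 [Vec (vscale N c f)] \<ominus>\<^bsub>T0\<^esub> word c [Vec f] \<in> tensor_relations P N"
    unfolding tensor_relations_def T0_eq Let_def using assms by blast
  then have "DV (vscale N c f) = dcl (word c [Vec f])"
    unfolding DV_def using assms N_vscale by (intro dcl_diff X_word) auto
  also have "\<dots> = sc c * DV f"
    unfolding DV_def by (simp only: sc_word Did_lists assms mult_1_right)
  finally show ?thesis .
qed

lemma Did_DV:
  assumes "a \<in> P" "f \<in> carrier N"
  shows "Did a * DV f = DV (lact N a f)" "DV f * Did a = DV (ract N f a)"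
proof -
  have "word 1 [Idemp a, Vec f] \<ominus>\<^bsub>T0\<^esub> word 1 [Vec (lact N a f)] \<in> tensor_relations P N"
    "word 1 [Vec f, Idemp a] \<ominus>\<^bsub>T0\<^esub> word 1 [Vec (ract N f a)] \<in> tensor_relations P N"
    unfolding tensor_relations_def T0_eq Let_def using assms by blast+
  then have *: "dcl (word 1 [Idemp a, Vec f]) = DV (lact N a f)" "dcl (word 1 [Vec f, Idemp a]) = DV (ract N f a)"
    unfolding DV_def using assms N_act by (intro dcl_diff X_word; auto)+
  show "Did a * DV f = DV (lact N a f)" "DV f * Did a = DV (ract N f a)"
    unfolding *[symmetric] unfolding Did_def DV_def
    by (simp_all add: dcl_word_mult[OF Did_lists(1,2)] dcl_word_mult[OF Did_lists(2,1)] assms)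
qed

lemma dcl_tensor_sum:
  assumes "finite B" "\<And>b. b \<in> B \<Longrightarrow> f b \<in> carrier N" "\<And>b. b \<in> B \<Longrightarrow> g b \<in> carrier N"
  shows "dcl (tensor_sum B c f g) = (\<Sum>b\<in>B. sc (c b) * (DV (f b) * DV (g b)))"
proof -
  have "dcl (tensor_sum B c f g) = (\<Sum>b\<in>B. dcl (word (c b) [Vec (f b), Vec (g b)]))"
    by (rule free_algebra_tensor_sum[OF dcl_ring_map]) (use assms in auto)
  also have "\<dots> = (\<Sum>b\<in>B. sc (c b) * (DV (f b) * DV (g b)))"
  proof (rule sum.cong[OF refl])
    fix b assume "b \<in> B"
    then have l: "[Vec (f b)] \<in> lists X" "[Vec (g b)] \<in> lists X" using assms by auto
    then have l2: "[Vec (f b)] @ [Vec (g b)] \<in> lists X" by simp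
    have "DV (f b) * DV (g b) = dcl (word 1 ([Vec (f b)] @ [Vec (g b)]))"
      unfolding DV_def using dcl_word_mult[OF l, of 1 1] by simp
    then show "dcl (word (c b) [Vec (f b), Vec (g b)]) = sc (c b) * (DV (f b) * DV (g b))"
      using sc_word(1)[OF l2, of "c b" 1] by simp
  qed
  finally show ?thesis .
qed

end

section \<open>The degree one part of \<open>A(W)\<close>\<close>

lemma single_Suc_neq_zero: "Poly_Mapping.single i (Suc 0) \<noteq> 0"
proof
  assume "Poly_Mapping.single i (Suc 0) = 0"
  then have "Poly_Mapping.lookup (Poly_Mapping.single i (Suc 0)) i = 0" by simp
  then show False by (simp add: lookup_single)
qed

text \<open>Exponents add up to zero only if both are zero.\<close>

lemma lookup_mult_zero:
  fixes p q :: "'i mpoly"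
  shows "Poly_Mapping.lookup (p * q) 0 = Poly_Mapping.lookup p 0 * Poly_Mapping.lookup q 0"
proof (induction p rule: poly_mapping_single_induct)
  case (single k x)
  show ?case
  proof (induction q rule: poly_mapping_single_induct)
    case (single l y)
    have "k + l = 0 \<longleftrightarrow> k = 0 \<and> l = 0"
      by (auto simp: poly_mapping_eq_iff lookup_add fun_eq_iff)
    then show ?case by (auto simp: mult_single lookup_single when_def)
  qed (simp add: lookup_add distrib_left)
qed (simp add: lookup_add distrib_right)

text \<open>The Leibniz rule at the origin: the exponent of a single variable splits only into zero
  and itself.\<close>

lemma lookup_mult_var:
  fixes p q :: "'i mpoly"
  shows "Poly_Mapping.lookup (p * q) (Poly_Mapping.single i (Suc 0)) =
    Poly_Mapping.lookup p 0 * Poly_Mapping.lookup q (Poly_Mapping.single i (Suc 0)) +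
    Poly_Mapping.lookup p (Poly_Mapping.single i (Suc 0)) * Poly_Mapping.lookup q 0"
proof (induction p rule: poly_mapping_single_induct)
  case (single k x)
  show ?case
  proof (induction q rule: poly_mapping_single_induct)
    case (single l y)
    let ?e = "Poly_Mapping.single i (1::nat)"
    have e0: "?e \<noteq> 0" using single_Suc_neq_zero by simp
    have "k + l = ?e \<longleftrightarrow> k = 0 \<and> l = ?e \<or> k = ?e \<and> l = 0"
    proof
      assume kl: "k + l = ?e"
      have j: "Poly_Mapping.lookup k j + Poly_Mapping.lookup l j = (if j = i then 1 else 0)" for j
        using arg_cong[OF kl, of "\<lambda>f. Poly_Mapping.lookup f j"] by (simp add: lookup_add lookup_single when_def eq_commute)
      have off: "Poly_Mapping.lookup k j = 0 \<and> Poly_Mapping.lookup l j = 0" if "j \<noteq> i" for j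
        using j[of j] that by simp
      have "Poly_Mapping.lookup k i = 0 \<and> Poly_Mapping.lookup l i = 1 \<or> Poly_Mapping.lookup k i = 1 \<and> Poly_Mapping.lookup l i = 0"
        using j[of i] by auto
      then show "k = 0 \<and> l = ?e \<or> k = ?e \<and> l = 0"
      proof
        assume "Poly_Mapping.lookup k i = 0 \<and> Poly_Mapping.lookup l i = 1"
        then have "Poly_Mapping.lookup k j = 0" "Poly_Mapping.lookup l j = Poly_Mapping.lookup ?e j" for j
          using off[of j] by (cases "j = i"; simp add: lookup_single when_def)+
        then show ?thesis by (intro disjI1 conjI poly_mapping_eqI) simp_all
      next
        assume "Poly_Mapping.lookup k i = 1 \<and> Poly_Mapping.lookup l i = 0"
        then have "Poly_Mapping.lookup l j = 0" "Poly_Mapping.lookup k j = Poly_Mapping.lookup ?e j" for j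
          using off[of j] by (cases "j = i"; simp add: lookup_single when_def)+
        then show ?thesis by (intro disjI2 conjI poly_mapping_eqI) simp_all
      qed
    qed auto
    then show ?case using e0 by (auto simp: mult_single lookup_single when_def)
  qed (simp add: lookup_add algebra_simps)
qed (simp add: lookup_add algebra_simps)

lemma lookup_poly_const: "Poly_Mapping.lookup (poly_const c) 0 = c"
  "Poly_Mapping.lookup (poly_const c) (Poly_Mapping.single i (Suc 0)) = 0"
  using single_Suc_neq_zero[of i] by (auto simp: poly_const_def lookup_single when_def)

lemma lookup_poly_var: "Poly_Mapping.lookup (poly_var i) 0 = 0"
  "Poly_Mapping.lookup (poly_var i) (Poly_Mapping.single j (Suc 0)) = (if j = i then 1 else 0)"
  by (auto simp: poly_var_def lookup_single when_def poly_mapping_eq_iff fun_eq_iff)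

lemma lookup_poly_one: "Poly_Mapping.lookup (1 :: 'i mpoly) 0 = 1"
  using lookup_poly_const(1)[of 1] by (simp add: poly_const_simps)

lemma homogeneous_zero_iff: "homogeneous 0 p \<longleftrightarrow> (\<exists>c. p = poly_const c)"
proof
  assume h: "homogeneous 0 p"
  have "m = 0" if "m \<in> Poly_Mapping.keys p" for m
    using h that by (auto simp: homogeneous_def poly_mapping_eq_iff fun_eq_iff)
  then have "p = poly_const (Poly_Mapping.lookup p 0)"
    by (intro poly_mapping_eqI) (auto simp: poly_const_def lookup_single when_def in_keys_iff)
  then show "\<exists>c. p = poly_const c" by blast
qed (auto simp: homogeneous_def poly_const_def split: if_splits)

context path_algebra_over
begin

lemma psingle_zero: "psingle S w \<zero> = \<zero>\<^bsub>PA\<^esub>"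
  by (auto simp: psingle_def PA_simps)

text \<open>Supports can shrink under addition. Therefore the induction proves the formula for all
  sufficiently large finite sets of paths; terms outside the support vanish, which brings it back to
  \<open>K\<close>.\<close>

lemma ring_map_support:
  fixes h :: "_ \<Rightarrow> 'r::ring"
  assumes h: "ring_map PA h" and f: "f \<in> carrier PA" and K: "finite K" "{w. f w \<noteq> \<zero>} \<subseteq> K"
  shows "h f = (\<Sum>w\<in>K. h (psingle S w (f w)))"
proof -
  have hz: "h (psingle S w \<zero>) = 0" for w
    using ring_map_zero[OF PA_ring h] by (simp add: psingle_zero)
  have "\<exists>K0. finite K0 \<and> (\<forall>K. finite K \<longrightarrow> K0 \<subseteq> K \<longrightarrow> h f = (\<Sum>w\<in>K. h (psingle S w (f w))))"
    using f
  proof (induction f rule: PA_induct)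
    case zero
    have "h (psingle S w (\<zero>\<^bsub>PA\<^esub> w)) = 0" for w by (simp only: PA_simps hz)
    then show ?case
      using ring_map_zero[OF PA_ring h] by (intro exI[of _ "{}"]) simp
  next
    case (single w s)
    have "h (psingle S w s) = (\<Sum>v\<in>K. h (psingle S v (psingle S w s v)))" if "finite K" "w \<in> K" for K
    proof -
      have "(\<Sum>v\<in>K. h (psingle S v (psingle S w s v))) = (\<Sum>v\<in>K. if v = w then h (psingle S w s) else 0)"
        by (intro sum.cong refl) (simp add: psingle_def[of S w] hz)
      then show ?thesis using that by simp
    qed
    then show ?case by (intro exI[of _ "{w}"]) simp
  next
    case (add f g)
    then obtain K1 K2 where K: "finite K1" "finite K2"
      "\<And>K. finite K \<Longrightarrow> K1 \<subseteq> K \<Longrightarrow> h f = (\<Sum>w\<in>K. h (psingle S w (f w)))"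
      "\<And>K. finite K \<Longrightarrow> K2 \<subseteq> K \<Longrightarrow> h g = (\<Sum>w\<in>K. h (psingle S w (g w)))" by blast
    have p: "h (psingle S w ((f \<oplus>\<^bsub>PA\<^esub> g) w)) = h (psingle S w (f w)) + h (psingle S w (g w))" for w
    proof (cases "w \<in> paths F E")
      case True
      have c: "f w \<in> carrier S" "g w \<in> carrier S" using PA_carrierD(1) add(1,2) by auto
      have "psingle S w ((f \<oplus>\<^bsub>PA\<^esub> g) w) = psingle S w (f w) \<oplus>\<^bsub>PA\<^esub> psingle S w (g w)"
        unfolding PA_simps(4)[of f g w] by (rule psingle_add[OF c])
      then show ?thesis
        using ring_mapD(1)[OF h psingle_closed[OF True c(1)] psingle_closed[OF True c(2)]] by simp
    next
      case False
      then have "f w = \<zero>" "g w = \<zero>" using PA_carrierD(3) add(1,2) by blast+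
      then show ?thesis by (simp add: PA_simps hz)
    qed
    have "h (f \<oplus>\<^bsub>PA\<^esub> g) = (\<Sum>w\<in>K. h (psingle S w ((f \<oplus>\<^bsub>PA\<^esub> g) w)))" if "finite K" "K1 \<union> K2 \<subseteq> K" for K
      using K(3)[of K] K(4)[of K] that ring_mapD(1)[OF h add(1,2)] by (simp add: p sum.distrib)
    then show ?case using K(1,2) by (intro exI[of _ "K1 \<union> K2"]) simp
  qed
  then obtain K0 where K0: "finite K0" "\<And>K. finite K \<Longrightarrow> K0 \<subseteq> K \<Longrightarrow> h f = (\<Sum>w\<in>K. h (psingle S w (f w)))"
    by blast
  have out: "h (psingle S w (f w)) = 0" if "w \<notin> K" for w
  proof -
    have "f w = \<zero>" using that K(2) by blast
    then show ?thesis by (simp add: hz)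
  qed
  have "h f = (\<Sum>w\<in>K \<union> K0. h (psingle S w (f w)))" using K0 K(1) by blast
  also have "\<dots> = (\<Sum>w\<in>K. h (psingle S w (f w)))"
    by (rule sum.mono_neutral_right) (use K0(1) K(1) out in auto)
  finally show ?thesis .
qed

end

section \<open>Arrows and the part of degree one\<close>

context arrangement
begin

interpretation U: arrangement U by (rule dual_arrangement)

text \<open>Restricted to \<open>P\<close>, because the other arrows of the quiver are zero in
  \<open>A(W)\<close> by \<open>AP_unbounded\<close>.\<close>

definition "arrows = {(a, b). a \<in> P \<and> b \<in> P \<and> adj a b}"

definition "A1 = A_degree W 1"

definition "lin c = (\<Sum>e\<in>arrows. AH (poly_const (c e)) * AP (fst e) (snd e))"

lemma finite_arrows: "finite arrows"
  by (rule finite_subset[of _ "P \<times> P"]) (auto simp: arrows_def finite_P)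

lemma arrows_F: "(a, b) \<in> arrows \<Longrightarrow> a \<in> F \<and> b \<in> F \<and> adj a b"
  using P_subset by (auto simp: arrows_def)

lemma arrows_flip: "(a, b) \<in> arrows \<Longrightarrow> \<exists>i. b = flip a i"
  using adj_flip[OF feasible_sign feasible_sign] arrows_F by blast

lemma arrows_sym: "(a, b) \<in> arrows \<Longrightarrow> (b, a) \<in> arrows"
  by (auto simp: arrows_def adj_sym)

lemma lin_add: "lin c + lin d = lin (\<lambda>e. c e + d e)"
  by (simp add: lin_def poly_const_simps AH_add distrib_right sum.distrib)

lemma lin_scale: "AH (poly_const k) * lin c = lin (\<lambda>e. k * c e)"
  by (simp add: lin_def poly_const_simps AH_mult sum_distrib_left mult.assoc)

lemma Aid_AH_AP: "Aid a * (AH q * AP b c) = (if a = b then AH q * AP b c else 0)"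
proof -
  have "Aid a * (AH q * AP b c) = AH q * (Aid a * AP b c)"
    by (simp only: mult.assoc[symmetric] AH_comm(1))
  then show ?thesis by (simp add: Aid_AP(1))
qed

lemma Aid_lin: "Aid a * lin c = lin (\<lambda>e. if fst e = a then c e else 0)"
  "lin c * Aid a = lin (\<lambda>e. if snd e = a then c e else 0)"
proof -
  show "Aid a * lin c = lin (\<lambda>e. if fst e = a then c e else 0)"
    unfolding lin_def sum_distrib_left
    by (intro sum.cong refl) (auto simp: Aid_AH_AP poly_const_simps AH_zero)
  show "lin c * Aid a = lin (\<lambda>e. if snd e = a then c e else 0)"
    unfolding lin_def sum_distrib_right
    by (intro sum.cong refl) (auto simp: mult.assoc Aid_AP poly_const_simps AH_zero)
qed

lemma lin_Aset: "lin c \<in> Aset"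
  unfolding lin_def by (intro Aset_sum Aset_closed AH_Aset AP_Aset)

lemma lin_single: "(a, b) \<in> arrows \<Longrightarrow> lin (\<lambda>e. if e = (a, b) then k else 0) = AH (poly_const k) * AP a b"
proof -
  assume ab: "(a, b) \<in> arrows"
  have "lin (\<lambda>e. if e = (a, b) then k else 0) = (\<Sum>e\<in>arrows. if e = (a, b) then AH (poly_const k) * AP a b else 0)"
    unfolding lin_def by (intro sum.cong refl) (auto simp: poly_const_simps AH_zero)
  then show ?thesis using ab finite_arrows by simp
qed

lemma AP_lin: "(a, b) \<in> arrows \<Longrightarrow> AP a b = lin (\<lambda>e. if e = (a, b) then 1 else 0)"
  by (simp add: lin_single poly_const_simps AH_unit)

text \<open>Degree one leaves only constants times paths with two vertices. Pairs outside
  \<open>arrows\<close> contribute zero, because they are not adjacent or have an end outside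
  \<open>P\<close>.\<close>

lemma A1_iff: "x \<in> A1 \<longleftrightarrow> x \<in> carrier (A_algebra W) \<and> (\<exists>c. emb (A_algebra W) x = lin c)"
proof -
  have pair: "(\<Sum>w\<in>(\<lambda>e. [fst e, snd e]) ` (F \<times> F). AQ (psingle S w (f w))) = lin c"
    if f: "f \<in> carrier Q" and c: "\<And>e. e \<in> F \<times> F \<Longrightarrow> f [fst e, snd e] = cls (poly_const (c e))" for f c
  proof -
    have "(\<Sum>w\<in>(\<lambda>e. [fst e, snd e]) ` (F \<times> F). AQ (psingle S w (f w)))
      = (\<Sum>e\<in>F \<times> F. AQ (psingle S [fst e, snd e] (f [fst e, snd e])))"
      by (subst sum.reindex) (auto simp: inj_on_def)
    also have "\<dots> = (\<Sum>e\<in>F \<times> F. AH (poly_const (c e)) * AP (fst e) (snd e))"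
    proof (rule sum.cong[OF refl])
      fix e assume e: "e \<in> F \<times> F"
      show "AQ (psingle S [fst e, snd e] (f [fst e, snd e])) = AH (poly_const (c e)) * AP (fst e) (snd e)"
      proof (cases "adj (fst e) (snd e)")
        case True
        then show ?thesis using e by (auto simp: c[OF e] AQ_single edge_path AP_def)
      next
        case False
        then have "[fst e, snd e] \<notin> paths F adj" by (simp add: paths_def)
        then have "f [fst e, snd e] = \<zero>\<^bsub>S\<^esub>" using PA.PA_carrierD(3)[OF f[unfolded Q_eq]] by blast
        then show ?thesis using False ring_map_zero[OF Q_ring AQ_ring_map]
          by (simp add: AP_def PA.psingle_zero[folded Q_eq])
      qed
    qed
    also have "\<dots> = lin c"
      unfolding lin_def
    proof (rule sum.mono_neutral_right)
      have "AP (fst e) (snd e) = 0" if "e \<notin> arrows" for e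
        using that AP_unbounded[of "fst e" "snd e"] by (cases e) (auto simp: arrows_def AP_def)
      then show "\<forall>e\<in>F \<times> F - arrows. AH (poly_const (c e)) * AP (fst e) (snd e) = 0" by simp
      show "arrows \<subseteq> F \<times> F" using arrows_F by auto
    qed (simp add: finite_feasible)
    finally show ?thesis .
  qed
  have supp: "finite ((\<lambda>e. [fst e, snd e]) ` (F \<times> F))" by (simp add: finite_feasible)
  show ?thesis
  proof
    assume "x \<in> A1"
    then obtain f where f: "f \<in> carrier Q" "x = A_class W f"
      and deg: "\<And>w. f w \<noteq> \<zero>\<^bsub>S\<^esub> \<Longrightarrow> \<exists>k p. length w - 1 + 2 * k = 1 \<and> homogeneous k p \<and> f w = cls p"
      unfolding A1_def A_degree_def by blast
    have w2: "length w = 2 \<and> (\<exists>c. f w = cls (poly_const c))" if nz: "f w \<noteq> \<zero>\<^bsub>S\<^esub>" for w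
    proof -
      obtain k p where kp: "length w - 1 + 2 * k = 1" "homogeneous k p" "f w = cls p" using deg[OF nz] by blast
      \<comment> \<open>Variables have even degree, so that none can occur. The truncated
        subtraction does no harm: for the empty list the sum would be even.\<close>
      then have "k = 0" "length w = 2" by presburger+
      then show ?thesis using kp(2,3) by (auto simp: homogeneous_zero_iff)
    qed
    have "{w. f w \<noteq> \<zero>\<^bsub>S\<^esub>} \<subseteq> (\<lambda>e. [fst e, snd e]) ` (F \<times> F)"
    proof
      fix w assume "w \<in> {w. f w \<noteq> \<zero>\<^bsub>S\<^esub>}"
      then have nz: "f w \<noteq> \<zero>\<^bsub>S\<^esub>" by simp
      then have "w \<in> paths F adj" using PA.PA_carrierD(3)[OF f(1)[unfolded Q_eq]] by blast
      moreover obtain a b where "w = [a, b]"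
        using w2[OF nz] by (auto simp: length_Suc_conv numeral_2_eq_2)
      ultimately show "w \<in> (\<lambda>e. [fst e, snd e]) ` (F \<times> F)"
        by (intro image_eqI[of _ _ "(a, b)"]) (auto simp: paths_def)
    qed
    then have "AQ f = (\<Sum>w\<in>(\<lambda>e. [fst e, snd e]) ` (F \<times> F). AQ (psingle S w (f w)))"
      by (rule PA.ring_map_support[OF AQ_ring_map[unfolded Q_eq] f(1)[unfolded Q_eq] supp])
    moreover have "\<exists>c. f w = cls (poly_const c)" for w
      using w2[of w] poly_const_simps(3) cls_simps(4) by metis
    then obtain c where "\<And>w. f w = cls (poly_const (c w))" by metis
    ultimately have "AQ f = lin (\<lambda>e. c [fst e, snd e])" using pair[OF f(1)] by simp
    then show "x \<in> carrier (A_algebra W) \<and> (\<exists>c. emb (A_algebra W) x = lin c)"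
      using f A_class_closed by (auto simp: AQ_def)
  next
    assume R: "x \<in> carrier (A_algebra W) \<and> (\<exists>c. emb (A_algebra W) x = lin c)"
    then obtain c where c: "emb (A_algebra W) x = lin c" by blast
    define f where "f w = (if w \<in> (\<lambda>e. [fst e, snd e]) ` arrows then cls (poly_const (c (hd w, last w))) else \<zero>\<^bsub>S\<^esub>)" for w
    have supp2: "{w. f w \<noteq> \<zero>\<^bsub>S\<^esub>} \<subseteq> (\<lambda>e. [fst e, snd e]) ` arrows" by (auto simp: f_def)
    have sub: "(\<lambda>e. [fst e, snd e]) ` arrows \<subseteq> paths F adj"
      using arrows_F by (auto simp: paths_def)
    have fQ: "f \<in> carrier Q"
      unfolding Q_eq
    proof (rule PA.PA_carrierI)
      show "finite {w. f w \<noteq> \<zero>\<^bsub>S\<^esub>}" using supp2 finite_arrows finite_subset by blast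
      show "{w. f w \<noteq> \<zero>\<^bsub>S\<^esub>} \<subseteq> paths F adj" using supp2 sub by blast
    qed (simp add: f_def PA.zero_closed)
    let ?c = "\<lambda>e. if e \<in> arrows then c e else 0"
    have mem: "[fst e, snd e] \<in> (\<lambda>e. [fst e, snd e]) ` arrows \<longleftrightarrow> e \<in> arrows" for e
      by (auto simp: image_iff prod_eq_iff)
    have val: "f [fst e, snd e] = cls (poly_const (?c e))" for e
      unfolding f_def mem by (simp add: poly_const_simps cls_simps)
    have "arrows \<subseteq> F \<times> F" using arrows_F by auto
    then have "{w. f w \<noteq> \<zero>\<^bsub>S\<^esub>} \<subseteq> (\<lambda>e. [fst e, snd e]) ` (F \<times> F)"
      by (rule subset_trans[OF supp2 image_mono])
    then have "AQ f = (\<Sum>w\<in>(\<lambda>e. [fst e, snd e]) ` (F \<times> F). AQ (psingle S w (f w)))"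
      by (rule PA.ring_map_support[OF AQ_ring_map[unfolded Q_eq] fQ[unfolded Q_eq] supp])
    also have "\<dots> = lin ?c" by (rule pair[OF fQ val])
    also have "\<dots> = lin c" by (simp add: lin_def)
    finally have "A_class W f = x"
      using c emb_inj[OF A_ring A_class_closed[OF fQ], of x] R by (simp add: AQ_def)
    moreover have "\<exists>k p. length w - 1 + 2 * k = 1 \<and> homogeneous k p \<and> f w = cls p" if nz: "f w \<noteq> \<zero>\<^bsub>S\<^esub>" for w
    proof -
      obtain e where "w = [fst e, snd e]" using supp2 nz by blast
      moreover have "homogeneous 0 (poly_const (?c e))" using homogeneous_zero_iff by blast
      ultimately show ?thesis using val[of e]
        by (intro exI[of _ 0] exI[of _ "poly_const (?c e)"]) (simp del: One_nat_def)
    qed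
    ultimately show "x \<in> A1" unfolding A1_def A_degree_def using fQ by blast
  qed
qed

text \<open>Linear functionals on polynomials that factor through the entry \<open>R_ac\<close> of
  \<open>B\<close> of the Gale dual.\<close>

definition "descends l a c \<longleftrightarrow> (\<forall>p q. l (p + q) = l p + l q) \<and> (\<forall>k q. l (poly_const k * q) = k * l q) \<and>
  (\<forall>q\<in>ideal2 U a c. l q = (0::real))"

text \<open>When the dual chambers meet, the empty monomial is not among the generators of the
  ideal, and all generators have constant coefficient zero.\<close>

lemma const_coeff_descends:
  assumes "chamber U a \<inter> chamber U c \<noteq> {}"
  shows "descends (\<lambda>q. Poly_Mapping.lookup q 0) a c"
proof -
  have "Poly_Mapping.lookup q 0 = 0" if "q \<in> ideal2 U a c" for q
    using that unfolding ideal2_def face_ideal_def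
  proof (induction q rule: poly_ideal_induct)
    case (gen g)
    then consider (face) T where "g = (\<Prod>i\<in>T. poly_var i)" "hyp U T \<inter> (chamber U a \<inter> chamber U c) = {}"
      | (linear) v where "g = linear_form v" by auto
    then show ?case
    proof cases
      case face
      have "T \<noteq> {}"
      proof
        assume "T = {}"
        then have "chamber U a \<inter> chamber U c = {}" using face(2) U.chamberD(1) by (auto simp: hyp_def)
        then show False using assms by blast
      qed
      then obtain i where "i \<in> T" by blast
      then have "g = poly_var i * (\<Prod>i\<in>T - {i}. poly_var i)" unfolding face(1) by (simp add: prod.remove)
      then show ?thesis by (simp add: lookup_mult_zero lookup_poly_var)
    next
      case linear
      have "Poly_Mapping.lookup (sum k I) 0 = (\<Sum>i\<in>I. Poly_Mapping.lookup (k i) 0)" for k :: "'i \<Rightarrow> 'i mpoly" and I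
        by (induction I rule: infinite_finite_induct) (simp_all add: lookup_add)
      then show ?thesis unfolding linear linear_form_def by (simp add: lookup_mult_zero lookup_poly_var)
    qed
  qed (simp_all add: lookup_add lookup_mult_zero)
  then show ?thesis by (simp add: descends_def lookup_add lookup_mult_zero lookup_poly_const)
qed

text \<open>A functional on linear polynomials is a vector \<open>w\<close>. It kills the linear
  forms of \<open>V\<^sup>\<bottom>\<close> as \<open>w\<close> lies in \<open>V\<close>, and the
  variables that are zero in \<open>R_aa\<close> as these belong to coordinates that cannot be
  flipped. Longer monomials have no linear coefficient.\<close>

lemma linear_coeff_descends:
  assumes a: "a \<in> feasible U" and w: "w \<in> dir W" "\<And>i. flip a i \<notin> feasible U \<Longrightarrow> w $ i = 0"
  shows "descends (\<lambda>q. \<Sum>i\<in>UNIV. w $ i * Poly_Mapping.lookup q (Poly_Mapping.single i (Suc 0))) a a"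
proof -
  let ?l = "\<lambda>q. \<Sum>i\<in>UNIV. w $ i * Poly_Mapping.lookup q (Poly_Mapping.single i (Suc 0))"
  obtain x where x: "x \<in> chamber U a" by (rule U.feasibleE[OF a])
  have c0: "Poly_Mapping.lookup q 0 = 0" if "q \<in> ideal2 U a a" for q
    using const_coeff_descends[of a a] x that by (auto simp: descends_def)
  have "q \<in> ideal2 U a a \<Longrightarrow> ?l q = 0" for q
  proof -
    assume "q \<in> ideal2 U a a"
    \<comment> \<open>The constant coefficient is carried along: by the Leibniz rule it enters the
      linear coefficients of a multiple of \<open>q\<close>.\<close>
    then have "Poly_Mapping.lookup q 0 = 0 \<and> ?l q = 0"
      unfolding ideal2_def face_ideal_def
    proof (induction q rule: poly_ideal_induct)
      case (gen g)
      have g: "g \<in> ideal2 U a a"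
        unfolding ideal2_def face_ideal_def using gen ring.genideal_self[OF poly_ring_ring] by (metis (no_types, lifting) UNIV_I poly_ring_simps(1) subsetD subsetI)
      consider (face) T where "g = (\<Prod>i\<in>T. poly_var i)" "hyp U T \<inter> (chamber U a \<inter> chamber U a) = {}"
        | (linear) v where "g = linear_form v" "v \<in> (dir W)\<^sup>\<bottom>" using gen dir_dual(1) by auto
      then have "?l g = 0"
      proof cases
        case face
        have "w $ i * Poly_Mapping.lookup g (Poly_Mapping.single i (Suc 0)) = 0" for i
        proof (cases "i \<in> T")
          case True
          show ?thesis
          proof (cases "T = {i}")
            case True
            \<comment> \<open>A single variable \<open>u_i\<close> is a generator only if the dual
              chamber of \<open>a\<close> has no point with \<open>x_i = 0\<close>, and then
              \<open>i\<close> cannot be flipped.\<close>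
            have "flip a i \<notin> feasible U"
            proof
              assume "flip a i \<in> feasible U"
              then obtain y where "y \<in> chamber U a" "y $ i = 0" by (rule U.facet_point[OF a])
              then show False using face(2) True U.chamberD(1) by (auto simp: hyp_def)
            qed
            then show ?thesis using w(2) by simp
          next
            case False
            then obtain j where j: "j \<in> T" "j \<noteq> i" using True by blast
            have "g = poly_var i * (poly_var j * (\<Prod>k\<in>T - {i} - {j}. poly_var k))"
              unfolding face(1) using True j by (simp add: prod.remove)
            then show ?thesis by (simp add: lookup_mult_var lookup_mult_zero lookup_poly_var)
          qed
        next
          case False
          have "Poly_Mapping.lookup (\<Prod>k\<in>T. poly_var k) (Poly_Mapping.single i (Suc 0)) = 0"
            using finite[of T] False
          proof (induction T)
            case empty
            then show ?case using lookup_poly_const(2)[of 1 i] by (simp add: poly_const_simps)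
          next
            case (insert k T)
            then show ?case by (simp add: lookup_mult_var lookup_poly_var)
          qed
          then show ?thesis unfolding face(1) by simp
        qed
        then show ?thesis by (intro sum.neutral) blast
      next
        case linear
        have ls: "Poly_Mapping.lookup (sum k I) m = (\<Sum>i\<in>I. Poly_Mapping.lookup (k i) m)" for k :: "'i \<Rightarrow> 'i mpoly" and I m
          by (induction I rule: infinite_finite_induct) (simp_all add: lookup_add)
        have "Poly_Mapping.lookup (linear_form v) (Poly_Mapping.single i (Suc 0)) = v $ i" for i
        proof -
          have "Poly_Mapping.lookup (linear_form v) (Poly_Mapping.single i (Suc 0)) = (\<Sum>j\<in>UNIV. if j = i then v $ i else 0)"
            unfolding linear_form_def ls
            by (intro sum.cong refl) (simp add: lookup_mult_var lookup_poly_var lookup_poly_const)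
          then show ?thesis by simp
        qed
        then have "?l g = w \<bullet> v" unfolding linear(1) by (simp add: inner_vec_def)
        also have "\<dots> = v \<bullet> w" by (rule inner_commute)
        also have "\<dots> = 0" by (rule inner_orthogonal_comp[OF linear(2) w(1)])
        finally show ?thesis .
      qed
      then show ?case using c0[OF g] by blast
    next
      case (mult p q)
      have "?l (p * q) = Poly_Mapping.lookup p 0 * ?l q"
        unfolding sum_distrib_left using mult by (intro sum.cong refl) (simp add: lookup_mult_var)
      also have "\<dots> = 0" using mult by simp
      finally show ?case using mult by (simp add: lookup_mult_zero)
    qed (auto simp: lookup_add distrib_left sum.distrib)
    then show "?l q = 0" by blast
  qed
  then show ?thesis
    unfolding descends_def
    by (auto simp: lookup_add lookup_mult_var lookup_poly_const distrib_left sum.distrib sum_distrib_left mult.left_commute)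
qed

lemma sum_Aset:
  assumes "\<And>x y. x \<in> Aset \<Longrightarrow> y \<in> Aset \<Longrightarrow> \<Psi> (x + y) = \<Psi> x + \<Psi> y" "\<Psi> 0 = (0 :: 'r::ring)"
    and "\<And>i. i \<in> I \<Longrightarrow> f i \<in> Aset"
  shows "\<Psi> (sum f I) = (\<Sum>i\<in>I. \<Psi> (f i))"
  using assms(3)
  by (induction I rule: infinite_finite_induct) (simp_all add: assms(1,2) Aset_sum del: image_iff)

definition "cmat c = (\<lambda>x. if x \<in> arrows then poly_const (c x) else 0)"

text \<open>Elements of degree one become matrices of constants, because \<open>taut\<close> between
  adjacent vertices is the arrow itself.\<close>

lemma A_to_B_lin:
  obtains \<Psi> where
    "\<And>x y. x \<in> Aset \<Longrightarrow> y \<in> Aset \<Longrightarrow> \<Psi> (x + y) = \<Psi> x + \<Psi> y"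
    "\<And>x y. x \<in> Aset \<Longrightarrow> y \<in> Aset \<Longrightarrow> \<Psi> (x * y) = \<Psi> x * \<Psi> y"
    "\<Psi> 0 = 0" "\<And>c. \<Psi> (lin c) = U.BE (cmat c)"
proof -
  obtain \<Psi> where add: "\<And>x y. x \<in> Aset \<Longrightarrow> y \<in> Aset \<Longrightarrow> \<Psi> (x + y) = \<Psi> x + \<Psi> y"
    and mult: "\<And>x y. x \<in> Aset \<Longrightarrow> y \<in> Aset \<Longrightarrow> \<Psi> (x * y) = \<Psi> x * \<Psi> y"
    and zero: "\<Psi> 0 = 0" and taut: "\<And>q a c. a \<in> F \<Longrightarrow> c \<in> F \<Longrightarrow> \<Psi> (AH q * taut a c) = B_unit a c q"
    by (rule A_to_B) blast
  have AP: "\<Psi> (AH q * AP (fst e) (snd e)) = U.BE (U.munit (fst e) (snd e) q)" if e: "e \<in> arrows" for q e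
  proof -
    obtain a b where ab: "e = (a, b)" by (cases e)
    obtain i where i: "b = flip a i" using arrows_flip e ab by blast
    have F: "a \<in> F" "b \<in> F" and P: "a \<in> P" "b \<in> P" using arrows_F e ab by (auto simp: arrows_def)
    have "AP a b = taut a b" using taut_adj[of a i] F i by simp
    then show ?thesis using taut[OF F] P by (simp add: ab B_unit_def)
  qed
  have lin: "\<Psi> (lin c) = U.BE (cmat c)" for c
  proof -
    have "\<Psi> (lin c) = (\<Sum>e\<in>arrows. \<Psi> (AH (poly_const (c e)) * AP (fst e) (snd e)))"
      unfolding lin_def
      by (rule sum_Aset, erule (1) add, rule zero, intro Aset_closed AH_Aset AP_Aset)
    also have "\<dots> = (\<Sum>e\<in>arrows. U.BE (U.munit (fst e) (snd e) (poly_const (c e))))"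
      by (intro sum.cong refl AP)
    also have "\<dots> = U.BE (\<lambda>x. \<Sum>e\<in>arrows. U.munit (fst e) (snd e) (poly_const (c e)) x)"
      by (rule U.BE_sum[symmetric])
    also have "(\<lambda>x. \<Sum>e\<in>arrows. U.munit (fst e) (snd e) (poly_const (c e)) x) = cmat c"
    proof
      fix x
      have "(\<Sum>e\<in>arrows. U.munit (fst e) (snd e) (poly_const (c e)) x) = (\<Sum>e\<in>arrows. if e = x then poly_const (c x) else 0)"
        by (intro sum.cong refl) (auto simp: U.munit_def)
      then show "(\<Sum>e\<in>arrows. U.munit (fst e) (snd e) (poly_const (c e)) x) = cmat c x"
        using finite_arrows by (simp add: cmat_def)
    qed
    finally show ?thesis .
  qed
  show ?thesis by (rule that[of \<Psi>, OF add mult zero lin])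
qed

text \<open>Linear independence of the arrows is seen in \<open>B\<close> of the Gale dual. The
  entry at an arrow is a constant in the ideal, and the ideal contains no other constant than 0,
  since the dual chambers of its ends meet.\<close>

lemma lin_eq_0:
  assumes "lin c = 0" "e \<in> arrows" shows "c e = 0"
proof -
  obtain \<Psi> where zero: "\<Psi> 0 = 0" and lin: "\<And>c. \<Psi> (lin c) = U.BE (cmat c)"
    by (rule A_to_B_lin) blast
  obtain a b where ab: "e = (a, b)" by (cases e)
  have P: "a \<in> P" "b \<in> P" using assms(2) ab by (auto simp: arrows_def)
  have "U.BE (cmat c) = 0" using lin[of c] assms(1) zero by simp
  then have "cmat c (a, b) \<in> ideal2 U a b" using P by (simp add: U.BE_eq_0_iff bounded_feasible_dual)
  then have mem: "poly_const (c e) \<in> ideal2 U a b" using assms(2) ab by (simp add: cmat_def)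
  obtain i where i: "b = flip a i" using arrows_flip assms(2) ab by blast
  have "a \<in> feasible U" "flip a i \<in> feasible U" using P i by (auto simp: bounded_feasible_eq)
  then obtain x where "x \<in> chamber U a" "x $ i = 0" by (rule U.facet_point)
  then have "chamber U a \<inter> chamber U b \<noteq> {}" using chamber_flip i by blast
  from const_coeff_descends[OF this] mem show ?thesis
    by (auto simp: descends_def lookup_poly_const)
qed

section \<open>Coordinates in degree one\<close>

definition "coef x = (SOME c. emb (A_algebra W) x = lin c)"

text \<open>The dual basis of the arrows. The value 0 off \<open>A1\<close> is demanded by the
  carrier of \<open>dual_bimodule\<close>.\<close>

definition "delta e = (\<lambda>x. if x \<in> A1 then coef x e else 0)"

definition "gen e = A_class W (path_elem W [fst e, snd e])"

abbreviation "MM \<equiv> degree_one_bimodule (A_algebra W) (A_scalar W) (A_idem W) A1"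

abbreviation "embA \<equiv> emb (A_algebra W)"

lemma A1_carrier: "x \<in> A1 \<Longrightarrow> x \<in> carrier (A_algebra W)"
  by (simp add: A1_iff)

lemma emb_coef:
  assumes "x \<in> A1" shows "embA x = lin (coef x)"
proof -
  have "\<exists>c. embA x = lin c" using A1_iff assms by blast
  then show ?thesis unfolding coef_def by (rule someI_ex)
qed

lemma lin_inj: "lin c = lin d \<Longrightarrow> e \<in> arrows \<Longrightarrow> c e = d e"
proof -
  assume "lin c = lin d" and e: "e \<in> arrows"
  then have "lin (\<lambda>e. c e + (- 1) * d e) = lin d + AH (poly_const (- 1)) * lin d"
    by (simp only: lin_add[symmetric] lin_scale)
  also have "\<dots> = lin (\<lambda>e. 0)" unfolding lin_scale lin_add by (simp add: lin_def)
  also have "\<dots> = 0" by (simp add: lin_def poly_const_simps AH_zero)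
  finally show "c e = d e" using lin_eq_0[OF _ e] by fastforce
qed

lemma coef_unique: "x \<in> A1 \<Longrightarrow> embA x = lin c \<Longrightarrow> e \<in> arrows \<Longrightarrow> coef x e = c e"
  by (rule lin_inj) (simp_all only: emb_coef[symmetric])

lemma A1_eqI: "x \<in> A1 \<Longrightarrow> y \<in> A1 \<Longrightarrow> embA x = embA y \<Longrightarrow> x = y"
  using emb_inj[OF A_ring A1_carrier A1_carrier] by blast

lemma gen_A1: assumes "e \<in> arrows" shows "gen e \<in> A1" "embA (gen e) = AP (fst e) (snd e)"
proof -
  obtain a b where e: "e = (a, b)" by (cases e)
  then have ab: "a \<in> F" "b \<in> F" "adj a b" "(a, b) \<in> arrows" using arrows_F assms by auto
  have c: "path_elem W [a, b] \<in> carrier Q"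
    unfolding scaled_path_eq by (rule psingle_Q[OF edge_path[of a F b adj]]) (use ab PA.one_closed in auto)
  show emb: "embA (gen e) = AP (fst e) (snd e)"
    using ab by (simp add: e gen_def AQ_def[symmetric] scaled_path_eq apath_def[symmetric] AP_def)
  have "embA (gen e) = lin (\<lambda>e. if e = (a, b) then 1 else 0)"
    unfolding emb using AP_lin[OF ab(4)] by (simp add: e)
  then show "gen e \<in> A1"
    unfolding A1_iff using A_class_closed[OF c] by (auto simp: gen_def e)
qed

lemma coef_gen: "e \<in> arrows \<Longrightarrow> e' \<in> arrows \<Longrightarrow> coef (gen e) e' = (if e' = e then 1 else 0)"
  using coef_unique[OF gen_A1(1), of e "\<lambda>e'. if e' = e then 1 else 0" e'] gen_A1(2)[of e] AP_lin[of "fst e" "snd e"]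
  by simp

lemma emb_scalar: "A_scalar W k \<in> carrier (A_algebra W)" "embA (A_scalar W k) = AH (poly_const k)"
proof -
  have c: "(\<lambda>w. if w \<in> (\<lambda>\<alpha>. [\<alpha>]) ` F then cls (poly_const k) else \<zero>\<^bsub>S\<^esub>) \<in> carrier Q"
    unfolding Q_eq by (rule PA.vertex_sum_closed) auto
  then show "A_scalar W k \<in> carrier (A_algebra W)" unfolding A_scalar_def by (rule A_class_closed)
  show "embA (A_scalar W k) = AH (poly_const k)"
    unfolding A_scalar_def AQ_def[symmetric] AH_def
    by (rule PA.ring_map_vertex_sum[OF AQ_ring_map[unfolded Q_eq] finite_feasible]) auto
qed

lemma emb_idem: "a \<in> P \<Longrightarrow> A_idem W a \<in> carrier (A_algebra W)" "a \<in> P \<Longrightarrow> embA (A_idem W a) = Aid a"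
proof -
  assume a: "a \<in> P"
  then have F: "a \<in> F" using P_subset by blast
  have "path_elem W [a] \<in> carrier Q"
    unfolding scaled_path_eq by (rule psingle_Q[OF vertex_path[OF F]]) (rule PA.one_closed)
  then show "A_idem W a \<in> carrier (A_algebra W)" unfolding A_idem_def by (rule A_class_closed)
  show "embA (A_idem W a) = Aid a"
    using F by (simp add: A_idem_def AQ_def[symmetric] scaled_path_eq apath_def[symmetric] Aid_def)
qed

lemma A1_I: "x \<in> carrier (A_algebra W) \<Longrightarrow> embA x = lin c \<Longrightarrow> x \<in> A1"
  by (auto simp: A1_iff)

lemma emb_add: "x \<in> carrier (A_algebra W) \<Longrightarrow> y \<in> carrier (A_algebra W) \<Longrightarrow>
    embA (x \<oplus>\<^bsub>A_algebra W\<^esub> y) = embA x + embA y"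
  by (rule ring_mapD(1)[OF emb_ring_map[OF A_ring]])

lemma emb_mult: "x \<in> carrier (A_algebra W) \<Longrightarrow> y \<in> carrier (A_algebra W) \<Longrightarrow>
    embA (x \<otimes>\<^bsub>A_algebra W\<^esub> y) = embA x * embA y"
  by (rule ring_mapD(2)[OF emb_ring_map[OF A_ring]])

lemma MM_carrier: "carrier MM = A1" by (simp add: degree_one_bimodule_def)

lemma MM_ops:
  assumes "x \<in> A1"
  shows "y \<in> A1 \<Longrightarrow> embA (vadd MM x y) = lin (\<lambda>e. coef x e + coef y e)" "y \<in> A1 \<Longrightarrow> vadd MM x y \<in> A1"
    "embA (vscale MM k x) = lin (\<lambda>e. k * coef x e)" "vscale MM k x \<in> A1"
    "a \<in> P \<Longrightarrow> embA (lact MM a x) = lin (\<lambda>e. if fst e = a then coef x e else 0)" "a \<in> P \<Longrightarrow> lact MM a x \<in> A1"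
    "a \<in> P \<Longrightarrow> embA (ract MM x a) = lin (\<lambda>e. if snd e = a then coef x e else 0)" "a \<in> P \<Longrightarrow> ract MM x a \<in> A1"
proof -
  interpret X: ring "A_algebra W" by (rule A_ring)
  note x = A1_carrier[OF assms] emb_coef[OF assms]
  show 1: "y \<in> A1 \<Longrightarrow> embA (vadd MM x y) = lin (\<lambda>e. coef x e + coef y e)"
    using x A1_carrier[of y] emb_coef[of y] by (simp add: degree_one_bimodule_def emb_add lin_add)
  show "y \<in> A1 \<Longrightarrow> vadd MM x y \<in> A1"
    by (rule A1_I[OF _ 1]) (use x A1_carrier in \<open>auto simp: degree_one_bimodule_def\<close>)
  show 2: "embA (vscale MM k x) = lin (\<lambda>e. k * coef x e)"
    using x by (simp add: degree_one_bimodule_def emb_mult emb_scalar lin_scale)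
  show "vscale MM k x \<in> A1"
    by (rule A1_I[OF _ 2]) (use x emb_scalar in \<open>auto simp: degree_one_bimodule_def\<close>)
  show 3: "a \<in> P \<Longrightarrow> embA (lact MM a x) = lin (\<lambda>e. if fst e = a then coef x e else 0)"
    using x by (simp add: degree_one_bimodule_def emb_mult emb_idem Aid_lin)
  show "a \<in> P \<Longrightarrow> lact MM a x \<in> A1"
    by (rule A1_I[OF _ 3]) (use x emb_idem in \<open>auto simp: degree_one_bimodule_def\<close>)
  show 4: "a \<in> P \<Longrightarrow> embA (ract MM x a) = lin (\<lambda>e. if snd e = a then coef x e else 0)"
    using x by (simp add: degree_one_bimodule_def emb_mult emb_idem Aid_lin)
  show "a \<in> P \<Longrightarrow> ract MM x a \<in> A1"
    by (rule A1_I[OF _ 4]) (use x emb_idem in \<open>auto simp: degree_one_bimodule_def\<close>)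
qed

lemma coef_ops:
  assumes "x \<in> A1" "e \<in> arrows"
  shows "y \<in> A1 \<Longrightarrow> coef (vadd MM x y) e = coef x e + coef y e" "coef (vscale MM k x) e = k * coef x e"
    "a \<in> P \<Longrightarrow> coef (lact MM a x) e = (if fst e = a then coef x e else 0)"
    "a \<in> P \<Longrightarrow> coef (ract MM x a) e = (if snd e = a then coef x e else 0)"
  using coef_unique[OF MM_ops(2,1)[OF assms(1)] assms(2)] coef_unique[OF MM_ops(4,3)[OF assms(1)] assms(2)]
    coef_unique[OF MM_ops(6,5)[OF assms(1)] assms(2)] coef_unique[OF MM_ops(8,7)[OF assms(1)] assms(2)]
  by auto

lemma A1_coef_eqI:
  assumes "x \<in> A1" "y \<in> A1" "\<And>e. e \<in> arrows \<Longrightarrow> coef x e = coef y e" shows "x = y"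
  by (rule A1_eqI[OF assms(1,2)]) (simp add: emb_coef assms lin_def)

end

section \<open>Relations of the quadratic dual of \<open>A(W)\<close>\<close>

context arrangement
begin

interpretation U: arrangement U by (rule dual_arrangement)

abbreviation "NN \<equiv> dual_bimodule MM"
abbreviation "RR \<equiv> quadratic_relations (A_algebra W) (A_scalar W) P (A_idem W) A1"

lemma MM_tensor_data: "tensor_data P MM"
  by unfold_locales (auto simp: finite_P MM_carrier intro: MM_ops)

interpretation TM: tensor_data P MM by (rule MM_tensor_data)

lemma A_quadratic_dual_eq: "A_quadratic_dual W = quadratic_dual P MM RR"
  unfolding A_quadratic_dual_def quadratic_dual_of_def A1_def ..

lemma emb_MM:
  assumes "x \<in> A1"
  shows "y \<in> A1 \<Longrightarrow> embA (vadd MM x y) = embA x + embA y"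
    "embA (vscale MM k x) = AH (poly_const k) * embA x"
    "a \<in> P \<Longrightarrow> embA (lact MM a x) = Aid a * embA x" "a \<in> P \<Longrightarrow> embA (ract MM x a) = embA x * Aid a"
  using MM_ops(1,3,5,7)[OF assms] emb_coef[OF assms] emb_coef[of y] by (simp_all add: lin_add lin_scale Aid_lin)

text \<open>The multiplication of two elements of degree one, extended to formal tensors and
  computed in \<open>rprod\<close>.\<close>

definition "tensor_value q = (\<Sum>x\<in>{(m, n). q [Vec m, (Vec n :: ('i sign_vector, _) tensor_gen)] \<noteq> 0}.
  AH (poly_const (q [Vec (fst x), Vec (snd x)])) * (embA (fst x) * embA (snd x)))"

lemma formal_support:
  assumes "q \<in> formal_tensors M" "x \<in> {(m, n). q [Vec m, Vec n] \<noteq> 0}"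
  shows "fst x \<in> carrier M" "snd x \<in> carrier M"
proof -
  have "q [Vec (fst x), Vec (snd x)] \<noteq> 0" using assms(2) by auto
  then have "[Vec (fst x), Vec (snd x)] \<in> {[Vec m, Vec n] | m n. m \<in> carrier M \<and> n \<in> carrier M}"
    using assms(1) unfolding formal_tensors_def by blast
  then show "fst x \<in> carrier M" "snd x \<in> carrier M" by auto
qed

lemma formal_finite:
  assumes "q \<in> formal_tensors M" shows "finite {(m, n). q [Vec m, Vec n] \<noteq> 0}"
proof -
  have sub: "(\<lambda>x. [Vec (fst x), Vec (snd x)]) ` {(m, n). q [Vec m, Vec n] \<noteq> 0} \<subseteq> {w. q w \<noteq> 0}" by auto
  have "finite {w. q w \<noteq> 0}" using assms by (simp add: formal_tensors_def)
  from finite_subset[OF sub this] show ?thesis by (rule finite_imageD) (auto simp: inj_on_def)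
qed

lemma formal_product_value:
  assumes q: "q \<in> formal_tensors MM"
  shows "formal_product (A_algebra W) (A_scalar W) q \<in> carrier (A_algebra W)"
    "embA (formal_product (A_algebra W) (A_scalar W) q) = tensor_value q"
proof -
  interpret X: ring "A_algebra W" by (rule A_ring)
  let ?I = "{(m, n). q [Vec m, Vec n] \<noteq> 0}"
  have c: "fst x \<in> carrier (A_algebra W)" "snd x \<in> carrier (A_algebra W)" if "x \<in> ?I" for x
    using formal_support[OF q that] A1_carrier by (auto simp: MM_carrier)
  have t: "A_scalar W (q [Vec (fst x), Vec (snd x)]) \<otimes>\<^bsub>A_algebra W\<^esub> (fst x \<otimes>\<^bsub>A_algebra W\<^esub> snd x) \<in> carrier (A_algebra W)"
    if "x \<in> ?I" for x using c[OF that] emb_scalar(1) by blast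
  show "formal_product (A_algebra W) (A_scalar W) q \<in> carrier (A_algebra W)"
    unfolding formal_product_def using t by (intro X.finsum_closed) auto
  show "embA (formal_product (A_algebra W) (A_scalar W) q) = tensor_value q"
  proof -
    have "embA (formal_product (A_algebra W) (A_scalar W) q) =
      (\<Sum>x\<in>?I. embA (A_scalar W (q [Vec (fst x), Vec (snd x)]) \<otimes>\<^bsub>A_algebra W\<^esub> (fst x \<otimes>\<^bsub>A_algebra W\<^esub> snd x)))"
      unfolding formal_product_def
      by (rule ring_map_finsum[OF A_ring emb_ring_map[OF A_ring] formal_finite[OF q] t])
    also have "\<dots> = tensor_value q"
      unfolding tensor_value_def using c by (intro sum.cong refl) (simp add: emb_mult emb_scalar)
    finally show ?thesis .
  qed
qed

text \<open>Membership in \<open>RR\<close> says only that some formal tensor of the same class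
  multiplies to zero. The multiplication extends to the tensor algebra by
  \<open>tensor_lift\<close>, so that the value depends on the class alone.\<close>

lemma RR_value:
  assumes q: "q \<in> formal_tensors MM" and R: "tensor_class P MM q \<in> RR"
  shows "tensor_value q = 0"
proof -
  obtain q' where q': "q' \<in> formal_tensors MM" "formal_product (A_algebra W) (A_scalar W) q' = \<zero>\<^bsub>A_algebra W\<^esub>"
    "tensor_class P MM q = tensor_class P MM q'"
    using R unfolding quadratic_relations_def Let_def by blast
  have z: "tensor_value q' = 0"
    using formal_product_value(2)[OF q'(1)] q'(2) ring_map_zero[OF A_ring emb_ring_map[OF A_ring]] by simp
  define m where "m x = (case x of Idemp a \<Rightarrow> Aid a | Vec y \<Rightarrow> embA y)" for x :: "('i sign_vector, _) tensor_gen"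
  have m: "m (Idemp a) = Aid a" "m (Vec y) = embA y" for a y by (simp_all add: m_def)
  have lin_comm: "AH (poly_const k) * lin c = lin c * AH (poly_const k)" for k c
  proof -
    have "AH (poly_const k) * (AH q * AP a b) = AH q * AP a b * AH (poly_const k)" for q a b
      by (simp only: mult.assoc AH_comm(2)[symmetric]) (simp only: mult.assoc[symmetric] AH_comm(3))
    then show ?thesis by (simp add: lin_def sum_distrib_left sum_distrib_right)
  qed
  have P_sum: "(\<Sum>a\<in>P. Aid a) = AH 1"
    unfolding AH_one by (rule sum.mono_neutral_left) (use finite_feasible P_subset Aid_unbounded in auto)
  obtain \<Phi> where \<Phi>: "ring_map TM.T0 \<Phi>" "\<And>r. r \<in> tensor_relations P MM \<Longrightarrow> \<Phi> r = 0"
    "\<And>\<phi>. \<phi> \<in> formal_tensors MM \<Longrightarrow> \<Phi> \<phi> = (\<Sum>x\<in>{(f, g). \<phi> [Vec f, Vec g] \<noteq> 0}.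
      AH (poly_const (\<phi> [Vec (fst x), Vec (snd x)])) * (m (Vec (fst x)) * m (Vec (snd x))))"
  proof (rule TM.tensor_lift[of "\<lambda>c. AH (poly_const c)" m])
    show "AH (poly_const c) * m x = m x * AH (poly_const c)" if "x \<in> TM.X" for c x
      using that by (auto simp: m AH_comm MM_carrier emb_coef lin_comm)
    show "AH (poly_const 1) * m x = m x" if "x \<in> TM.X" for x
      using that by (auto simp: m AH_unit MM_carrier emb_coef lin_scale poly_const_simps(4) AH_one_Aset lin_Aset)
    show "(\<Sum>a\<in>P. m (Idemp a)) = AH (poly_const 1)" by (simp add: m P_sum poly_const_simps)
  qed (auto simp: m MM_carrier emb_MM Aid_mult poly_const_simps AH_add AH_mult)
  have val: "\<Phi> p = tensor_value p" if "p \<in> formal_tensors MM" for p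
    unfolding \<Phi>(3)[OF that] tensor_value_def m ..
  have qc: "q \<in> carrier TM.T0" "q' \<in> carrier TM.T0" using q q'(1) TM.formal_closed by auto
  have "q \<ominus>\<^bsub>TM.T0\<^esub> q' \<in> tensor_ideal P MM"
    using q'(3) coset_eq_iff[OF TM.tensor_ideal_ideal qc] by (simp add: TM.tensor_class_eq)
  then have "\<Phi> (q \<ominus>\<^bsub>TM.T0\<^esub> q') = 0"
    unfolding tensor_ideal_def TM.T0_eq
    by (intro ring_map_Idl_zero[OF free_algebra_ring \<Phi>(1) TM.tensor_relations_closed \<Phi>(2)])
  then have "\<Phi> q = \<Phi> q'" using ring_map_diff[OF free_algebra_ring \<Phi>(1) qc] by simp
  then show ?thesis using val q q'(1) z by simp
qed

definition "mid a c = {b. (a, b) \<in> arrows \<and> (b, c) \<in> arrows}"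

lemma finite_mid: "finite (mid a c)"
  by (rule finite_subset[OF _ finite_P]) (auto simp: mid_def arrows_def)

lemma mid_subset: "mid a c \<subseteq> P"
  by (auto simp: mid_def arrows_def)

text \<open>In \<open>B\<close> of the Gale dual the entry at \<open>(a, c)\<close> of a product of
  two elements of degree one is a combination of the monomials \<open>crossing a b c\<close>. A
  relation puts this entry into the ideal, where \<open>l\<close> vanishes.\<close>

lemma descends_relation:
  assumes q: "q \<in> formal_tensors MM" and z: "tensor_value q = 0" and ac: "a \<in> P" "c \<in> P"
    and l: "descends l a c"
  shows "(\<Sum>b\<in>mid a c. l (crossing a b c) * (\<Sum>x\<in>{(m, n). q [Vec m, Vec n] \<noteq> 0}.
    q [Vec (fst x), Vec (snd x)] * (coef (fst x) (a, b) * coef (snd x) (b, c)))) = 0"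
proof -
  let ?I = "{(m, n). q [Vec m, Vec n] \<noteq> 0}"
  let ?q = "\<lambda>x. q [Vec (fst x), Vec (snd x)]"
  obtain \<Psi> where add: "\<And>x y. x \<in> Aset \<Longrightarrow> y \<in> Aset \<Longrightarrow> \<Psi> (x + y) = \<Psi> x + \<Psi> y"
    and mult: "\<And>x y. x \<in> Aset \<Longrightarrow> y \<in> Aset \<Longrightarrow> \<Psi> (x * y) = \<Psi> x * \<Psi> y"
    and zero: "\<Psi> 0 = 0" and lin: "\<And>c. \<Psi> (lin c) = U.BE (cmat c)"
    by (rule A_to_B_lin) blast
  let ?T = "\<lambda>x. U.tmul (cmat (\<lambda>e. ?q x * coef (fst x) e)) (cmat (coef (snd x)))"
  have "tensor_value q = (\<Sum>x\<in>?I. lin (\<lambda>e. ?q x * coef (fst x) e) * lin (coef (snd x)))"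
    unfolding tensor_value_def
  proof (rule sum.cong[OF refl])
    fix x assume "x \<in> ?I"
    then have "fst x \<in> A1" "snd x \<in> A1" using formal_support[OF q] by (auto simp: MM_carrier)
    then show "AH (poly_const (?q x)) * (embA (fst x) * embA (snd x)) = lin (\<lambda>e. ?q x * coef (fst x) e) * lin (coef (snd x))"
      by (simp add: emb_coef lin_scale[symmetric] mult.assoc)
  qed
  then have "0 = \<Psi> (\<Sum>x\<in>?I. lin (\<lambda>e. ?q x * coef (fst x) e) * lin (coef (snd x)))" using z zero by simp
  also have "\<dots> = (\<Sum>x\<in>?I. \<Psi> (lin (\<lambda>e. ?q x * coef (fst x) e) * lin (coef (snd x))))"
    by (rule sum_Aset, erule (1) add, rule zero, intro Aset_closed lin_Aset)
  also have "\<dots> = (\<Sum>x\<in>?I. U.BE (?T x))"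
    by (simp only: mult[OF lin_Aset lin_Aset] lin U.BE_simps(2))
  also have "\<dots> = U.BE (\<lambda>y. \<Sum>x\<in>?I. ?T x y)" by (rule U.BE_sum[symmetric])
  finally have mem: "(\<Sum>x\<in>?I. ?T x (a, c)) \<in> ideal2 U a c"
    using ac U.BE_eq_0_iff[of "\<lambda>y. \<Sum>x\<in>?I. ?T x y"] by (simp add: bounded_feasible_dual)
  have ladd: "l (p + r) = l p + l r" and lk: "l (poly_const k * r) = k * l r" for p r k
    using l by (auto simp: descends_def)
  have l0: "l 0 = 0" using ladd[of 0 0] by simp
  have lsum: "l (sum g J) = (\<Sum>j\<in>J. l (g j))" for g :: "'z \<Rightarrow> 'i mpoly" and J
    by (induction J rule: infinite_finite_induct) (simp_all add: l0 ladd)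
  have entry: "l (?T x (a, c)) = (\<Sum>b\<in>mid a c. l (crossing a b c) * (?q x * (coef (fst x) (a, b) * coef (snd x) (b, c))))" for x
  proof -
    have "l (?T x (a, c)) = (\<Sum>b\<in>P. l (crossing a b c * (cmat (\<lambda>e. ?q x * coef (fst x) e) (a, b) * cmat (coef (snd x)) (b, c))))"
      unfolding U.tmul_def bounded_feasible_dual prod.case by (rule lsum)
    also have "\<dots> = (\<Sum>b\<in>mid a c. l (crossing a b c * (cmat (\<lambda>e. ?q x * coef (fst x) e) (a, b) * cmat (coef (snd x)) (b, c))))"
      by (rule sum.mono_neutral_right) (use finite_P mid_subset in \<open>auto simp: mid_def cmat_def l0\<close>)
    also have "\<dots> = (\<Sum>b\<in>mid a c. l (crossing a b c) * (?q x * (coef (fst x) (a, b) * coef (snd x) (b, c))))"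
    proof (rule sum.cong[OF refl])
      fix b assume "b \<in> mid a c"
      then have "l (crossing a b c * (cmat (\<lambda>e. ?q x * coef (fst x) e) (a, b) * cmat (coef (snd x)) (b, c)))
        = l (poly_const (?q x * coef (fst x) (a, b) * coef (snd x) (b, c)) * crossing a b c)"
        by (simp add: mid_def cmat_def poly_const_simps(2) mult.commute)
      then show "l (crossing a b c * (cmat (\<lambda>e. ?q x * coef (fst x) e) (a, b) * cmat (coef (snd x)) (b, c)))
        = l (crossing a b c) * (?q x * (coef (fst x) (a, b) * coef (snd x) (b, c)))"
        by (simp add: lk)
    qed
    finally show ?thesis .
  qed
  have "0 = l (\<Sum>x\<in>?I. ?T x (a, c))" using mem l by (simp add: descends_def)
  also have "\<dots> = (\<Sum>x\<in>?I. \<Sum>b\<in>mid a c. l (crossing a b c) * (?q x * (coef (fst x) (a, b) * coef (snd x) (b, c))))"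
    unfolding lsum entry ..
  also have "\<dots> = (\<Sum>b\<in>mid a c. \<Sum>x\<in>?I. l (crossing a b c) * (?q x * (coef (fst x) (a, b) * coef (snd x) (b, c))))"
    by (rule sum.swap)
  finally show ?thesis by (simp add: sum_distrib_left)
qed

section \<open>The dual bimodule and its dual basis\<close>

lemma NN_iff: "f \<in> carrier NN \<longleftrightarrow> (\<forall>x\<in>A1. \<forall>y\<in>A1. f (vadd MM x y) = f x + f y) \<and>
    (\<forall>k. \<forall>x\<in>A1. f (vscale MM k x) = k * f x) \<and> (\<forall>x. x \<notin> A1 \<longrightarrow> f x = 0)"
  unfolding dual_bimodule_def by (simp add: MM_carrier)

lemma NN_ops: "vadd NN f g = (\<lambda>x. f x + g x)" "vscale NN k f = (\<lambda>x. k * f x)"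
  "lact NN a f = (\<lambda>x. if x \<in> A1 then f (ract MM x a) else 0)"
  "ract NN f a = (\<lambda>x. if x \<in> A1 then f (lact MM a x) else 0)"
  by (simp_all add: dual_bimodule_def MM_carrier)

lemma act_linear:
  assumes "a \<in> P" "x \<in> A1"
  shows "y \<in> A1 \<Longrightarrow> lact MM a (vadd MM x y) = vadd MM (lact MM a x) (lact MM a y)"
    "y \<in> A1 \<Longrightarrow> ract MM (vadd MM x y) a = vadd MM (ract MM x a) (ract MM y a)"
    "lact MM a (vscale MM k x) = vscale MM k (lact MM a x)"
    "ract MM (vscale MM k x) a = vscale MM k (ract MM x a)"
  using assms by (rule_tac A1_coef_eqI; simp add: MM_ops coef_ops distrib_left)+

lemma NN_quadratic_data: "quadratic_data P NN MM"
proof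
  show "lact NN a f \<in> carrier NN" if "a \<in> P" "f \<in> carrier NN" for a f
    using that by (auto simp: NN_iff NN_ops act_linear MM_ops)
  show "ract NN f a \<in> carrier NN" if "a \<in> P" "f \<in> carrier NN" for a f
    using that by (auto simp: NN_iff NN_ops act_linear MM_ops)
qed (auto simp: finite_P NN_iff NN_ops MM_ops algebra_simps)

interpretation QD: quadratic_data P NN MM RR by (rule NN_quadratic_data)

lemma delta_NN: "e \<in> arrows \<Longrightarrow> delta e \<in> carrier NN"
  by (auto simp: NN_iff delta_def coef_ops MM_ops)

lemma delta_act:
  assumes "e \<in> arrows" "a \<in> P"
  shows "lact NN a (delta e) = (if snd e = a then delta e else (\<lambda>x. 0))"
    "ract NN (delta e) a = (if fst e = a then delta e else (\<lambda>x. 0))"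
  using assms by (auto simp: NN_ops delta_def coef_ops MM_ops fun_eq_iff)

text \<open>Induction on a set \<open>G\<close> of arrows outside which the coordinates vanish; one
  coordinate at a time is removed by subtracting a multiple of \<open>gen d\<close>.\<close>

lemma NN_expand:
  assumes f: "f \<in> carrier NN" and x: "x \<in> A1"
  shows "f x = (\<Sum>e\<in>arrows. coef x e * f (gen e))"
proof -
  have fa: "f (vadd MM x y) = f x + f y" if "x \<in> A1" "y \<in> A1" for x y using f that by (simp add: NN_iff)
  have fs: "f (vscale MM k x) = k * f x" if "x \<in> A1" for k x using f that by (simp add: NN_iff)
  have "\<forall>y\<in>A1. (\<forall>e\<in>arrows - G. coef y e = 0) \<longrightarrow> f y = (\<Sum>e\<in>G. coef y e * f (gen e))"
    if "finite G" "G \<subseteq> arrows" for G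
    using that
  proof (induction G)
    case empty
    show ?case
    proof (intro ballI impI)
      fix y assume y: "y \<in> A1" "\<forall>e\<in>arrows - {}. coef y e = 0"
      have "y = vscale MM 0 y" using y by (intro A1_coef_eqI MM_ops) (simp_all add: coef_ops)
      then show "f y = (\<Sum>e\<in>{}. coef y e * f (gen e))" using fs[OF y(1), of 0] by simp
    qed
  next
    case (insert d G)
    have d: "d \<in> arrows" using insert.prems by blast
    note g = gen_A1(1)[OF d]
    show ?case
    proof (intro ballI impI)
      fix y assume y: "y \<in> A1" "\<forall>e\<in>arrows - insert d G. coef y e = 0"
      let ?z = "vscale MM (- coef y d) (gen d)"
      let ?y = "vadd MM y ?z"
      have z: "?z \<in> A1" by (rule MM_ops(4)[OF g])
      have "?y \<in> A1" by (rule MM_ops(2)[OF y(1) z])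
      have c: "coef ?y e = (if e = d then 0 else coef y e)" if "e \<in> arrows" for e
        using that by (simp add: coef_ops(1)[OF y(1) that z] coef_ops(2)[OF g that] coef_gen[OF d that])
      have "f ?y = (\<Sum>e\<in>G. coef ?y e * f (gen e))"
        using insert \<open>?y \<in> A1\<close> c y(2) by auto
      also have "\<dots> = (\<Sum>e\<in>G. coef y e * f (gen e))"
      proof (rule sum.cong[OF refl])
        fix e assume "e \<in> G"
        then have "e \<in> arrows" "e \<noteq> d" using insert.prems insert.hyps by auto
        then show "coef ?y e * f (gen e) = coef y e * f (gen e)" by (simp add: c)
      qed
      finally have "f y + (- coef y d) * f (gen d) = (\<Sum>e\<in>G. coef y e * f (gen e))"
        using fa[OF y(1) z] fs[OF g] by simp
      then show "f y = (\<Sum>e\<in>insert d G. coef y e * f (gen e))" using insert.hyps by simp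
    qed
  qed
  from this[OF finite_arrows order_refl] x show ?thesis by simp
qed

lemma DV_zero: "QD.DV (\<lambda>x. 0) = 0"
proof -
  have z: "(\<lambda>x. 0) \<in> carrier NN" by (simp add: NN_iff)
  have "QD.DV (\<lambda>x. 0) = QD.DV (\<lambda>x. 0) + QD.DV (\<lambda>x. 0)"
    using QD.DV_add[OF z z] by (simp add: NN_ops)
  then show ?thesis by simp
qed

lemma DV_expand:
  assumes f: "f \<in> carrier NN"
  shows "QD.DV f = (\<Sum>e\<in>arrows. QD.sc (f (gen e)) * QD.DV (delta e))"
proof -
  let ?f = "\<lambda>G x. \<Sum>e\<in>G. f (gen e) * delta e x"
  have "?f G \<in> carrier NN \<and> QD.DV (?f G) = (\<Sum>e\<in>G. QD.sc (f (gen e)) * QD.DV (delta e))"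
    if "finite G" "G \<subseteq> arrows" for G
    using that
  proof (induction G)
    case empty
    then show ?case by (simp add: DV_zero) (simp add: NN_iff)
  next
    case (insert d G)
    have d: "delta d \<in> carrier NN" using insert.prems delta_NN by blast
    have eq: "?f (insert d G) = vadd NN (vscale NN (f (gen d)) (delta d)) (?f G)"
      using insert.hyps by (simp add: NN_ops)
    have s: "vscale NN (f (gen d)) (delta d) \<in> carrier NN" by (rule QD.N_vscale[OF d])
    have IH: "?f G \<in> carrier NN" "QD.DV (?f G) = (\<Sum>e\<in>G. QD.sc (f (gen e)) * QD.DV (delta e))"
      using insert by auto
    show ?case
      unfolding eq using QD.N_vadd[OF s IH(1)] QD.DV_add[OF s IH(1)] QD.DV_scale[OF d] IH(2) insert.hyps by simp
  qed
  from this[OF finite_arrows order_refl]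
  have "QD.DV (?f arrows) = (\<Sum>e\<in>arrows. QD.sc (f (gen e)) * QD.DV (delta e))" by blast
  moreover have "?f arrows = f"
  proof
    fix x show "?f arrows x = f x"
    proof (cases "x \<in> A1")
      case True
      then show ?thesis using NN_expand[OF f True] by (simp add: delta_def mult.commute)
    next
      case False
      then show ?thesis using f by (simp add: delta_def NN_iff)
    qed
  qed
  ultimately show ?thesis by simp
qed

text \<open>The tensor with these coefficients pairs with a relation of \<open>A(W)\<close> as
  \<open>l\<close> evaluates its entry at \<open>(a, c)\<close>, so it belongs to the annihilator.
  The factors stand in reverse order because the actions on the dual are interchanged.\<close>

lemma dual_relation:
  assumes ac: "a \<in> P" "c \<in> P" and l: "descends l a c"
  shows "(\<Sum>b\<in>mid a c. QD.sc (l (crossing a b c)) * (QD.DV (delta (b, c)) * QD.DV (delta (a, b)))) = 0"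
proof -
  let ?t = "tensor_sum (mid a c) (\<lambda>b. l (crossing a b c)) (\<lambda>b. delta (b, c)) (\<lambda>b. delta (a, b))
    :: ('i sign_vector, _) tensor_gen list \<Rightarrow> real"
  have ar: "(a, b) \<in> arrows" "(b, c) \<in> arrows" "b \<in> P" if "b \<in> mid a c" for b
    using that by (auto simp: mid_def arrows_def)
  have d: "delta (b, c) \<in> carrier NN" "delta (a, b) \<in> carrier NN" if "b \<in> mid a c" for b
    using ar[OF that] delta_NN by auto
  have "QD.dcl ?t = 0"
  proof (rule QD.dcl_annihilator)
    show "?t \<in> formal_tensors NN" by (rule tensor_sum_formal[OF finite_mid d])
    fix q assume q: "q \<in> formal_tensors MM" "tensor_class P MM q \<in> RR"
    let ?I = "{(m, n). q [Vec m, Vec n] \<noteq> 0}"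
    have in1: "(\<Sum>a'\<in>P. delta (b, c) (lact MM a' (snd x)) * delta (a, b) (ract MM (fst x) a'))
      = coef (fst x) (a, b) * coef (snd x) (b, c)" if b: "b \<in> mid a c" and x: "x \<in> ?I" for b x
    proof -
      have x1: "fst x \<in> A1" "snd x \<in> A1" using formal_support[OF q(1) x] by (auto simp: MM_carrier)
      have "(\<Sum>a'\<in>P. delta (b, c) (lact MM a' (snd x)) * delta (a, b) (ract MM (fst x) a'))
        = (\<Sum>a'\<in>P. if a' = b then coef (fst x) (a, b) * coef (snd x) (b, c) else 0)"
        using x1 ar[OF b] by (intro sum.cong refl) (auto simp: delta_def MM_ops coef_ops)
      then show ?thesis using ar(3)[OF b] finite_P by simp
    qed
    have "tensor_pairing P MM ?t q = (\<Sum>b\<in>mid a c. l (crossing a b c) * (\<Sum>x\<in>?I.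
      q [Vec (fst x), Vec (snd x)] * (coef (fst x) (a, b) * coef (snd x) (b, c))))"
      unfolding tensor_pairing_left[OF finite_mid] by (intro sum.cong refl) (simp add: in1)
    also have "\<dots> = 0" by (rule descends_relation[OF q(1) RR_value[OF q] ac l])
    finally show "tensor_pairing P MM ?t q = 0" .
  qed
  moreover have "QD.dcl ?t = (\<Sum>b\<in>mid a c. QD.sc (l (crossing a b c)) * (QD.DV (delta (b, c)) * QD.DV (delta (a, b))))"
    by (rule QD.dcl_tensor_sum) (use d finite_mid in auto)
  ultimately show ?thesis by simp
qed

text \<open>The value of the functional given by \<open>\<phi>\<close> on
  \<open>p(a, b) \<otimes> p(b, c)\<close>.\<close>

definition "pairing_coeff \<phi> a b c = (\<Sum>x\<in>{(f, g). \<phi> [Vec f, (Vec g :: ('i sign_vector, _) tensor_gen)] \<noteq> (0::real)}.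
  \<phi> [Vec (fst x), Vec (snd x)] * (fst x (gen (b, c)) * snd x (gen (a, b))))"

text \<open>The vanishing combination of paths of length two is the product of a formal tensor in
  \<open>RR\<close>, and its pairing with \<open>\<phi>\<close> is the sum in question.\<close>

lemma annihilator_coeff:
  assumes \<phi>: "\<phi> \<in> formal_tensors NN"
    and ann: "\<And>q. q \<in> formal_tensors MM \<Longrightarrow> tensor_class P MM q \<in> RR \<Longrightarrow> tensor_pairing P MM \<phi> q = 0"
    and d: "(\<Sum>b\<in>mid a c. AH (poly_const (d b)) * (AP a b * AP b c)) = 0"
  shows "(\<Sum>b\<in>mid a c. d b * pairing_coeff \<phi> a b c) = 0"
proof -
  let ?q = "tensor_sum (mid a c) d (\<lambda>b. gen (a, b)) (\<lambda>b. gen (b, c)) :: ('i sign_vector, _) tensor_gen list \<Rightarrow> real"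
  let ?F = "{(f, g). \<phi> [Vec f, Vec g] \<noteq> 0}"
  have ar: "(a, b) \<in> arrows" "(b, c) \<in> arrows" "b \<in> P" if "b \<in> mid a c" for b
    using that by (auto simp: mid_def arrows_def)
  have g: "gen (a, b) \<in> carrier MM" "gen (b, c) \<in> carrier MM" if "b \<in> mid a c" for b
    using gen_A1(1)[OF ar(1)[OF that]] gen_A1(1)[OF ar(2)[OF that]] by (simp_all add: MM_carrier)
  have q: "?q \<in> formal_tensors MM" by (rule tensor_sum_formal[OF finite_mid g])
  have S: "{(m, n). ?q [Vec m, (Vec n :: ('i sign_vector, _) tensor_gen)] \<noteq> 0}
      = {x. ?q [Vec (fst x), (Vec (snd x) :: ('i sign_vector, _) tensor_gen)] \<noteq> 0}" by auto
  have "tensor_value ?q = (\<Sum>b\<in>mid a c. AH (poly_const (d b)) * (embA (fst (gen (a, b), gen (b, c))) * embA (snd (gen (a, b), gen (b, c)))))"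
    unfolding tensor_value_def S
    by (rule sum_tensor_sum[where h = "\<lambda>c. AH (poly_const c)" and H = "\<lambda>x. embA (fst x) * embA (snd x)"])
      (simp_all add: finite_mid poly_const_simps AH_add)
  also have "\<dots> = (\<Sum>b\<in>mid a c. AH (poly_const (d b)) * (AP a b * AP b c))"
    using ar by (intro sum.cong refl) (simp add: gen_A1(2))
  finally have "tensor_value ?q = 0" using d by simp
  then have "embA (formal_product (A_algebra W) (A_scalar W) ?q) = embA \<zero>\<^bsub>A_algebra W\<^esub>"
    using formal_product_value(2)[OF q] ring_map_zero[OF A_ring emb_ring_map[OF A_ring]] by simp
  then have "formal_product (A_algebra W) (A_scalar W) ?q = \<zero>\<^bsub>A_algebra W\<^esub>"
    using emb_inj[OF A_ring formal_product_value(1)[OF q] ring.ring_simprules(2)[OF A_ring]] by simp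
  then have "tensor_class P MM ?q \<in> RR"
    unfolding quadratic_relations_def Let_def using q by blast
  then have "0 = tensor_pairing P MM \<phi> ?q" using ann[OF q] by simp
  also have "\<dots> = (\<Sum>b\<in>mid a c. d b * pairing_coeff \<phi> a b c)"
    unfolding tensor_pairing_right[OF finite_mid] pairing_coeff_def
  proof (rule sum.cong[OF refl])
    fix b assume b: "b \<in> mid a c"
    have "(\<Sum>a'\<in>P. fst x (lact MM a' (gen (b, c))) * snd x (ract MM (gen (a, b)) a')) = fst x (gen (b, c)) * snd x (gen (a, b))"
      if x: "x \<in> ?F" for x
    proof -
      have f: "fst x \<in> carrier NN" using formal_support[OF \<phi> x] by simp
      note g1 = gen_A1(1)[OF ar(1)[OF b]] gen_A1(1)[OF ar(2)[OF b]]
      have l: "fst x (lact MM a' (gen (b, c))) = (if a' = b then fst x (gen (b, c)) else 0)" if "a' \<in> P" for a'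
      proof (cases "a' = b")
        case True
        have "lact MM b (gen (b, c)) = gen (b, c)"
          using ar[OF b] g1 by (intro A1_coef_eqI MM_ops) (simp_all add: coef_ops coef_gen)
        then show ?thesis using True by simp
      next
        case False
        have "lact MM a' (gen (b, c)) = vscale MM 0 (gen (b, c))"
          using ar[OF b] g1 False that by (intro A1_coef_eqI MM_ops) (auto simp: coef_ops coef_gen)
        then show ?thesis using f g1(2) False by (simp add: NN_iff)
      qed
      have r: "ract MM (gen (a, b)) b = gen (a, b)"
        using ar[OF b] g1 by (intro A1_coef_eqI MM_ops) (simp_all add: coef_ops coef_gen)
      have "(\<Sum>a'\<in>P. fst x (lact MM a' (gen (b, c))) * snd x (ract MM (gen (a, b)) a'))
        = (\<Sum>a'\<in>P. if a' = b then fst x (gen (b, c)) * snd x (gen (a, b)) else 0)"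
        by (intro sum.cong refl) (simp add: l r)
      then show ?thesis using ar(3)[OF b] finite_P by simp
    qed
    then show "d b * (\<Sum>x\<in>?F. \<phi> [Vec (fst x), Vec (snd x)] * (\<Sum>a'\<in>P. fst x (lact MM a' (gen (b, c))) * snd x (ract MM (gen (a, b)) a')))
      = d b * (\<Sum>x\<in>?F. \<phi> [Vec (fst x), Vec (snd x)] * (fst x (gen (b, c)) * snd x (gen (a, b))))"
      by simp
  qed
  finally show ?thesis ..
qed

end

section \<open>The quadratic dual maps onto \<open>A\<close> of the Gale dual\<close>

text \<open>An injective numbering, which fixes a linear order on the coordinates.\<close>

definition position :: "'i::finite \<Rightarrow> nat" where "position = (SOME f. inj f)"

lemma position_inj: "position i = position j \<longleftrightarrow> i = j"
proof -
  have "\<exists>f :: 'a \<Rightarrow> nat. inj f" using finite_imp_inj_to_nat_seg[OF finite_class.finite_UNIV] by blast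
  then have "inj (position :: 'a \<Rightarrow> nat)" unfolding position_def by (rule someI_ex)
  then show ?thesis by (auto simp: inj_def)
qed

text \<open>A sign on the edges of the cube such that the product over each square is \<open>- 1\<close>.\<close>

definition edge_sign :: "'i::finite sign_vector \<Rightarrow> 'i sign_vector \<Rightarrow> real" where
  "edge_sign a b = (\<Prod>j\<in>{j. \<exists>i. a i \<noteq> b i \<and> position j < position i}. a j)"

text \<open>In direction \<open>i\<close> the sign is the parity of the negative entries before
  \<open>i\<close>, as in a Koszul complex.\<close>

lemma edge_sign_flip:
  assumes "a \<in> sign_vectors"
  shows "edge_sign a (flip a i) = (\<Prod>j\<in>{j. position j < position i}. a j)"
proof -
  have "a k \<noteq> flip a i k \<longleftrightarrow> k = i" for k using sign_nonzero[OF assms, of k] by (auto simp: flip_apply)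
  then show ?thesis by (simp add: edge_sign_def)
qed

lemma prod_flip: "(\<Prod>k\<in>K. flip a i k) = (if i \<in> K then - 1 else 1) * (\<Prod>k\<in>K. a k)" for K :: "'i::finite set"
proof (cases "i \<in> K")
  case True
  have "(\<Prod>k\<in>K - {i}. flip a i k) = (\<Prod>k\<in>K - {i}. a k)" by (intro prod.cong) (auto simp: flip_apply)
  then show ?thesis using True prod.remove[of K i "flip a i"] prod.remove[of K i a] by (simp add: flip_apply)
next
  case False
  then have "(\<Prod>k\<in>K. flip a i k) = (\<Prod>k\<in>K. a k)" by (intro prod.cong) (auto simp: flip_apply)
  then show ?thesis using False by simp
qed

lemma edge_sign_sym:
  assumes "a \<in> sign_vectors" shows "edge_sign (flip a i) a = edge_sign a (flip a i)"
  using edge_sign_flip[OF flip_sign[OF assms], of i i] edge_sign_flip[OF assms, of i]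
  by (simp add: prod_flip)

lemma edge_sign_sq:
  assumes "a \<in> sign_vectors" shows "edge_sign a (flip a i) * edge_sign a (flip a i) = 1"
  unfolding edge_sign_flip[OF assms] prod.distrib[symmetric] by (simp add: sign_sq[OF assms])

text \<open>If \<open>i\<close> comes before \<open>j\<close>, flipping \<open>i\<close> changes the
  sign of an edge in direction \<open>j\<close>, while flipping \<open>j\<close> leaves the sign in
  direction \<open>i\<close> unchanged.\<close>

lemma edge_sign_square:
  assumes "a \<in> sign_vectors" "i \<noteq> j"
  shows "edge_sign a (flip a i) * edge_sign (flip a i) (flip (flip a i) j) =
    - (edge_sign a (flip a j) * edge_sign (flip a j) (flip (flip a i) j))"
proof -
  have "position i < position j \<or> position j < position i"
    using position_inj[of i j] assms(2) by (meson linorder_neqE_nat)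
  then show ?thesis
    unfolding flip_commute[of a i j]
    using edge_sign_flip[OF flip_sign[OF assms(1)], of i j] edge_sign_flip[OF flip_sign[OF assms(1)], of j i]
    by (auto simp: edge_sign_flip[OF assms(1)] prod_flip flip_commute[of a j i])
qed

section \<open>Loops and squares at a vertex\<close>

context arrangement
begin

lemma AH_comm_Aset:
  assumes "x \<in> Aset" shows "AH q * x = x * AH q"
proof -
  obtain x' where x': "x = emb (A_algebra W) x'" "x' \<in> carrier (A_algebra W)" using assms by blast
  show ?thesis unfolding x'(1) using x'(2)
  proof (induction rule: emb_A_induct)
    case (single w r)
    have "AH q * (AH r * apath w) = AH r * (AH q * apath w)"
      by (simp only: mult.assoc[symmetric] AH_comm(3))
    also have "\<dots> = AH r * apath w * AH q" by (simp only: AH_apath_comm[OF single(1), of q] mult.assoc)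
    finally show ?case .
  qed (simp_all add: distrib_left distrib_right)
qed

lemma AH_sum: "AH (sum f I) = (\<Sum>i\<in>I. AH (f i))"
  by (induction I rule: infinite_finite_induct) (simp_all add: AH_zero AH_add)

lemma AH_linear_form_sum: "AH (linear_form v) = (\<Sum>i\<in>UNIV. AH (poly_const (v $ i)) * AH (poly_var i))"
  by (simp add: linear_form_def AH_sum AH_mult)

lemma AH_var_unbounded:
  assumes "a \<in> F" "flip a i \<in> F" "flip a i \<notin> P" shows "AH (poly_var i) * Aid a = 0"
  using AP_back[OF assms(1,2)] AP_unbounded[of a "flip a i"] assms(3) by simp

lemma mid_self: "mid a a = flip a ` {k. (a, flip a k) \<in> arrows}"
  using arrows_flip arrows_sym by (force simp: mid_def)

lemma arrowsI: "a \<in> P \<Longrightarrow> flip a i \<in> P \<Longrightarrow> (a, flip a i) \<in> arrows"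
  using adj_flipI[OF P_sign] by (auto simp: arrows_def)

lemma arrows_flip_iff: "a \<in> P \<Longrightarrow> (a, flip a i) \<in> arrows \<longleftrightarrow> flip a i \<in> P"
  using arrowsI by (auto simp: arrows_def)

lemma sum_mid_self:
  fixes G :: "'i sign_vector \<Rightarrow> 'r::comm_monoid_add"
  assumes "a \<in> P"
  shows "(\<Sum>b\<in>mid a a. G b) = (\<Sum>k\<in>{k. flip a k \<in> P}. G (flip a k))"
  unfolding mid_self arrows_flip_iff[OF assms]
  by (subst sum.reindex) (auto simp: inj_on_def flip_inj[OF P_sign[OF assms]])

text \<open>Two steps have to change both \<open>i\<close> and \<open>j\<close>, so that the first
  step changes one of them.\<close>

lemma mid_square:
  assumes "a \<in> sign_vectors" "i \<noteq> j"
  shows "mid a (flip (flip a i) j) \<subseteq> {flip a i, flip a j}"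
proof
  fix b assume b: "b \<in> mid a (flip (flip a i) j)"
  then obtain k where k: "b = flip a k" using arrows_flip by (auto simp: mid_def)
  have "(b, flip (flip a i) j) \<in> arrows" using b by (simp add: mid_def)
  then obtain l where l: "flip (flip a i) j = flip b l" using arrows_flip by blast
  have "k = i \<or> k = j"
  proof (rule ccontr)
    assume n: "\<not> (k = i \<or> k = j)"
    have "flip (flip a i) j k = a k" using n by (simp add: flip_apply)
    then have "flip (flip a k) l k = a k" using l k by simp
    then have "k = l" using sign_nonzero[OF assms(1), of k] by (auto simp: flip_apply split: if_splits)
    then have "flip (flip a i) j = a" using l k by simp
    then have "flip (flip a i) j i = a i" by simp
    then show False using assms(2) sign_nonzero[OF assms(1), of i] by (simp add: flip_apply)
  qed
  then show "b \<in> {flip a i, flip a j}" using k by auto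
qed

lemma mid_square_cases:
  assumes "a \<noteq> c" "b \<in> mid a c"
  obtains i j where "i \<noteq> j" "b = flip a i" "c = flip (flip a i) j"
proof -
  obtain i where i: "b = flip a i" using assms(2) arrows_flip by (auto simp: mid_def)
  have "(b, c) \<in> arrows" using assms(2) by (simp add: mid_def)
  then obtain j where j: "c = flip b j" using arrows_flip by blast
  have "i \<noteq> j" using assms(1) i j by auto
  then show ?thesis using that i j by blast
qed

end

context arrangement
begin

interpretation U: arrangement U by (rule dual_arrangement)

text \<open>
  The coefficients \<open>Y\<close> of \<open>p(c, b) p(b, a)\<close> annihilate all relations between the \<open>p(a, b) p(b, c)\<close>.
  For \<open>a = c\<close> the relations are \<open>\<real>\<^sup>I \<inter> (V\<^sup>\<bottom> + \<real>\<^sup>J)\<close>, with \<open>I\<close> and \<open>J\<close> the flips of \<open>a\<close> to \<open>P\<close> and to \<open>F - P\<close>,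
  so that \<open>Y\<close> extends to an element of \<open>V \<inter> (\<real>\<^sup>J)\<^sup>\<bottom>\<close>.
\<close>

lemma orthogonal_relation_self:
  assumes a: "a \<in> P"
    and ortho: "\<And>d. (\<Sum>b\<in>mid a a. AH (poly_const (d b)) * (AP a b * AP b a)) = 0 \<Longrightarrow> (\<Sum>b\<in>mid a a. d b * Y b) = 0"
  shows "(\<Sum>b\<in>mid a a. U.AH (poly_const (Y b)) * (U.AP a b * U.AP b a)) = 0"
proof -
  have aF: "a \<in> F" "a \<in> feasible U" using a by (auto simp: bounded_feasible_eq)
  have PU: "x \<in> F \<and> x \<in> feasible U" if "x \<in> P" for x using that by (auto simp: bounded_feasible_eq)
  let ?I = "{k. flip a k \<in> P}" and ?J = "{k. flip a k \<in> F \<and> flip a k \<notin> P}"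
  define y :: "real ^ 'i" where "y = (\<chi> k. if k \<in> ?I then Y (flip a k) else 0)"
  let ?S = "{v \<in> dir W. \<forall>k\<in>?J. v $ k = 0}" and ?T = "{t :: real ^ 'i. \<forall>k\<in>?I. t $ k = 0}"
  have S: "subspace ?S" using subspace_dir by (auto simp: subspace_def)
  have T: "subspace ?T" by (auto simp: subspace_def)
  \<comment> \<open>The test vectors \<open>z\<close> for membership of \<open>y\<close> in
    \<open>?S + ?T\<close> vanish off \<open>?I\<close> and lie in
    \<open>V\<^sup>\<bottom> + \<real>\<^sup>J\<close>; hence they are the coefficients of relations
    between the loops at \<open>a\<close>, to which \<open>ortho\<close> applies.\<close>
  have "z \<bullet> y = 0" if zS: "\<And>s. s \<in> ?S \<Longrightarrow> z \<bullet> s = 0" and zT: "\<And>t. t \<in> ?T \<Longrightarrow> z \<bullet> t = 0" for z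
  proof -
    have zI: "z $ k = 0" if "k \<notin> ?I" for k
    proof -
      have "axis k 1 \<in> ?T" using that by (auto simp: axis_def)
      from zT[OF this] show ?thesis by (simp add: inner_axis)
    qed
    let ?R = "{r :: real ^ 'i. \<forall>k. k \<notin> ?J \<longrightarrow> r $ k = 0}"
    have R: "subspace ?R" by (auto simp: subspace_def)
    have "\<exists>s\<in>(dir W)\<^sup>\<bottom>. \<exists>t\<in>?R. z = s + t"
    proof (rule orthogonal_comp_sum[OF subspace_orthogonal_comp R])
      fix u assume u: "\<And>s. s \<in> (dir W)\<^sup>\<bottom> \<Longrightarrow> u \<bullet> s = 0" "\<And>t. t \<in> ?R \<Longrightarrow> u \<bullet> t = 0"
      have "u \<in> (dir W)\<^sup>\<bottom>\<^sup>\<bottom>" using u(1) by (rule orthogonal_compI)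
      then have "u \<in> dir W" using orthogonal_comp_self[OF subspace_dir] by simp
      moreover have "u $ k = 0" if "k \<in> ?J" for k
      proof -
        have "axis k 1 \<in> ?R" using that by (auto simp: axis_def)
        from u(2)[OF this] show ?thesis by (simp add: inner_axis)
      qed
      ultimately have "u \<in> ?S" by blast
      then show "u \<bullet> z = 0" using zS by (simp add: inner_commute)
    qed
    then obtain w r where wr: "w \<in> (dir W)\<^sup>\<bottom>" "r \<in> ?R" "z = w + r" by blast
    \<comment> \<open>A coefficient indexed by vertices is needed. The sum has one term only, as
      different coordinates give different flips.\<close>
    define d where "d b = (\<Sum>k\<in>{k. b = flip a k}. z $ k)" for b
    have d: "d (flip a k) = z $ k" for k
    proof -
      have "{k'. flip a k = flip a k'} = {k}" using flip_inj[OF P_sign[OF a]] by auto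
      then show ?thesis by (simp add: d_def)
    qed
    have "(\<Sum>b\<in>mid a a. AH (poly_const (d b)) * (AP a b * AP b a)) =
      (\<Sum>k\<in>?I. AH (poly_const (z $ k)) * AH (poly_var k) * Aid a)"
      unfolding sum_mid_self[OF a] d using PU aF by (intro sum.cong refl) (simp add: AP_back mult.assoc)
    also have "\<dots> = (\<Sum>k\<in>UNIV. AH (poly_const (z $ k)) * AH (poly_var k) * Aid a)"
      by (rule sum.mono_neutral_left) (use zI in \<open>auto simp: poly_const_simps AH_zero\<close>)
    also have "\<dots> = (\<Sum>k\<in>UNIV. AH (poly_const (w $ k)) * AH (poly_var k) * Aid a) +
      (\<Sum>k\<in>UNIV. AH (poly_const (r $ k)) * AH (poly_var k) * Aid a)"
      unfolding wr(3) by (simp add: poly_const_simps AH_add distrib_right sum.distrib)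
    also have "(\<Sum>k\<in>UNIV. AH (poly_const (w $ k)) * AH (poly_var k) * Aid a) = AH (linear_form w) * Aid a"
      by (simp add: AH_linear_form_sum sum_distrib_right)
    also have "\<dots> = 0" using AH_linear_form[OF wr(1)] by simp
    also have "(\<Sum>k\<in>UNIV. AH (poly_const (r $ k)) * AH (poly_var k) * Aid a) = 0"
    proof (rule sum.neutral, rule ballI)
      fix k
      show "AH (poly_const (r $ k)) * AH (poly_var k) * Aid a = 0"
      proof (cases "k \<in> ?J")
        case True
        then show ?thesis using AH_var_unbounded[OF aF(1), of k] by (simp add: mult.assoc)
      next
        case False
        then have "r $ k = 0" using wr(2) by blast
        then show ?thesis by (simp add: poly_const_simps AH_zero)
      qed
    qed
    finally have "(\<Sum>b\<in>mid a a. d b * Y b) = 0" by (intro ortho) simp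
    then have "(\<Sum>k\<in>?I. z $ k * Y (flip a k)) = 0" by (simp add: sum_mid_self[OF a] d)
    moreover have "z \<bullet> y = (\<Sum>k\<in>?I. z $ k * Y (flip a k))"
      unfolding inner_vec_def by (rule sum.mono_neutral_cong_right) (auto simp: y_def)
    ultimately show ?thesis by simp
  qed
  then have "\<exists>s\<in>?S. \<exists>t\<in>?T. y = s + t" by (rule orthogonal_comp_sum[OF S T])
  then obtain v t where v: "v \<in> dir W" "\<And>k. k \<in> ?J \<Longrightarrow> v $ k = 0" and t: "t \<in> ?T" "y = v + t" by blast
  have vI: "v $ k = Y (flip a k)" if "k \<in> ?I" for k
  proof -
    have "y $ k = v $ k + t $ k" using t(2) by simp
    moreover have "t $ k = 0" using t(1) that by blast
    moreover have "y $ k = Y (flip a k)" using that by (simp add: y_def)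
    ultimately show ?thesis by simp
  qed
  have "(\<Sum>b\<in>mid a a. U.AH (poly_const (Y b)) * (U.AP a b * U.AP b a)) =
    (\<Sum>k\<in>?I. U.AH (poly_const (v $ k)) * U.AH (poly_var k) * U.Aid a)"
    unfolding sum_mid_self[OF a] using PU aF vI by (intro sum.cong refl) (simp add: U.AP_back mult.assoc)
  also have "\<dots> = (\<Sum>k\<in>UNIV. U.AH (poly_const (v $ k)) * U.AH (poly_var k) * U.Aid a)"
  proof (rule sum.mono_neutral_left)
    show "\<forall>k\<in>UNIV - ?I. U.AH (poly_const (v $ k)) * U.AH (poly_var k) * U.Aid a = 0"
    proof
      fix k assume "k \<in> UNIV - ?I"
      then have k: "flip a k \<notin> P" by simp
      show "U.AH (poly_const (v $ k)) * U.AH (poly_var k) * U.Aid a = 0"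
      proof (cases "flip a k \<in> F")
        case True
        then have "v $ k = 0" using v(2) k by blast
        then show ?thesis by (simp add: poly_const_simps U.AH_zero)
      next
        case False
        \<comment> \<open>Coordinates outside both \<open>?I\<close> and \<open>?J\<close> are left
          free by \<open>v\<close>. There \<open>flip a k\<close> is feasible for the Gale dual but
          not in \<open>P\<close>, so that the variable is zero at \<open>a\<close> in its
          algebra.\<close>
        then have "flip a k \<in> feasible U" using flip_feasible_or_bounded[OF aF, of k] by blast
        then show ?thesis using U.AH_var_unbounded[OF aF(2), of k] k by (simp add: bounded_feasible_dual mult.assoc)
      qed
    qed
  qed auto
  also have "\<dots> = U.AH (linear_form v) * U.Aid a"
    by (simp add: U.AH_linear_form_sum sum_distrib_right)
  also have "\<dots> = 0" using U.AH_linear_form[of v] v(1) dir_dual(2) by simp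
  finally show ?thesis .
qed

text \<open>For \<open>a \<noteq> c\<close> a path through \<open>b\<close> spans a square with one
  further middle vertex \<open>flip a j\<close>. If it is in \<open>P\<close>, orthogonality makes
  the two coefficients equal and the edge signs make them opposite. If it is in
  \<open>F - P\<close>, the path through \<open>b\<close> is zero in \<open>A(W)\<close>, which
  forces \<open>Y b = 0\<close>. Otherwise it is feasible for the Gale dual, and the reversed path
  is zero there.\<close>

lemma orthogonal_relation:
  assumes ac: "a \<in> P" "c \<in> P"
    and ortho: "\<And>d. (\<Sum>b\<in>mid a c. AH (poly_const (d b)) * (AP a b * AP b c)) = 0 \<Longrightarrow> (\<Sum>b\<in>mid a c. d b * Y b) = 0"
  shows "(\<Sum>b\<in>mid a c. U.AH (poly_const (edge_sign a b * edge_sign b c * Y b)) * (U.AP c b * U.AP b a)) = 0"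
proof (cases "a = c")
  case True
  have sg: "a \<in> sign_vectors" by (rule P_sign[OF ac(1)])
  have "edge_sign a b * edge_sign b a = 1" if "b \<in> mid a a" for b
    using that edge_sign_sym[OF sg] edge_sign_sq[OF sg] by (auto simp: mid_self)
  then have "(\<Sum>b\<in>mid a a. U.AH (poly_const (edge_sign a b * edge_sign b a * Y b)) * (U.AP a b * U.AP b a)) =
    (\<Sum>b\<in>mid a a. U.AH (poly_const (Y b)) * (U.AP a b * U.AP b a))" by (intro sum.cong refl) simp
  also have "\<dots> = 0"
    by (rule orthogonal_relation_self[OF ac(1)]) (rule ortho[folded True])
  finally show ?thesis using True by simp
next
  case False
  have sg: "a \<in> sign_vectors" by (rule P_sign[OF ac(1)])
  have PU: "x \<in> F \<and> x \<in> feasible U" if "x \<in> P" for x using that by (auto simp: bounded_feasible_eq)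
  show ?thesis
  proof (cases "mid a c = {}")
    case False
    then obtain b where b: "b \<in> mid a c" by blast
    obtain i j where ij: "i \<noteq> j" "b = flip a i" "c = flip (flip a i) j"
      by (rule mid_square_cases[OF \<open>a \<noteq> c\<close> b])
    let ?b = "flip a j"
    have bP: "b \<in> P" using b mid_subset by blast
    have c2: "c = flip ?b i" using ij by (simp add: flip_commute)
    have sub: "mid a c \<subseteq> {b, ?b}" using mid_square[OF sg ij(1)] ij by simp
    have ne: "b \<noteq> ?b" using ij flip_inj[OF sg] by simp
    have fl: "flip c j = b" "flip (flip c j) i = a" by (simp_all add: ij)
    have fl2: "flip c i = ?b" unfolding c2 by simp
    have sq: "AP a b * AP b c = AP a ?b * AP ?b c" if "?b \<in> F"
      using AP_square[of a i j] ij PU[OF ac(1)] PU[OF ac(2)] PU[OF bP] that by simp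
    have sqU: "U.AP c b * U.AP b a = U.AP c ?b * U.AP ?b a" if "?b \<in> feasible U"
      using U.AP_square[of c j i] fl fl2 ij(1) PU[OF ac(1)] PU[OF ac(2)] PU[OF bP] that by simp
    show ?thesis
    proof (cases "?b \<in> P")
      case True
      have "(a, ?b) \<in> arrows" "(?b, c) \<in> arrows"
        using arrowsI[OF ac(1) True] arrowsI[OF True, of i] ac(2) c2 by auto
      then have mid: "mid a c = {b, ?b}" using sub b by (auto simp: mid_def)
      have "(\<Sum>x\<in>mid a c. AH (poly_const (if x = b then 1 else - 1)) * (AP a x * AP x c)) = 0"
      proof -
        have "(\<Sum>x\<in>mid a c. AH (poly_const (if x = b then 1 else - 1)) * (AP a x * AP x c)) =
          (AH (poly_const 1) + AH (poly_const (- 1))) * (AP a b * AP b c)"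
          using sq PU[OF True] ne by (simp add: mid distrib_right)
        also have "AH (poly_const 1) + AH (poly_const (- 1)) = 0"
          by (simp add: AH_add[symmetric] poly_const_simps(1)[symmetric] poly_const_simps(3) AH_zero)
        finally show ?thesis by simp
      qed
      from ortho[OF this] have "Y b = Y ?b" using ne by (simp add: mid)
      moreover have s: "edge_sign a b * edge_sign b c = - (edge_sign a ?b * edge_sign ?b c)"
        using edge_sign_square[OF sg ij(1)] ij by simp
      ultimately have "(\<Sum>x\<in>mid a c. U.AH (poly_const (edge_sign a x * edge_sign x c * Y x)) * (U.AP c x * U.AP x a)) =
        (U.AH (poly_const (- (edge_sign a ?b * edge_sign ?b c) * Y b)) + U.AH (poly_const (edge_sign a ?b * edge_sign ?b c * Y b))) * (U.AP c b * U.AP b a)"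
        using sqU PU[OF True] ne by (simp add: mid distrib_right)
      also have "\<dots> = 0"
        by (simp add: U.AH_add[symmetric] poly_const_simps(1)[symmetric] poly_const_simps(3) U.AH_zero)
      finally show ?thesis .
    next
      case nP: False
      then have "?b \<notin> mid a c" using mid_subset by blast
      then have mid: "mid a c = {b}" using sub b by auto
      have aF: "a \<in> F" "a \<in> feasible U" using PU[OF ac(1)] by auto
      show ?thesis
      proof (cases "?b \<in> F")
        case True
        have "AP a b * AP b c = 0" using sq[OF True] AP_unbounded[of a ?b] nP by simp
        then have "(\<Sum>x\<in>mid a c. AH (poly_const 1) * (AP a x * AP x c)) = 0" by (simp add: mid)
        from ortho[OF this] have "Y b = 0" by (simp add: mid)
        then show ?thesis by (simp add: mid poly_const_simps U.AH_zero)
      next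
        case False
        then have "?b \<in> feasible U" using flip_feasible_or_bounded[OF aF, of j] by blast
        from sqU[OF this] have "U.AP c b * U.AP b a = 0"
          using U.AP_unbounded[of c ?b] nP by (simp add: bounded_feasible_dual)
        then show ?thesis by (simp add: mid)
      qed
    qed
  qed simp
qed

section \<open>The homomorphism from the quadratic dual\<close>

interpretation QD: quadratic_data P NN MM RR by (rule NN_quadratic_data)

text \<open>Sends the dual basis vector of an arrow to the reversed arrow, with the sign of the
  edge. Reversal accounts for the interchange of left and right actions on the dual.\<close>

definition "dual_value f = (\<Sum>e\<in>arrows. arrangement.AH (gale_dual W) (poly_const (edge_sign (fst e) (snd e) * f (gen e)))
  * arrangement.AP (gale_dual W) (snd e) (fst e))"

lemma act_gen:
  assumes "e \<in> arrows" "a \<in> P" "f \<in> carrier NN"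
  shows "f (lact MM a (gen e)) = (if fst e = a then f (gen e) else 0)"
    "f (ract MM (gen e) a) = (if snd e = a then f (gen e) else 0)"
proof -
  note g = gen_A1(1)[OF assms(1)]
  have z: "f (vscale MM 0 (gen e)) = 0" using assms(3) g by (simp add: NN_iff)
  have "lact MM a (gen e) = (if fst e = a then gen e else vscale MM 0 (gen e))"
    using assms(1,2) g by (intro A1_coef_eqI) (auto simp: MM_ops coef_ops coef_gen)
  then show "f (lact MM a (gen e)) = (if fst e = a then f (gen e) else 0)" using z by simp
  have "ract MM (gen e) a = (if snd e = a then gen e else vscale MM 0 (gen e))"
    using assms(1,2) g by (intro A1_coef_eqI) (auto simp: MM_ops coef_ops coef_gen)
  then show "f (ract MM (gen e) a) = (if snd e = a then f (gen e) else 0)" using z by simp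
qed

lemma dual_value_Aset: "dual_value f \<in> U.Aset"
  unfolding dual_value_def by (intro U.Aset_sum U.Aset_closed U.AH_Aset U.AP_Aset)

lemma dual_value_ops:
  "dual_value (vadd NN f g) = dual_value f + dual_value g"
  "dual_value (vscale NN c f) = U.AH (poly_const c) * dual_value f"
  "a \<in> P \<Longrightarrow> f \<in> carrier NN \<Longrightarrow> dual_value (lact NN a f) = U.Aid a * dual_value f"
  "a \<in> P \<Longrightarrow> f \<in> carrier NN \<Longrightarrow> dual_value (ract NN f a) = dual_value f * U.Aid a"
proof -
  show "dual_value (vadd NN f g) = dual_value f + dual_value g"
    by (simp add: dual_value_def NN_ops distrib_left distrib_right poly_const_simps U.AH_add sum.distrib)
  have "U.AH (poly_const (edge_sign (fst e) (snd e) * (c * f (gen e)))) * U.AP (snd e) (fst e) =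
    U.AH (poly_const c) * (U.AH (poly_const (edge_sign (fst e) (snd e) * f (gen e))) * U.AP (snd e) (fst e))" for e
    by (simp only: mult.assoc[symmetric] U.AH_mult[symmetric] poly_const_simps(2)[symmetric]) (simp only: mult.commute mult.left_commute)
  then show "dual_value (vscale NN c f) = U.AH (poly_const c) * dual_value f"
    unfolding dual_value_def NN_ops sum_distrib_left by (intro sum.cong refl)
  assume a: "a \<in> P" and f: "f \<in> carrier NN"
  show "dual_value (lact NN a f) = U.Aid a * dual_value f"
    unfolding dual_value_def sum_distrib_left
    by (intro sum.cong refl) (simp add: NN_ops gen_A1 act_gen[OF _ a f] U.Aid_AH_AP poly_const_simps U.AH_zero)
  show "dual_value (ract NN f a) = dual_value f * U.Aid a"
    unfolding dual_value_def sum_distrib_right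
    by (intro sum.cong refl) (simp add: NN_ops gen_A1 act_gen[OF _ a f] mult.assoc U.Aid_AP poly_const_simps U.AH_zero)
qed

lemma dual_value_mult:
  "dual_value f * dual_value g = (\<Sum>(a, c)\<in>P \<times> P. \<Sum>b\<in>mid a c.
    U.AH (poly_const (edge_sign a b * edge_sign b c * (f (gen (b, c)) * g (gen (a, b))))) * (U.AP c b * U.AP b a))"
proof -
  let ?t = "\<lambda>e e'. U.AH (poly_const (edge_sign (fst e') (snd e') * edge_sign (fst e) (snd e) * (f (gen e) * g (gen e')))) *
    (U.AP (snd e) (fst e) * U.AP (snd e') (fst e'))"
  let ?Z = "Sigma (P \<times> P) (\<lambda>(a, c). mid a c)"
  have t: "U.AH (poly_const (edge_sign (fst e) (snd e) * f (gen e))) * U.AP (snd e) (fst e) *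
      (U.AH (poly_const (edge_sign (fst e') (snd e') * g (gen e'))) * U.AP (snd e') (fst e')) = ?t e e'" for e e'
  proof -
    let ?x = "edge_sign (fst e) (snd e) * f (gen e)" and ?y = "edge_sign (fst e') (snd e') * g (gen e')"
    have "U.AH (poly_const ?x) * U.AP (snd e) (fst e) * (U.AH (poly_const ?y) * U.AP (snd e') (fst e')) =
      U.AH (poly_const ?x) * (U.AH (poly_const ?y) * U.AP (snd e) (fst e)) * U.AP (snd e') (fst e')"
      by (simp only: mult.assoc U.AH_AP_left)
    also have "\<dots> = U.AH (poly_const (?x * ?y)) * (U.AP (snd e) (fst e) * U.AP (snd e') (fst e'))"
      by (simp only: poly_const_simps(2) U.AH_mult mult.assoc)
    also have "?x * ?y = edge_sign (fst e') (snd e') * edge_sign (fst e) (snd e) * (f (gen e) * g (gen e'))"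
      by (simp only: ac_simps)
    finally show ?thesis .
  qed
  have "dual_value f * dual_value g = (\<Sum>e\<in>arrows. \<Sum>e'\<in>arrows. ?t e e')"
    unfolding dual_value_def sum_product t ..
  also have "\<dots> = (\<Sum>(e, e')\<in>arrows \<times> arrows. ?t e e')" by (rule sum.cartesian_product)
  also have "\<dots> = (\<Sum>(e, e')\<in>{(e, e'). e \<in> arrows \<and> e' \<in> arrows \<and> fst e = snd e'}. ?t e e')"
  proof (rule sum.mono_neutral_right)
    show "finite (arrows \<times> arrows)" using finite_arrows by simp
    have z: "U.AP (snd e) (fst e) * U.AP (snd e') (fst e') = 0" if "fst e \<noteq> snd e'" for e e'
    proof -
      have "U.AP (snd e) (fst e) * U.AP (snd e') (fst e') =
        U.AP (snd e) (fst e) * U.Aid (fst e) * (U.Aid (snd e') * U.AP (snd e') (fst e'))"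
        by (simp add: U.Aid_AP)
      also have "\<dots> = U.AP (snd e) (fst e) * (U.Aid (fst e) * U.Aid (snd e')) * U.AP (snd e') (fst e')"
        by (simp only: mult.assoc)
      finally show ?thesis using that by (simp add: U.Aid_mult)
    qed
    show "\<forall>x\<in>arrows \<times> arrows - {(e, e'). e \<in> arrows \<and> e' \<in> arrows \<and> fst e = snd e'}. (case x of (e, e') \<Rightarrow> ?t e e') = 0"
    proof (intro ballI)
      fix x assume "x \<in> arrows \<times> arrows - {(e, e'). e \<in> arrows \<and> e' \<in> arrows \<and> fst e = snd e'}"
      then obtain e e' where x: "x = (e, e')" "fst e \<noteq> snd e'" by (cases x) auto
      show "(case x of (e, e') \<Rightarrow> ?t e e') = 0" unfolding x(1) prod.case z[OF x(2)] by simp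
    qed
  qed auto
  also have "\<dots> = (\<Sum>(x, b)\<in>?Z. ?t (b, snd x) (fst x, b))"
    by (rule sum.reindex_bij_witness[where i = "\<lambda>(x, b). ((b, snd x), (fst x, b))" and j = "\<lambda>(e, e'). ((fst e', snd e), fst e)"])
      (auto simp: mid_def, auto simp: arrows_def)
  also have "\<dots> = (\<Sum>x\<in>P \<times> P. \<Sum>b\<in>(case x of (a, c) \<Rightarrow> mid a c). ?t (b, snd x) (fst x, b))"
    by (rule sum.Sigma[symmetric]) (auto simp: finite_P finite_mid)
  finally show ?thesis by (simp add: case_prod_unfold)
qed

text \<open>An annihilating tensor has coefficients restricted by \<open>annihilator_coeff\<close>,
  so that its image vanishes for each pair of ends by \<open>orthogonal_relation\<close>. The map
  \<open>\<Phi>\<close> on the free algebra is kept, because its values on words are needed for the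
  comparison with the inverse.\<close>

lemma dual_map:
  obtains g \<Phi> where "ring_map (A_quadratic_dual W) g" "ring_map QD.T0 \<Phi>"
    "\<And>f. f \<in> carrier QD.T0 \<Longrightarrow> g (QD.Dcls f) = \<Phi> f"
    "\<And>w c. w \<in> lists QD.X \<Longrightarrow> \<Phi> (word c w) =
      U.AH (poly_const c) * prod_list (map (case_tensor_gen U.Aid dual_value) w)"
proof -
  let ?m = "case_tensor_gen U.Aid dual_value"
  have P_sum: "(\<Sum>a\<in>P. U.Aid a) = U.AH 1"
    unfolding U.AH_one
    by (rule sum.mono_neutral_left) (use finite_feasible U.P_subset U.Aid_unbounded bounded_feasible_dual in auto)
  obtain \<Phi> where \<Phi>: "ring_map QD.T0 \<Phi>"
    "\<And>w c. w \<in> lists QD.X \<Longrightarrow> \<Phi> (word c w) = U.AH (poly_const c) * prod_list (map ?m w)"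
    "\<And>r. r \<in> tensor_relations P NN \<Longrightarrow> \<Phi> r = 0"
    "\<And>\<phi>. \<phi> \<in> formal_tensors NN \<Longrightarrow> \<Phi> \<phi> = (\<Sum>x\<in>{(f, g). \<phi> [Vec f, Vec g] \<noteq> 0}.
      U.AH (poly_const (\<phi> [Vec (fst x), Vec (snd x)])) * (?m (Vec (fst x)) * ?m (Vec (snd x))))"
  proof (rule QD.tensor_lift[of "\<lambda>c. U.AH (poly_const c)" ?m])
    show "U.AH (poly_const c) * ?m x = ?m x * U.AH (poly_const c)" if "x \<in> QD.X" for c x
      using that U.AH_comm_Aset[OF U.Aid_Aset] U.AH_comm_Aset[OF dual_value_Aset] by auto
    show "U.AH (poly_const 1) * ?m x = ?m x" if "x \<in> QD.X" for x
      using that U.AH_one_Aset[OF U.Aid_Aset] U.AH_one_Aset[OF dual_value_Aset] by (auto simp: poly_const_simps(4))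
    show "(\<Sum>a\<in>P. ?m (Idemp a)) = U.AH (poly_const 1)" using P_sum by (simp add: poly_const_simps(4))
  qed (auto simp: dual_value_ops U.Aid_mult poly_const_simps U.AH_add U.AH_mult)
  have ann: "\<Phi> \<phi> = 0" if \<phi>: "\<phi> \<in> formal_tensors NN"
    and an: "\<And>q. q \<in> formal_tensors MM \<Longrightarrow> tensor_class P MM q \<in> RR \<Longrightarrow> tensor_pairing P MM \<phi> q = 0" for \<phi>
  proof -
    let ?F = "{(f, g). \<phi> [Vec f, Vec g] \<noteq> 0}"
    let ?p = "\<lambda>x. \<phi> [Vec (fst x), Vec (snd x)]"
    let ?u = "\<lambda>a b c x. edge_sign a b * edge_sign b c * (?p x * (fst x (gen (b, c)) * snd x (gen (a, b))))"
    have "\<Phi> \<phi> = (\<Sum>x\<in>?F. \<Sum>(a, c)\<in>P \<times> P. \<Sum>b\<in>mid a c. U.AH (poly_const (?u a b c x)) * (U.AP c b * U.AP b a))"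
      unfolding \<Phi>(4)[OF \<phi>]
    proof (rule sum.cong[OF refl])
      fix x
      have k: "U.AH (poly_const (?p x)) * (U.AH (poly_const y) * z) = U.AH (poly_const (?p x * y)) * z" for y z
        by (simp only: poly_const_simps(2) U.AH_mult mult.assoc)
      have "U.AH (poly_const (?p x)) * (dual_value (fst x) * dual_value (snd x)) =
        (\<Sum>(a, c)\<in>P \<times> P. \<Sum>b\<in>mid a c. U.AH (poly_const (?p x * (edge_sign a b * edge_sign b c * (fst x (gen (b, c)) * snd x (gen (a, b)))))) * (U.AP c b * U.AP b a))"
        unfolding dual_value_mult case_prod_unfold sum_distrib_left k ..
      then show "U.AH (poly_const (?p x)) * (?m (Vec (fst x)) * ?m (Vec (snd x))) =
        (\<Sum>(a, c)\<in>P \<times> P. \<Sum>b\<in>mid a c. U.AH (poly_const (?u a b c x)) * (U.AP c b * U.AP b a))"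
        by (simp only: tensor_gen.case mult.left_commute[of "?p x"])
    qed
    also have "\<dots> = (\<Sum>(a, c)\<in>P \<times> P. \<Sum>x\<in>?F. \<Sum>b\<in>mid a c. U.AH (poly_const (?u a b c x)) * (U.AP c b * U.AP b a))"
      unfolding case_prod_unfold by (rule sum.swap)
    also have "\<dots> = (\<Sum>(a, c)\<in>P \<times> P. 0)"
    proof (rule sum.cong[OF refl])
      fix z assume "z \<in> P \<times> P"
      then obtain a c where z: "z = (a, c)" "a \<in> P" "c \<in> P" by blast
      have pc: "poly_const (sum h I) = (\<Sum>i\<in>I. poly_const (h i))" for h :: "'z \<Rightarrow> real" and I
        by (induction I rule: infinite_finite_induct) (simp_all add: poly_const_simps)
      have "(\<Sum>x\<in>?F. \<Sum>b\<in>mid a c. U.AH (poly_const (?u a b c x)) * (U.AP c b * U.AP b a))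
        = (\<Sum>b\<in>mid a c. \<Sum>x\<in>?F. U.AH (poly_const (?u a b c x)) * (U.AP c b * U.AP b a))" by (rule sum.swap)
      also have "\<dots> = (\<Sum>b\<in>mid a c. U.AH (poly_const (edge_sign a b * edge_sign b c * pairing_coeff \<phi> a b c)) * (U.AP c b * U.AP b a))"
        unfolding pairing_coeff_def sum_distrib_left pc U.AH_sum sum_distrib_right ..
      also have "\<dots> = 0"
        by (rule orthogonal_relation[OF z(2,3)]) (rule annihilator_coeff[OF \<phi> an])
      finally show "(case z of (a, c) \<Rightarrow> \<Sum>x\<in>?F. \<Sum>b\<in>mid a c. U.AH (poly_const (?u a b c x)) * (U.AP c b * U.AP b a)) = (case z of (a, c) \<Rightarrow> 0)"
        by (simp only: z(1) prod.case)
    qed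
    finally show ?thesis by simp
  qed
  obtain g where g: "ring_map QD.D g" "\<And>f. f \<in> carrier QD.T0 \<Longrightarrow> g (QD.Dcls f) = \<Phi> f"
  proof (rule QD.D_lift[of \<Phi>])
    show "ring_map QD.T0 \<Phi>" by (rule \<Phi>(1))
    show "\<Phi> r = 0" if "r \<in> tensor_relations P NN" for r using that by (rule \<Phi>(3))
    show "\<Phi> \<phi> = 0" if "\<phi> \<in> formal_tensors NN"
      "\<And>q. q \<in> formal_tensors MM \<Longrightarrow> tensor_class P MM q \<in> RR \<Longrightarrow> tensor_pairing P MM \<phi> q = 0" for \<phi>
      using that by (rule ann)
  qed (rule that)
  show ?thesis by (rule that[OF g(1)[folded A_quadratic_dual_eq] \<Phi>(1) g(2) \<Phi>(2)])
qed

end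

section \<open>The inverse map to the quadratic dual\<close>

context arrangement
begin

interpretation U: arrangement U by (rule dual_arrangement)
interpretation QD: quadratic_data P NN MM RR by (rule NN_quadratic_data)

section \<open>Generators and relations inside the quadratic dual\<close>

definition "Did0 a = (if a \<in> P then QD.Did a else 0)"
text \<open>Inverse to \<open>dual_value\<close> on the dual basis, since edge signs are symmetric
  and square to 1.\<close>

definition "DP a b = (if (a, b) \<in> arrows then QD.sc (edge_sign a b) * QD.DV (delta (b, a)) else 0)"

lemma P_F: "a \<in> P \<longleftrightarrow> a \<in> F \<and> a \<in> feasible U" by (simp add: bounded_feasible_eq)

lemma sc_zero: "QD.sc 0 = 0" using QD.sc_add[of 0 0] by simp

lemma sc_sc: "QD.sc c * (QD.sc d * x) = QD.sc (c * d) * x" by (simp add: QD.sc_mult mult.assoc)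

lemma edge_sign_arrow:
  assumes "(a, b) \<in> arrows"
  shows "edge_sign b a = edge_sign a b" "edge_sign a b * edge_sign a b = 1"
proof -
  obtain i where i: "b = flip a i" using arrows_flip[OF assms] by blast
  have sg: "a \<in> sign_vectors" using assms P_sign by (auto simp: arrows_def)
  show "edge_sign b a = edge_sign a b" "edge_sign a b * edge_sign a b = 1"
    unfolding i by (rule edge_sign_sym[OF sg], rule edge_sign_sq[OF sg])
qed

lemma sc_DP: "QD.sc c * DP a b = DP a b * QD.sc c"
proof (cases "(a, b) \<in> arrows")
  case True
  have d: "delta (b, a) \<in> carrier NN" by (rule delta_NN[OF arrows_sym[OF True]])
  have "QD.sc c * (QD.sc (edge_sign a b) * QD.DV (delta (b, a))) = QD.sc (edge_sign a b) * (QD.sc c * QD.DV (delta (b, a)))"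
    by (simp add: sc_sc mult.commute)
  also have "QD.sc c * QD.DV (delta (b, a)) = QD.DV (delta (b, a)) * QD.sc c" by (rule QD.sc_comm(2)[OF d])
  finally show ?thesis using True by (simp add: DP_def mult.assoc)
qed (simp add: DP_def)

lemma sc_one_DP: "QD.sc 1 * DP a b = DP a b"
  by (simp add: DP_def sc_sc)

lemma sc_Did0: "QD.sc c * Did0 a = Did0 a * QD.sc c" "QD.sc 1 * Did0 a = Did0 a"
proof -
  show "QD.sc c * Did0 a = Did0 a * QD.sc c" by (simp add: Did0_def QD.sc_comm)
  show "QD.sc 1 * Did0 a = Did0 a" by (simp add: Did0_def QD.sc_one)
qed

lemma Did0_mult: "Did0 a * Did0 b = (if a = b then Did0 a else 0)"
  by (simp add: Did0_def QD.Did_mult)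

lemma Did0_DP: "Did0 c * DP a b = (if c = a then DP a b else 0)"
proof (cases "(a, b) \<in> arrows \<and> c \<in> P")
  case True
  then have ab: "(b, a) \<in> arrows" "(a, b) \<in> arrows" and c: "c \<in> P" using arrows_sym by auto
  have "QD.Did c * (QD.sc (edge_sign a b) * QD.DV (delta (b, a))) = QD.sc (edge_sign a b) * (QD.Did c * QD.DV (delta (b, a)))"
    by (simp only: mult.assoc[symmetric] QD.sc_comm(1)[OF c])
  also have "QD.Did c * QD.DV (delta (b, a)) = (if c = a then QD.DV (delta (b, a)) else 0)"
    unfolding QD.Did_DV(1)[OF c delta_NN[OF ab(1)]] delta_act(1)[OF ab(1) c] using DV_zero by simp
  finally show ?thesis using ab c by (simp add: DP_def Did0_def)
qed (auto simp: DP_def Did0_def arrows_def)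

lemma DP_Did0: "DP a b * Did0 c = (if c = b then DP a b else 0)"
proof (cases "(a, b) \<in> arrows \<and> c \<in> P")
  case True
  then have ab: "(b, a) \<in> arrows" "(a, b) \<in> arrows" and c: "c \<in> P" using arrows_sym by auto
  have "QD.DV (delta (b, a)) * QD.Did c = (if c = b then QD.DV (delta (b, a)) else 0)"
    unfolding QD.Did_DV(2)[OF c delta_NN[OF ab(1)]] delta_act(2)[OF ab(1) c] using DV_zero by simp
  then show ?thesis using ab c by (simp add: DP_def Did0_def mult.assoc)
qed (auto simp: DP_def Did0_def arrows_def)

text \<open>The additional factor \<open>edge_sign c b * edge_sign b a\<close> cancels the signs
  inside \<open>DP\<close>, which leaves \<open>dual_relation\<close>.\<close>

lemma DP_relation:
  assumes ac: "a \<in> P" "c \<in> P" and l: "descends l a c"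
  shows "(\<Sum>b\<in>mid a c. QD.sc (l (crossing a b c) * (edge_sign c b * edge_sign b a)) * (DP c b * DP b a)) = 0"
proof -
  have "QD.sc (l (crossing a b c) * (edge_sign c b * edge_sign b a)) * (DP c b * DP b a)
    = QD.sc (l (crossing a b c)) * (QD.DV (delta (b, c)) * QD.DV (delta (a, b)))" if "b \<in> mid a c" for b
  proof -
    have ar: "(a, b) \<in> arrows" "(b, c) \<in> arrows" using that by (auto simp: mid_def)
    then have ar': "(c, b) \<in> arrows" "(b, a) \<in> arrows" using arrows_sym by auto
    have d: "delta (b, c) \<in> carrier NN" using delta_NN ar by blast
    have "DP c b * DP b a = QD.sc (edge_sign c b) * (QD.DV (delta (b, c)) * QD.sc (edge_sign b a)) * QD.DV (delta (a, b))"
      using ar' by (simp add: DP_def mult.assoc)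
    also have "\<dots> = QD.sc (edge_sign c b * edge_sign b a) * (QD.DV (delta (b, c)) * QD.DV (delta (a, b)))"
      unfolding QD.sc_comm(2)[OF d, symmetric] by (simp add: QD.sc_mult mult.assoc)
    finally have "QD.sc (l (crossing a b c) * (edge_sign c b * edge_sign b a)) * (DP c b * DP b a)
      = QD.sc (l (crossing a b c) * (edge_sign c b * edge_sign b a) * (edge_sign c b * edge_sign b a)) * (QD.DV (delta (b, c)) * QD.DV (delta (a, b)))"
      by (simp only: sc_sc)
    also have "l (crossing a b c) * (edge_sign c b * edge_sign b a) * (edge_sign c b * edge_sign b a)
      = l (crossing a b c) * ((edge_sign c b * edge_sign c b) * (edge_sign b a * edge_sign b a))" by (simp only: ac_simps)
    also have "\<dots> = l (crossing a b c)" by (simp add: edge_sign_arrow(2)[OF ar'(1)] edge_sign_arrow(2)[OF ar'(2)])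
    finally show ?thesis .
  qed
  then show ?thesis using dual_relation[OF ac l] by simp
qed

text \<open>The dual chambers of opposite corners meet, so the constant coefficient descends to
  their entry. It gives a relation with both coefficients 1, an anticommuting square of dual basis
  vectors, and the edge signs make the square commute.\<close>

lemma DP_square:
  assumes a: "a \<in> feasible U" "flip a i \<in> feasible U" "flip a j \<in> feasible U" "flip (flip a i) j \<in> feasible U" "i \<noteq> j"
  shows "DP a (flip a i) * DP (flip a i) (flip (flip a i) j) = DP a (flip a j) * DP (flip a j) (flip (flip a i) j)"
proof -
  let ?b = "flip a i" and ?d = "flip a j" and ?c = "flip (flip a i) j"
  show ?thesis
  proof (cases "a \<in> P \<and> ?c \<in> P")
    case False
    then have "DP a x * DP x ?c = 0" for x by (auto simp: DP_def arrows_def)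
    then show ?thesis by simp
  next
    case True
    then have ac: "a \<in> P" "?c \<in> P" by auto
    have sg: "a \<in> sign_vectors" by (rule P_sign[OF ac(1)])
    have ne: "?b \<noteq> ?d" using flip_inj[OF sg] a(5) by simp
    obtain x where x: "x \<in> chamber U a" "x $ i = 0" "x $ j = 0"
    proof (rule U.codim2_point[of a i j])
      show "flip (flip a j) i \<in> feasible U" using a(4) by (simp add: flip_commute)
    qed (use a in auto)
    have "x \<in> chamber U ?c" using chamber_flip[OF chamber_flip[OF x(1,2)] x(3)] .
    then have l: "descends (\<lambda>q. Poly_Mapping.lookup q 0) ?c a" using x(1) by (intro const_coeff_descends) blast
    have mid_sym: "mid ?c a = mid a ?c" using arrows_sym by (auto simp: mid_def)
    have sub: "mid ?c a \<subseteq> {?b, ?d}" unfolding mid_sym by (rule mid_square[OF sg a(5)])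
    have cr: "crossing ?c x a = 1" if "x \<in> {?b, ?d}" for x
    proof -
      have cs: "?c \<in> sign_vectors" by (rule P_sign[OF ac(2)])
      have s: "i \<in> separating ?c a" "j \<in> separating ?c a"
        using a(5) sign_nonzero[OF sg, of i] sign_nonzero[OF sg, of j] by (auto simp: separating_def flip_apply)
      have "?b = flip ?c j" by simp
      moreover have "?d = flip ?c i" by (simp add: flip_commute[of a i j])
      ultimately show ?thesis using that s crossing_flip[OF cs, of j a] crossing_flip[OF cs, of i a] by auto
    qed
    have "0 = (\<Sum>x\<in>mid ?c a. QD.sc (edge_sign a x * edge_sign x ?c) * (DP a x * DP x ?c))"
      unfolding DP_relation[OF ac(2,1) l, symmetric]
      using sub by (intro sum.cong refl) (use cr in \<open>auto simp: lookup_poly_one\<close>)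
    also have "\<dots> = (\<Sum>x\<in>{?b, ?d}. QD.sc (edge_sign a x * edge_sign x ?c) * (DP a x * DP x ?c))"
    proof (rule sum.mono_neutral_left[OF _ sub])
      have "DP a x * DP x ?c = 0" if "x \<notin> mid ?c a" for x
        using that unfolding mid_sym by (auto simp: DP_def mid_def)
      then show "\<forall>x\<in>{?b, ?d} - mid ?c a. QD.sc (edge_sign a x * edge_sign x ?c) * (DP a x * DP x ?c) = 0" by auto
    qed simp
    also have "\<dots> = QD.sc (edge_sign a ?b * edge_sign ?b ?c) * (DP a ?b * DP ?b ?c) +
      QD.sc (edge_sign a ?d * edge_sign ?d ?c) * (DP a ?d * DP ?d ?c)" using ne by simp
    finally have eq: "QD.sc (edge_sign a ?b * edge_sign ?b ?c) * (DP a ?b * DP ?b ?c) +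
      QD.sc (edge_sign a ?d * edge_sign ?d ?c) * (DP a ?d * DP ?d ?c) = 0" by simp
    let ?s = "edge_sign a ?b * edge_sign ?b ?c"
    have t: "edge_sign a ?d * edge_sign ?d ?c = - ?s" using edge_sign_square[OF sg a(5)] by simp
    have "edge_sign ?b ?c * edge_sign ?b ?c = 1" by (rule edge_sign_sq[OF flip_sign[OF sg]])
    moreover have "?s * ?s = (edge_sign a ?b * edge_sign a ?b) * (edge_sign ?b ?c * edge_sign ?b ?c)" by (simp only: ac_simps)
    ultimately have ss: "?s * ?s = 1" using edge_sign_sq[OF sg] by simp
    have u: "QD.sc 1 * (DP x y * z) = DP x y * z" for x y z by (simp only: mult.assoc[symmetric] sc_one_DP)
    have m: "QD.sc (- 1) * x = - (QD.sc 1 * x)" for x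
    proof -
      have "QD.sc (- 1) * x + QD.sc 1 * x = 0"
        unfolding distrib_right[symmetric] QD.sc_add[symmetric] by (simp add: sc_zero)
      then show ?thesis by (simp add: eq_neg_iff_add_eq_0)
    qed
    \<comment> \<open>Multiplication by the sign \<open>?s\<close>, whose square is 1, normalises
      the coefficients to 1 and \<open>- 1\<close>.\<close>
    have "0 = QD.sc ?s * (QD.sc ?s * (DP a ?b * DP ?b ?c) + QD.sc (- ?s) * (DP a ?d * DP ?d ?c))"
      using eq unfolding t by simp
    also have "\<dots> = QD.sc (?s * ?s) * (DP a ?b * DP ?b ?c) + QD.sc (?s * - ?s) * (DP a ?d * DP ?d ?c)"
      by (simp only: distrib_left sc_sc)
    also have "?s * - ?s = - 1" using ss by simp
    finally show ?thesis unfolding ss m u by simp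
  qed
qed

text \<open>The element \<open>\<Sum> y_k t_k\<close> at the vertex \<open>a\<close>, expressed by
  loops. It deserves this meaning when \<open>supported a y\<close> holds, as then every coordinate
  that occurs can be flipped in the Gale dual.\<close>

definition "Lam a y = (\<Sum>k\<in>UNIV. QD.sc (y $ k) * (DP a (flip a k) * DP (flip a k) a))"

lemma Lam_add: "Lam a (x + y) = Lam a x + Lam a y"
  by (simp add: Lam_def QD.sc_add distrib_right sum.distrib)

lemma Lam_scale: "Lam a (c *\<^sub>R x) = QD.sc c * Lam a x"
  by (simp add: Lam_def sum_distrib_left sc_sc)

lemma Lam_sum: "Lam a (sum f I) = (\<Sum>i\<in>I. Lam a (f i))"
  by (induction I rule: infinite_finite_induct) (simp_all add: Lam_add, simp_all add: Lam_def sc_zero)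

definition "supported a y \<longleftrightarrow> (\<forall>k. flip a k \<notin> feasible U \<longrightarrow> y $ k = 0)"

text \<open>The functional on linear coefficients given by \<open>w\<close> takes the value
  \<open>w_k\<close> at the variable \<open>k\<close>, so that the relation it yields in the
  quadratic dual has \<open>w\<close> itself as its coefficients.\<close>

lemma Lam_zero:
  assumes a: "a \<in> P" and w: "w \<in> dir W" "supported a w"
  shows "Lam a w = 0"
proof -
  let ?l = "\<lambda>q. \<Sum>i\<in>UNIV. w $ i * Poly_Mapping.lookup q (Poly_Mapping.single i (Suc 0))"
  have sg: "a \<in> sign_vectors" by (rule P_sign[OF a])
  have l: "descends ?l a a"
    by (rule linear_coeff_descends[OF _ w(1)]) (use a w(2) in \<open>auto simp: P_F supported_def\<close>)
  have lk: "?l (poly_var k) = w $ k" for k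
  proof -
    have "?l (poly_var k) = (\<Sum>i\<in>UNIV. if i = k then w $ k else 0)"
      by (intro sum.cong refl) (simp add: lookup_poly_var)
    then show ?thesis by simp
  qed
  have cr: "crossing a (flip a k) a = poly_var k" for k
    by (simp add: crossing_flip[OF sg] separating_def)
  have e: "edge_sign a (flip a k) * edge_sign (flip a k) a = 1" for k
    by (simp add: edge_sign_sym[OF sg] edge_sign_sq[OF sg])
  have "0 = (\<Sum>k\<in>{k. flip a k \<in> P}. QD.sc (?l (crossing a (flip a k) a) * (edge_sign a (flip a k) * edge_sign (flip a k) a)) *
    (DP a (flip a k) * DP (flip a k) a))"
    using DP_relation[OF a a l] unfolding sum_mid_self[OF a] by simp
  also have "\<dots> = (\<Sum>k\<in>{k. flip a k \<in> P}. QD.sc (w $ k) * (DP a (flip a k) * DP (flip a k) a))"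
    unfolding cr e lk by simp
  also have "\<dots> = Lam a w"
    unfolding Lam_def by (rule sum.mono_neutral_left) (auto simp: DP_def arrows_def)
  finally show ?thesis ..
qed

lemma Lam_eq:
  assumes "a \<in> P" "supported a x" "supported a y" "x - y \<in> dir W"
  shows "Lam a x = Lam a y"
proof -
  have "Lam a (x - y) = 0" using assms by (intro Lam_zero) (auto simp: supported_def)
  then show ?thesis using Lam_add[of a "x - y" y] by simp
qed

lemma sc_Lam: "QD.sc c * Lam a y = Lam a y * QD.sc c"
proof -
  have "QD.sc c * (QD.sc d * (DP a b * DP b a)) = QD.sc d * (DP a b * DP b a) * QD.sc c" for d b
  proof -
    have "QD.sc c * (QD.sc d * (DP a b * DP b a)) = QD.sc d * (QD.sc c * (DP a b * DP b a))"
      by (simp add: sc_sc mult.commute)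
    also have "QD.sc c * (DP a b * DP b a) = DP a b * DP b a * QD.sc c"
      by (simp only: mult.assoc[symmetric] sc_DP) (simp only: mult.assoc sc_DP)
    finally show ?thesis by (simp only: mult.assoc)
  qed
  then show ?thesis by (simp add: Lam_def sum_distrib_left sum_distrib_right)
qed

lemma Lam_Did0: "Did0 c * Lam a y = (if c = a then Lam a y else 0)" "Lam a y * Did0 c = (if c = a then Lam a y else 0)"
proof -
  have "Did0 c * (QD.sc d * (DP a b * DP b a)) = (if c = a then QD.sc d * (DP a b * DP b a) else 0)" for d b
    by (simp only: mult.assoc[symmetric] sc_Did0(1)[symmetric]) (simp add: mult.assoc Did0_DP mult.assoc[symmetric, of "Did0 c" "DP a b"])
  then show "Did0 c * Lam a y = (if c = a then Lam a y else 0)" by (simp add: Lam_def sum_distrib_left)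
  have "QD.sc d * (DP a b * DP b a) * Did0 c = (if c = a then QD.sc d * (DP a b * DP b a) else 0)" for d b
    by (simp add: mult.assoc DP_Did0)
  then show "Lam a y * Did0 c = (if c = a then Lam a y else 0)" by (simp add: Lam_def sum_distrib_right)
qed

text \<open>Each loop in a direction \<open>k\<close> of the support is carried across the arrow by
  two squares, whose corners are feasible for the Gale dual because \<open>k\<close> can be flipped
  at both ends; for \<open>k = i\<close> only brackets move.\<close>

lemma Lam_DP:
  assumes ab: "(a, flip a i) \<in> arrows" and y: "supported a y" "supported (flip a i) y"
  shows "Lam a y * DP a (flip a i) = DP a (flip a i) * Lam (flip a i) y"
proof -
  let ?b = "flip a i"
  have P: "a \<in> feasible U" "?b \<in> feasible U" using ab by (auto simp: arrows_def P_F)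
  have "QD.sc (y $ k) * (DP a (flip a k) * DP (flip a k) a) * DP a ?b =
    DP a ?b * (QD.sc (y $ k) * (DP ?b (flip ?b k) * DP (flip ?b k) ?b))" for k
  proof (cases "y $ k = 0")
    case False
    then have k: "flip a k \<in> feasible U" "flip ?b k \<in> feasible U" using y by (auto simp: supported_def)
    have "DP a (flip a k) * DP (flip a k) a * DP a ?b = DP a ?b * (DP ?b (flip ?b k) * DP (flip ?b k) ?b)"
    proof (cases "k = i")
      case True
      then show ?thesis by (simp add: mult.assoc)
    next
      case False
      have c: "flip (flip a k) i = flip ?b k" by (simp add: flip_commute)
      have 1: "DP (flip a k) a * DP a ?b = DP (flip a k) (flip ?b k) * DP (flip ?b k) ?b"
        using DP_square[of "flip a k" k i] k P False by (simp add: c)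
      have 2: "DP a (flip a k) * DP (flip a k) (flip ?b k) = DP a ?b * DP ?b (flip ?b k)"
        using DP_square[of a k i] k P False by (simp add: c)
      have "DP a (flip a k) * DP (flip a k) a * DP a ?b = DP a (flip a k) * (DP (flip a k) a * DP a ?b)"
        by (simp only: mult.assoc)
      also have "\<dots> = DP a (flip a k) * DP (flip a k) (flip ?b k) * DP (flip ?b k) ?b"
        unfolding 1 by (simp only: mult.assoc)
      finally show ?thesis unfolding 2 by (simp only: mult.assoc)
    qed
    then have "QD.sc (y $ k) * (DP a (flip a k) * DP (flip a k) a) * DP a ?b =
      QD.sc (y $ k) * DP a ?b * (DP ?b (flip ?b k) * DP (flip ?b k) ?b)" by (simp only: mult.assoc)
    then show ?thesis unfolding sc_DP by (simp only: mult.assoc)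
  qed (simp add: sc_zero)
  then show ?thesis by (simp add: Lam_def sum_distrib_left sum_distrib_right)
qed

text \<open>The flips at a vertex of the intersection of the two chambers are available on both
  sides, and there are enough of them to represent every vector modulo \<open>V\<close>.\<close>

lemma common_support:
  assumes "a \<in> feasible U" "c \<in> feasible U" "x0 \<in> chamber U a" "x0 \<in> chamber U c"
  shows "\<exists>w. supported a w \<and> supported c w \<and> u - w \<in> dir W"
proof -
  obtain Z where Z: "\<And>k. k \<in> Z \<Longrightarrow> flip a k \<in> feasible U" "\<And>k. k \<in> Z \<Longrightarrow> flip c k \<in> feasible U"
    "\<And>u. \<exists>w. (\<forall>k. k \<notin> Z \<longrightarrow> w $ k = 0) \<and> u - w \<in> (dir U)\<^sup>\<bottom>"
    by (rule U.common_flips[OF assms]) (rule that)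
  obtain w where w: "\<And>k. k \<notin> Z \<Longrightarrow> w $ k = 0" "u - w \<in> (dir U)\<^sup>\<bottom>" using Z(3)[of u] by blast
  have "w $ k = 0" if "flip a k \<notin> feasible U \<or> flip c k \<notin> feasible U" for k
    by (rule w(1)) (use Z that in blast)
  then show ?thesis using w(2) dir_dual(2) unfolding supported_def by (intro exI[of _ w]) auto
qed

text \<open>The images of idempotents and arrows are at hand; what has to be constructed is the
  action of the polynomials, that is, commuting elements \<open>\<theta> i\<close> in the role of
  \<open>t_i\<close>.\<close>

lemma dual_representation:
  obtains h where "A_representation U h Did0 DP" "\<And>c. h (poly_const c) = QD.sc c"
proof -
  have "\<exists>w. supported a w \<and> axis i 1 - w \<in> dir W" if a: "a \<in> P" for a i
  proof -
    have aU: "a \<in> feasible U" using a by (simp add: P_F)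
    obtain x where x: "x \<in> chamber U a" by (rule U.feasibleE[OF aU])
    show ?thesis using common_support[OF aU aU x x, of "axis i 1"] by blast
  qed
  then have "\<forall>a i. \<exists>w. a \<in> P \<longrightarrow> supported a w \<and> axis i 1 - w \<in> dir W" by blast
  then obtain wv where wv: "\<And>a i. a \<in> P \<Longrightarrow> supported a (wv a i)" "\<And>a i. a \<in> P \<Longrightarrow> axis i 1 - wv a i \<in> dir W"
    by metis
  \<comment> \<open>At each vertex the unit vector is replaced by a supported vector in its class
    modulo \<open>V\<close>; by \<open>Lam_eq\<close> the choice does not matter.\<close>
  define \<theta> where "\<theta> i = (\<Sum>a\<in>P. Lam a (wv a i))" for i
  have th_e: "\<theta> i * Did0 a = (if a \<in> P then Lam a (wv a i) else 0)" "Did0 a * \<theta> i = (if a \<in> P then Lam a (wv a i) else 0)" for i a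
    using finite_P by (simp_all add: \<theta>_def sum_distrib_left sum_distrib_right Lam_Did0)
  have th_s: "QD.sc c * \<theta> i = \<theta> i * QD.sc c" for c i
    by (simp add: \<theta>_def sum_distrib_left sum_distrib_right sc_Lam)
  \<comment> \<open>Along an arrow the two separate choices are exchanged for one vector
    \<open>w\<close> supported at both ends, and \<open>Lam_DP\<close> moves its loops
    across.\<close>
  have th_p: "\<theta> i * DP a b = DP a b * \<theta> i" for i a b
  proof (cases "(a, b) \<in> arrows")
    case True
    obtain j where j: "b = flip a j" using arrows_flip[OF True] by blast
    have P: "a \<in> P" "b \<in> P" using True by (auto simp: arrows_def)
    then have U: "a \<in> feasible U" "flip a j \<in> feasible U" using j by (auto simp: P_F)
    obtain x where x: "x \<in> chamber U a" "x $ j = 0" by (rule U.facet_point[OF U])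
    obtain w where w: "supported a w" "supported b w" "axis i 1 - w \<in> dir W"
      using common_support[OF U x(1) chamber_flip[OF x], of "axis i 1"] j by blast
    have wd: "wv c i - w \<in> dir W" if "c \<in> P" for c
      using subspace_diff[OF subspace_dir w(3) wv(2)[OF that, of i]] by simp
    have "\<theta> i * DP a b = \<theta> i * (Did0 a * DP a b)" by (simp add: Did0_DP)
    also have "\<dots> = Lam a (wv a i) * DP a b" using P by (simp add: th_e flip: mult.assoc)
    also have "\<dots> = Lam a w * DP a b" using Lam_eq[OF P(1) wv(1)[OF P(1)] w(1) wd[OF P(1)]] by simp
    also have "\<dots> = DP a b * Lam b w" using Lam_DP[of a j w] True w j by simp
    also have "\<dots> = DP a b * Lam b (wv b i)" using Lam_eq[OF P(2) wv(1)[OF P(2)] w(2) wd[OF P(2)]] by simp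
    also have "\<dots> = DP a b * Did0 b * \<theta> i" using P by (simp add: th_e mult.assoc)
    also have "\<dots> = DP a b * \<theta> i" by (simp add: DP_Did0)
    finally show ?thesis .
  qed (simp add: DP_def)
  have th_Lam: "\<theta> i * Lam a y = Lam a y * \<theta> i" for i a y
  proof -
    have "\<theta> i * (QD.sc d * (DP a b * DP b a)) = QD.sc d * (DP a b * DP b a) * \<theta> i" for d b
    proof -
      have "\<theta> i * (QD.sc d * (DP a b * DP b a)) = QD.sc d * (\<theta> i * DP a b) * DP b a"
        by (simp only: mult.assoc[symmetric] th_s)
      also have "\<dots> = QD.sc d * DP a b * (\<theta> i * DP b a)" by (simp only: th_p mult.assoc)
      finally show ?thesis by (simp only: th_p mult.assoc)
    qed
    then show ?thesis by (simp add: Lam_def sum_distrib_left sum_distrib_right)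
  qed
  have th_th: "\<theta> i * \<theta> j = \<theta> j * \<theta> i" for i j
    unfolding \<theta>_def[of j] by (simp add: sum_distrib_left sum_distrib_right th_Lam)
  have sc1: "QD.sc 1 * \<theta> i = \<theta> i" for i
    using Lam_scale[of _ 1] by (simp add: \<theta>_def sum_distrib_left)
  interpret E: evaluation QD.sc \<theta>
    by unfold_locales (rule QD.sc_add QD.sc_mult th_s th_th sc1)+
  let ?h = "ev QD.sc \<theta>"
  have "A_representation U ?h Did0 DP"
  proof
    show "?h (linear_form v) = 0" if v: "v \<in> (dir U)\<^sup>\<bottom>" for v
    proof -
      have v': "v \<in> dir W" using v dir_dual(2) by simp
      have "?h (linear_form v) = (\<Sum>i\<in>UNIV. \<Sum>a\<in>P. QD.sc (v $ i) * Lam a (wv a i))"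
        unfolding E.ev_linear_form \<theta>_def sum_distrib_left ..
      also have "\<dots> = (\<Sum>a\<in>P. \<Sum>i\<in>UNIV. QD.sc (v $ i) * Lam a (wv a i))" by (rule sum.swap)
      also have "\<dots> = (\<Sum>a\<in>P. 0)"
      proof (rule sum.cong[OF refl])
        fix a assume a: "a \<in> P"
        \<comment> \<open>At \<open>a\<close> the linear form of \<open>v\<close> becomes
          \<open>Lam a ?t\<close>. Since \<open>?t\<close> is congruent to \<open>v\<close> modulo
          \<open>V\<close>, it lies in \<open>V\<close>, and it is supported at
          \<open>a\<close>.\<close>
        let ?t = "\<Sum>i\<in>UNIV. v $ i *\<^sub>R wv a i"
        have "supported a ?t" using wv(1)[OF a] by (simp add: supported_def)
        moreover have "?t \<in> dir W"
        proof -
          have "(\<Sum>i\<in>UNIV. v $ i *\<^sub>R (axis i 1 - wv a i)) \<in> dir W"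
            by (intro subspace_sum[OF subspace_dir] subspace_scale[OF subspace_dir] wv(2)[OF a])
          moreover have "(\<Sum>i\<in>UNIV. v $ i *\<^sub>R axis i 1) = v"
          proof -
            have "(\<Sum>i\<in>UNIV. v $ i *\<^sub>R axis i (1::real)) $ k = v $ k" for k
            proof -
              have "(\<Sum>i\<in>UNIV. v $ i *\<^sub>R axis i (1::real)) $ k = (\<Sum>i\<in>UNIV. if i = k then v $ k else 0)"
                unfolding sum_component by (intro sum.cong refl) (auto simp: axis_def)
              then show ?thesis by simp
            qed
            then show ?thesis by (simp add: vec_eq_iff)
          qed
          ultimately have "v - ?t \<in> dir W" by (simp add: scaleR_diff_right sum_subtractf)
          from subspace_diff[OF subspace_dir v' this] show ?thesis by simp
        qed
        ultimately have "Lam a ?t = 0" by (intro Lam_zero[OF a])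
        then show "(\<Sum>i\<in>UNIV. QD.sc (v $ i) * Lam a (wv a i)) = 0" by (simp add: Lam_sum Lam_scale)
      qed
      finally show ?thesis by simp
    qed
    show "?h q * Did0 a = Did0 a * ?h q" for q a
      by (rule E.ev_comm) (simp_all add: sc_Did0(1) th_e)
    show "?h q * DP a (flip a i) = DP a (flip a i) * ?h q" for q a i
      by (rule E.ev_comm) (simp_all add: sc_DP th_p)
    show "?h 1 * Did0 a = Did0 a" for a
      using E.ev_const[of 1] sc_Did0(2)[of a] by (simp add: poly_const_simps(4))
    show "DP a (flip a i) * DP (flip a i) a = ?h (poly_var i) * Did0 a" if "a \<in> feasible U" "flip a i \<in> feasible U" for a i
    proof (cases "a \<in> P")
      case True
      \<comment> \<open>When \<open>flip a i\<close> is feasible for the Gale dual, the unit vector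
        is itself supported at \<open>a\<close>, and \<open>Lam\<close> reduces to the single loop
        through \<open>flip a i\<close>.\<close>
      have ax: "supported a (axis i 1)" using that(2) by (auto simp: supported_def axis_def)
      have "?h (poly_var i) * Did0 a = Lam a (wv a i)" using True by (simp add: E.ev_var th_e)
      also have "\<dots> = Lam a (axis i 1)"
        by (rule Lam_eq[OF True ax wv(1)[OF True] wv(2)[OF True], symmetric])
      also have "\<dots> = (\<Sum>k\<in>UNIV. if k = i then QD.sc 1 * (DP a (flip a i) * DP (flip a i) a) else 0)"
        unfolding Lam_def by (intro sum.cong refl) (auto simp: axis_def sc_zero)
      also have "\<dots> = QD.sc 1 * (DP a (flip a i) * DP (flip a i) a)" by simp
      also have "\<dots> = DP a (flip a i) * DP (flip a i) a" by (simp only: mult.assoc[symmetric] sc_one_DP)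
      finally show ?thesis ..
    next
      case False
      then show ?thesis by (simp add: DP_def Did0_def arrows_def)
    qed
    show "Did0 a = 0" if "a \<in> feasible U - bounded_feasible U" for a
      using that by (simp add: Did0_def bounded_feasible_dual)
  qed (auto simp: E.ev_add E.ev_mult Did0_mult Did0_DP DP_Did0 intro: DP_square)
  then show ?thesis by (rule that) (rule E.ev_const)
qed

lemma dual_value_delta:
  assumes "(a, b) \<in> arrows"
  shows "dual_value (delta (b, a)) = U.AH (poly_const (edge_sign b a)) * U.AP a b"
proof -
  have ba: "(b, a) \<in> arrows" by (rule arrows_sym[OF assms])
  have "dual_value (delta (b, a)) = (\<Sum>e\<in>arrows. if e = (b, a) then U.AH (poly_const (edge_sign b a)) * U.AP a b else 0)"
    unfolding dual_value_def
    by (intro sum.cong refl) (auto simp: delta_def gen_A1 coef_gen ba poly_const_simps U.AH_zero)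
  then show ?thesis using ba finite_arrows by simp
qed

text \<open>Injectivity comes from \<open>\<Psi> (\<Phi> f) = dcl f\<close>, checked on words.
  Surjectivity amounts to the generation of \<open>A\<close> of the Gale dual in degrees zero and
  one.\<close>

theorem quadratic_dual_iso: "A_quadratic_dual W \<simeq> A_algebra U"
proof -
  let ?m = "case_tensor_gen U.Aid dual_value"
  obtain g \<Phi> where g: "ring_map (A_quadratic_dual W) g" and \<Phi>: "ring_map QD.T0 \<Phi>"
    and g\<Phi>: "\<And>f. f \<in> carrier QD.T0 \<Longrightarrow> g (QD.Dcls f) = \<Phi> f"
    and word: "\<And>w c. w \<in> lists QD.X \<Longrightarrow> \<Phi> (word c w) = U.AH (poly_const c) * prod_list (map ?m w)"
    by (rule dual_map) (rule that)
  obtain h where h: "A_representation U h Did0 DP" "\<And>c. h (poly_const c) = QD.sc c"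
    by (rule dual_representation) (rule that)
  interpret R: A_representation U h Did0 DP by (rule h(1))
  obtain \<Psi> where add: "\<And>x y. x \<in> U.Aset \<Longrightarrow> y \<in> U.Aset \<Longrightarrow> \<Psi> (x + y) = \<Psi> x + \<Psi> y"
    and mult: "\<And>x y. x \<in> U.Aset \<Longrightarrow> y \<in> U.Aset \<Longrightarrow> \<Psi> (x * y) = \<Psi> x * \<Psi> y"
    and zero: "\<Psi> 0 = 0" and AH: "\<And>q y. y \<in> U.Aset \<Longrightarrow> \<Psi> (U.AH q * y) = h q * \<Psi> y"
    and id: "\<And>a. a \<in> feasible U \<Longrightarrow> \<Psi> (U.Aid a) = Did0 a"
    and AP: "\<And>a i. a \<in> feasible U \<Longrightarrow> flip a i \<in> feasible U \<Longrightarrow> \<Psi> (U.AP a (flip a i)) = DP a (flip a i)"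
    by (rule R.extension_rprod) (rule that)
  have m_Aset: "?m x \<in> U.Aset" for x
    using U.Aid_Aset dual_value_Aset by (cases x) (simp_all del: image_iff)
  \<comment> \<open>An initial factor from \<open>Aset\<close> is carried along, because the empty
    product is the unit of \<open>rprod\<close>, which is not in \<open>Aset\<close>.\<close>
  have "y * prod_list (map ?m w) \<in> U.Aset" if "y \<in> U.Aset" for y w
    using that
  proof (induction w arbitrary: y)
    case (Cons x w)
    have "y * ?m x \<in> U.Aset" by (rule U.Aset_closed(2)[OF Cons.prems m_Aset])
    from Cons.IH[OF this] show ?case by (simp add: mult.assoc del: image_iff)
  qed (simp del: image_iff)
  then have word_Aset: "U.AH (poly_const c) * prod_list (map ?m w) \<in> U.Aset" for c w using U.AH_Aset by blast
  interpret T: ring QD.T0 by (rule free_algebra_ring)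
  have \<Phi>_Aset: "\<Phi> f \<in> U.Aset" if "f \<in> carrier QD.T0" for f
    using that
  proof (induction f rule: free_algebra_induct)
    case zero
    then show ?case using ring_map_zero[OF free_algebra_ring \<Phi>] U.Aset_zero by (simp del: image_iff)
  next
    case (word w c)
    then show ?case using \<open>\<And>w c. w \<in> lists QD.X \<Longrightarrow> \<Phi> (word c w) = _ c w\<close> word_Aset by (simp del: image_iff lists_eq_set)
  next
    case (add f f')
    then show ?case using ring_mapD(1)[OF \<Phi> add(1,2)] U.Aset_closed(1) by (simp del: image_iff)
  qed
  have \<Psi>_AP: "\<Psi> (U.AP b a) = DP b a" if ba: "(b, a) \<in> arrows" for a b
  proof -
    obtain i where i: "a = flip b i" using arrows_flip[OF ba] by blast
    have "b \<in> feasible U" "flip b i \<in> feasible U" using ba i by (auto simp: arrows_def P_F)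
    then show ?thesis using AP i by simp
  qed
  have \<Psi>_m: "\<Psi> (?m x) = QD.dcl (word 1 [x])" if x: "x \<in> QD.X" for x
  proof (cases x)
    case (Idemp a)
    then have "a \<in> P" using x by auto
    then show ?thesis using id[of a] Idemp by (simp add: Did0_def QD.Did_def P_F)
  next
    case (Vec f)
    then have f: "f \<in> carrier NN" using x by auto
    have "\<Psi> (dual_value f) = (\<Sum>e\<in>arrows. \<Psi> (U.AH (poly_const (edge_sign (fst e) (snd e) * f (gen e))) * U.AP (snd e) (fst e)))"
      unfolding dual_value_def
      by (rule U.sum_Aset, erule (1) add, rule zero, intro U.Aset_closed U.AH_Aset U.AP_Aset)
    also have "\<dots> = (\<Sum>e\<in>arrows. QD.sc (f (gen e)) * QD.DV (delta e))"
    proof (rule sum.cong[OF refl])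
      fix e assume "e \<in> arrows"
      obtain a b where e: "e = (a, b)" by (cases e)
      have ab: "(a, b) \<in> arrows" and ba: "(b, a) \<in> arrows" using \<open>e \<in> arrows\<close> e arrows_sym by auto
      have "\<Psi> (U.AH (poly_const (edge_sign a b * f (gen e))) * U.AP b a) = QD.sc (edge_sign a b * f (gen e)) * DP b a"
        by (simp only: AH[OF U.AP_Aset] h(2) \<Psi>_AP[OF ba])
      also have "\<dots> = QD.sc (edge_sign a b * f (gen e) * edge_sign b a) * QD.DV (delta (a, b))"
        using ba by (simp add: DP_def sc_sc)
      also have "edge_sign a b * f (gen e) * edge_sign b a = f (gen e) * (edge_sign a b * edge_sign a b)"
        by (simp only: edge_sign_arrow(1)[OF ab] ac_simps)
      also have "\<dots> = f (gen e)" by (simp add: edge_sign_arrow(2)[OF ab])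
      finally show "\<Psi> (U.AH (poly_const (edge_sign (fst e) (snd e) * f (gen e))) * U.AP (snd e) (fst e)) = QD.sc (f (gen e)) * QD.DV (delta e)"
        by (simp add: e)
    qed
    also have "\<dots> = QD.DV f" by (rule DV_expand[OF f, symmetric])
    finally show ?thesis using Vec by (simp add: QD.DV_def)
  qed
  have \<Psi>_word: "\<Psi> (U.AH (poly_const c) * prod_list (map ?m w)) = QD.dcl (word c w)" if "w \<in> lists QD.X" for c w
    using that
  proof (induction w)
    \<comment> \<open>\<open>\<Psi>\<close> is known on products \<open>AH q * y\<close>, so the
      unit \<open>AH 1\<close> is split off and evaluated as the sum of the idempotents.\<close>
    case Nil
    have "\<Psi> (U.AH 1) = (\<Sum>a\<in>feasible U. \<Psi> (U.Aid a))"
      unfolding U.AH_one by (rule U.sum_Aset, erule (1) add, rule zero, rule U.Aid_Aset)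
    also have "\<dots> = (\<Sum>a\<in>feasible U. Did0 a)" by (intro sum.cong refl id)
    also have "\<dots> = (\<Sum>a\<in>P. QD.Did a)"
      by (rule sum.mono_neutral_cong_right) (auto simp: finite_feasible Did0_def P_F)
    also have "\<dots> = QD.sc 1" by (rule QD.Did_sum)
    finally have one: "\<Psi> (U.AH 1) = QD.sc 1" .
    have "\<Psi> (U.AH (poly_const c) * U.AH 1) = QD.sc c * QD.sc 1"
      by (simp only: AH[OF U.AH_Aset] h(2) one)
    then have "\<Psi> (U.AH (poly_const c)) = QD.sc c"
      by (simp flip: U.AH_mult QD.sc_mult)
    then show ?case by (simp add: QD.sc_def)
  next
    case (Cons x w)
    have x: "x \<in> QD.X" "[x] \<in> lists QD.X" "w \<in> lists QD.X" using Cons.hyps by (auto simp: in_lists_conv_set)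
    have "U.AH (poly_const c) * prod_list (map ?m (x # w)) = ?m x * (U.AH (poly_const c) * prod_list (map ?m w))"
      by (simp only: list.map prod_list.Cons mult.assoc[symmetric] U.AH_comm_Aset[OF m_Aset])
    then have "\<Psi> (U.AH (poly_const c) * prod_list (map ?m (x # w))) = \<Psi> (?m x) * \<Psi> (U.AH (poly_const c) * prod_list (map ?m w))"
      using mult[OF m_Aset word_Aset] by simp
    also have "\<dots> = QD.dcl (word 1 [x]) * QD.dcl (word c w)" using \<Psi>_m[OF x(1)] Cons.IH by simp
    also have "\<dots> = QD.dcl (word c (x # w))" using QD.dcl_word_mult[OF x(2,3), of 1 c] by simp
    finally show ?case .
  qed
  have \<Psi>\<Phi>: "\<Psi> (\<Phi> f) = QD.dcl f" if "f \<in> carrier QD.T0" for f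
    using that
  proof (induction f rule: free_algebra_induct)
    case zero
    then show ?case using ring_map_zero[OF free_algebra_ring \<Phi>] ring_map_zero[OF free_algebra_ring QD.dcl_ring_map] \<open>\<Psi> 0 = 0\<close> by simp
  next
    case (word w c)
    then show ?case unfolding \<open>\<And>w c. w \<in> lists QD.X \<Longrightarrow> \<Phi> (word c w) = _ c w\<close>[OF word] by (rule \<Psi>_word)
  next
    case (add f f')
    then show ?case
      using ring_mapD(1)[OF \<Phi> add(1,2)] ring_mapD(1)[OF QD.dcl_ring_map add(1,2)]
        \<open>\<And>x y. x \<in> U.Aset \<Longrightarrow> y \<in> U.Aset \<Longrightarrow> \<Psi> (x + y) = \<Psi> x + \<Psi> y\<close>[OF \<Phi>_Aset[OF add(1)] \<Phi>_Aset[OF add(2)]] by simp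
  qed
  let ?Im = "\<Phi> ` carrier QD.T0"
  have Im: "x + y \<in> ?Im" "x * y \<in> ?Im" if "x \<in> ?Im" "y \<in> ?Im" for x y
  proof -
    obtain f f' where f: "x = \<Phi> f" "y = \<Phi> f'" "f \<in> carrier QD.T0" "f' \<in> carrier QD.T0" using \<open>x \<in> ?Im\<close> \<open>y \<in> ?Im\<close> by blast
    show "x + y \<in> ?Im" "x * y \<in> ?Im"
      unfolding f(1,2) ring_mapD[OF \<Phi> f(3,4), symmetric] using f(3,4) by (auto intro!: imageI)
  qed
  have Im0: "0 \<in> ?Im" using ring_map_zero[OF free_algebra_ring \<Phi>] T.zero_closed by (metis imageI)
  have Im_sum: "sum k I \<in> ?Im" if "\<And>i. i \<in> I \<Longrightarrow> k i \<in> ?Im" for k and I :: "'i set"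
    using that by (induction I rule: infinite_finite_induct) (simp_all add: Im0 Im del: image_iff)
  have Im_word: "U.AH (poly_const c) * prod_list (map ?m w) \<in> ?Im" if "w \<in> lists QD.X" for c w
    unfolding word[OF that, symmetric] by (rule imageI[OF word_closed[OF that]])
  have Im_const: "U.AH (poly_const c) \<in> ?Im" for c using Im_word[of "[]" c] by (simp del: image_iff)
  have Im_cid: "U.AH (poly_const c) * U.Aid a \<in> ?Im" for a c
  proof (cases "a \<in> P")
    case True
    then show ?thesis using Im_word[of "[Idemp a]" c] by (simp del: image_iff)
  next
    case False
    then show ?thesis using Im0 U.Aid_unbounded[of a] by (simp add: bounded_feasible_dual del: image_iff)
  qed
  have Im_id: "U.Aid a \<in> ?Im" for a
    using Im_cid[of 1 a] by (simp add: poly_const_simps(4) U.AH_unit del: image_iff)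
  have Im_AP: "U.AP a b \<in> ?Im" for a b
  proof (cases "(a, b) \<in> arrows")
    case True
    have ba: "(b, a) \<in> arrows" by (rule arrows_sym[OF True])
    have "U.AH (poly_const (edge_sign b a)) * (U.AH (poly_const (edge_sign b a)) * U.AP a b) \<in> ?Im"
      using Im_word[of "[Vec (delta (b, a))]" "edge_sign b a"] delta_NN[OF ba] dual_value_delta[OF True] by (simp del: image_iff)
    moreover have "U.AH (poly_const (edge_sign b a)) * (U.AH (poly_const (edge_sign b a)) * U.AP a b) = U.AP a b"
      by (simp only: mult.assoc[symmetric] U.AH_mult[symmetric] poly_const_simps(2)[symmetric] edge_sign_arrow(2)[OF ba] poly_const_simps(4) U.AH_unit)
    ultimately show ?thesis by (simp del: image_iff)
  next
    case False
    then have "U.AP a b = 0" using U.AP_unbounded[of a b] by (auto simp: arrows_def bounded_feasible_dual U.AP_def)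
    then show ?thesis using Im0 by (simp del: image_iff)
  qed
  have Im_AHid: "U.AH q * U.Aid a \<in> ?Im" if a: "a \<in> feasible U" for q a
  proof (induction q rule: mpoly_induct)
    case (const c)
    show ?case by (rule Im_cid)
  next
    \<comment> \<open>The loop at \<open>i\<close> may be missing. Modulo linear forms that vanish,
      the variable is exchanged for variables of coordinates that can be flipped at
      \<open>a\<close>, and these give loops.\<close>
    case (var i)
    obtain x where x: "x \<in> chamber U a" by (rule U.feasibleE[OF a])
    obtain w where w: "supported a w" "axis i 1 - w \<in> dir W" using common_support[OF a a x x, of "axis i 1"] by blast
    have lf: "linear_form (axis i 1) = (poly_var i :: 'i mpoly)"
    proof -
      have "linear_form (axis i 1) = (\<Sum>k\<in>UNIV. if k = i then poly_var i else (0 :: 'i mpoly))"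
        unfolding linear_form_def by (intro sum.cong refl) (auto simp: axis_def poly_const_simps)
      then show ?thesis by simp
    qed
    have "U.AH (linear_form (axis i 1)) = U.AH (linear_form (axis i 1 - w)) + U.AH (linear_form w)"
      unfolding U.AH_linear_form_sum sum.distrib[symmetric] distrib_right[symmetric] U.AH_add[symmetric] poly_const_simps(1)[symmetric]
      by simp
    also have "U.AH (linear_form (axis i 1 - w)) = 0" using U.AH_linear_form w(2) dir_dual(2) by simp
    finally have "U.AH (poly_var i) * U.Aid a = (\<Sum>k\<in>UNIV. U.AH (poly_const (w $ k)) * (U.AH (poly_var k) * U.Aid a))"
      unfolding lf U.AH_linear_form_sum by (simp add: sum_distrib_right mult.assoc)
    also have "\<dots> = (\<Sum>k\<in>UNIV. U.AH (poly_const (w $ k)) * (U.AP a (flip a k) * U.AP (flip a k) a))"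
    proof (rule sum.cong[OF refl])
      fix k
      show "U.AH (poly_const (w $ k)) * (U.AH (poly_var k) * U.Aid a) = U.AH (poly_const (w $ k)) * (U.AP a (flip a k) * U.AP (flip a k) a)"
      proof (cases "flip a k \<in> feasible U")
        case True
        then show ?thesis using U.AP_back[OF a] by simp
      next
        case False
        then have "w $ k = 0" using w(1) by (simp add: supported_def)
        then show ?thesis by (simp add: poly_const_simps(3) U.AH_zero)
      qed
    qed
    also have "\<dots> \<in> ?Im" by (intro Im_sum Im(2) Im_const Im_AP)
    finally show ?case .
  next
    case (add p q)
    then show ?case using Im(1)[OF add] by (simp add: U.AH_add distrib_right del: image_iff)
  next
    case (mult p q)
    have "U.Aid a * (U.AH q * U.Aid a) = U.AH q * U.Aid a"
      by (simp only: mult.assoc[symmetric] U.AH_comm(1)[of q a, symmetric]) (simp add: mult.assoc U.Aid_mult)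
    then have "U.AH (p * q) * U.Aid a = U.AH p * U.Aid a * (U.AH q * U.Aid a)"
      by (simp add: U.AH_mult mult.assoc)
    then show ?case using Im(2)[OF mult] by (simp del: image_iff)
  qed
  have Im_path: "U.apath w \<in> ?Im" if "w \<in> paths (feasible U) adj" for w
    using that
  proof (induction w rule: induct_list012)
    case (2 a)
    then have "U.apath [a] = U.Aid a" by (simp add: U.Aid_def paths_def)
    then show ?case using Im_id by (simp del: image_iff)
  next
    case (3 a b w)
    have "b # w \<in> paths (feasible U) adj" using 3(3) by (auto simp: paths_def)
    from Im(2)[OF Im_AP 3(2)[OF this]] show ?case unfolding U.apath_Cons[OF 3(3)] .
  qed (simp add: paths_def)
  have Im_all: "emb (A_algebra U) x \<in> ?Im" if "x \<in> carrier (A_algebra U)" for x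
    using that
  proof (induction rule: U.emb_A_induct)
    case (single w q)
    have a: "hd w \<in> feasible U" using single(1) hd_in_set[of w] by (auto simp: paths_def)
    have "w \<noteq> []" using single(1) by (simp add: paths_def)
    then have "U.Aid (hd w) * U.apath w = U.apath w"
      using a single(1) U.apath_mult[OF vertex_path[OF a] single(1)] by (cases w) (auto simp: U.Aid_def)
    then have "U.AH q * U.apath w = U.AH q * U.Aid (hd w) * U.apath w" by (simp add: mult.assoc)
    then show ?case using Im(2)[OF Im_AHid[OF a] Im_path[OF single(1)]] by (simp del: image_iff)
  qed (simp_all add: Im0 Im del: image_iff)
  have D: "carrier (A_quadratic_dual W) = QD.Dcls ` carrier QD.T0"
    unfolding A_quadratic_dual_eq by (rule QD.D_carrier)
  have ring: "ring (A_quadratic_dual W)" unfolding A_quadratic_dual_eq by (rule QD.D_ring)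
  show ?thesis
  proof (rule ring_iso_of_emb[OF ring U.A_ring g])
    have "g ` carrier (A_quadratic_dual W) = ?Im"
      unfolding D image_image by (rule image_cong[OF refl g\<Phi>])
    also have "\<dots> = U.Aset"
    proof
      show "?Im \<subseteq> U.Aset" using \<Phi>_Aset by (rule image_subsetI)
      show "U.Aset \<subseteq> ?Im" using Im_all by (rule image_subsetI)
    qed
    finally show "g ` carrier (A_quadratic_dual W) = U.Aset" .
  next
    fix x assume x: "x \<in> carrier (A_quadratic_dual W)" "g x = 0"
    obtain f where f: "x = QD.Dcls f" "f \<in> carrier QD.T0" using x(1) unfolding D by blast
    have "\<Phi> f = 0" using x(2) g\<Phi>[OF f(2)] f(1) by simp
    then have "QD.dcl f = 0" using \<Psi>\<Phi>[OF f(2)] zero by simp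
    then have "emb (A_quadratic_dual W) x = emb (A_quadratic_dual W) \<zero>\<^bsub>A_quadratic_dual W\<^esub>"
      using ring_map_zero[OF ring emb_ring_map[OF ring]] by (simp add: f(1) QD.dcl_def A_quadratic_dual_eq)
    then show "x = \<zero>\<^bsub>A_quadratic_dual W\<^esub>"
      using emb_inj[OF ring x(1) ring.ring_simprules(2)[OF ring]] by simp
  qed
qed

end

theorem mainTheorem1:
  fixes \<V> :: "'i::finite arrangement"
  assumes "polarized \<V>"
  shows "A_quadratic_dual \<V> \<simeq> A_algebra (gale_dual \<V>) \<and> A_algebra (gale_dual \<V>) \<simeq> B_algebra \<V>"
proof
  interpret V: arrangement \<V> by unfold_locales (rule polarized_arrangement_data[OF assms])
  show "A_quadratic_dual \<V> \<simeq> A_algebra (gale_dual \<V>)" by (rule V.quadratic_dual_iso)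
  \<comment> \<open>The isomorphism is applied to the Gale dual, whose own Gale dual is the given
    arrangement.\<close>
  show "A_algebra (gale_dual \<V>) \<simeq> B_algebra \<V>"
    using arrangement.A_iso_B[OF V.dual_arrangement] by (simp only: V.dual_dual)
qed

end
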